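(* Let $b\ge 2$ be an integer, let $\mathcal{N}_b\subseteq[0,1)$ be the set of real numbers in $[0,1)$ that are Borel normal in base $b$, and let $\mathcal{P}_b\subseteq[0,1)$ be the set of real numbers in $[0,1)$ that are Poisson generic in base $b$. Then $\mathcal{N}_b\setminus\mathcal{P}_b$ is $D_2\text{-}\Pi^0_3$-complete in the effective (lightface) Borel hierarchy.
   Context: Each $x\in[0,1)$ is identified with its base-$b$ expansion $x=\sum_{j\ge1}x_jb^{-j}$, $x_j\in\{0,\dots,b-1\}$, with $x_j\neq0$ for infinitely many $j$. For real $r>1$, $x\restriction r$ denotes $x_1\cdots x_{\lfloor r\rfloor}$. Occurrences of words are counted over all starting positions (overlaps allowed). $x$ is Borel normal in base $b$ if for every finite word $w$ over $\{0,\dots,b-1\}$, (number of occurrences of $w$ in $x\restriction n$)$/n\to b^{-|w|}$. For real $\lambda>0$, integers $j\ge0,k\ge1$, $Z^\lambda_{j,k}(x)=b^{-k}|\{w\in\{0,\dots,b-1\}^k: w\text{ occurs exactly } j\text{ times in } x\restriction(\lambda b^k+k)\}|$; $x$ is Poisson generic in base $b$ if for every real $\lambda>0$ and integer $j\ge0$, $Z^\lambda_{j,k}(x)\to e^{-\lambda}\lambda^j/j!$. A set of reals is $\Pi^0_3$ in the effective Borel hierarchy if membership is definable by a $\Pi^0_3$ formula of second-order arithmetic (atomic formulas: integer algebraic identities or membership of the real in rational-endpoint intervals; quantifiers over integers). $D_2\text{-}\Pi^0_3$ is the class of sets $A\setminus B$ with $A,B$ both effectively $\Pi^0_3$. A set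 is complete for an effective class if it belongs to the class and every set in the class (e.g. in $\omega^\omega$) is reducible to it via a computable map. *)

theory Defs
  imports Complex_Main "HOL-Library.Nat_Bijection"
begin

section \<open>Expansions, Borel normality and Poisson genericity\<close>

text \<open>Digit sequences are indexed from 1; the value at 0 is never used.\<close>

definition is_expansion :: "nat \<Rightarrow> real \<Rightarrow> (nat \<Rightarrow> nat) \<Rightarrow> bool" where
  "is_expansion b x d \<longleftrightarrow>
     (\<forall>j\<ge>1. d j < b) \<and>
     (\<lambda>j. real (d (Suc j)) / real b ^ Suc j) sums x \<and>
     infinite {j. j \<ge> 1 \<and> d j \<noteq> 0}"

definition restrict_to :: "(nat \<Rightarrow> nat) \<Rightarrow> real \<Rightarrow> nat list" where
  "restrict_to d r = map d [1..<Suc (nat \<lfloor>r\<rfloor>)]"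

definition words :: "nat \<Rightarrow> nat \<Rightarrow> nat list set" where
  "words b k = {w. length w = k \<and> set w \<subseteq> {..<b}}"

definition occurrences :: "nat list \<Rightarrow> nat list \<Rightarrow> nat" where
  "occurrences w u = card {i. i + length w \<le> length u \<and> take (length w) (drop i u) = w}"

definition normal_expansion :: "nat \<Rightarrow> (nat \<Rightarrow> nat) \<Rightarrow> bool" where
  "normal_expansion b d \<longleftrightarrow>
     (\<forall>k. \<forall>w\<in>words b k.
        (\<lambda>n. real (occurrences w (restrict_to d (real n))) / real n) \<longlonglongrightarrow> 1 / real b ^ k)"

definition Z :: "nat \<Rightarrow> real \<Rightarrow> nat \<Rightarrow> nat \<Rightarrow> (nat \<Rightarrow> nat) \<Rightarrow> real" where
  "Z b lam j k d =
     real (card {w \<in> words b k. occurrences w (restrict_to d (lam * real b ^ k + real k)) = j})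
       / real b ^ k"

definition Poisson_generic_expansion :: "nat \<Rightarrow> (nat \<Rightarrow> nat) \<Rightarrow> bool" where
  "Poisson_generic_expansion b d \<longleftrightarrow>
     (\<forall>lam>0. \<forall>j. (\<lambda>k. Z b lam j k d) \<longlonglongrightarrow> exp (- lam) * lam ^ j / fact j)"

text \<open>Every \<open>x\<close> in \<open>(0,1)\<close> has exactly one expansion in the above sense (up to \<open>d 0\<close>), whereas \<open>0\<close> has
  none. With the existential quantifier, \<open>0\<close> belongs to neither of the following two sets, as it
  should: no constant digit sequence is normal or Poisson generic.\<close>

definition normal_numbers :: "nat \<Rightarrow> real set" where
  "normal_numbers b = {x \<in> {0..<1}. \<exists>d. is_expansion b x d \<and> normal_expansion b d}"

definition Poisson_generic_numbers :: "nat \<Rightarrow> real set" where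
  "Poisson_generic_numbers b =
     {x \<in> {0..<1}. \<exists>d. is_expansion b x d \<and> Poisson_generic_expansion b d}"


section \<open>The finite levels of the effective Borel hierarchy\<close>

datatype trm = Var nat | Const int | Add trm trm | Mul trm trm

primrec tval :: "(nat \<Rightarrow> int) \<Rightarrow> trm \<Rightarrow> int" where
  "tval e (Var v) = e v"
| "tval e (Const c) = c"
| "tval e (Add s t) = tval e s + tval e t"
| "tval e (Mul s t) = tval e s * tval e t"

text \<open>The type \<open>'a\<close> consists of the atomic formulas that speak about the point of the space
  under consideration (see \<open>real_sat\<close> and \<open>baire_sat\<close> below). \<open>BAll\<close> with bounds \<open>s\<close>, \<open>t\<close> ranges
  over the integers between \<open>s\<close> and \<open>t\<close>; bounded existential quantifiers and the other
  connectives are obtained by negation.\<close>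

datatype 'a fm =
    Ident trm trm
  | Point 'a
  | Neg "'a fm"
  | Conj "'a fm" "'a fm"
  | BAll nat trm trm "'a fm"
  | All nat "'a fm"
  | Ex nat "'a fm"

primrec sat :: "('a \<Rightarrow> (nat \<Rightarrow> int) \<Rightarrow> bool) \<Rightarrow> (nat \<Rightarrow> int) \<Rightarrow> 'a fm \<Rightarrow> bool" where
  "sat P e (Ident s t) \<longleftrightarrow> tval e s = tval e t"
| "sat P e (Point a) \<longleftrightarrow> P a e"
| "sat P e (Neg \<phi>) \<longleftrightarrow> \<not> sat P e \<phi>"
| "sat P e (Conj \<phi> \<psi>) \<longleftrightarrow> sat P e \<phi> \<and> sat P e \<psi>"
| "sat P e (BAll v s t \<phi>) \<longleftrightarrow> (\<forall>i\<in>{tval e s..tval e t}. sat P (e(v := i)) \<phi>)"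
| "sat P e (All v \<phi>) \<longleftrightarrow> (\<forall>i. sat P (e(v := i)) \<phi>)"
| "sat P e (Ex v \<phi>) \<longleftrightarrow> (\<exists>i. sat P (e(v := i)) \<phi>)"

primrec bounded_fm :: "'a fm \<Rightarrow> bool" where
  "bounded_fm (Ident s t) \<longleftrightarrow> True"
| "bounded_fm (Point a) \<longleftrightarrow> True"
| "bounded_fm (Neg \<phi>) \<longleftrightarrow> bounded_fm \<phi>"
| "bounded_fm (Conj \<phi> \<psi>) \<longleftrightarrow> bounded_fm \<phi> \<and> bounded_fm \<psi>"
| "bounded_fm (BAll v s t \<phi>) \<longleftrightarrow> bounded_fm \<phi>"
| "bounded_fm (All v \<phi>) \<longleftrightarrow> False"
| "bounded_fm (Ex v \<phi>) \<longleftrightarrow> False"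

inductive Sigma_fm :: "nat \<Rightarrow> 'a fm \<Rightarrow> bool" and Pi_fm :: "nat \<Rightarrow> 'a fm \<Rightarrow> bool" where
  "bounded_fm \<phi> \<Longrightarrow> Sigma_fm 0 \<phi>"
| "bounded_fm \<phi> \<Longrightarrow> Pi_fm 0 \<phi>"
| "Pi_fm n \<phi> \<Longrightarrow> Sigma_fm (Suc n) (Ex v \<phi>)"
| "Sigma_fm n \<phi> \<Longrightarrow> Pi_fm (Suc n) (All v \<phi>)"

text \<open>\<open>at_pt x\<close> interprets the atoms at the point \<open>x\<close>. Requiring the equivalence for every assignment
  \<open>e\<close> says that the defining formula has no integer parameters.\<close>

definition effective_Pi ::
    "('x \<Rightarrow> 'a \<Rightarrow> (nat \<Rightarrow> int) \<Rightarrow> bool) \<Rightarrow> nat \<Rightarrow> 'x set \<Rightarrow> bool" where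
  "effective_Pi at_pt n A \<longleftrightarrow>
     (\<exists>\<phi>. Pi_fm n \<phi> \<and> (\<forall>x e. x \<in> A \<longleftrightarrow> sat (at_pt x) e \<phi>))"

definition effective_D2_Pi ::
    "('x \<Rightarrow> 'a \<Rightarrow> (nat \<Rightarrow> int) \<Rightarrow> bool) \<Rightarrow> nat \<Rightarrow> 'x set \<Rightarrow> bool" where
  "effective_D2_Pi at_pt n A \<longleftrightarrow>
     (\<exists>B C. effective_Pi at_pt n B \<and> effective_Pi at_pt n C \<and> A = B - C)"

text \<open>\<open>Interval p q r s\<close> is the open interval with end points \<open>p/q\<close> and \<open>r/s\<close>. A zero denominator
  is harmless, as it just yields the end point 0.\<close>

datatype real_atom = Interval trm trm trm trm

primrec real_sat :: "real \<Rightarrow> real_atom \<Rightarrow> (nat \<Rightarrow> int) \<Rightarrow> bool" where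
  "real_sat x (Interval p q r s) e \<longleftrightarrow>
     x \<in> {real_of_int (tval e p) / real_of_int (tval e q) <..<
          real_of_int (tval e r) / real_of_int (tval e s)}"

text \<open>For the Baire space \<open>nat \<Rightarrow> nat\<close>, the intervals are replaced by the subbasic clopen sets
  \<open>{z. z m = n}\<close>.\<close>

datatype baire_atom = Value trm trm

primrec baire_sat :: "(nat \<Rightarrow> nat) \<Rightarrow> baire_atom \<Rightarrow> (nat \<Rightarrow> int) \<Rightarrow> bool" where
  "baire_sat z (Value s t) e \<longleftrightarrow> tval e s \<ge> 0 \<and> int (z (nat (tval e s))) = tval e t"


section \<open>Computable maps from the Baire space to the reals\<close>

text \<open>Partial recursive functions relative to an oracle \<open>z\<close>: \<open>computes z f xs y\<close> says that the
  function with code \<open>f\<close>, applied to the arguments \<open>xs\<close>, converges to \<open>y\<close>.\<close>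

datatype recf =
    Zero
  | Succ
  | Oracle
  | Proj nat
  | Comp recf "recf list"
  | Prec recf recf
  | Mu recf

inductive computes :: "(nat \<Rightarrow> nat) \<Rightarrow> recf \<Rightarrow> nat list \<Rightarrow> nat \<Rightarrow> bool" for z where
  zero: "computes z Zero xs 0"
| succ: "computes z Succ [x] (Suc x)"
| orac: "computes z Oracle [x] (z x)"
| proj: "i < length xs \<Longrightarrow> computes z (Proj i) xs (xs ! i)"
| comp: "list_all2 (\<lambda>g y. computes z g xs y) gs ys \<Longrightarrow> computes z f ys v
         \<Longrightarrow> computes z (Comp f gs) xs v"
| prec_0: "computes z f xs v \<Longrightarrow> computes z (Prec f g) (0 # xs) v"
| prec_Suc: "computes z (Prec f g) (n # xs) u \<Longrightarrow> computes z g (n # u # xs) v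
             \<Longrightarrow> computes z (Prec f g) (Suc n # xs) v"
| mu: "computes z f (n # xs) 0 \<Longrightarrow> \<forall>m<n. \<exists>v>0. computes z f (m # xs) v
       \<Longrightarrow> computes z (Mu f) xs n"

inductive_cases computes_ZeroE: "computes z Zero xs v"
inductive_cases computes_SuccE: "computes z Succ xs v"
inductive_cases computes_OracleE: "computes z Oracle xs v"
inductive_cases computes_ProjE: "computes z (Proj i) xs v"
inductive_cases computes_CompE: "computes z (Comp f gs) xs v"
inductive_cases computes_Prec_0E: "computes z (Prec f g) (0 # xs) v"
inductive_cases computes_Prec_SucE: "computes z (Prec f g) (Suc n # xs) v"
inductive_cases computes_MuE: "computes z (Mu f) xs v"

lemma computes_deterministic:
  "computes z f xs v \<Longrightarrow> computes z f xs v' \<Longrightarrow> v' = v"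
proof (induction arbitrary: v' rule: computes.induct)
  case (comp xs gs ys f v)
  from comp.prems obtain ys' where
    ys': "list_all2 (\<lambda>g y. computes z g xs y) gs ys'" "computes z f ys' v'"
    by (rule computes_CompE)
  have len: "length ys' = length ys"
    using list_all2_lengthD[OF comp.IH(1)] list_all2_lengthD[OF ys'(1)] by simp
  have "ys' ! i = ys ! i" if "i < length ys'" for i
    using list_all2_nthD2[OF comp.IH(1), of i] list_all2_nthD2[OF ys'(1), of i] that len by simp
  with len have "ys' = ys" by (simp add: nth_equalityI)
  with ys'(2) comp.IH(2) show ?case by blast
next
  case (prec_Suc f g n xs u v)
  from prec_Suc.prems obtain u' where
    "computes z (Prec f g) (n # xs) u'" "computes z g (n # u' # xs) v'"
    by (rule computes_Prec_SucE)
  with prec_Suc.IH show ?case by blast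
next
  case (mu f n xs)
  from mu.prems have v': "computes z f (v' # xs) 0" "\<forall>m<v'. \<exists>v>0. computes z f (m # xs) v"
    by (rule computes_MuE, blast)+
  have "\<not> n < v'" using v'(2) mu.IH(1) by blast
  moreover have "\<not> v' < n" using v'(1) mu.IH(2) by blast
  ultimately show ?case by simp
qed (blast elim: computes_ZeroE computes_SuccE computes_OracleE computes_ProjE computes_Prec_0E)+

text \<open>A map is computable if one oracle machine produces, uniformly in the argument \<open>z\<close> (given as
  the oracle) and in \<open>n\<close>, a dyadic rational approximation of the value up to \<open>2\<^sup>-\<^sup>n\<close>;
  \<open>int_decode\<close> lets the machine output integers.\<close>

definition computable_map :: "((nat \<Rightarrow> nat) \<Rightarrow> real) \<Rightarrow> bool" where
  "computable_map F \<longleftrightarrow>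
     (\<exists>f. \<forall>z n. \<exists>v. computes z f [n] v \<and> \<bar>F z - real_of_int (int_decode v) / 2 ^ n\<bar> \<le> 1 / 2 ^ n)"

definition D2_Pi_complete :: "nat \<Rightarrow> real set \<Rightarrow> bool" where
  "D2_Pi_complete n A \<longleftrightarrow>
     effective_D2_Pi real_sat n A \<and>
     (\<forall>C. effective_D2_Pi baire_sat n C \<longrightarrow>
        (\<exists>F. computable_map F \<and> range F \<subseteq> {0..<1} \<and> (\<forall>z. z \<in> C \<longleftrightarrow> F z \<in> A)))"

end

theory Submission
  imports Defs "HOL-Number_Theory.Cong"
begin

text \<open>
  The reduction perturbs a computable sequence \<open>base_seq b\<close> that is both normal and Poisson generic.  That
  sequence is built in stages ending at positions \<open>s ^ 5\<close>.  By a second-moment argument some extension over a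
  stage moves the proportions \<open>p\<^sub>j\<close> of words of length \<open>k\<close> occurring \<open>j\<close> times by approximately
  \<open>h * (p\<^sub>j\<^sub>-\<^sub>1 - p\<^sub>j)\<close> with \<open>h\<close> the stage length over \<open>b ^ k\<close>, simultaneously for all small \<open>k\<close> and \<open>j\<close>;
  this is the Euler scheme for the equation \<open>p\<^sub>j' = p\<^sub>j\<^sub>-\<^sub>1 - p\<^sub>j\<close> solved by the Poisson distribution.

  Given a \<open>\<Pi>\<^sup>0\<^sub>3\<close> set one computes from \<open>z\<close> a sequence that tends to infinity iff \<open>z\<close> is in the set.  At scale
  \<open>k\<close> a block of \<open>b ^ k div m k\<close> digits starting at position \<open>b ^ k\<close> is overwritten: by zeros if \<open>k\<close> is even,
  by a copy of the preceding digits if \<open>k\<close> is odd.  If \<open>m k\<close> tends to infinity the change is too sparse to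
  affect either property.  If it does not, long blocks of zeros destroy normality, while long copies keep
  normality but add almost no new words of length \<open>k\<close>, which leaves too many words unseen and destroys Poisson
  genericity.  So the even scales encode the first \<open>\<Pi>\<^sup>0\<^sub>3\<close> set and the odd scales the second.

  For membership in the class, the real is read through the oracle \<open>interval_oracle\<close>, and Poisson
  genericity is tested at rational \<open>\<lambda>\<close> against the rational numbers \<open>(1 - \<lambda>/k) ^ k * \<lambda> ^ j / j!\<close>.
\<close>

text \<open>The one-stage estimate holds for every prefix, not merely for a typical one, so each
  stage is found by a finite search that never has to be revised; this makes the base sequence
  computable. The exponent 5 balances two errors. Stage \<open>s\<close> has at most
  \<open>5 * Suc s ^ 4\<close> digits, and about \<open>s ^ 2\<close> quantities are controlled at
  once, which permits deviations of order \<open>s ^ 3\<close>; summed over the stages they give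
  \<open>s ^ 4\<close>, negligible against \<open>s ^ 5\<close>. At word length \<open>k\<close>
  about \<open>b ^ (k/5)\<close> stages matter and the step sizes are of order
  \<open>b ^ (- k/5)\<close>, so the squared step sizes of the Euler scheme also sum to order
  \<open>b ^ (- k/5)\<close>. A long copy keeps normality because it is an interval of a normal
  sequence, as is the interval that it replaces. Blocks take up at most a quarter of
  \<open>b ^ k\<close>, so they meet neither each other nor the source of a copy. For membership,
  formulas know only addition and multiplication; powers, counts and factorials reach them through
  Goedel's beta function. A decidable matrix has a Sigma_1 negation, whose witness is absorbed by
  the last universal quantifier, so the level stays 3.\<close>

section \<open>Recursion relative to an oracle\<close>

text \<open>Variables are de Bruijn indices: in the rules for bounded sums, quantifiers, recursion and search the
  bound variable is \<open>e 0\<close> and the outer environment is \<open>\<lambda>i. e (Suc i)\<close>.\<close>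
definition recursive :: "nat \<Rightarrow> ((nat \<Rightarrow> nat) \<Rightarrow> (nat \<Rightarrow> nat) \<Rightarrow> nat) \<Rightarrow> bool" where
  "recursive n f \<longleftrightarrow> (\<exists>c. \<forall>z e. computes z c (map e [0..<n]) (f z e))"

lemma recursive_comp:
  assumes "recursive m f" "\<And>i. i < m \<Longrightarrow> recursive n (g i)"
  shows "recursive n (\<lambda>z e. f z (\<lambda>i. g i z e))"
proof -
  from assms(1) obtain c where c: "\<And>z e. computes z c (map e [0..<m]) (f z e)"
    unfolding recursive_def by blast
  from assms(2) have "\<forall>i. \<exists>d. i < m \<longrightarrow> (\<forall>z e. computes z d (map e [0..<n]) (g i z e))"
    unfolding recursive_def by blast
  then obtain d where d: "\<And>i z e. i < m \<Longrightarrow> computes z (d i) (map e [0..<n]) (g i z e)"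
    by metis
  have "computes z (Comp c (map d [0..<m])) (map e [0..<n]) (f z (\<lambda>i. g i z e))" for z e
    by (rule computes.comp[OF _ c]) (auto simp: list_all2_conv_all_nth d)
  then show ?thesis unfolding recursive_def by blast
qed

lemma recursive_var: "i < n \<Longrightarrow> recursive n (\<lambda>z e. e i)"
  unfolding recursive_def by (rule exI[of _ "Proj i"]) (metis computes.proj length_map length_upt diff_zero nth_map_upt add_0)

text \<open>With \<open>f\<close> instantiated by a named function, this rule and the next three let
  \<open>intro\<close> break down an application of it to arbitrary recursive arguments.\<close>

lemma recursive_comp1:
  assumes "recursive (Suc 0) (\<lambda>z e. f z (e 0))" "recursive n a"
  shows "recursive n (\<lambda>z e. f z (a z e))"
  using recursive_comp[OF assms(1), of n "\<lambda>_. a"] assms(2) by simp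

lemma recursive_comp2:
  assumes "recursive (Suc (Suc 0)) (\<lambda>z e. f z (e 0) (e (Suc 0)))" "recursive n a" "recursive n b"
  shows "recursive n (\<lambda>z e. f z (a z e) (b z e))"
  using recursive_comp[OF assms(1), of n "\<lambda>i. if i = 0 then a else b"] assms(2,3) by simp

lemma recursive_comp3:
  assumes "recursive (Suc (Suc (Suc 0))) (\<lambda>z e. f z (e 0) (e (Suc 0)) (e (Suc (Suc 0))))" "recursive n a" "recursive n b" "recursive n c"
  shows "recursive n (\<lambda>z e. f z (a z e) (b z e) (c z e))"
  using recursive_comp[OF assms(1), of n "\<lambda>i. if i = 0 then a else if i = 1 then b else c"] assms(2-) by simp

lemma recursive_comp4:
  assumes "recursive (Suc (Suc (Suc (Suc 0)))) (\<lambda>z e. f z (e 0) (e (Suc 0)) (e (Suc (Suc 0))) (e (Suc (Suc (Suc 0)))))"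
    "recursive n a" "recursive n b" "recursive n c" "recursive n d"
  shows "recursive n (\<lambda>z e. f z (a z e) (b z e) (c z e) (d z e))"
  using recursive_comp[OF assms(1), of n "\<lambda>i. if i = 0 then a else if i = 1 then b else if i = 2 then c else d"]
    assms(2-) by simp

lemma recursive_Suc: "recursive n f \<Longrightarrow> recursive n (\<lambda>z e. Suc (f z e))"
proof -
  have "recursive (Suc 0) (\<lambda>z e. Suc (e 0))" unfolding recursive_def
    by (rule exI[of _ Succ]) (auto intro: computes.succ)
  then show "recursive n f \<Longrightarrow> recursive n (\<lambda>z e. Suc (f z e))" by (rule recursive_comp1)
qed

lemma recursive_oracle: "recursive n f \<Longrightarrow> recursive n (\<lambda>z e. z (f z e))"
proof -
  have "recursive (Suc 0) (\<lambda>z e. z (e 0))" unfolding recursive_def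
    by (rule exI[of _ Oracle]) (auto intro: computes.orac)
  then show "recursive n f \<Longrightarrow> recursive n (\<lambda>z e. z (f z e))" by (rule recursive_comp1)
qed

lemma recursive_const: "recursive n (\<lambda>z e. k)"
proof (induction k)
  case 0
  show ?case unfolding recursive_def by (rule exI[of _ Zero]) (auto intro: computes.zero)
qed (rule recursive_Suc)

lemma map_upt_Suc': "map e [0..<Suc n] = e 0 # map (\<lambda>i. e (Suc i)) [0..<n]"
  by (simp add: map_upt_Suc del: upt_Suc)

lemma recursive_prec:
  assumes f: "recursive n f" and g: "recursive (Suc (Suc n)) (\<lambda>z e. g z (\<lambda>i. e (Suc (Suc i))) (e 0) (e (Suc 0)))"
    and k: "recursive n k"
  shows "recursive n (\<lambda>z e. rec_nat (f z e) (g z e) (k z e))"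
proof -
  from f obtain cf where cf: "\<And>z e. computes z cf (map e [0..<n]) (f z e)"
    unfolding recursive_def by blast
  from g obtain cg where cg: "\<And>z e. computes z cg (map e [0..<Suc (Suc n)])
      (g z (\<lambda>i. e (Suc (Suc i))) (e 0) (e (Suc 0)))"
    unfolding recursive_def by blast
  have cg': "computes z cg (m # u # map e [0..<n]) (g z e m u)" for z e m u
    using cg[of z "case_nat m (case_nat u e)"] by (simp add: map_upt_Suc' del: upt_Suc)
  have *: "computes z (Prec cf cg) (m # map e [0..<n]) (rec_nat (f z e) (g z e) m)" for z e m
    by (induction m) (auto intro: computes.intros cf cg')
  have "recursive (Suc n) (\<lambda>z e. rec_nat (f z (\<lambda>i. e (Suc i))) (g z (\<lambda>i. e (Suc i))) (e 0))"
    unfolding recursive_def using * by (intro exI[of _ "Prec cf cg"]) (simp add: map_upt_Suc' del: upt_Suc)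
  \<comment> \<open>The recursion variable at index 0 is replaced by \<open>k\<close>, and the outer
    variables return to their places.\<close>
  from recursive_comp[OF this, of n "case_nat k (\<lambda>i z e. e i)"] show ?thesis
    using k by (simp add: recursive_var split: nat.splits)
qed

lemma recursive_Least:
  assumes P: "recursive (Suc n) (\<lambda>z e. of_bool (P z (\<lambda>i. e (Suc i)) (e 0)))"
    and ex: "\<And>z e. \<exists>v. P z e v"
  shows "recursive n (\<lambda>z e. LEAST v. P z e v)"
proof -
  \<comment> \<open>\<open>Mu\<close> searches for the value 0 while truth is 1, so the bit is
    flipped.\<close>
  have "recursive (Suc n) (\<lambda>z e. rec_nat (Suc 0) (\<lambda>_ _. 0) (of_bool (P z (\<lambda>i. e (Suc i)) (e 0))))"
    by (rule recursive_prec[OF recursive_const _ P]) (rule recursive_const)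
  then obtain c where c: "\<And>z e. computes z c (map e [0..<Suc n])
     (rec_nat (Suc 0) (\<lambda>_ _. 0) (of_bool (P z (\<lambda>i. e (Suc i)) (e 0))))"
    unfolding recursive_def by blast
  have c': "computes z c (m # map e [0..<n]) (if P z e m then 0 else Suc 0)" for z e m
    using c[of z "case_nat m e"] by (simp add: map_upt_Suc' of_bool_def del: upt_Suc split: if_splits)
  have "computes z (Mu c) (map e [0..<n]) (LEAST v. P z e v)" for z e
  proof (rule computes.mu)
    have "P z e (LEAST v. P z e v)" using ex[of z e] by (metis LeastI_ex)
    then show "computes z c ((LEAST v. P z e v) # map e [0..<n]) 0"
      using c'[of z "LEAST v. P z e v" e] by simp
    show "\<forall>m<LEAST v. P z e v. \<exists>v>0. computes z c (m # map e [0..<n]) v"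
      using c'[of z _ e] not_less_Least[of _ "P z e"] by (metis zero_less_Suc)
  qed
  then show ?thesis unfolding recursive_def by blast
qed

lemma recursive_add: assumes "recursive n f" "recursive n g" shows "recursive n (\<lambda>z e. f z e + g z e)"
proof -
  have "recursive n (\<lambda>z e. rec_nat (g z e) (\<lambda>m u. Suc u) (f z e))"
    by (intro recursive_prec recursive_Suc recursive_var assms) auto
  moreover have "rec_nat b (\<lambda>m u. Suc u) a = a + b" for a b :: nat by (induction a) auto
  ultimately show ?thesis by simp
qed

lemma recursive_sum:
  assumes f: "recursive (Suc n) (\<lambda>z e. f z (\<lambda>i. e (Suc i)) (e 0))" and k: "recursive n k"
  shows "recursive n (\<lambda>z e. \<Sum>i<k z e. f z e i)"
proof -
  \<comment> \<open>In the recursion step the accumulator occupies index 1, so the outer variables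
    move up once more.\<close>
  have f': "recursive (Suc (Suc n)) (\<lambda>z e. f z (\<lambda>i. e (Suc (Suc i))) (e 0))"
    using recursive_comp[OF f, of "Suc (Suc n)" "\<lambda>i z e. e (if i = 0 then 0 else Suc i)"]
    by (simp add: recursive_var)
  have "recursive n (\<lambda>z e. rec_nat 0 (\<lambda>m u. u + f z e m) (k z e))"
    by (intro recursive_prec recursive_const k recursive_add f' recursive_var) simp
  moreover have "rec_nat 0 (\<lambda>m u. u + f z e m) k = (\<Sum>i<k. f z e i)" for z e k
    by (induction k) auto
  ultimately show ?thesis by simp
qed

lemma recursive_mult: assumes "recursive n f" "recursive n g" shows "recursive n (\<lambda>z e. f z e * g z e)"
proof -
  have "recursive n (\<lambda>z e. \<Sum>i<f z e. g z e)"
    by (intro recursive_sum assms(1))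
       (use recursive_comp[OF assms(2), of "Suc n" "\<lambda>i z e. e (Suc i)"] recursive_var in auto)
  then show ?thesis by simp
qed

lemma recursive_pow: assumes "recursive n f" "recursive n g" shows "recursive n (\<lambda>z e. f z e ^ g z e)"
proof -
  have "recursive n (\<lambda>z e. rec_nat 1 (\<lambda>m u. f z e * u) (g z e))"
    by (intro recursive_prec recursive_mult recursive_var recursive_const assms)
       (use recursive_comp[OF assms(1), of "Suc (Suc n)" "\<lambda>i z e. e (Suc (Suc i))"] recursive_var in auto)
  moreover have "rec_nat 1 (\<lambda>m u. a * u) k = a ^ k" for a k :: nat by (induction k) auto
  ultimately show ?thesis by simp
qed

lemma recursive_fact: assumes "recursive n f" shows "recursive n (\<lambda>z e. fact (f z e))"
proof -
  have "recursive n (\<lambda>z e. rec_nat 1 (\<lambda>m u. Suc m * u) (f z e))"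
    by (intro recursive_prec recursive_mult recursive_Suc recursive_var recursive_const assms) auto
  moreover have "rec_nat 1 (\<lambda>m u. Suc m * u) k = fact k" for k :: nat by (induction k) auto
  ultimately show ?thesis by simp
qed

lemma recursive_monus: assumes "recursive n f" "recursive n g" shows "recursive n (\<lambda>z e. f z e - g z e)"
proof -
  have "recursive (Suc 0) (\<lambda>z e. rec_nat 0 (\<lambda>m u. m) (e 0))"
    by (intro recursive_prec recursive_var recursive_const) auto
  moreover have "rec_nat 0 (\<lambda>m u. m) k = k - 1" for k :: nat by (induction k) auto
  ultimately have "recursive (Suc 0) (\<lambda>z e. e 0 - 1)" by simp
  note pred = recursive_comp1[OF this]
  have "recursive n (\<lambda>z e. rec_nat (f z e) (\<lambda>m u. u - 1) (g z e))"
    by (intro recursive_prec pred recursive_var assms) auto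
  moreover have "rec_nat a (\<lambda>m u. u - 1) k = a - k" for a k :: nat by (induction k) auto
  ultimately show ?thesis by simp
qed

section \<open>Decidable predicates, counting and division\<close>

abbreviation decidable :: "nat \<Rightarrow> ((nat \<Rightarrow> nat) \<Rightarrow> (nat \<Rightarrow> nat) \<Rightarrow> bool) \<Rightarrow> bool" where
  "decidable n P \<equiv> recursive n (\<lambda>z e. of_bool (P z e))"

lemma decidable_not: assumes "decidable n P" shows "decidable n (\<lambda>z e. \<not> P z e)"
proof -
  have "(1::nat) - of_bool p = of_bool (\<not> p)" for p by simp
  with recursive_monus[OF recursive_const[of n 1] assms] show ?thesis by simp
qed

lemma decidable_conj: "decidable n P \<Longrightarrow> decidable n Q \<Longrightarrow> decidable n (\<lambda>z e. P z e \<and> Q z e)"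
  by (simp add: of_bool_conj recursive_mult)

lemma decidable_imp: "decidable n P \<Longrightarrow> decidable n Q \<Longrightarrow> decidable n (\<lambda>z e. P z e \<longrightarrow> Q z e)"
  using decidable_not[OF decidable_conj[OF _ decidable_not], of n P Q] by simp

lemma decidable_disj: "decidable n P \<Longrightarrow> decidable n Q \<Longrightarrow> decidable n (\<lambda>z e. P z e \<or> Q z e)"
  using decidable_not[OF decidable_conj[OF decidable_not decidable_not], of n P Q] by simp

lemma decidable_pos: assumes "recursive n f" shows "decidable n (\<lambda>z e. 0 < f z e)"
proof -
  have "(1 - (1 - f z e)) = of_bool (0 < f z e)" for z e by auto
  with recursive_monus[OF recursive_const[of n 1] recursive_monus[OF recursive_const[of n 1] assms]] show ?thesis by simp
qed

lemma decidable_less: assumes "recursive n f" "recursive n g" shows "decidable n (\<lambda>z e. f z e < g z e)"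
  using decidable_pos[OF recursive_monus[OF assms(2,1)]] by simp

lemma decidable_le: assumes "recursive n f" "recursive n g" shows "decidable n (\<lambda>z e. f z e \<le> g z e)"
  using decidable_not[OF decidable_less[OF assms(2,1)]] by (simp add: not_less)

lemma decidable_eq: assumes "recursive n f" "recursive n g" shows "decidable n (\<lambda>z e. f z e = g z e)"
  using decidable_conj[OF decidable_le[OF assms] decidable_le[OF assms(2,1)]] by (simp add: eq_iff)

lemma recursive_if: assumes "decidable n P" "recursive n f" "recursive n g" shows "recursive n (\<lambda>z e. if P z e then f z e else g z e)"
proof -
  have "of_bool (P z e) * f z e + of_bool (\<not> P z e) * g z e = (if P z e then f z e else g z e)" for z e
    by simp
  then show ?thesis using recursive_add[OF recursive_mult[OF assms(1,2)] recursive_mult[OF decidable_not[OF assms(1)] assms(3)]] by simp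
qed

text \<open>Bounded quantifiers are derived from counting: a universal one says that no
  counterexample is counted.\<close>

lemma recursive_card:
  assumes P: "decidable (Suc n) (\<lambda>z e. P z (\<lambda>i. e (Suc i)) (e 0))" and k: "recursive n k"
  shows "recursive n (\<lambda>z e. card {i. i < k z e \<and> P z e i})"
proof -
  have "card {i. i < k \<and> P z e i} = (\<Sum>i<k. of_bool (P z e i))" for k z e
    by (simp add: of_bool_def sum.If_cases Int_def)
  then show ?thesis using recursive_sum[OF P k] by simp
qed

lemma decidable_ball:
  assumes P: "decidable (Suc n) (\<lambda>z e. P z (\<lambda>i. e (Suc i)) (e 0))" and k: "recursive n k"
  shows "decidable n (\<lambda>z e. \<forall>i<k z e. P z e i)"
proof -
  have "card {i. i < k \<and> \<not> P z e i} = 0 \<longleftrightarrow> (\<forall>i<k. P z e i)" for k z e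
    by (auto simp: card_eq_0_iff)
  then show ?thesis using decidable_eq[OF recursive_card[OF decidable_not[OF P] k] recursive_const[of n 0]] by (simp del: card_0_eq)
qed

lemma decidable_bex:
  assumes P: "decidable (Suc n) (\<lambda>z e. P z (\<lambda>i. e (Suc i)) (e 0))" and k: "recursive n k"
  shows "decidable n (\<lambda>z e. \<exists>i<k z e. P z e i)"
  using decidable_not[OF decidable_ball[OF decidable_not[OF P] k]] by simp

text \<open>Division is a count: for \<open>b > 0\<close>, exactly the \<open>i < a div b\<close>
  satisfy \<open>Suc i * b \<le> a\<close>. The clause \<open>b > 0\<close> makes the count 0 when
  dividing by 0.\<close>

lemma recursive_div: assumes "recursive n f" "recursive n g" shows "recursive n (\<lambda>z e. f z e div g z e)"
proof -
  have *: "card {i. i < a \<and> Suc i * b \<le> a \<and> b > 0} = a div b" for a b :: nat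
  proof (cases "b = 0")
    case False
    have "{i. i < a \<and> Suc i * b \<le> a \<and> b > 0} = {..<a div b}"
    proof (intro set_eqI iffI)
      fix i assume "i \<in> {i. i < a \<and> Suc i * b \<le> a \<and> b > 0}"
      then have "Suc i * b \<le> a" by auto
      then have "Suc i \<le> a div b" using False by (simp only: less_eq_div_iff_mult_less_eq neq0_conv)
      then show "i \<in> {..<a div b}" by auto
    next
      fix i assume "i \<in> {..<a div b}"
      then have "Suc i \<le> a div b" by auto
      then have 1: "Suc i * b \<le> a" using False by (simp only: less_eq_div_iff_mult_less_eq neq0_conv)
      moreover have "i < Suc i * b" using False by (cases b) auto
      ultimately have "i < a" by linarith
      with 1 False show "i \<in> {i. i < a \<and> Suc i * b \<le> a \<and> b > 0}" by simp
    qed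
    then show ?thesis by simp
  qed simp
  have "recursive (Suc (Suc 0)) (\<lambda>z e. card {i. i < e 0 \<and> Suc i * e (Suc 0) \<le> e 0 \<and> e (Suc 0) > 0})"
    by (intro recursive_card decidable_conj decidable_le decidable_less recursive_mult recursive_Suc recursive_var recursive_const) auto
  then have "recursive (Suc (Suc 0)) (\<lambda>z e. e 0 div e (Suc 0))" by (simp only: *)
  from recursive_comp2[OF this assms] show ?thesis .
qed

lemma recursive_mod: assumes "recursive n f" "recursive n g" shows "recursive n (\<lambda>z e. f z e mod g z e)"
  unfolding modulo_nat_def by (intro recursive_monus recursive_mult recursive_div assms)

lemma decidable_even: assumes "recursive n f" shows "decidable n (\<lambda>z e. even (f z e))"
  unfolding even_iff_mod_2_eq_zero by (intro decidable_eq recursive_mod recursive_const assms)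

lemma recursive_prod_encode: assumes "recursive n f" "recursive n g" shows "recursive n (\<lambda>z e. prod_encode (f z e, g z e))"
  unfolding prod_encode_def triangle_def prod.case
  by (intro recursive_add recursive_div recursive_mult recursive_Suc recursive_const assms)

lemmas recursive_intros = recursive_add recursive_mult recursive_pow recursive_fact recursive_monus recursive_div recursive_mod recursive_prod_encode recursive_if
  decidable_not decidable_conj decidable_imp decidable_disj decidable_less decidable_le decidable_eq decidable_even decidable_ball decidable_bex recursive_card recursive_sum
  recursive_Suc recursive_var recursive_const recursive_oracle

section \<open>Integer terms and bounded formulas over the Baire space\<close>

text \<open>The machine computes on naturals, so an integer is handled through its positive and its
  negative part.\<close>

definition recursive_int :: "nat \<Rightarrow> ((nat \<Rightarrow> nat) \<Rightarrow> (nat \<Rightarrow> nat) \<Rightarrow> int) \<Rightarrow> bool" where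
  "recursive_int n f \<longleftrightarrow> recursive n (\<lambda>z e. nat (f z e)) \<and> recursive n (\<lambda>z e. nat (- f z e))"

lemma recursive_int_add: assumes "recursive_int n f" "recursive_int n g" shows "recursive_int n (\<lambda>z e. f z e + g z e)"
proof -
  have *: "nat (a + b) = (nat a + nat b) - (nat (- a) + nat (- b))" for a b by linarith
  have "nat (- (a + b)) = (nat (- a) + nat (- b)) - (nat a + nat b)" for a b by linarith
  with * show ?thesis using assms unfolding recursive_int_def by (auto intro!: recursive_monus recursive_add)
qed

lemma recursive_int_mult: assumes "recursive_int n f" "recursive_int n g" shows "recursive_int n (\<lambda>z e. f z e * g z e)"
proof -
  have *: "nat (a * b) = (nat a * nat b + nat (- a) * nat (- b)) - (nat a * nat (- b) + nat (- a) * nat b)"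
    "nat (- (a * b)) = (nat a * nat (- b) + nat (- a) * nat b) - (nat a * nat b + nat (- a) * nat (- b))" for a b
    by (cases a; cases b; simp add: nat_mult_distrib nat_diff_distrib' mult_le_0_iff zero_le_mult_iff
        flip: of_nat_mult of_nat_Suc mult_minus_left mult_minus_right del: of_nat_Suc of_nat_mult)+
  with * show ?thesis using assms unfolding recursive_int_def by (auto intro!: recursive_monus recursive_mult recursive_add)
qed

lemma recursive_int_const: "recursive_int n (\<lambda>z e. c)"
  unfolding recursive_int_def by (auto intro: recursive_const)

lemma recursive_int_decode: assumes "recursive n f" shows "recursive_int n (\<lambda>z e. int_decode (f z e))"
proof -
  have "nat (int_decode c) = (if even c then c div 2 else 0)"
    "nat (- int_decode c) = (if even c then 0 else Suc (c div 2))" for c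
    by (auto simp: int_decode_def sum_decode_def)
  then show ?thesis unfolding recursive_int_def by (simp add: recursive_intros assms)
qed

lemma decidable_int_eq: assumes "recursive_int n f" "recursive_int n g" shows "decidable n (\<lambda>z e. f z e = g z e)"
proof -
  have "a = b \<longleftrightarrow> nat a = nat b \<and> nat (- a) = nat (- b)" for a b by linarith
  then show ?thesis using assms unfolding recursive_int_def by (auto intro!: decidable_conj decidable_eq)
qed

lemma decidable_int_le: assumes "recursive_int n f" "recursive_int n g" shows "decidable n (\<lambda>z e. f z e \<le> g z e)"
proof -
  have "a \<le> b \<longleftrightarrow> nat a + nat (- b) \<le> nat b + nat (- a)" for a b by linarith
  then show ?thesis using assms unfolding recursive_int_def by (simp only:) (intro decidable_le recursive_add; blast)
qed

text \<open>The arity has to exceed every variable of the term. A threshold, unlike an exact arity,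
  can be raised, so the thresholds of subterms combine by a maximum.\<close>

lemma recursive_int_tval: "\<exists>m. \<forall>n\<ge>m. recursive_int n (\<lambda>z e. tval (\<lambda>i. int_decode (e i)) t)"
proof (induction t)
  case (Var v)
  have "recursive_int n (\<lambda>z e. int_decode (e v))" if "Suc v \<le> n" for n
    using that by (intro recursive_int_decode recursive_var) simp
  then show ?case by (intro exI[of _ "Suc v"]) auto
next
  case (Const x)
  then show ?case by (auto intro: recursive_int_const)
next
  case (Add t1 t2)
  then obtain m1 m2 where "\<And>n. n \<ge> m1 \<Longrightarrow> recursive_int n (\<lambda>z e. tval (\<lambda>i. int_decode (e i)) t1)"
     "\<And>n. n \<ge> m2 \<Longrightarrow> recursive_int n (\<lambda>z e. tval (\<lambda>i. int_decode (e i)) t2)" by blast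
  then have "\<forall>n\<ge>max m1 m2. recursive_int n (\<lambda>z e. tval (\<lambda>i. int_decode (e i)) (Add t1 t2))"
    by (auto intro: recursive_int_add)
  then show ?case ..
next
  case (Mul t1 t2)
  then obtain m1 m2 where "\<And>n. n \<ge> m1 \<Longrightarrow> recursive_int n (\<lambda>z e. tval (\<lambda>i. int_decode (e i)) t1)"
     "\<And>n. n \<ge> m2 \<Longrightarrow> recursive_int n (\<lambda>z e. tval (\<lambda>i. int_decode (e i)) t2)" by blast
  then have "\<forall>n\<ge>max m1 m2. recursive_int n (\<lambda>z e. tval (\<lambda>i. int_decode (e i)) (Mul t1 t2))"
    by (auto intro: recursive_int_mult)
  then show ?case ..
qed

text \<open>Turns a quantifier over an interval of integers into a bounded quantifier over their
  codes.\<close>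

lemma int_decode_bound: "int_decode c = i \<Longrightarrow> c < 2 * (nat i + nat (- i)) + 2"
  by (auto simp: int_decode_def sum_decode_def split: if_splits)

lemma decidable_bounded_fm:
  "bounded_fm \<phi> \<Longrightarrow> \<exists>m. \<forall>n\<ge>m. decidable n (\<lambda>z e. sat (baire_sat z) (\<lambda>i. int_decode (e i)) \<phi>)"
proof (induction \<phi>)
  case (Ident s t)
  obtain m1 m2 where "\<And>n. n \<ge> m1 \<Longrightarrow> recursive_int n (\<lambda>z e. tval (\<lambda>i. int_decode (e i)) s)"
     "\<And>n. n \<ge> m2 \<Longrightarrow> recursive_int n (\<lambda>z e. tval (\<lambda>i. int_decode (e i)) t)" using recursive_int_tval by metis
  then show ?case by (intro exI[of _ "max m1 m2"]) (auto intro: decidable_int_eq)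
next
  case (Point a)
  obtain s t where a: "a = Value s t" by (cases a)
  obtain m1 m2 where m: "\<And>n. n \<ge> m1 \<Longrightarrow> recursive_int n (\<lambda>z e. tval (\<lambda>i. int_decode (e i)) s)"
     "\<And>n. n \<ge> m2 \<Longrightarrow> recursive_int n (\<lambda>z e. tval (\<lambda>i. int_decode (e i)) t)" using recursive_int_tval by metis
  have "i \<ge> 0 \<and> int (z (nat i)) = j \<longleftrightarrow> nat (- i) = 0 \<and> nat (- j) = 0 \<and> z (nat i) = nat j" for i j and z :: "nat \<Rightarrow> nat"
    by auto
  then show ?case using m unfolding a recursive_int_def
    by (intro exI[of _ "max m1 m2"]) (auto simp only: sat.simps baire_sat.simps intro!: decidable_conj decidable_eq recursive_oracle recursive_const)
next
  case (Neg \<phi>)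
  then obtain m where "\<And>n. n \<ge> m \<Longrightarrow> decidable n (\<lambda>z e. sat (baire_sat z) (\<lambda>i. int_decode (e i)) \<phi>)" by auto
  then have "decidable n (\<lambda>z e. sat (baire_sat z) (\<lambda>i. int_decode (e i)) (Neg \<phi>))" if "n \<ge> m" for n
    using that unfolding sat.simps by (intro decidable_not)
  then show ?case by blast
next
  case (Conj \<phi>1 \<phi>2)
  then obtain m1 m2 where "\<And>n. n \<ge> m1 \<Longrightarrow> decidable n (\<lambda>z e. sat (baire_sat z) (\<lambda>i. int_decode (e i)) \<phi>1)"
     "\<And>n. n \<ge> m2 \<Longrightarrow> decidable n (\<lambda>z e. sat (baire_sat z) (\<lambda>i. int_decode (e i)) \<phi>2)" by auto
  then show ?case by (intro exI[of _ "max m1 m2"]) (auto intro: decidable_conj)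
next
  case (BAll v s t \<phi>)
  obtain m1 m2 where m: "\<And>n. n \<ge> m1 \<Longrightarrow> recursive_int n (\<lambda>z e. tval (\<lambda>i. int_decode (e i)) s)"
     "\<And>n. n \<ge> m2 \<Longrightarrow> recursive_int n (\<lambda>z e. tval (\<lambda>i. int_decode (e i)) t)" using recursive_int_tval by metis
  from BAll obtain m3 where m3: "\<And>n. n \<ge> m3 \<Longrightarrow> decidable n (\<lambda>z e. sat (baire_sat z) (\<lambda>i. int_decode (e i)) \<phi>)" by auto
  let ?E = "\<lambda>e i. int_decode (e i)"
  \<comment> \<open>An integer between \<open>s\<close> and \<open>t\<close> has absolute value at
    most the sum of the absolute values of \<open>s\<close> and \<open>t\<close>.\<close>
  let ?B = "\<lambda>e. 2 * ((nat (tval (?E e) s) + nat (- tval (?E e) s)) + (nat (tval (?E e) t) + nat (- tval (?E e) t))) + 2"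
  have eq: "sat (baire_sat z) (?E e) (BAll v s t \<phi>) \<longleftrightarrow>
    (\<forall>c<?B e. tval (?E e) s \<le> int_decode c \<and> int_decode c \<le> tval (?E e) t \<longrightarrow>
        sat (baire_sat z) (?E (\<lambda>i. if i = v then c else e i)) \<phi>)" for z e
  proof -
    have fe: "?E (\<lambda>i. if i = v then c else e i) = (?E e)(v := int_decode c)" for c by auto
    have "c < ?B e" if "tval (?E e) s \<le> int_decode c" "int_decode c \<le> tval (?E e) t" for c
      using int_decode_bound[of c, OF refl] nat_mono[OF that(2)]
        nat_mono[of "- int_decode c" "- tval (?E e) s"] that(1) by simp
    then have "(\<forall>c<?B e. tval (?E e) s \<le> int_decode c \<and> int_decode c \<le> tval (?E e) t \<longrightarrow>
        sat (baire_sat z) (?E (\<lambda>i. if i = v then c else e i)) \<phi>) \<longleftrightarrow>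
      (\<forall>c. tval (?E e) s \<le> int_decode c \<and> int_decode c \<le> tval (?E e) t \<longrightarrow>
        sat (baire_sat z) ((?E e)(v := int_decode c)) \<phi>)" unfolding fe by blast
    also have "\<dots> \<longleftrightarrow> (\<forall>i. tval (?E e) s \<le> i \<and> i \<le> tval (?E e) t \<longrightarrow> sat (baire_sat z) ((?E e)(v := i)) \<phi>)"
      by (metis int_encode_inverse)
    finally show ?thesis by auto
  qed
  have "decidable n (\<lambda>z e. sat (baire_sat z) (?E e) (BAll v s t \<phi>))" if n: "n \<ge> max m1 (max m2 m3)" for n
  proof -
    have st: "recursive_int n (\<lambda>z e. tval (?E e) s)" "recursive_int n (\<lambda>z e. tval (?E e) t)"
      "recursive_int (Suc n) (\<lambda>z e. tval (?E e) s)" "recursive_int (Suc n) (\<lambda>z e. tval (?E e) t)" using m n by auto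
    have sh: "recursive_int (Suc n) (\<lambda>z e. g z (\<lambda>i. e (Suc i)))" if "recursive_int n g" for g
      using that recursive_comp[of n _ "Suc n" "\<lambda>i z e. e (Suc i)"] unfolding recursive_int_def by (auto simp: recursive_var)
    have "decidable n (\<lambda>z e. sat (baire_sat z) (?E e) \<phi>)" using m3 n by simp
    \<comment> \<open>\<open>decidable_ball\<close> supplies the bound variable at index 0, whereas
      the formula expects it at \<open>v\<close>.\<close>
    from recursive_comp[OF this, of "Suc n" "\<lambda>i z e. e (if i = v then 0 else Suc i)", OF recursive_var]
    have ph: "decidable (Suc n) (\<lambda>z e. sat (baire_sat z) (\<lambda>i. int_decode (if i = v then e 0 else e (Suc i))) \<phi>)"
      by (simp add: if_distrib cong: if_cong)
    show ?thesis unfolding eq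
      by (intro decidable_ball decidable_imp decidable_conj decidable_int_le recursive_int_decode recursive_var ph recursive_add recursive_mult recursive_const)
         (use st sh[OF st(1)] sh[OF st(2)] in \<open>auto simp: recursive_int_def\<close>)
  qed
  then show ?case by blast
qed auto

section \<open>Arithmetical definability\<close>

text \<open>Goedel's beta function: with \<open>c\<close> a suitable factorial the moduli
  \<open>Suc (Suc i * c)\<close> are pairwise coprime, and the Chinese remainder theorem packs a
  finite sequence into two numbers. It serves to express primitive recursion by quantifiers over
  numbers.\<close>

lemma beta_function:
  fixes f :: "nat \<Rightarrow> nat"
  shows "\<exists>a c. \<forall>i\<le>N. a mod (Suc (Suc i * c)) = f i"
proof -
  \<comment> \<open>\<open>M\<close> is at least every difference of two indices, so these divide
    \<open>c\<close>, and at least every value, so the values lie below the moduli.\<close>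
  define M where "M = Suc N + (\<Sum>i\<le>N. f i)"
  define c :: nat where "c = fact M"
  have fM: "f i < Suc (Suc i * c)" if "i \<le> N" for i
  proof -
    have "f i \<le> (\<Sum>i\<le>N. f i)" using that by (intro member_le_sum) auto
    also have "\<dots> \<le> M" by (simp add: M_def)
    also have "\<dots> \<le> c" unfolding c_def by (rule fact_ge_self)
    finally show ?thesis by simp
  qed
  have cop: "coprime (Suc (Suc i * c)) (Suc (Suc j * c))" if ij: "i < j" "j \<le> N" for i j
  proof (rule ccontr)
    assume "\<not> ?thesis"
    then have "gcd (Suc (Suc i * c)) (Suc (Suc j * c)) \<noteq> 1" by (metis coprime_iff_gcd_eq_1)
    then obtain p where p: "prime p" "p dvd gcd (Suc (Suc i * c)) (Suc (Suc j * c))"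
      using prime_factor_nat by blast
    then have p1: "p dvd Suc (Suc i * c)" and p2: "p dvd Suc (Suc j * c)" by auto
    have "Suc (Suc j * c) - Suc (Suc i * c) = (j - i) * c" by (simp add: diff_mult_distrib)
    then have "p dvd (j - i) * c" using p1 p2 by (metis dvd_diff_nat)
    then have "p dvd j - i \<or> p dvd c" using p(1) by (simp add: prime_dvd_mult_iff)
    moreover have "p dvd c" if "p dvd j - i"
    proof -
      have "j - i > 0" "j - i \<le> M" using ij by (auto simp: M_def)
      then have "j - i dvd c" unfolding c_def by (simp add: dvd_fact)
      then show ?thesis using that by (rule dvd_trans[rotated])
    qed
    ultimately have "p dvd c" by blast
    then have "p dvd Suc i * c" by simp
    with p1 have "p dvd 1" by (metis Suc_eq_plus1 dvd_add_right_iff)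
    with p(1) show False by (simp add: prime_nat_iff)
  qed
  obtain a where "\<forall>i\<in>{..N}. [a = f i] (mod Suc (Suc i * c))"
    using chinese_remainder_nat[of "{..N}" "\<lambda>i. Suc (Suc i * c)" f] cop
    by (metis atMost_iff coprime_commute finite_atMost nat_neq_iff)
  then show ?thesis using fM by (intro exI[of _ a] exI[of _ c]) (auto simp: cong_def simp del: mult_Suc)
qed

section \<open>Renaming variables in formulas about a real\<close>

primrec rename_trm :: "(nat \<Rightarrow> nat) \<Rightarrow> trm \<Rightarrow> trm" where
  "rename_trm \<sigma> (Var v) = Var (\<sigma> v)"
| "rename_trm \<sigma> (Const c) = Const c"
| "rename_trm \<sigma> (Add s t) = Add (rename_trm \<sigma> s) (rename_trm \<sigma> t)"
| "rename_trm \<sigma> (Mul s t) = Mul (rename_trm \<sigma> s) (rename_trm \<sigma> t)"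

primrec max_var_trm :: "trm \<Rightarrow> nat" where
  "max_var_trm (Var v) = v"
| "max_var_trm (Const c) = 0"
| "max_var_trm (Add s t) = max (max_var_trm s) (max_var_trm t)"
| "max_var_trm (Mul s t) = max (max_var_trm s) (max_var_trm t)"

lemma tval_rename_trm: "tval e (rename_trm \<sigma> t) = tval (\<lambda>i. e (\<sigma> i)) t"
  by (induction t) auto

lemma tval_cong: "(\<And>i. i \<le> max_var_trm t \<Longrightarrow> e i = e' i) \<Longrightarrow> tval e t = tval e' t"
  by (induction t) auto

primrec rename_atom :: "(nat \<Rightarrow> nat) \<Rightarrow> real_atom \<Rightarrow> real_atom" where
  "rename_atom \<sigma> (Interval p q r s) = Interval (rename_trm \<sigma> p) (rename_trm \<sigma> q) (rename_trm \<sigma> r) (rename_trm \<sigma> s)"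

primrec max_var_atom :: "real_atom \<Rightarrow> nat" where
  "max_var_atom (Interval p q r s) = max (max (max_var_trm p) (max_var_trm q)) (max (max_var_trm r) (max_var_trm s))"

primrec max_var :: "real_atom fm \<Rightarrow> nat" where
  "max_var (Ident s t) = max (max_var_trm s) (max_var_trm t)"
| "max_var (Point a) = max_var_atom a"
| "max_var (Neg \<phi>) = max_var \<phi>"
| "max_var (Conj \<phi> \<psi>) = max (max_var \<phi>) (max_var \<psi>)"
| "max_var (BAll v s t \<phi>) = max (max (max_var_trm s) (max_var_trm t)) (max_var \<phi>)"
| "max_var (All v \<phi>) = max_var \<phi>"
| "max_var (Ex v \<phi>) = max_var \<phi>"

lemma sat_cong: "(\<And>i. i \<le> max_var \<phi> \<Longrightarrow> e i = e' i) \<Longrightarrow> sat (real_sat x) e \<phi> = sat (real_sat x) e' \<phi>"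
proof (induction \<phi> arbitrary: e e')
  case (Ident s t)
  then show ?case using tval_cong[of s e e'] tval_cong[of t e e'] by auto
next
  case (Point a)
  then show ?case by (cases a) (auto cong: tval_cong)
next
  case (Conj \<phi> \<psi>)
  then show ?case by (metis max_var.simps(4) max.coboundedI1 max.coboundedI2 sat.simps(4))
next
  case (BAll v s t \<phi>)
  have "tval e s = tval e' s" "tval e t = tval e' t" using BAll.prems by (auto intro!: tval_cong)
  moreover have "sat (real_sat x) (e(v := i)) \<phi> = sat (real_sat x) (e'(v := i)) \<phi>" for i
    using BAll.prems by (intro BAll.IH) auto
  ultimately show ?case by simp
next
  case (All v \<phi>)
  have "sat (real_sat x) (e(v := i)) \<phi> = sat (real_sat x) (e'(v := i)) \<phi>" for i
    using All.prems by (intro All.IH) auto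
  then show ?case by simp
next
  case (Ex v \<phi>)
  have "sat (real_sat x) (e(v := i)) \<phi> = sat (real_sat x) (e'(v := i)) \<phi>" for i
    using Ex.prems by (intro Ex.IH) auto
  then show ?case by simp
next
  case (Neg \<phi>)
  then show ?case by (metis max_var.simps(3) sat.simps(3))
qed

text \<open>Renaming avoids capture: the new bound variable is larger than the image of every
  variable of the body.\<close>

primrec rename_fm :: "real_atom fm \<Rightarrow> (nat \<Rightarrow> nat) \<Rightarrow> real_atom fm" where
  "rename_fm (Ident s t) \<sigma> = Ident (rename_trm \<sigma> s) (rename_trm \<sigma> t)"
| "rename_fm (Point a) \<sigma> = Point (rename_atom \<sigma> a)"
| "rename_fm (Neg \<phi>) \<sigma> = Neg (rename_fm \<phi> \<sigma>)"
| "rename_fm (Conj \<phi> \<psi>) \<sigma> = Conj (rename_fm \<phi> \<sigma>) (rename_fm \<psi> \<sigma>)"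
| "rename_fm (BAll v s t \<phi>) \<sigma> = (let v' = Suc (\<Sum>i\<le>max_var \<phi>. \<sigma> i) in
     BAll v' (rename_trm \<sigma> s) (rename_trm \<sigma> t) (rename_fm \<phi> (\<sigma>(v := v'))))"
| "rename_fm (All v \<phi>) \<sigma> = All v \<phi>"
| "rename_fm (Ex v \<phi>) \<sigma> = Ex v \<phi>"

lemma bounded_rename_fm: "bounded_fm \<phi> \<Longrightarrow> bounded_fm (rename_fm \<phi> \<sigma>)"
  by (induction \<phi> arbitrary: \<sigma>) (auto simp: Let_def)

lemma sat_rename_fm: "bounded_fm \<phi> \<Longrightarrow> sat (real_sat x) e (rename_fm \<phi> \<sigma>) \<longleftrightarrow> sat (real_sat x) (\<lambda>i. e (\<sigma> i)) \<phi>"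
proof (induction \<phi> arbitrary: e \<sigma>)
  case (Point a)
  then show ?case by (cases a) (simp add: tval_rename_trm)
next
  case (BAll v s t \<phi>)
  define v' where "v' = Suc (\<Sum>i\<le>max_var \<phi>. \<sigma> i)"
  have "sat (real_sat x) (e(v' := i)) (rename_fm \<phi> (\<sigma>(v := v'))) \<longleftrightarrow> sat (real_sat x) ((\<lambda>i. e (\<sigma> i))(v := i)) \<phi>" for i
  proof -
    have 1: "\<sigma> j \<noteq> v'" if "j \<le> max_var \<phi>" for j
    proof -
      have "\<sigma> j \<le> (\<Sum>i\<le>max_var \<phi>. \<sigma> i)" using that by (intro member_le_sum) auto
      then show ?thesis by (simp add: v'_def)
    qed
    have "sat (real_sat x) (e(v' := i)) (rename_fm \<phi> (\<sigma>(v := v'))) \<longleftrightarrow>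
       sat (real_sat x) (\<lambda>j. (e(v' := i)) ((\<sigma>(v := v')) j)) \<phi>" using BAll by simp
    also have "\<dots> \<longleftrightarrow> sat (real_sat x) ((\<lambda>i. e (\<sigma> i))(v := i)) \<phi>"
      using 1 by (intro sat_cong) auto
    finally show ?thesis .
  qed
  then show ?case by (simp add: v'_def[symmetric] Let_def tval_rename_trm)
qed (auto simp: tval_rename_trm)

section \<open>Bounded formulas over the natural numbers\<close>

definition nat_term :: "((nat \<Rightarrow> nat) \<Rightarrow> nat) \<Rightarrow> bool" where
  "nat_term f \<longleftrightarrow> (\<exists>t. \<forall>e. tval (\<lambda>i. int (e i)) t = int (f e))"

lemma nat_term_var: "nat_term (\<lambda>e. e i)" unfolding nat_term_def by (rule exI[of _ "Var i"]) simp
lemma nat_term_const: "nat_term (\<lambda>e. c)" unfolding nat_term_def by (rule exI[of _ "Const (int c)"]) simp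
lemma nat_term_add: "nat_term f \<Longrightarrow> nat_term g \<Longrightarrow> nat_term (\<lambda>e. f e + g e)"
  unfolding nat_term_def by clarify (rename_tac s t, rule_tac x = "Add s t" in exI, simp)
lemma nat_term_mult: "nat_term f \<Longrightarrow> nat_term g \<Longrightarrow> nat_term (\<lambda>e. f e * g e)"
  unfolding nat_term_def by clarify (rename_tac s t, rule_tac x = "Mul s t" in exI, simp)
lemma nat_term_Suc: "nat_term f \<Longrightarrow> nat_term (\<lambda>e. Suc (f e))"
  using nat_term_add[OF nat_term_const[of 1]] by simp
lemma nat_term_reindex: assumes "nat_term f" shows "nat_term (\<lambda>e. f (\<lambda>i. e (\<sigma> i)))"
proof -
  from assms obtain t where "\<And>e. tval (\<lambda>i. int (e i)) t = int (f e)" unfolding nat_term_def by blast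
  then show ?thesis unfolding nat_term_def by (intro exI[of _ "rename_trm \<sigma> t"]) (simp add: tval_rename_trm)
qed
lemmas nat_term_intros = nat_term_add nat_term_mult nat_term_Suc nat_term_var nat_term_const

text \<open>Formulas are evaluated only at natural assignments, so that they share environments with
  the recursive functions; integer quantifiers return in \<open>effective_Pi_3I\<close>.\<close>

definition delta0 :: "(real \<Rightarrow> (nat \<Rightarrow> nat) \<Rightarrow> bool) \<Rightarrow> bool" where
  "delta0 Q \<longleftrightarrow> (\<exists>\<phi>. bounded_fm \<phi> \<and> (\<forall>x e. sat (real_sat x) (\<lambda>i. int (e i)) \<phi> \<longleftrightarrow> Q x e))"

lemma delta0_eq: assumes "nat_term f" "nat_term g" shows "delta0 (\<lambda>x e. f e = g e)"
proof -
  from assms obtain s t where "\<And>e. tval (\<lambda>i. int (e i)) s = int (f e)" "\<And>e. tval (\<lambda>i. int (e i)) t = int (g e)"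
    unfolding nat_term_def by blast
  then show ?thesis unfolding delta0_def by (intro exI[of _ "Ident s t"]) simp
qed

lemma delta0_not: "delta0 Q \<Longrightarrow> delta0 (\<lambda>x e. \<not> Q x e)"
  unfolding delta0_def by clarify (rename_tac s, rule_tac x = "Neg s" in exI, simp)

lemma delta0_conj: "delta0 P \<Longrightarrow> delta0 Q \<Longrightarrow> delta0 (\<lambda>x e. P x e \<and> Q x e)"
  unfolding delta0_def by clarify (rename_tac s t, rule_tac x = "Conj s t" in exI, simp)

lemma delta0_disj: "delta0 P \<Longrightarrow> delta0 Q \<Longrightarrow> delta0 (\<lambda>x e. P x e \<or> Q x e)"
  using delta0_not[OF delta0_conj[OF delta0_not delta0_not], of P Q] by simp

lemma delta0_imp: "delta0 P \<Longrightarrow> delta0 Q \<Longrightarrow> delta0 (\<lambda>x e. P x e \<longrightarrow> Q x e)"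
  using delta0_not[OF delta0_conj[OF _ delta0_not], of P Q] by simp

lemma delta0_reindex: "delta0 Q \<Longrightarrow> delta0 (\<lambda>x e. Q x (\<lambda>i. e (\<sigma> i)))"
  unfolding delta0_def by clarify (rename_tac \<phi>, rule_tac x = "rename_fm \<phi> \<sigma>" in exI, simp add: sat_rename_fm bounded_rename_fm)

lemma delta0_ball:
  assumes "delta0 (\<lambda>x e. Q x (\<lambda>i. e (Suc i)) (e 0))" "nat_term k"
  shows "delta0 (\<lambda>x e. \<forall>i\<le>k e. Q x e i)"
proof -
  from assms(1) obtain \<phi> where \<phi>: "bounded_fm \<phi>"
    "\<And>x e. sat (real_sat x) (\<lambda>i. int (e i)) \<phi> \<longleftrightarrow> Q x (\<lambda>i. e (Suc i)) (e 0)" unfolding delta0_def by blast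
  from assms(2) obtain t where t: "\<And>e. tval (\<lambda>i. int (e i)) t = int (k e)" unfolding nat_term_def by blast
  \<comment> \<open>The de Bruijn index 0 becomes the named variable \<open>v\<close>, and the
    others move down by one; \<open>v\<close> lies above all of them.\<close>
  define v where "v = Suc (max_var \<phi>)"
  have 1: "sat (real_sat x) ((\<lambda>i. int (e i))(v := int j)) (rename_fm \<phi> (case_nat v (\<lambda>n. n))) \<longleftrightarrow> Q x e j" for x e j
  proof -
    have "sat (real_sat x) ((\<lambda>i. int (e i))(v := int j)) (rename_fm \<phi> (case_nat v (\<lambda>n. n))) \<longleftrightarrow>
      sat (real_sat x) (\<lambda>i. int (case_nat j e i)) \<phi>"
      unfolding sat_rename_fm[OF \<phi>(1)] by (rule sat_cong) (auto simp: v_def split: nat.splits)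
    also have "\<dots> \<longleftrightarrow> Q x e j" unfolding \<phi>(2) by simp
    finally show ?thesis .
  qed
  show ?thesis unfolding delta0_def
  proof (intro exI[of _ "BAll v (Const 0) t (rename_fm \<phi> (case_nat v (\<lambda>n. n)))"] conjI allI)
    show "bounded_fm (BAll v (Const 0) t (rename_fm \<phi> (case_nat v (\<lambda>n. n))))"
      using \<phi>(1) by (simp add: bounded_rename_fm)
    fix x e
    have "(\<forall>i\<in>{0..int (k e)}. sat (real_sat x) ((\<lambda>i. int (e i))(v := i)) (rename_fm \<phi> (case_nat v (\<lambda>n. n)))) \<longleftrightarrow>
       (\<forall>j\<le>k e. Q x e j)"
    proof (intro iffI ballI allI impI)
      fix j assume "j \<le> k e" and "\<forall>i\<in>{0..int (k e)}. sat (real_sat x) ((\<lambda>i. int (e i))(v := i)) (rename_fm \<phi> (case_nat v (\<lambda>n. n)))"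
      then show "Q x e j" using 1[of x e j] by simp
    next
      fix i assume "\<forall>j\<le>k e. Q x e j" "i \<in> {0..int (k e)}"
      then show "sat (real_sat x) ((\<lambda>i. int (e i))(v := i)) (rename_fm \<phi> (case_nat v (\<lambda>n. n)))"
        using 1[of x e "nat i"] by auto
    qed
    then show "sat (real_sat x) (\<lambda>i. int (e i)) (BAll v (Const 0) t (rename_fm \<phi> (case_nat v (\<lambda>n. n)))) \<longleftrightarrow> (\<forall>j\<le>k e. Q x e j)"
      by (simp add: t)
  qed
qed

lemma delta0_bex:
  assumes "delta0 (\<lambda>x e. Q x (\<lambda>i. e (Suc i)) (e 0))" "nat_term k"
  shows "delta0 (\<lambda>x e. \<exists>i\<le>k e. Q x e i)"
  using delta0_not[OF delta0_ball[OF delta0_not[OF assms(1)] assms(2)]] by simp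

text \<open>There is no atom for the order, so it is extracted from the bound of a
  quantifier.\<close>

lemma delta0_le: assumes "nat_term f" "nat_term g" shows "delta0 (\<lambda>x e. f e \<le> g e)"
proof -
  have "delta0 (\<lambda>x e. \<exists>i\<le>g e. f e = i)"
    by (intro delta0_bex delta0_eq nat_term_reindex[OF assms(1)] assms(2) nat_term_var)
  then show ?thesis by simp
qed

lemma delta0_less: assumes "nat_term f" "nat_term g" shows "delta0 (\<lambda>x e. f e < g e)"
  using delta0_le[OF nat_term_Suc[OF assms(1)] assms(2)] by (simp add: Suc_le_eq)

lemma delta0_mod: assumes "nat_term f" "nat_term g" "nat_term h" shows "delta0 (\<lambda>x e. f e mod Suc (g e) = h e)"
proof -
  have "delta0 (\<lambda>x e. \<exists>q\<le>f e. f e = q * Suc (g e) + h e \<and> h e < Suc (g e))"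
    by (intro delta0_bex delta0_eq delta0_conj delta0_less nat_term_intros assms nat_term_reindex[OF assms(1)] nat_term_reindex[OF assms(2)] nat_term_reindex[OF assms(3)])
  moreover have "(\<exists>q\<le>a. a = q * Suc b + c \<and> c < Suc b) \<longleftrightarrow> a mod Suc b = c" for a b c
  proof
    assume "\<exists>q\<le>a. a = q * Suc b + c \<and> c < Suc b"
    then obtain q where "a = q * Suc b + c" "c < Suc b" by blast
    then show "a mod Suc b = c" by (simp del: mult_Suc_right)
  next
    assume "a mod Suc b = c"
    then have "a = (a div Suc b) * Suc b + c \<and> c < Suc b" by (metis div_mult_mod_eq mod_less_divisor zero_less_Suc)
    then show "\<exists>q\<le>a. a = q * Suc b + c \<and> c < Suc b" by (metis div_le_dividend)
  qed
  ultimately show ?thesis by simp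
qed

lemma delta0_True: "delta0 (\<lambda>x e. True)" using delta0_eq[OF nat_term_const[of 0] nat_term_const[of 0]] by simp
lemma delta0_False: "delta0 (\<lambda>x e. False)" using delta0_not[OF delta0_True] by simp

section \<open>Sigma_1 relations\<close>

definition sigma1 :: "(real \<Rightarrow> (nat \<Rightarrow> nat) \<Rightarrow> bool) \<Rightarrow> bool" where
  "sigma1 Q \<longleftrightarrow> (\<exists>R. delta0 (\<lambda>x e. R x (\<lambda>i. e (Suc i)) (e 0)) \<and> (\<forall>x e. Q x e \<longleftrightarrow> (\<exists>t. R x e t)))"

lemma sigma1I: "delta0 (\<lambda>x e. R x (\<lambda>i. e (Suc i)) (e 0)) \<Longrightarrow> sigma1 (\<lambda>x e. \<exists>t. R x e t)"
  unfolding sigma1_def by blast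

lemma sigma1E: assumes "sigma1 Q" obtains R where "delta0 (\<lambda>x e. R x (\<lambda>i. e (Suc i)) (e 0))" "Q = (\<lambda>x e. \<exists>t. R x e t)"
proof -
  from assms obtain R where "delta0 (\<lambda>x e. R x (\<lambda>i. e (Suc i)) (e 0))" "\<And>x e. Q x e \<longleftrightarrow> (\<exists>t. R x e t)"
    unfolding sigma1_def by blast
  then show thesis by (intro that[of R] ext)
qed

lemma sigma1_delta0: "delta0 Q \<Longrightarrow> sigma1 Q"
  using sigma1I[of "\<lambda>x e t. Q x e"] delta0_reindex[of Q Suc] by simp

lemma sigma1_reindex: assumes "sigma1 Q" shows "sigma1 (\<lambda>x e. Q x (\<lambda>i. e (\<sigma> i)))"
proof -
  from assms obtain R where R: "delta0 (\<lambda>x e. R x (\<lambda>i. e (Suc i)) (e 0))" "Q = (\<lambda>x e. \<exists>t. R x e t)" by (rule sigma1E)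
  have "delta0 (\<lambda>x e. R x (\<lambda>i. e (Suc (\<sigma> i))) (e 0))"
    using delta0_reindex[OF R(1), of "case_nat 0 (\<lambda>i. Suc (\<sigma> i))"] by simp
  then show ?thesis unfolding R(2) by (rule sigma1I)
qed

lemma delta0_sub2: assumes "delta0 (\<lambda>x e. R x (\<lambda>i. e (Suc i)) (e 0))" shows "delta0 (\<lambda>x e. R x (\<lambda>i. e (\<sigma> i)) (e j))"
  using delta0_reindex[OF assms, of "case_nat j \<sigma>"] by simp

text \<open>Two witnesses are traded for one common bound, the witnesses themselves becoming
  boundedly quantified.\<close>

lemma sigma1_ex: assumes "sigma1 (\<lambda>x e. Q x (\<lambda>i. e (Suc i)) (e 0))" shows "sigma1 (\<lambda>x e. \<exists>i. Q x e i)"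
proof -
  from assms obtain R where R: "delta0 (\<lambda>x e. R x (\<lambda>i. e (Suc i)) (e 0))"
    "(\<lambda>x e. Q x (\<lambda>i. e (Suc i)) (e 0)) = (\<lambda>x e. \<exists>t. R x e t)" by (rule sigma1E)
  have Q: "Q x e j \<longleftrightarrow> (\<exists>t. R x (case_nat j e) t)" for x e j
    using fun_cong[OF fun_cong[OF R(2), of x], of "case_nat j e"] by simp
  have "(\<exists>i. Q x e i) \<longleftrightarrow> (\<exists>m. \<exists>i\<le>m. \<exists>t\<le>m. R x (case_nat i e) t)" for x e
    unfolding Q by (meson max.cobounded1 max.cobounded2)
  moreover have "delta0 (\<lambda>x e. R x (case_nat (e (Suc 0)) (\<lambda>i. e (Suc (Suc (Suc i))))) (e 0))"
  proof -
    have "case_nat (e (Suc 0)) (\<lambda>i. e (Suc (Suc (Suc i)))) = (\<lambda>i. e (case_nat (Suc 0) (\<lambda>i. Suc (Suc (Suc i))) i))" for e :: "nat \<Rightarrow> nat"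
      by (rule ext) (simp split: nat.splits)
    then show ?thesis by (simp only: delta0_sub2[OF R(1)])
  qed
  then have "delta0 (\<lambda>x e. \<exists>i\<le>e 0. \<exists>t\<le>e 0. R x (case_nat i (\<lambda>i. e (Suc i))) t)"
    by (intro delta0_bex nat_term_var)
  ultimately show ?thesis using sigma1I by simp
qed

lemma sigma1_conj: assumes "sigma1 P" "sigma1 Q" shows "sigma1 (\<lambda>x e. P x e \<and> Q x e)"
proof -
  from assms(1) obtain R where R: "delta0 (\<lambda>x e. R x (\<lambda>i. e (Suc i)) (e 0))" "P = (\<lambda>x e. \<exists>t. R x e t)" by (rule sigma1E)
  from assms(2) obtain S where S: "delta0 (\<lambda>x e. S x (\<lambda>i. e (Suc i)) (e 0))" "Q = (\<lambda>x e. \<exists>t. S x e t)" by (rule sigma1E)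
  have "sigma1 (\<lambda>x e. \<exists>t. \<exists>u. R x e t \<and> S x e u)"
    by (intro sigma1_ex sigma1_delta0 delta0_conj delta0_sub2[OF R(1)] delta0_sub2[OF S(1)])
  then show ?thesis unfolding R(2) S(2) by simp
qed

text \<open>Collection: finitely many witnesses have a common bound, for instance their sum.\<close>

lemma sigma1_ball: assumes "sigma1 (\<lambda>x e. Q x (\<lambda>i. e (Suc i)) (e 0))" "nat_term k" shows "sigma1 (\<lambda>x e. \<forall>i<k e. Q x e i)"
proof -
  from assms obtain R where R: "delta0 (\<lambda>x e. R x (\<lambda>i. e (Suc i)) (e 0))"
    "(\<lambda>x e. Q x (\<lambda>i. e (Suc i)) (e 0)) = (\<lambda>x e. \<exists>t. R x e t)" by (blast elim: sigma1E)
  have Q: "Q x e j \<longleftrightarrow> (\<exists>t. R x (case_nat j e) t)" for x e j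
    using fun_cong[OF fun_cong[OF R(2), of x], of "case_nat j e"] by simp
  have "(\<forall>i<k e. Q x e i) \<longleftrightarrow> (\<exists>m. \<forall>i\<le>k e. i < k e \<longrightarrow> (\<exists>t\<le>m. R x (case_nat i e) t))" for x e
  proof
    assume "\<forall>i<k e. Q x e i"
    then have "\<forall>i. \<exists>t. i < k e \<longrightarrow> R x (case_nat i e) t" unfolding Q by blast
    then obtain t where t: "\<And>i. i < k e \<Longrightarrow> R x (case_nat i e) (t i)" by metis
    have "t i \<le> (\<Sum>i<k e. t i)" if "i < k e" for i using that by (intro member_le_sum) auto
    with t show "\<exists>m. \<forall>i\<le>k e. i < k e \<longrightarrow> (\<exists>t\<le>m. R x (case_nat i e) t)" by blast
  next
    assume "\<exists>m. \<forall>i\<le>k e. i < k e \<longrightarrow> (\<exists>t\<le>m. R x (case_nat i e) t)"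
    then show "\<forall>i<k e. Q x e i" unfolding Q by (meson less_imp_le)
  qed
  moreover have "delta0 (\<lambda>x e. R x (case_nat (e (Suc 0)) (\<lambda>i. e (Suc (Suc (Suc i))))) (e 0))"
  proof -
    have "case_nat (e (Suc 0)) (\<lambda>i. e (Suc (Suc (Suc i)))) = (\<lambda>i. e (case_nat (Suc 0) (\<lambda>i. Suc (Suc (Suc i))) i))" for e :: "nat \<Rightarrow> nat"
      by (rule ext) (simp split: nat.splits)
    then show ?thesis by (simp only: delta0_sub2[OF R(1)])
  qed
  then have "delta0 (\<lambda>x e. \<forall>i\<le>k (\<lambda>i. e (Suc i)). i < k (\<lambda>i. e (Suc i)) \<longrightarrow> (\<exists>t\<le>e 0. R x (case_nat i (\<lambda>i. e (Suc i))) t))"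
    by (intro delta0_ball delta0_imp delta0_less delta0_bex nat_term_var nat_term_reindex[OF assms(2)])
  ultimately show ?thesis using sigma1I by simp
qed

lemma sigma1_all_less: "(\<And>i. i < m \<Longrightarrow> sigma1 (Q i)) \<Longrightarrow> sigma1 (\<lambda>x e. \<forall>i<m. Q i x e)" for m :: nat
proof (induction m)
  case 0
  then show ?case using sigma1_delta0[OF delta0_True] by simp
next
  case (Suc m)
  then have "sigma1 (\<lambda>x e. (\<forall>i<m. Q i x e) \<and> Q m x e)" by (intro sigma1_conj) auto
  moreover have "(\<forall>i<Suc m. Q i x e) \<longleftrightarrow> (\<forall>i<m. Q i x e) \<and> Q m x e" for x e
    by (auto simp: less_Suc_eq)
  ultimately show ?case by simp
qed

text \<open>For the intermediate values of a composition, whose number depends on the code. They are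
  put in front of the environment.\<close>

lemma sigma1_exlist: "sigma1 Q \<Longrightarrow> sigma1 (\<lambda>x e. \<exists>ys. length ys = m \<and> Q x (\<lambda>i. if i < m then ys ! i else e (i - m)))"
proof (induction m arbitrary: Q)
  case 0
  then show ?case by simp
next
  case (Suc m)
  have "sigma1 (\<lambda>x e. \<exists>y. Q x (case_nat y e))"
  proof (rule sigma1_ex)
    have "case_nat (e 0) (\<lambda>i. e (Suc i)) = e" for e :: "nat \<Rightarrow> nat"
      by (rule ext) (simp split: nat.splits)
    then show "sigma1 (\<lambda>x e. Q x (case_nat (e 0) (\<lambda>i. e (Suc i))))" using Suc.prems by simp
  qed
  from Suc.IH[OF this] have *: "sigma1 (\<lambda>x e. \<exists>ys. length ys = m \<and>
    (\<exists>y. Q x (case_nat y (\<lambda>i. if i < m then ys ! i else e (i - m)))))" .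
  have env: "case_nat y (\<lambda>i. if i < m then ys ! i else e (i - m)) = (\<lambda>i. if i < Suc m then (y # ys) ! i else e (i - Suc m))"
    for y and ys :: "nat list" and e
    by (rule ext) (simp split: nat.splits)
  have "(\<exists>ys. length ys = Suc m \<and> Q x (\<lambda>i. if i < Suc m then ys ! i else e (i - Suc m))) \<longleftrightarrow>
     (\<exists>ys. length ys = m \<and> (\<exists>y. Q x (\<lambda>i. if i < Suc m then (y # ys) ! i else e (i - Suc m))))" for x e
    unfolding length_Suc_conv by blast
  then show ?case using * unfolding env by simp
qed

section \<open>Computations are Sigma_1\<close>

lemma computes_Zero_iff: "computes z Zero xs v \<longleftrightarrow> v = 0"
  by (auto intro: computes.intros elim: computes_ZeroE)
lemma computes_Succ_iff: "computes z Succ xs v \<longleftrightarrow> (\<exists>x. xs = [x] \<and> v = Suc x)"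
  by (auto intro: computes.intros elim: computes_SuccE)
lemma computes_Oracle_iff: "computes z Oracle xs v \<longleftrightarrow> (\<exists>x. xs = [x] \<and> v = z x)"
  by (auto intro: computes.intros elim: computes_OracleE)
lemma computes_Proj_iff: "computes z (Proj i) xs v \<longleftrightarrow> i < length xs \<and> v = xs ! i"
  by (auto intro: computes.intros elim: computes_ProjE)
lemma computes_Comp_iff: "computes z (Comp f gs) xs v \<longleftrightarrow>
    (\<exists>ys. length ys = length gs \<and> (\<forall>i<length gs. computes z (gs ! i) xs (ys ! i)) \<and> computes z f ys v)"
proof
  assume "computes z (Comp f gs) xs v"
  then obtain ys where "list_all2 (\<lambda>g y. computes z g xs y) gs ys" "computes z f ys v"
    by (rule computes_CompE)
  then show "\<exists>ys. length ys = length gs \<and> (\<forall>i<length gs. computes z (gs ! i) xs (ys ! i)) \<and> computes z f ys v"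
    by (intro exI[of _ ys]) (auto simp: list_all2_conv_all_nth)
next
  assume "\<exists>ys. length ys = length gs \<and> (\<forall>i<length gs. computes z (gs ! i) xs (ys ! i)) \<and> computes z f ys v"
  then obtain ys where "length ys = length gs" "\<forall>i<length gs. computes z (gs ! i) xs (ys ! i)" "computes z f ys v" by blast
  then show "computes z (Comp f gs) xs v"
    by (intro computes.comp[of _ _ _ ys]) (auto simp: list_all2_conv_all_nth)
qed
lemma computes_Mu_iff: "computes z (Mu f) xs n \<longleftrightarrow> computes z f (n # xs) 0 \<and> (\<forall>m<n. \<exists>v. 0 < v \<and> computes z f (m # xs) v)"
  by (auto intro: computes.intros elim: computes_MuE)
lemma computes_Prec_Nil: "\<not> computes z (Prec f g) [] v"
  by (auto elim: computes.cases)

lemma computes_Prec_iff_seq: "computes z (Prec f g) (n # xs) v \<longleftrightarrow>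
  (\<exists>u. computes z f xs (u 0) \<and> (\<forall>i<n. computes z g (i # u i # xs) (u (Suc i))) \<and> u n = v)"
proof (induction n arbitrary: v)
  case 0
  show ?case
  proof
    assume "computes z (Prec f g) (0 # xs) v"
    then have "computes z f xs v" by (rule computes_Prec_0E)
    then show "\<exists>u. computes z f xs (u 0) \<and> (\<forall>i<0. computes z g (i # u i # xs) (u (Suc i))) \<and> u 0 = v"
      by (intro exI[of _ "\<lambda>_. v"]) simp
  qed (auto intro: computes.intros)
next
  case (Suc n)
  show ?case
  proof
    assume "computes z (Prec f g) (Suc n # xs) v"
    then obtain w where w: "computes z (Prec f g) (n # xs) w" "computes z g (n # w # xs) v"
      by (rule computes_Prec_SucE)
    from w(1)[unfolded Suc.IH] obtain u where u: "computes z f xs (u 0)" "\<forall>i<n. computes z g (i # u i # xs) (u (Suc i))" "u n = w"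
      by blast
    then show "\<exists>u. computes z f xs (u 0) \<and> (\<forall>i<Suc n. computes z g (i # u i # xs) (u (Suc i))) \<and> u (Suc n) = v"
      using w by (intro exI[of _ "u(Suc n := v)"]) (auto simp: less_Suc_eq)
  next
    assume "\<exists>u. computes z f xs (u 0) \<and> (\<forall>i<Suc n. computes z g (i # u i # xs) (u (Suc i))) \<and> u (Suc n) = v"
    then obtain u where u: "computes z f xs (u 0)" "\<forall>i<Suc n. computes z g (i # u i # xs) (u (Suc i))" "u (Suc n) = v"
      by blast
    then have "computes z (Prec f g) (n # xs) (u n)" unfolding Suc.IH by (metis less_Suc_eq)
    then show "computes z (Prec f g) (Suc n # xs) v" using u by (auto intro: computes.intros)
  qed
qed

text \<open>The run of a primitive recursion is coded by the two parameters of the beta function.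
  The remainders get names \<open>u\<close>, \<open>u'\<close> because \<open>delta0_mod\<close>
  treats a remainder only within an equation.\<close>

lemma computes_Prec_iff: "computes z (Prec f g) (n # xs) v \<longleftrightarrow>
  (\<exists>a c. (\<exists>u. a mod Suc (Suc 0 * c) = u \<and> computes z f xs u) \<and>
     (\<forall>i<n. \<exists>u u'. a mod Suc (Suc i * c) = u \<and> a mod Suc (Suc (Suc i) * c) = u' \<and> computes z g (i # u # xs) u') \<and>
     a mod Suc (Suc n * c) = v)" (is "_ \<longleftrightarrow> ?R")
proof
  assume "computes z (Prec f g) (n # xs) v"
  then obtain u where u: "computes z f xs (u 0)" "\<forall>i<n. computes z g (i # u i # xs) (u (Suc i))" "u n = v"
    unfolding computes_Prec_iff_seq by blast
  obtain a c where "\<forall>i\<le>n. a mod (Suc (Suc i * c)) = u i" using beta_function by blast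
  then show ?R using u by (intro exI[of _ a] exI[of _ c]) (auto simp del: mult_Suc)
next
  assume ?R
  then obtain a c where "computes z f xs (a mod Suc (Suc 0 * c))"
    "\<forall>i<n. computes z g (i # a mod Suc (Suc i * c) # xs) (a mod Suc (Suc (Suc i) * c))"
    "a mod Suc (Suc n * c) = v" by blast
  then show "computes z (Prec f g) (n # xs) v"
    unfolding computes_Prec_iff_seq by (intro exI[of _ "\<lambda>i. a mod Suc (Suc i * c)"]) auto
qed

text \<open>The outcome for the interval \<open>(p/q, 1)\<close>; for \<open>q = 0\<close> this is \<open>(0, 1)\<close>.\<close>
definition interval_oracle :: "real \<Rightarrow> nat \<Rightarrow> nat" where
  "interval_oracle x m = (case prod_decode m of (p, q) \<Rightarrow> of_bool (real p / real q < x \<and> x < 1))"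

lemma delta0_Interval: assumes "nat_term p" "nat_term q" shows "delta0 (\<lambda>x e. real (p e) / real (q e) < x \<and> x < 1)"
proof -
  from assms obtain s t where "\<And>e. tval (\<lambda>i. int (e i)) s = int (p e)" "\<And>e. tval (\<lambda>i. int (e i)) t = int (q e)"
    unfolding nat_term_def by blast
  then show ?thesis unfolding delta0_def
    by (intro exI[of _ "Point (Interval s t (Const 1) (Const 1))"]) simp
qed

lemma delta0_interval_oracle: "delta0 (\<lambda>x e. interval_oracle x (e 1) = e 0)"
proof -
  have "interval_oracle x m = v \<longleftrightarrow> (\<exists>p\<le>m. \<exists>q\<le>m. 2 * m = (p + q) * Suc (p + q) + 2 * p \<and>
      ((real p / real q < x \<and> x < 1) \<and> v = 1 \<or> \<not> (real p / real q < x \<and> x < 1) \<and> v = 0))" (is "_ \<longleftrightarrow> ?R") for x m v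
  proof -
    obtain p q where pq: "prod_decode m = (p, q)" by force
    \<comment> \<open>Doubling removes the division by 2 in the triangular numbers and leaves a
      polynomial equation.\<close>
    have enc: "2 * prod_encode (a, b) = (a + b) * Suc (a + b) + 2 * a" for a b
    proof -
      have "2 * triangle k = k * Suc k" for k unfolding triangle_def by (simp add: even_two_times_div_two)
      then show ?thesis by (simp add: prod_encode_def distrib_left)
    qed
    have "2 * m = (a + b) * Suc (a + b) + 2 * a \<longleftrightarrow> (a, b) = (p, q)" for a b
    proof -
      have "2 * m = (a + b) * Suc (a + b) + 2 * a \<longleftrightarrow> m = prod_encode (a, b)" using enc[of a b] by linarith
      then show ?thesis using pq by (metis prod_decode_inverse prod_encode_inverse)
    qed
    moreover have "p \<le> m" "q \<le> m" using pq by (metis le_prod_encode_1 le_prod_encode_2 prod_decode_inverse)+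
    ultimately have "?R \<longleftrightarrow> ((real p / real q < x \<and> x < 1) \<and> v = 1 \<or> \<not> (real p / real q < x \<and> x < 1) \<and> v = 0)"
      by (metis Pair_inject)
    also have "\<dots> \<longleftrightarrow> interval_oracle x m = v" unfolding interval_oracle_def pq by (auto simp: of_bool_def)
    finally show ?thesis by (rule sym)
  qed
  moreover have "delta0 (\<lambda>x e. \<exists>p\<le>e 1. \<exists>q\<le>e 1. 2 * e 1 = (p + q) * Suc (p + q) + 2 * p \<and>
      ((real p / real q < x \<and> x < 1) \<and> e 0 = 1 \<or> \<not> (real p / real q < x \<and> x < 1) \<and> e 0 = 0))"
    by (intro delta0_bex delta0_conj delta0_disj delta0_eq delta0_not delta0_Interval nat_term_intros)
  ultimately show ?thesis by simp
qed

text \<open>Induction on the code, for all arities at once, since subcodes run with other numbers of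
  arguments. The value is variable 0 and the arguments follow.\<close>

lemma sigma1_computes: "sigma1 (\<lambda>x e. computes (interval_oracle x) c (map (\<lambda>i. e (Suc i)) [0..<n]) (e 0))"
proof (induction c arbitrary: n)
  case Zero
  then show ?case unfolding computes_Zero_iff by (intro sigma1_delta0 delta0_eq nat_term_intros)
next
  case Succ
  have "(\<exists>x. map (\<lambda>i. e (Suc i)) [0..<n] = [x] \<and> v = Suc x) \<longleftrightarrow> n = 1 \<and> v = Suc (e 1)" for e v
  proof (cases "n = 1")
    case False
    then have "map (\<lambda>i. e (Suc i)) [0..<n] \<noteq> [x]" for x by (metis length_map length_upt diff_zero length_Cons list.size(3) One_nat_def)
    then show ?thesis using False by simp
  qed simp
  moreover have "sigma1 (\<lambda>x e. n = 1 \<and> e 0 = Suc (e 1))"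
    using sigma1_delta0[OF delta0_eq[OF nat_term_var nat_term_Suc[OF nat_term_var]], of 0 1] sigma1_delta0[OF delta0_False] by (cases "n = 1") simp_all
  ultimately show ?case unfolding computes_Succ_iff by simp
next
  case Oracle
  have "(\<exists>y. map (\<lambda>i. e (Suc i)) [0..<n] = [y] \<and> v = interval_oracle x y) \<longleftrightarrow> n = 1 \<and> v = interval_oracle x (e 1)" for e v x
  proof (cases "n = 1")
    case False
    then have "map (\<lambda>i. e (Suc i)) [0..<n] \<noteq> [x]" for x by (metis length_map length_upt diff_zero length_Cons list.size(3) One_nat_def)
    then show ?thesis using False by simp
  qed auto
  moreover have "sigma1 (\<lambda>x e. n = 1 \<and> e 0 = interval_oracle x (e 1))"
    using sigma1_delta0[OF delta0_interval_oracle] sigma1_delta0[OF delta0_False]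
    by (cases "n = 1") (simp_all add: eq_commute[of "interval_oracle _ _"])
  ultimately show ?case unfolding computes_Oracle_iff by simp
next
  case (Proj i)
  have "sigma1 (\<lambda>x e. i < n \<and> e 0 = e (Suc i))"
    using sigma1_delta0[OF delta0_eq[OF nat_term_var nat_term_var], of 0 "Suc i"] sigma1_delta0[OF delta0_False] by (cases "i < n") simp_all
  moreover have "i < length (map (\<lambda>i. e (Suc i)) [0..<n]) \<and> v = map (\<lambda>i. e (Suc i)) [0..<n] ! i \<longleftrightarrow> i < n \<and> v = e (Suc i)" for e :: "nat \<Rightarrow> nat" and v
    by auto
  ultimately show ?case unfolding computes_Proj_iff by simp
next
  case (Comp f gs)
  let ?m = "length gs"
  have 1: "sigma1 (\<lambda>x e. computes (interval_oracle x) (gs ! i) (map (\<lambda>j. e (?m + Suc j)) [0..<n]) (e i))" if "i < ?m" for i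
  proof -
    have "gs ! i \<in> set gs" using that by simp
    from sigma1_reindex[OF Comp(2)[OF this], of "case_nat i (\<lambda>j. ?m + Suc j)"] show ?thesis by simp
  qed
  have 2: "sigma1 (\<lambda>x e. computes (interval_oracle x) f (map (\<lambda>i. e i) [0..<?m]) (e ?m))"
    using sigma1_reindex[OF Comp(1)[of ?m], of "case_nat ?m (\<lambda>i. i)"] by simp
  have 12: "sigma1 (\<lambda>x e. (\<forall>i<?m. computes (interval_oracle x) (gs ! i) (map (\<lambda>j. e (?m + Suc j)) [0..<n]) (e i)) \<and>
     computes (interval_oracle x) f (map (\<lambda>i. e i) [0..<?m]) (e ?m))"
    by (intro sigma1_conj sigma1_all_less 1 2)
  have 3: "sigma1 (\<lambda>x e. \<exists>ys. length ys = ?m \<and> (\<forall>i<?m. computes (interval_oracle x) (gs ! i) (map (\<lambda>i. e (Suc i)) [0..<n]) (ys ! i)) \<and>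
     computes (interval_oracle x) f (map (\<lambda>i. if i < ?m then ys ! i else e (i - ?m)) [0..<?m]) (e 0))"
    using sigma1_exlist[OF 12, of ?m] by (simp cong: conj_cong)
  have "map (\<lambda>i. if i < ?m then ys ! i else e (i - ?m)) [0..<?m] = ys" if "length ys = ?m" for ys and e :: "nat \<Rightarrow> nat"
    using that by (intro nth_equalityI) auto
  with 3 show ?case unfolding computes_Comp_iff by (simp cong: conj_cong)
next
  case (Prec f g)
  show ?case
  proof (cases n)
    case 0
    then show ?thesis using sigma1_delta0[OF delta0_False] by (simp add: computes_Prec_Nil)
  next
    case (Suc m)
    have F: "sigma1 (\<lambda>x e. computes (interval_oracle x) f (map (\<lambda>i. e (\<sigma> i)) [0..<m]) (e j))" for \<sigma> j
      using sigma1_reindex[OF Prec(1), of "case_nat j \<sigma>"] by simp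
    have G: "sigma1 (\<lambda>x e. computes (interval_oracle x) g (e a # e b # map (\<lambda>i. e (\<sigma> i)) [0..<m]) (e j))" for \<sigma> a b j
      using sigma1_reindex[OF Prec(2)[of "Suc (Suc m)"], of "case_nat j (case_nat a (case_nat b \<sigma>))"]
      by (simp add: map_upt_Suc' del: upt_Suc)
    have "sigma1 (\<lambda>x e. \<exists>a c. (\<exists>u. a mod Suc (Suc 0 * c) = u \<and> computes (interval_oracle x) f (map (\<lambda>i. e (Suc (Suc i))) [0..<m]) u) \<and>
     (\<forall>i<e 1. \<exists>u u'. a mod Suc (Suc i * c) = u \<and> a mod Suc (Suc (Suc i) * c) = u' \<and>
       computes (interval_oracle x) g (i # u # map (\<lambda>i. e (Suc (Suc i))) [0..<m]) u') \<and>
     a mod Suc (Suc (e 1) * c) = e 0)"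
      by (intro sigma1_ex sigma1_conj sigma1_ball sigma1_delta0[OF delta0_mod] F G nat_term_intros)
    then show ?thesis unfolding Suc map_upt_Suc' computes_Prec_iff by simp
  qed
next
  case (Mu f)
  have F: "sigma1 (\<lambda>x e. computes (interval_oracle x) f (e a # map (\<lambda>i. e (\<sigma> i)) [0..<n]) (e j))" for \<sigma> a j
    using sigma1_reindex[OF Mu[of "Suc n"], of "case_nat j (case_nat a \<sigma>)"]
    by (simp add: map_upt_Suc' del: upt_Suc)
  have "sigma1 (\<lambda>x e. \<exists>v. v = 0 \<and> computes (interval_oracle x) f (e 0 # map (\<lambda>i. e (Suc i)) [0..<n]) v)"
    by (intro sigma1_ex sigma1_conj sigma1_delta0[OF delta0_eq] F nat_term_intros)
  moreover have "sigma1 (\<lambda>x e. \<forall>m<e 0. \<exists>v. 0 < v \<and> computes (interval_oracle x) f (m # map (\<lambda>i. e (Suc i)) [0..<n]) v)"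
    by (intro sigma1_ball sigma1_ex sigma1_conj sigma1_delta0[OF delta0_less] F nat_term_intros)
  ultimately show ?case unfolding computes_Mu_iff by (intro sigma1_conj) simp_all
qed

text \<open>Determinism identifies the graph of the function with the relation
  \<open>computes\<close> for its code.\<close>

lemma sigma1_recursive:
  assumes "recursive n f"
  shows "sigma1 (\<lambda>x e. f (interval_oracle x) (\<lambda>i. e (Suc i)) = e 0)"
proof -
  from assms obtain c where c: "\<And>z e. computes z c (map e [0..<n]) (f z e)" unfolding recursive_def by blast
  have "f (interval_oracle x) (\<lambda>i. e (Suc i)) = e 0 \<longleftrightarrow>
     computes (interval_oracle x) c (map (\<lambda>i. e (Suc i)) [0..<n]) (e 0)" for x e
    using c[of "interval_oracle x" "\<lambda>i. e (Suc i)"] by (metis computes_deterministic)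
  with sigma1_computes[of c n] show ?thesis by simp
qed

text \<open>A failure of \<open>R\<close> has a Sigma_1 description, hence \<open>R\<close> holds
  iff no \<open>t\<close> witnesses a failure. The quantifier over \<open>t\<close> joins the one
  over \<open>d\<close>, and only a bounded matrix remains.\<close>

lemma effective_Pi_3I:
  assumes R: "decidable 3 (\<lambda>z e. R z (e 0) (e 1) (e 2))"
    and A: "\<And>x. x \<in> A \<longleftrightarrow> 0 < x \<and> x < 1 \<and> (\<forall>a. \<exists>c. \<forall>d. R (interval_oracle x) a c d)"
  shows "effective_Pi real_sat 3 A"
proof -
  have "sigma1 (\<lambda>x e. of_bool (R (interval_oracle x) (e (Suc 0)) (e (Suc 1)) (e (Suc 2))) = e 0)"
    using sigma1_recursive[OF R] by simp
  from sigma1_conj[OF sigma1_delta0[OF delta0_eq[OF nat_term_var[of 0] nat_term_const[of 0]]] this]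
  have "sigma1 (\<lambda>x e. \<exists>v::nat. v = 0 \<and> of_bool (R (interval_oracle x) (e 0) (e 1) (e 2)) = v)"
    by (intro sigma1_ex) simp
  then have "sigma1 (\<lambda>x e. \<not> R (interval_oracle x) (e 0) (e 1) (e 2))" by simp
  then obtain S where S: "delta0 (\<lambda>x e. S x (\<lambda>i. e (Suc i)) (e 0))"
    and S': "(\<lambda>x e. \<not> R (interval_oracle x) (e 0) (e 1) (e 2)) = (\<lambda>x e. \<exists>t. S x e t)" by (rule sigma1E)
  have S'': "R (interval_oracle x) a c d \<longleftrightarrow> (\<forall>t. \<not> S x (case_nat a (case_nat c (case_nat d e))) t)" for x a c d e
    using fun_cong[OF fun_cong[OF S', of x], of "case_nat a (case_nat c (case_nat d e))"]
    by (simp add: numeral_2_eq_2) blast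
  \<comment> \<open>Variable 2 bounds both \<open>d\<close> and \<open>t\<close>; as it runs through
    all numbers, every pair is covered.\<close>
  define K where "K x e \<longleftrightarrow> (0 < x \<and> x < 1) \<and>
     (\<forall>d\<le>e 2. \<forall>t\<le>e 2. \<not> S x (case_nat (e 0) (case_nat (e 1) (case_nat d (\<lambda>_. e 0)))) t)" for x :: real and e :: "nat \<Rightarrow> nat"
  have "delta0 K"
  proof -
    have "delta0 (\<lambda>x e. S x (case_nat (e (Suc (Suc 0))) (case_nat (e (Suc (Suc 1)))
        (case_nat (e (Suc 0)) (\<lambda>i. e (Suc (Suc 0)))))) (e 0))"
    proof -
      have "case_nat (e (Suc (Suc 0))) (case_nat (e (Suc (Suc 1))) (case_nat (e (Suc 0)) (\<lambda>i. e (Suc (Suc 0))))) =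
        (\<lambda>i. e (case_nat (Suc (Suc 0)) (case_nat (Suc (Suc 1)) (case_nat (Suc 0) (\<lambda>i. Suc (Suc 0)))) i))" for e :: "nat \<Rightarrow> nat"
        by (rule ext) (simp split: nat.splits)
      then show ?thesis by (simp only: delta0_sub2[OF S])
    qed
    moreover have "delta0 (\<lambda>x e. 0 < x \<and> x < 1)" using delta0_Interval[OF nat_term_const[of 0] nat_term_const[of 1]] by simp
    ultimately have "delta0 (\<lambda>x e. (0 < x \<and> x < 1) \<and>
     (\<forall>d\<le>e 2. \<forall>t\<le>e 2. \<not> S x (case_nat (e 0) (case_nat (e 1) (case_nat d (\<lambda>_. e 0)))) t))"
      by (intro delta0_conj[of "\<lambda>x e. 0 < x \<and> x < 1"] delta0_ball delta0_not nat_term_intros)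
    then show ?thesis unfolding K_def .
  qed
  then obtain \<phi> where \<phi>: "bounded_fm \<phi>" "\<And>x e. sat (real_sat x) (\<lambda>i. int (e i)) \<phi> \<longleftrightarrow> K x e"
    unfolding delta0_def by blast
  \<comment> \<open>Every further variable is read as variable 0, so that it is nonnegative as soon
    as the three quantified ones are.\<close>
  define \<sigma> :: "nat \<Rightarrow> nat" where "\<sigma> i = (if i < 3 then i else 0)" for i
  \<comment> \<open>Nonnegativity of \<open>v\<close> says that no integer lies between
    \<open>v\<close> and -1.\<close>
  define ge0 :: "nat \<Rightarrow> real_atom fm" where "ge0 v = BAll 3 (Var v) (Const (-1)) (Ident (Const 0) (Const 1))" for v
  have ge0: "sat (real_sat x) e (ge0 v) \<longleftrightarrow> e v \<ge> 0" for x e v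
  proof -
    have "(\<forall>i\<in>{a..-1::int}. False) \<longleftrightarrow> a \<ge> 0" for a by (cases "a \<ge> 0") (auto intro: bexI[of _ a])
    then show ?thesis unfolding ge0_def by simp
  qed
  \<comment> \<open>The quantifiers of the final formula range over all integers; this relativises
    each of them to the nonnegative ones.\<close>
  define \<chi> where "\<chi> = Neg (Conj (ge0 0) (Neg (Conj (ge0 1) (Neg (Conj (ge0 2) (Neg (rename_fm \<phi> \<sigma>)))))))"
  have b: "bounded_fm \<chi>" using \<phi>(1) by (simp add: \<chi>_def ge0_def bounded_rename_fm)
  have ren: "sat (real_sat x) e (rename_fm \<phi> \<sigma>) \<longleftrightarrow> K x (\<lambda>i. nat (e (\<sigma> i)))"
    if "e 0 \<ge> 0" "e 1 \<ge> 0" "e 2 \<ge> 0" for x e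
  proof -
    have "(\<lambda>i. e (\<sigma> i)) = (\<lambda>i. int (nat (e (\<sigma> i))))"
      using that by (auto simp: \<sigma>_def fun_eq_iff less_Suc_eq numeral_3_eq_3 numeral_2_eq_2)
    then show ?thesis unfolding sat_rename_fm[OF \<phi>(1)] using \<phi>(2)[of x "\<lambda>i. nat (e (\<sigma> i))"] by simp
  qed
  have \<chi>: "sat (real_sat x) (e(0 := a, 1 := c, 2 := d)) \<chi> \<longleftrightarrow>
     (a \<ge> 0 \<longrightarrow> c \<ge> 0 \<and> (d \<ge> 0 \<longrightarrow> K x (\<lambda>i. nat ((e(0 := a, 1 := c, 2 := d)) (\<sigma> i)))))" for x e a c d
    using ren[of "e(0 := a, 1 := c, 2 := d)" x] by (auto simp: \<chi>_def ge0)
  have K: "(\<forall>d::int. d \<ge> 0 \<longrightarrow> K x (\<lambda>i. nat ((e(0 := int a, 1 := int c, 2 := d)) (\<sigma> i)))) \<longleftrightarrow>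
    0 < x \<and> x < 1 \<and> (\<forall>d. R (interval_oracle x) a c d)" for x e a c
  proof -
    have "(\<forall>d::int. d \<ge> 0 \<longrightarrow> K x (\<lambda>i. nat ((e(0 := int a, 1 := int c, 2 := d)) (\<sigma> i)))) \<longleftrightarrow>
       (\<forall>d::nat. K x (\<lambda>i. nat ((e(0 := int a, 1 := int c, 2 := int d)) (\<sigma> i))))"
      by (metis nat_0_le of_nat_0_le_iff)
    also have "\<dots> \<longleftrightarrow> (0 < x \<and> x < 1) \<and> (\<forall>m. \<forall>d\<le>m. \<forall>t\<le>m. \<not> S x (case_nat a (case_nat c (case_nat d (\<lambda>_. a)))) t)"
      unfolding K_def by (simp add: \<sigma>_def)
    also have "\<dots> \<longleftrightarrow> 0 < x \<and> x < 1 \<and> (\<forall>d. \<forall>t. \<not> S x (case_nat a (case_nat c (case_nat d (\<lambda>_. a)))) t)"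
      by (meson linear)
    also have "\<dots> \<longleftrightarrow> 0 < x \<and> x < 1 \<and> (\<forall>d. R (interval_oracle x) a c d)"
      using S'' by blast
    finally show ?thesis .
  qed
  show ?thesis unfolding effective_Pi_def
  proof (intro exI[of _ "All 0 (Ex 1 (All 2 \<chi>))"] conjI allI)
    have "Pi_fm (Suc (Suc (Suc 0))) (All 0 (Ex 1 (All 2 \<chi>)))"
      by (intro Sigma_fm_Pi_fm.intros b)
    then show "Pi_fm 3 (All 0 (Ex 1 (All 2 \<chi>)))" by (simp add: numeral_3_eq_3)
    fix x e
    let ?P = "\<lambda>a c. \<forall>d::int. d \<ge> 0 \<longrightarrow> K x (\<lambda>i. nat ((e(0 := a, 1 := c, 2 := d)) (\<sigma> i)))"
    have gen: "(\<forall>d::int. A \<longrightarrow> B \<and> (d \<ge> 0 \<longrightarrow> Q d)) \<longleftrightarrow> (A \<longrightarrow> B \<and> (\<forall>d. d \<ge> 0 \<longrightarrow> Q d))" for A B Q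
      by blast
    have "sat (real_sat x) e (All 0 (Ex 1 (All 2 \<chi>))) \<longleftrightarrow> (\<forall>a. \<exists>c. \<forall>d. sat (real_sat x) (e(0 := a, 1 := c, 2 := d)) \<chi>)"
      by (simp only: sat.simps)
    also have "\<dots> \<longleftrightarrow> (\<forall>a::int. \<exists>c::int. a \<ge> 0 \<longrightarrow> c \<ge> 0 \<and> ?P a c)"
      unfolding \<chi> gen by (rule refl)
    also have "\<dots> \<longleftrightarrow> (\<forall>a::nat. \<exists>c::nat. ?P (int a) (int c))"
    proof -
      have "(\<forall>a::int. \<exists>c::int. a \<ge> 0 \<longrightarrow> c \<ge> 0 \<and> P a c) \<longleftrightarrow> (\<forall>a::nat. \<exists>c::nat. P (int a) (int c))" for P
      proof
        assume *: "\<forall>a::int. \<exists>c::int. a \<ge> 0 \<longrightarrow> c \<ge> 0 \<and> P a c"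
        show "\<forall>a::nat. \<exists>c::nat. P (int a) (int c)"
        proof
          fix a :: nat
          from * obtain c where "c \<ge> 0" "P (int a) c" by (meson of_nat_0_le_iff)
          then show "\<exists>c::nat. P (int a) (int c)" by (intro exI[of _ "nat c"]) simp
        qed
      next
        assume *: "\<forall>a::nat. \<exists>c::nat. P (int a) (int c)"
        show "\<forall>a::int. \<exists>c::int. a \<ge> 0 \<longrightarrow> c \<ge> 0 \<and> P a c"
        proof
          fix a :: int
          from * obtain c where "P (int (nat a)) (int c)" by blast
          then show "\<exists>c::int. a \<ge> 0 \<longrightarrow> c \<ge> 0 \<and> P a c" by (intro exI[of _ "int c"]) auto
        qed
      qed
      then show ?thesis by simp
    qed
    also have "\<dots> \<longleftrightarrow> x \<in> A"
      unfolding K A by blast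
    finally show "x \<in> A \<longleftrightarrow> sat (real_sat x) e (All 0 (Ex 1 (All 2 \<chi>)))" ..
  qed
qed

section \<open>Word counts and their averages over extensions\<close>

text \<open>Digit sequences are indexed from 0 and words of length \<open>k\<close> are coded by numbers below \<open>b ^ k\<close>, first digit
  least significant.  The argument \<open>n\<close> of \<open>cnt\<close>, \<open>cls\<close> and \<open>clsp\<close> counts starting positions, so that \<open>n\<close> windows
  of length \<open>k\<close> involve \<open>n + k - 1\<close> digits.\<close>
definition win :: "nat \<Rightarrow> (nat \<Rightarrow> nat) \<Rightarrow> nat \<Rightarrow> nat \<Rightarrow> nat" where
  "win b D k i = (\<Sum>t<k. D (i + t) * b ^ t)"

definition cnt :: "nat \<Rightarrow> (nat \<Rightarrow> nat) \<Rightarrow> nat \<Rightarrow> nat \<Rightarrow> nat \<Rightarrow> nat" where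
  "cnt b D k w n = card {i. i < n \<and> win b D k i = w}"

definition cls :: "nat \<Rightarrow> (nat \<Rightarrow> nat) \<Rightarrow> nat \<Rightarrow> nat \<Rightarrow> nat \<Rightarrow> nat" where
  "cls b D k j n = card {w. w < b ^ k \<and> cnt b D k w n = j}"

text \<open>This is \<open>cls\<close> at \<open>j - 1\<close>, but 0 for \<open>j = 0\<close>: the words that the next occurrence moves into class \<open>j\<close>.\<close>
definition clsp :: "nat \<Rightarrow> (nat \<Rightarrow> nat) \<Rightarrow> nat \<Rightarrow> nat \<Rightarrow> nat \<Rightarrow> nat" where
  "clsp b D k j n = card {w. w < b ^ k \<and> Suc (cnt b D k w n) = j}"

lemma win_cong: "(\<And>t. t < k \<Longrightarrow> D (i + t) = D' (i' + t)) \<Longrightarrow> win b D k i = win b D' k i'"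
  unfolding win_def by (intro sum.cong) auto

lemma digit_sum_less: "(\<And>t. t < k \<Longrightarrow> d t < b) \<Longrightarrow> (\<Sum>t<k. d t * b ^ t) < (b::nat) ^ k"
proof (induction k)
  case (Suc k)
  have "(\<Sum>t<k. d t * b ^ t) < b ^ k" using Suc by simp
  moreover have "Suc (d k) * b ^ k \<le> b * b ^ k" using Suc.prems[of k] by (intro mult_right_mono) auto
  ultimately show ?case by simp
qed simp

lemma win_less: "(\<And>i. D i < b) \<Longrightarrow> win b D k i < b ^ k"
  unfolding win_def by (intro digit_sum_less)

lemma digit_sum_eqD:
  assumes "\<And>t. t < k \<Longrightarrow> d t < b" "\<And>t. t < k \<Longrightarrow> d' t < b" "(\<Sum>t<k. d t * b ^ t) = (\<Sum>t<k. d' t * (b::nat) ^ t)"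
  shows "t < k \<Longrightarrow> d t = d' t"
  using assms
proof (induction k arbitrary: t)
  case (Suc k)
  have l: "(\<Sum>t<k. d t * b ^ t) < b ^ k" "(\<Sum>t<k. d' t * b ^ t) < b ^ k"
    using Suc.prems by (auto intro!: digit_sum_less)
  have nz: "b ^ k \<noteq> 0" using l(1) by (metis not_less0)
  have "((\<Sum>t<k. d t * b ^ t) + d k * b ^ k) div b ^ k = d k"
     "((\<Sum>t<k. d' t * b ^ t) + d' k * b ^ k) div b ^ k = d' k"
    by (simp_all only: div_mult_self1[OF nz] l div_less add_0_right)
  then have "d k = d' k" using Suc.prems(4) by simp
  with Suc show ?case by (auto simp: less_Suc_eq)
qed simp

lemma win_eq_iff:
  assumes "\<And>i. D i < b" "\<And>i. D' i < b"
  shows "win b D k i = win b D' k i' \<longleftrightarrow> (\<forall>t<k. D (i + t) = D' (i' + t))"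
  using digit_sum_eqD[of k "\<lambda>t. D (i + t)" b "\<lambda>t. D' (i' + t)"] assms win_cong[of k D i D' i' b]
  by (auto simp: win_def)

lemma digit_expansion: "w < b ^ k \<Longrightarrow> (\<Sum>t<k. (w div b ^ t mod b) * b ^ t) = (w::nat)"
proof (induction k arbitrary: w)
  case (Suc k)
  show ?case
  proof (cases "b = 0")
    case False
    have "(\<Sum>t<k. (w div b ^ t mod b) * b ^ t) = (\<Sum>t<k. ((w mod b ^ k) div b ^ t mod b) * b ^ t)"
    proof (intro sum.cong refl)
      fix t assume "t \<in> {..<k}"
      then obtain r where r: "k = Suc (t + r)" using less_imp_Suc_add by auto
      have "b ^ k = b ^ t * b ^ Suc r" unfolding r by (simp add: power_add)
      then have "(w mod b ^ k) div b ^ t = w div b ^ t mod b ^ Suc r"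
        using False by (simp add: mod_mult2_eq)
      then show "w div b ^ t mod b * b ^ t = w mod b ^ k div b ^ t mod b * b ^ t"
        by (simp add: mod_mod_cancel)
    qed
    also have "\<dots> = w mod b ^ k" using Suc.IH False by simp
    finally have "(\<Sum>t<Suc k. (w div b ^ t mod b) * b ^ t) = w mod b ^ k + (w div b ^ k mod b) * b ^ k" by simp
    also have "w div b ^ k mod b = w div b ^ k" using Suc.prems
      by (simp add: less_mult_imp_div_less)
    also have "w mod b ^ k + w div b ^ k * b ^ k = w" by (rule mod_div_mult_eq)
    finally show ?thesis .
  qed (use Suc in auto)
qed simp

lemma win_eq_code_iff:
  assumes "\<And>i. D i < b" "w < b ^ k" "0 < b"
  shows "win b D k i = w \<longleftrightarrow> (\<forall>t<k. D (i + t) = w div b ^ t mod b)"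
proof -
  have "win b (\<lambda>t. w div b ^ t mod b) k 0 = w" using digit_expansion[OF assms(2)] by (simp add: win_def)
  with win_eq_iff[of D b "\<lambda>t. w div b ^ t mod b" k i 0] assms show ?thesis by simp
qed

lemma cnt_0 [simp]: "cnt b D k w 0 = 0"
  by (simp add: cnt_def)

lemma cnt_Suc: "cnt b D k w (Suc n) = cnt b D k w n + of_bool (win b D k n = w)"
proof (cases "win b D k n = w")
  case True
  then have "{i. i < Suc n \<and> win b D k i = w} = insert n {i. i < n \<and> win b D k i = w}"
    by (auto simp: less_Suc_eq)
  with True show ?thesis by (simp add: cnt_def)
next
  case False
  then have "{i. i < Suc n \<and> win b D k i = w} = {i. i < n \<and> win b D k i = w}"
    by (auto simp: less_Suc_eq)
  with False show ?thesis by (simp add: cnt_def)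
qed

lemma cnt_sum: "cnt b D k w n = (\<Sum>i<n. of_bool (win b D k i = w))"
  by (induction n) (simp_all add: cnt_Suc)

lemma cnt_cong: "(\<And>i. i < n \<Longrightarrow> win b D k i = win b D' k i) \<Longrightarrow> cnt b D k w n = cnt b D' k w n"
  unfolding cnt_sum by (intro sum.cong) auto

lemma cnt_mono: "n \<le> n' \<Longrightarrow> cnt b D k w n \<le> cnt b D k w n'"
  unfolding cnt_def by (intro card_mono) auto

lemma cnt_diff_le: "n \<le> n' \<Longrightarrow> cnt b D k w n' \<le> cnt b D k w n + (n' - n)"
  by (induction n' rule: dec_induct) (auto simp: cnt_Suc of_bool_def)

lemma card_fibre_diff_le:
  assumes "finite A"
  shows "\<bar>real (card {w\<in>A. P w}) - real (card {w\<in>A. Q w})\<bar> \<le> real (card {w\<in>A. P w \<noteq> Q w})"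
proof -
  have 1: "card {w\<in>A. P w} \<le> card {w\<in>A. Q w} + card {w\<in>A. P w \<noteq> Q w}" for P Q
  proof -
    have "card {w\<in>A. P w} \<le> card ({w\<in>A. Q w} \<union> {w\<in>A. P w \<noteq> Q w})"
      using assms by (intro card_mono) auto
    also have "\<dots> \<le> card {w\<in>A. Q w} + card {w\<in>A. P w \<noteq> Q w}" by (rule card_Un_le)
    finally show ?thesis .
  qed
  show ?thesis using 1[of P Q] 1[of Q P] by (simp add: abs_le_iff eq_commute[of "Q _"])
qed

lemma cls_diff_le:
  assumes "\<And>w. w < b ^ k \<Longrightarrow> w \<notin> W \<Longrightarrow> cnt b D k w n = cnt b D' k w n'" "finite W"
  shows "\<bar>real (cls b D k j n) - real (cls b D' k j n')\<bar> \<le> card W"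
proof -
  have "\<bar>real (cls b D k j n) - real (cls b D' k j n')\<bar> \<le>
     real (card {w\<in>{..<b^k}. (cnt b D k w n = j) \<noteq> (cnt b D' k w n' = j)})"
    using card_fibre_diff_le[of "{..<b^k}" "\<lambda>w. cnt b D k w n = j" "\<lambda>w. cnt b D' k w n' = j"]
    by (simp add: cls_def)
  also have "\<dots> \<le> card W"
  proof (intro of_nat_mono card_mono assms(2) subsetI)
    fix w assume "w \<in> {w \<in> {..<b ^ k}. (cnt b D k w n = j) \<noteq> (cnt b D' k w n' = j)}"
    then have "w < b ^ k" "cnt b D k w n \<noteq> cnt b D' k w n'" by auto
    then show "w \<in> W" using assms(1)[of w] by blast
  qed
  finally show ?thesis .
qed

text \<open>A window in which the sequences differ disturbs the counts of two words only, the one it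
  shows in \<open>D\<close> and the one it shows in \<open>D'\<close>.\<close>

lemma cls_diff_windows:
  "\<bar>real (cls b D k j n) - real (cls b D' k j n)\<bar> \<le> 2 * real (card {i. i < n \<and> win b D k i \<noteq> win b D' k i})"
proof -
  let ?I = "{i. i < n \<and> win b D k i \<noteq> win b D' k i}"
  have "\<bar>real (cls b D k j n) - real (cls b D' k j n)\<bar> \<le> card (win b D k ` ?I \<union> win b D' k ` ?I)"
  proof (rule cls_diff_le)
    fix w assume w: "w \<notin> win b D k ` ?I \<union> win b D' k ` ?I"
    have "{i. i < n \<and> win b D k i = w} = {i. i < n \<and> win b D' k i = w}" using w by auto
    then show "cnt b D k w n = cnt b D' k w n" by (simp add: cnt_def)
  qed simp
  also have "\<dots> \<le> real (card (win b D k ` ?I) + card (win b D' k ` ?I))" by (intro of_nat_mono card_Un_le)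
  also have "\<dots> \<le> real (card ?I + card ?I)" by (intro of_nat_mono add_mono card_image_le) auto
  finally show ?thesis by simp
qed

lemma cnt_diff_windows:
  "\<bar>real (cnt b D k w n) - real (cnt b D' k w n)\<bar> \<le> real (card {i. i < n \<and> win b D k i \<noteq> win b D' k i})"
proof -
  have "\<bar>real (cnt b D k w n) - real (cnt b D' k w n)\<bar> \<le> real (card {i\<in>{..<n}. (win b D k i = w) \<noteq> (win b D' k i = w)})"
    using card_fibre_diff_le[of "{..<n}" "\<lambda>i. win b D k i = w" "\<lambda>i. win b D' k i = w"] by (simp add: cnt_def)
  also have "\<dots> \<le> real (card {i. i < n \<and> win b D k i \<noteq> win b D' k i})" by (intro of_nat_mono card_mono) auto
  finally show ?thesis .
qed

lemma cls_diff_length: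
  assumes "n \<le> n'"
  shows "\<bar>real (cls b D k j n) - real (cls b D k j n')\<bar> \<le> real n' - real n"
proof -
  have "\<bar>real (cls b D k j n) - real (cls b D k j n')\<bar> \<le> card (win b D k ` {n..<n'})"
  proof (rule cls_diff_le)
    fix w assume w: "w \<notin> win b D k ` {n..<n'}"
    have "{i. i < n \<and> win b D k i = w} = {i. i < n' \<and> win b D k i = w}" using w assms by (auto simp: image_iff)
    then show "cnt b D k w n = cnt b D k w n'" by (simp add: cnt_def)
  qed simp
  also have "\<dots> \<le> real (card {n..<n'})" by (intro of_nat_mono card_image_le) auto
  finally show ?thesis using assms by simp
qed

text \<open>Reading one more window moves a single word to the next class.\<close>

lemma cls_step:
  assumes "win b D k i < b ^ k"
  shows "real (cls b D k j (Suc i)) = real (cls b D k j i) +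
     (of_bool (Suc (cnt b D k (win b D k i) i) = j) - of_bool (cnt b D k (win b D k i) i = j))"
proof -
  let ?w = "win b D k i"
  let ?A = "{..<b^k} - {?w}"
  have 1: "card {w. w < b ^ k \<and> P w} = card {w\<in>?A. P w} + of_bool (P ?w)" for P
  proof (cases "P ?w")
    case True
    then have "{w. w < b ^ k \<and> P w} = insert ?w {w\<in>?A. P w}" using assms by auto
    with True show ?thesis by simp
  next
    case False
    then have "{w. w < b ^ k \<and> P w} = {w\<in>?A. P w}" by auto
    with False show ?thesis by simp
  qed
  have "{w\<in>?A. cnt b D k w (Suc i) = j} = {w\<in>?A. cnt b D k w i = j}" by (auto simp: cnt_Suc)
  then show ?thesis unfolding cls_def 1 by (simp add: cnt_Suc)
qed

section \<open>Expectation and variance over random words\<close>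

text \<open>The expectation of \<open>f\<close> at a uniformly random word of length
  \<open>L\<close>. Recursion on the first letter allows conditioning on initial letters by
  induction.\<close>

primrec average :: "nat \<Rightarrow> nat \<Rightarrow> (nat list \<Rightarrow> real) \<Rightarrow> real" where
  "average b 0 f = f []"
| "average b (Suc L) f = (\<Sum>a<b. average b L (\<lambda>v. f (a # v))) / b"

lemma words_0: "words b 0 = {[]}" by (auto simp: words_def)
lemma words_Suc_iff: "a # v \<in> words b (Suc L) \<longleftrightarrow> a < b \<and> v \<in> words b L" by (auto simp: words_def)

lemma average_mono: "(\<And>v. v \<in> words b L \<Longrightarrow> f v \<le> g v) \<Longrightarrow> average b L f \<le> average b L g"
proof (induction L arbitrary: f g)
  case (Suc L)
  have "average b L (\<lambda>v. f (a # v)) \<le> average b L (\<lambda>v. g (a # v))" if "a < b" for a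
    using that by (intro Suc) (simp add: words_Suc_iff)
  then show ?case by (auto intro!: divide_right_mono sum_mono)
qed (simp add: words_0)

lemma average_cong: "(\<And>v. v \<in> words b L \<Longrightarrow> f v = g v) \<Longrightarrow> average b L f = average b L g"
  by (intro antisym average_mono) auto

lemma average_add: "average b L (\<lambda>v. f v + g v) = average b L f + average b L g"
  by (induction L arbitrary: f g) (simp_all add: sum.distrib add_divide_distrib)

lemma average_cmult: "average b L (\<lambda>v. c * f v) = c * average b L f"
  by (induction L arbitrary: f) (simp_all add: sum_distrib_left[symmetric])

lemma average_uminus: "average b L (\<lambda>v. - f v) = - average b L f"
  using average_cmult[of b L "-1" f] by simp

lemma average_diff: "average b L (\<lambda>v. f v - g v) = average b L f - average b L g"
  using average_add[of b L f "\<lambda>v. - g v"] by (simp add: average_uminus)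

lemma average_const: "b > 0 \<Longrightarrow> average b L (\<lambda>v. c) = c"
  by (induction L) simp_all

lemma average_sum: "b > 0 \<Longrightarrow> average b L (\<lambda>v. \<Sum>i\<in>I. f i v) = (\<Sum>i\<in>I. average b L (f i))"
  by (induction I rule: infinite_finite_induct) (simp_all add: average_add average_const)

lemma average_abs: "\<bar>average b L f\<bar> \<le> average b L (\<lambda>v. \<bar>f v\<bar>)"
proof -
  have "average b L f \<le> average b L (\<lambda>v. \<bar>f v\<bar>)" "- average b L f \<le> average b L (\<lambda>v. \<bar>f v\<bar>)"
    unfolding average_uminus[symmetric] by (intro average_mono; simp)+
  then show ?thesis by linarith
qed

lemma average_exists: assumes "b > 0" shows "\<exists>v\<in>words b L. f v \<le> average b L f"
proof (rule ccontr)
  assume "\<not> ?thesis"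
  then have *: "\<And>v. v \<in> words b L \<Longrightarrow> f v > average b L f" by force
  have ne: "replicate L 0 \<in> words b L" using assms by (auto simp: words_def)
  have fin: "finite (words b L)" unfolding words_def
    using finite_lists_length_eq[of "{..<b}" L] by (simp add: conj_commute)
  define m where "m = Min (f ` words b L)"
  have "m > average b L f" unfolding m_def using * fin ne by (subst Min_gr_iff) auto
  moreover have "average b L f \<ge> average b L (\<lambda>_. m)" unfolding m_def using fin by (intro average_mono) auto
  ultimately show False using average_const[OF assms] by simp
qed

text \<open>The Efron-Stein inequality for functions with bounded differences, by splitting off the first digit.\<close>
lemma average_variance:
  assumes b: "b > 0" and c: "c \<ge> 0"
    and bd: "\<And>v i a. v \<in> words b L \<Longrightarrow> i < L \<Longrightarrow> a < b \<Longrightarrow> \<bar>f (v[i := a]) - f v\<bar> \<le> c"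
  shows "average b L (\<lambda>v. (f v - average b L f)\<^sup>2) \<le> L * c\<^sup>2"
  using bd
proof (induction L arbitrary: f)
  case (Suc L)
  define g where "g a = average b L (\<lambda>v. f (a # v))" for a
  define m where "m = average b (Suc L) f"
  have m: "m = (\<Sum>a<b. g a) / b" by (simp add: m_def g_def)
  have 1: "average b L (\<lambda>v. (f (a # v) - m)\<^sup>2) \<le> L * c\<^sup>2 + c\<^sup>2" if a: "a < b" for a
  proof -
    have "\<bar>f (a # v[i := x]) - f (a # v)\<bar> \<le> c" if "v \<in> words b L" "i < L" "x < b" for v i x
      using Suc.prems[of "a # v" "Suc i" x] that a by (simp add: words_Suc_iff)
    from Suc.IH[OF this] have V: "average b L (\<lambda>v. (f (a # v) - g a)\<^sup>2) \<le> L * c\<^sup>2" unfolding g_def by blast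
    have "\<bar>g a - g a'\<bar> \<le> c" if "a' < b" for a'
    proof -
      have "\<bar>g a - g a'\<bar> \<le> average b L (\<lambda>v. \<bar>f (a # v) - f (a' # v)\<bar>)"
        unfolding g_def average_diff[symmetric] by (rule average_abs)
      also have "\<dots> \<le> average b L (\<lambda>v. c)"
        using Suc.prems[of "a' # _" 0 a] that a by (intro average_mono) (auto simp: words_Suc_iff)
      finally show ?thesis using b by (simp add: average_const)
    qed
    then have "\<bar>(\<Sum>a'<b. (g a - g a'))\<bar> \<le> (\<Sum>a'<b. c)"
      by (intro order.trans[OF sum_abs] sum_mono) auto
    moreover have "(\<Sum>a'<b. (g a - g a')) = b * (g a - m)"
      using b by (simp add: m sum_subtractf right_diff_distrib)
    ultimately have "b * \<bar>g a - m\<bar> \<le> b * c" by (simp add: abs_mult)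
    then have gm: "\<bar>g a - m\<bar> \<le> c" using b by simp
    have "average b L (\<lambda>v. (f (a # v) - m)\<^sup>2) =
      average b L (\<lambda>v. (f (a # v) - g a)\<^sup>2 + (2 * (g a - m) * (f (a # v) - g a) + (g a - m)\<^sup>2))"
      by (intro average_cong) (simp add: power2_eq_square algebra_simps)
    also have "\<dots> = average b L (\<lambda>v. (f (a # v) - g a)\<^sup>2) + (2 * (g a - m) * (g a - g a) + (g a - m)\<^sup>2)"
      using b by (simp add: average_add average_cmult average_diff average_const g_def)
    also have "(g a - m)\<^sup>2 \<le> c\<^sup>2" using gm c by (simp add: abs_le_square_iff[symmetric])
    then have "average b L (\<lambda>v. (f (a # v) - g a)\<^sup>2) + (2 * (g a - m) * (g a - g a) + (g a - m)\<^sup>2) \<le> L * c\<^sup>2 + c\<^sup>2"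
      using V by simp
    finally show ?thesis .
  qed
  have "(\<Sum>a<b. average b L (\<lambda>v. (f (a # v) - m)\<^sup>2)) \<le> (\<Sum>a<b. L * c\<^sup>2 + c\<^sup>2)"
    using 1 by (intro sum_mono) auto
  then have "average b (Suc L) (\<lambda>v. (f v - m)\<^sup>2) \<le> L * c\<^sup>2 + c\<^sup>2" using b by (simp add: divide_le_eq mult.commute)
  then show ?case unfolding m_def by (simp add: algebra_simps)
qed simp

text \<open>Here \<open>k\<close> consecutive letters are each prescribed by the letters before them.\<close>
lemma average_determined:
  assumes b: "b > 0"
  shows "i + k \<le> L \<Longrightarrow> (\<And>p. G p < b) \<Longrightarrow> average b L (\<lambda>v. of_bool (\<forall>t<k. v ! (i + t) = G (take (i + t) v))) = 1 / real b ^ k"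
proof (induction L arbitrary: i k G)
  case (Suc L)
  show ?case
  proof (cases i)
    case (Suc i')
    have "average b L (\<lambda>v. of_bool (\<forall>t<k. (a # v) ! (i + t) = G (take (i + t) (a # v)))) = 1 / real b ^ k" for a
      using Suc.IH[of i' k "\<lambda>p. G (a # p)"] Suc.prems Suc by simp
    then show ?thesis using b by simp
  next
    case i0: 0
    show ?thesis
    proof (cases k)
      case 0
      then show ?thesis using b average_const[OF b, of "Suc L" 1] by simp
    next
      case (Suc k')
      have "average b L (\<lambda>v. of_bool (\<forall>t<k. (a # v) ! (i + t) = G (take (i + t) (a # v)))) = (if a = G [] then 1 / real b ^ k' else 0)" for a
      proof -
        have "(\<forall>t<k. (a # v) ! (i + t) = G (take (i + t) (a # v))) \<longleftrightarrow> a = G [] \<and> (\<forall>t<k'. v ! (0 + t) = G (a # take (0 + t) v))" for v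
          unfolding Suc i0 All_less_Suc2 by simp
        then show ?thesis using Suc.IH[of 0 k' "\<lambda>p. G (a # p)"] Suc.prems i0 Suc average_const[OF b, of L 0]
          by (cases "a = G []") (simp_all only:, simp_all)
      qed
      then have "average b (Suc L) (\<lambda>v. of_bool (\<forall>t<k. v ! (i + t) = G (take (i + t) v))) =
         (\<Sum>a<b. if a = G [] then 1 / real b ^ k' else 0) / b" by simp
      also have "\<dots> = 1 / real b ^ k" using Suc.prems(2)[of "[]"] Suc by simp
      finally show ?thesis .
    qed
  qed
qed (simp add: b)

section \<open>Random extensions of a fixed prefix\<close>

definition glue :: "nat \<Rightarrow> (nat \<Rightarrow> nat) \<Rightarrow> nat list \<Rightarrow> nat \<Rightarrow> nat" where
  "glue n u v i = (if i < n then u i else if i - n < length v then v ! (i - n) else 0)"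

lemma glue_less: "(\<And>i. u i < b) \<Longrightarrow> v \<in> words b L \<Longrightarrow> glue n u v i < b"
proof -
  assume u: "\<And>i. u i < b" and v: "v \<in> words b L"
  have "b > 0" using u[of 0] by simp
  moreover have "v ! (i - n) < b" if "i - n < length v"
    using v nth_mem[OF that] by (auto simp: words_def)
  ultimately show ?thesis using u by (simp add: glue_def)
qed

lemma words_nth: "v \<in> words b L \<Longrightarrow> m < L \<Longrightarrow> v ! m < b"
proof -
  assume "v \<in> words b L" "m < L"
  then have "v ! m \<in> set v" "set v \<subseteq> {..<b}" by (auto simp: words_def)
  then show "v ! m < b" by auto
qed

lemma prob_window:
  assumes b: "b > 0" and u: "\<And>i. u i < b" and i: "n \<le> i" "i + k \<le> n + L" and w: "w < b ^ k"
  shows "average b L (\<lambda>v. of_bool (win b (glue n u v) k i = w)) = 1 / real b ^ k"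
proof -
  \<comment> \<open>The length of the prefix reveals the offset within the window, hence which digit
    of \<open>w\<close> is prescribed next.\<close>
  define G where "G p = w div b ^ (length p - (i - n)) mod b" for p :: "nat list"
  have "average b L (\<lambda>v. of_bool (win b (glue n u v) k i = w)) =
     average b L (\<lambda>v. of_bool (\<forall>t<k. v ! (i - n + t) = G (take (i - n + t) v)))"
  proof (intro average_cong arg_cong[of _ _ of_bool])
    fix v assume v: "v \<in> words b L"
    have len: "length v = L" using v by (simp add: words_def)
    show "(win b (glue n u v) k i = w) = (\<forall>t<k. v ! (i - n + t) = G (take (i - n + t) v))"
      unfolding win_eq_code_iff[OF glue_less[OF u v] w b]
      using i len by (intro all_cong) (auto simp: glue_def G_def min_def)
  qed
  also have "\<dots> = 1 / real b ^ k"
    using i b by (intro average_determined) (auto simp: G_def)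
  finally show ?thesis .
qed

text \<open>The two windows may overlap: the collision still fixes every digit of the later window in terms of
  earlier digits.\<close>
lemma prob_collision:
  assumes b: "b > 0" and u: "\<And>i. u i < b" and i: "n \<le> i" "i + k \<le> n + L" and j: "j < i"
  shows "average b L (\<lambda>v. of_bool (win b (glue n u v) k j = win b (glue n u v) k i)) = 1 / real b ^ k"
proof -
  define G where "G p = (let m = j + (length p - (i - n)) in if m < n then u m else p ! (m - n)) mod b" for p :: "nat list"
  have "average b L (\<lambda>v. of_bool (win b (glue n u v) k j = win b (glue n u v) k i)) =
     average b L (\<lambda>v. of_bool (\<forall>t<k. v ! (i - n + t) = G (take (i - n + t) v)))"
  proof (intro average_cong arg_cong[of _ _ of_bool])
    fix v assume v: "v \<in> words b L"
    have len: "length v = L" using v by (simp add: words_def)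
    have vb: "v ! m < b" if "m < L" for m using words_nth[OF v that] .
    have "glue n u v (j + t) = glue n u v (i + t) \<longleftrightarrow> v ! (i - n + t) = G (take (i - n + t) v)" if t: "t < k" for t
    proof -
      have "i + t - n = i - n + t" "\<not> i + t < n" "i - n + t < L" using i t by auto
      then have 1: "glue n u v (i + t) = v ! (i - n + t)" using len by (simp only: glue_def if_False if_True)
      have 2: "G (take (i - n + t) v) = glue n u v (j + t)"
      proof -
        have l: "length (take (i - n + t) v) - (i - n) = t" using i t len by simp
        have "take (i - n + t) v ! (j + t - n) = v ! (j + t - n)" if "\<not> j + t < n" using that i j t by simp
        then show ?thesis unfolding G_def l Let_def
          using u i j t len vb[of "j + t - n"] by (auto simp: glue_def)
      qed
      show ?thesis unfolding 1 2 by auto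
    qed
    then show "(win b (glue n u v) k j = win b (glue n u v) k i) = (\<forall>t<k. v ! (i - n + t) = G (take (i - n + t) v))"
      unfolding win_eq_iff[OF glue_less[OF u v] glue_less[OF u v]] by auto
  qed
  also have "\<dots> = 1 / real b ^ k"
    using i b by (intro average_determined) (auto simp: G_def)
  finally show ?thesis .
qed

text \<open>\<open>n + 1 - k\<close> is the number of windows of length \<open>k\<close> that lie
  within the first \<open>n\<close> digits.\<close>

lemma win_glue_old: "i < n + 1 - k \<Longrightarrow> win b (glue n u v) k i = win b u k i"
proof (rule win_cong)
  fix t assume "i < n + 1 - k" "t < k"
  then have "i + t < n" by linarith
  then show "glue n u v (i + t) = u (i + t)" by (simp add: glue_def)
qed

lemma cnt_glue_old: "m \<le> n + 1 - k \<Longrightarrow> cnt b (glue n u v) k w m = cnt b u k w m"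
  by (rule cnt_cong) (simp add: win_glue_old)

text \<open>The word in the new window is uniformly distributed, so with the old counts the
  probability would be exactly the proportion of words satisfying \<open>Q\<close>. The true count
  differs only if one of the windows since \<open>n + 1 - k\<close> shows the same word, and each
  does so with probability \<open>1 / b ^ k\<close>.\<close>

lemma prob_count:
  assumes b: "b > 0" and u: "\<And>i. u i < b" and k: "0 < k" "k \<le> n" and i: "n \<le> i" "i + k \<le> n + L"
  shows "\<bar>average b L (\<lambda>v. of_bool (Q (cnt b (glue n u v) k (win b (glue n u v) k i) i))) -
     real (card {w. w < b ^ k \<and> Q (cnt b u k w (n + 1 - k))}) / real b ^ k\<bar> \<le> real (i - (n + 1 - k)) / real b ^ k"
proof -
  let ?M = "n + 1 - k" and ?D = "glue n u"
  have 1: "average b L (\<lambda>v. of_bool (Q (cnt b u k (win b (?D v) k i) ?M))) =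
      real (card {w. w < b ^ k \<and> Q (cnt b u k w ?M)}) / real b ^ k"
  proof -
    have "average b L (\<lambda>v. of_bool (Q (cnt b u k (win b (?D v) k i) ?M))) =
       average b L (\<lambda>v. \<Sum>w<b^k. of_bool (Q (cnt b u k w ?M)) * of_bool (win b (?D v) k i = w))"
    proof (rule average_cong)
      fix v assume v: "v \<in> words b L"
      have "win b (?D v) k i < b ^ k" using glue_less[OF u v] by (rule win_less)
      then show "of_bool (Q (cnt b u k (win b (?D v) k i) ?M)) = (\<Sum>w<b^k. of_bool (Q (cnt b u k w ?M)) * of_bool (win b (?D v) k i = w) :: real)"
        by (simp add: of_bool_def if_distrib[of "\<lambda>x. _ * x"] cong: if_cong)
    qed
    also have "\<dots> = (\<Sum>w<b^k. of_bool (Q (cnt b u k w ?M)) * (1 / real b ^ k))"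
      unfolding average_sum[OF b] average_cmult by (intro sum.cong refl) (simp only: prob_window[OF b u i] lessThan_iff)
    also have "\<dots> = (\<Sum>w<b^k. of_bool (Q (cnt b u k w ?M))) * (1 / real b ^ k)"
      by (rule sum_distrib_right[symmetric])
    also have "(\<Sum>w<b^k. of_bool (Q (cnt b u k w ?M))) = real (card {w. w < b ^ k \<and> Q (cnt b u k w ?M)})"
      by (simp add: of_bool_def sum.If_cases Int_def)
    finally show ?thesis by simp
  qed
  have "\<bar>average b L (\<lambda>v. of_bool (Q (cnt b (?D v) k (win b (?D v) k i) i))) - average b L (\<lambda>v. of_bool (Q (cnt b u k (win b (?D v) k i) ?M)))\<bar> \<le>
    average b L (\<lambda>v. \<bar>of_bool (Q (cnt b (?D v) k (win b (?D v) k i) i)) - of_bool (Q (cnt b u k (win b (?D v) k i) ?M))\<bar>)"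
    unfolding average_diff[symmetric] by (rule average_abs)
  also have "\<dots> \<le> average b L (\<lambda>v. \<Sum>j\<in>{?M..<i}. of_bool (win b (?D v) k j = win b (?D v) k i))"
  proof (rule average_mono)
    fix v
    let ?W = "win b (?D v) k i"
    show "\<bar>of_bool (Q (cnt b (?D v) k ?W i)) - of_bool (Q (cnt b u k ?W ?M))\<bar> \<le>
      (\<Sum>j\<in>{?M..<i}. of_bool (win b (?D v) k j = ?W) :: real)"
    proof (cases "\<exists>j\<in>{?M..<i}. win b (?D v) k j = ?W")
      case True
      then obtain j where j: "j \<in> {?M..<i}" "win b (?D v) k j = ?W" by blast
      have "1 \<le> (\<Sum>j\<in>{j}. of_bool (win b (?D v) k j = ?W) :: real)" using j by simp
      also have "\<dots> \<le> (\<Sum>j\<in>{?M..<i}. of_bool (win b (?D v) k j = ?W))" using j(1) by (intro sum_mono2) auto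
      finally show ?thesis by (auto simp: of_bool_def)
    next
      case False
      have "?M \<le> i" using i k by simp
      with False have "{j. j < i \<and> win b (?D v) k j = ?W} = {j. j < ?M \<and> win b (?D v) k j = ?W}"
        by auto
      then have "cnt b (?D v) k ?W i = cnt b (?D v) k ?W ?M" by (simp add: cnt_def)
      also have "\<dots> = cnt b u k ?W ?M" by (rule cnt_glue_old) simp
      finally show ?thesis by (simp add: sum_nonneg)
    qed
  qed
  also have "\<dots> = (\<Sum>j\<in>{?M..<i}. 1 / real b ^ k)"
    unfolding average_sum[OF b] by (intro sum.cong refl prob_collision[OF b u i]) simp
  also have "\<dots> = real (i - ?M) / real b ^ k" by simp
  finally show ?thesis unfolding 1 .
qed

lemma average_ge: "b > 0 \<Longrightarrow> (\<And>v. v \<in> words b L \<Longrightarrow> c \<le> f v) \<Longrightarrow> c \<le> average b L f"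
  using average_mono[of b L "\<lambda>_. c" f] by (simp add: average_const)

lemma average_le: "b > 0 \<Longrightarrow> (\<And>v. v \<in> words b L \<Longrightarrow> f v \<le> c) \<Longrightarrow> average b L f \<le> c"
  using average_mono[of b L f "\<lambda>_. c"] by (simp add: average_const)

text \<open>Fewer than \<open>k\<close> of the new windows start before \<open>n\<close> and so
  involve old digits. They contribute the constant 2 each, the others only \<open>c\<close>.\<close>

lemma sum_boundary_bound:
  fixes L :: nat and t :: "nat \<Rightarrow> real" and c d :: real
  assumes k: "0 < k" "k \<le> n" and c: "0 \<le> c"
    and t: "\<And>i. i \<in> {n + 1 - k..<n + 1 - k + L} \<Longrightarrow> \<bar>t i - d\<bar> \<le> 2 * of_bool (i < n) + c"
  shows "\<bar>(\<Sum>i\<in>{n + 1 - k..<n + 1 - k + L}. t i) - real L * d\<bar> \<le> 2 * real k + real L * c"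
proof -
  let ?I = "{n + 1 - k..<n + 1 - k + L}"
  have "(\<Sum>i\<in>?I. t i) - real L * d = (\<Sum>i\<in>?I. t i - d)" by (simp add: sum_subtractf)
  also have "\<bar>\<dots>\<bar> \<le> (\<Sum>i\<in>?I. 2 * of_bool (i < n) + c)"
    using t by (intro order.trans[OF sum_abs] sum_mono)
  also have "\<dots> = 2 * real (card {i\<in>?I. i < n}) + real L * c"
    by (simp add: sum.distrib sum_distrib_left[symmetric] of_bool_def sum.If_cases Int_def)
  also have "card {i\<in>?I. i < n} \<le> card {n + 1 - k..<n}" by (intro card_mono) auto
  also have "card {n + 1 - k..<n} \<le> k" using k by simp
  finally show ?thesis by simp
qed

text \<open>Each new window moves the expected class size by about
  \<open>(clsp - cls) / b ^ k\<close>, so a whole stage is one Euler step. The term quadratic in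
  \<open>L\<close> accounts for collisions between windows of the same stage.\<close>

lemma mean_cls:
  assumes b: "b > 0" and u: "\<And>i. u i < b" and k: "0 < k" "k \<le> n"
  shows "\<bar>average b L (\<lambda>v. real (cls b (glue n u v) k j (n + 1 - k + L))) - real (cls b u k j (n + 1 - k)) -
     L * ((real (clsp b u k j (n + 1 - k)) - real (cls b u k j (n + 1 - k))) / real b ^ k)\<bar> \<le> 2 * real k + 2 * real L ^ 2 / real b ^ k"
proof -
  let ?M = "n + 1 - k" and ?D = "glue n u"
  \<comment> \<open>The change of the class size caused by window \<open>i\<close>; the class size
    after the stage is a telescoping sum of these.\<close>
  define T where "T i v = (of_bool (Suc (cnt b (?D v) k (win b (?D v) k i) i) = j) - of_bool (cnt b (?D v) k (win b (?D v) k i) i = j) :: real)" for i v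
  define d where "d = (real (clsp b u k j ?M) - real (cls b u k j ?M)) / real b ^ k"
  have tel: "real (cls b (?D v) k j (?M + L)) = real (cls b u k j ?M) + (\<Sum>i\<in>{?M..<?M+L}. T i v)" if v: "v \<in> words b L" for v
  proof -
    have w: "win b (?D v) k i < b ^ k" for i using glue_less[OF u v] by (rule win_less)
    have "real (cls b (?D v) k j (?M + l)) = real (cls b u k j ?M) + (\<Sum>i\<in>{?M..<?M+l}. T i v)" for l
    proof (induction l)
      case 0
      show ?case by (simp add: cls_def cnt_glue_old cong: conj_cong)
    next
      case (Suc l)
      then show ?case using cls_step[OF w, of j "?M + l"] by (simp add: T_def)
    qed
    then show ?thesis .
  qed
  have avt: "average b L (\<lambda>v. real (cls b (?D v) k j (?M + L))) - real (cls b u k j ?M) = (\<Sum>i\<in>{?M..<?M+L}. average b L (T i))"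
    using average_cong[OF tel] by (simp add: average_add average_const[OF b] average_sum[OF b])
  have card_le: "card {w. w < b ^ k \<and> Q w} \<le> b ^ k" for Q
    using card_mono[of "{..<b^k}" "{w. w < b ^ k \<and> Q w}"] by auto
  have bk: "real b ^ k > 0" using b by simp
  have d1: "\<bar>d\<bar> \<le> 1"
  proof -
    have "real (clsp b u k j ?M) \<le> real b ^ k" "real (cls b u k j ?M) \<le> real b ^ k"
      unfolding clsp_def cls_def of_nat_power[symmetric] by (intro of_nat_mono card_le)+
    then have "\<bar>real (clsp b u k j ?M) - real (cls b u k j ?M)\<bar> \<le> real b ^ k" by linarith
    then show ?thesis unfolding d_def using bk by simp
  qed
  have "\<bar>(\<Sum>i\<in>{?M..<?M+L}. average b L (T i)) - real L * d\<bar> \<le> 2 * real k + real L * (2 * real L / real b ^ k)"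
  proof (rule sum_boundary_bound[OF k])
    fix i assume i: "i \<in> {?M..<?M+L}"
    show "\<bar>average b L (T i) - d\<bar> \<le> 2 * of_bool (i < n) + 2 * real L / real b ^ k"
    proof (cases "i < n")
      case True
      have "- 1 \<le> average b L (T i)" "average b L (T i) \<le> 1"
        by (rule average_ge[OF b], simp add: T_def of_bool_def, rule average_le[OF b], simp add: T_def of_bool_def)
      then have "\<bar>average b L (T i) - d\<bar> \<le> 2" using d1 by linarith
      also have "\<dots> \<le> 2 * of_bool (i < n) + 2 * real L / real b ^ k" using True bk by simp
      finally show ?thesis .
    next
      case False
      have i': "n \<le> i" "i + k \<le> n + L" using False i k by auto
      have 1: "real (i - ?M) / real b ^ k \<le> real L / real b ^ k" using i bk by (intro divide_right_mono) auto
      have "average b L (T i) - d =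
        (average b L (\<lambda>v. of_bool (Suc (cnt b (?D v) k (win b (?D v) k i) i) = j)) - real (clsp b u k j ?M) / real b ^ k) -
        (average b L (\<lambda>v. of_bool (cnt b (?D v) k (win b (?D v) k i) i = j)) - real (cls b u k j ?M) / real b ^ k)"
        unfolding T_def average_diff d_def by (simp add: diff_divide_distrib)
      moreover have "2 * of_bool (i < n) + 2 * real L / real b ^ k = 2 * (real L / real b ^ k)" using False by simp
      ultimately show ?thesis using prob_count[where u = u and Q = "\<lambda>c. Suc c = j", OF b u k i'] prob_count[where u = u and Q = "\<lambda>c. c = j", OF b u k i'] 1
        unfolding clsp_def[symmetric] cls_def[symmetric] by linarith
    qed
  qed (use bk in simp)
  moreover have "real L * (2 * real L / real b ^ k) = 2 * real L ^ 2 / real b ^ k" by (simp add: power2_eq_square)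
  ultimately show ?thesis unfolding avt[symmetric] d_def by (simp only:)
qed

text \<open>By linearity collisions do not enter here; only windows reaching back into the prefix
  cause an error.\<close>

lemma mean_cnt:
  assumes b: "b > 0" and u: "\<And>i. u i < b" and k: "0 < k" "k \<le> n" and w: "w < b ^ k"
  shows "\<bar>average b L (\<lambda>v. real (cnt b (glue n u v) k w (n + 1 - k + L))) - real (cnt b u k w (n + 1 - k)) - L / real b ^ k\<bar> \<le> 2 * real k"
proof -
  let ?M = "n + 1 - k" and ?D = "glue n u"
  have "real (cnt b (?D v) k w (?M + l)) = real (cnt b u k w ?M) + (\<Sum>i\<in>{?M..<?M+l}. of_bool (win b (?D v) k i = w))" for l v
    by (induction l) (simp_all add: cnt_glue_old cnt_Suc)
  then have avt: "average b L (\<lambda>v. real (cnt b (?D v) k w (?M + L))) - real (cnt b u k w ?M) =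
      (\<Sum>i\<in>{?M..<?M+L}. average b L (\<lambda>v. of_bool (win b (?D v) k i = w)))"
    by (simp only: average_add average_const[OF b] average_sum[OF b] add_diff_cancel_left')
  have bk: "real b ^ k \<ge> 1" using b by simp
  have "\<bar>(\<Sum>i\<in>{?M..<?M+L}. average b L (\<lambda>v. of_bool (win b (?D v) k i = w))) - real L * (1 / real b ^ k)\<bar> \<le> 2 * real k + real L * 0"
  proof (rule sum_boundary_bound[OF k])
    fix i assume i: "i \<in> {?M..<?M+L}"
    show "\<bar>average b L (\<lambda>v. of_bool (win b (?D v) k i = w)) - 1 / real b ^ k\<bar> \<le> 2 * of_bool (i < n) + 0"
    proof (cases "i < n")
      case True
      have "0 \<le> average b L (\<lambda>v. of_bool (win b (?D v) k i = w))" "average b L (\<lambda>v. of_bool (win b (?D v) k i = w)) \<le> 1"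
        by (rule average_ge[OF b], simp, rule average_le[OF b], simp)
      moreover have "0 \<le> 1 / real b ^ k" "1 / real b ^ k \<le> 1" using bk by (auto simp: divide_le_eq)
      ultimately have "\<bar>average b L (\<lambda>v. of_bool (win b (?D v) k i = w)) - 1 / real b ^ k\<bar> \<le> 2" by linarith
      with True show ?thesis by simp
    next
      case False
      have i': "n \<le> i" "i + k \<le> n + L" using False i k by auto
      then show ?thesis using prob_window[OF b u i' w] False by simp
    qed
  qed simp
  then show ?thesis unfolding avt by simp
qed

lemma windows_update:
  assumes "v \<in> words b L"
  shows "card {s. s < m \<and> win b (glue n u (v[i := a])) k s \<noteq> win b (glue n u v) k s} \<le> k"
proof -
  have "{s. s < m \<and> win b (glue n u (v[i := a])) k s \<noteq> win b (glue n u v) k s} \<subseteq> {n + i + 1 - k..<n + i + 1}"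
  proof
    fix s assume "s \<in> {s. s < m \<and> win b (glue n u (v[i := a])) k s \<noteq> win b (glue n u v) k s}"
    then have "win b (glue n u (v[i := a])) k s \<noteq> win b (glue n u v) k s" by simp
    then obtain t where t: "t < k" "glue n u (v[i := a]) (s + t) \<noteq> glue n u v (s + t)"
      using win_cong[of k "glue n u (v[i := a])" s "glue n u v" s b] by blast
    have "s + t \<ge> n" using t by (auto simp: glue_def split: if_splits)
    moreover have "s + t - n = i"
    proof (rule ccontr)
      assume "s + t - n \<noteq> i"
      then have "v[i := a] ! (s + t - n) = v ! (s + t - n)" by simp
      with t(2) show False by (simp add: glue_def split: if_splits)
    qed
    ultimately have "s + t \<ge> n" "s + t - n = i" by auto
    then show "s \<in> {n + i + 1 - k..<n + i + 1}" using t by auto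
  qed
  then have "card {s. s < m \<and> win b (glue n u (v[i := a])) k s \<noteq> win b (glue n u v) k s} \<le> card {n + i + 1 - k..<n + i + 1}"
    by (intro card_mono) auto
  then show ?thesis by simp
qed

text \<open>A digit lies in at most \<open>k\<close> windows, and each changed window affects two
  words; this is the bounded difference that the variance estimate asks for.\<close>

lemma variance_cls:
  assumes b: "b > 0"
  shows "average b L (\<lambda>v. (real (cls b (glue n u v) k j m) - average b L (\<lambda>v. real (cls b (glue n u v) k j m)))\<^sup>2) \<le> L * (2 * real (Suc k))\<^sup>2"
proof (rule average_variance[OF b])
  fix v i a assume v: "v \<in> words b L"
  show "\<bar>real (cls b (glue n u (v[i := a])) k j m) - real (cls b (glue n u v) k j m)\<bar> \<le> 2 * real (Suc k)"
    using cls_diff_windows[of b "glue n u (v[i := a])" k j m "glue n u v"]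
      of_nat_mono[OF windows_update[OF v, of m n u i a k], where 'a = real] by simp
qed simp

lemma variance_cnt:
  assumes b: "b > 0"
  shows "average b L (\<lambda>v. (real (cnt b (glue n u v) k w m) - average b L (\<lambda>v. real (cnt b (glue n u v) k w m)))\<^sup>2) \<le> L * (2 * real (Suc k))\<^sup>2"
proof (rule average_variance[OF b])
  fix v i a assume v: "v \<in> words b L"
  show "\<bar>real (cnt b (glue n u (v[i := a])) k w m) - real (cnt b (glue n u v) k w m)\<bar> \<le> 2 * real (Suc k)"
    using cnt_diff_windows[of b "glue n u (v[i := a])" k w m "glue n u v"]
      of_nat_mono[OF windows_update[OF v, of m n u i a k], where 'a = real] by simp
qed simp

text \<open>Chebyshev's inequality and the union bound in one average: the squared deviations
  divided by \<open>c\<close> sum to at most \<open>card I\<close> on average, hence at some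
  word.\<close>

lemma simultaneous_deviation:
  fixes f :: "'t \<Rightarrow> nat list \<Rightarrow> real" and c :: "'t \<Rightarrow> real"
  assumes b: "b > 0" and I: "finite I" and c: "\<And>t. t \<in> I \<Longrightarrow> c t > 0"
    and var: "\<And>t. t \<in> I \<Longrightarrow> average b L (\<lambda>v. (f t v - average b L (f t))\<^sup>2) \<le> c t"
  shows "\<exists>v\<in>words b L. \<forall>t\<in>I. (f t v - average b L (f t))\<^sup>2 \<le> card I * c t"
proof -
  define \<Phi> where "\<Phi> v = (\<Sum>t\<in>I. (1 / c t) * (f t v - average b L (f t))\<^sup>2)" for v
  have "average b L \<Phi> = (\<Sum>t\<in>I. (1 / c t) * average b L (\<lambda>v. (f t v - average b L (f t))\<^sup>2))"
    unfolding \<Phi>_def by (simp only: average_sum[OF b] average_cmult)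
  also have "\<dots> \<le> (\<Sum>t\<in>I. (1 / c t) * c t)"
    using c var by (intro sum_mono mult_left_mono) (auto intro: less_imp_le)
  also have "\<dots> = card I" using c by (simp add: less_imp_neq[symmetric])
  finally have A: "average b L \<Phi> \<le> card I" .
  obtain v where v: "v \<in> words b L" "\<Phi> v \<le> average b L \<Phi>" using average_exists[OF b] by blast
  have "(f t v - average b L (f t))\<^sup>2 \<le> card I * c t" if t: "t \<in> I" for t
  proof -
    have "(1 / c t) * (f t v - average b L (f t))\<^sup>2 \<le> \<Phi> v"
      unfolding \<Phi>_def using I t c by (intro member_le_sum[of t I "\<lambda>t. (1 / c t) * (f t v - average b L (f t))\<^sup>2"]) (auto simp: less_imp_le)
    also have "\<dots> \<le> card I" using v A by simp
    finally show ?thesis using c[OF t] by (simp add: field_simps)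
  qed
  with v show ?thesis by blast
qed

section \<open>A normal and Poisson generic base sequence\<close>

definition digit :: "nat \<Rightarrow> nat \<Rightarrow> nat \<Rightarrow> nat" where
  "digit b U i = U div b ^ i mod b"

definition gap :: "nat \<Rightarrow> nat" where "gap s = Suc s ^ 5 - s ^ 5"

text \<open>\<open>2 * k\<close> is the boundary error of the means. The rest bounds the deviation:
  at most \<open>2 * s ^ 2\<close> quantities, each with variance at most
  \<open>5 * Suc s ^ 4 * (2 * Suc k) ^ 2\<close>, give a squared deviation of at most 40 times the
  square of \<open>Suc k * Suc s ^ 3\<close>, and 40 is below \<open>12 ^ 2\<close>.\<close>

definition tolerance :: "nat \<Rightarrow> nat \<Rightarrow> nat" where "tolerance s k = 2 * k + 12 * Suc k * Suc s ^ 3"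

text \<open>The means of the class sizes and of the counts are attained up to \<open>tolerance\<close>; multiplied by \<open>b ^ k\<close> and
  with both sides moved, so that no division or subtraction occurs and the test is recursive.\<close>
definition good :: "nat \<Rightarrow> nat \<Rightarrow> (nat \<Rightarrow> nat) \<Rightarrow> bool" where
  "good b s D \<longleftrightarrow>
     (\<forall>k<s. \<forall>j<s. 0 < k \<longrightarrow>
       b ^ k * cls b D k j (Suc s ^ 5 + 1 - k) + gap s * cls b D k j (s ^ 5 + 1 - k) \<le>
       b ^ k * cls b D k j (s ^ 5 + 1 - k) + gap s * clsp b D k j (s ^ 5 + 1 - k) + (b ^ k * tolerance s k + 2 * gap s ^ 2) \<and>
       b ^ k * cls b D k j (s ^ 5 + 1 - k) + gap s * clsp b D k j (s ^ 5 + 1 - k) \<le>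
       b ^ k * cls b D k j (Suc s ^ 5 + 1 - k) + gap s * cls b D k j (s ^ 5 + 1 - k) + (b ^ k * tolerance s k + 2 * gap s ^ 2)) \<and>
     (\<forall>k<s. \<forall>w<s. 0 < k \<longrightarrow> w < b ^ k \<longrightarrow>
       b ^ k * cnt b D k w (Suc s ^ 5 + 1 - k) \<le> b ^ k * cnt b D k w (s ^ 5 + 1 - k) + gap s + b ^ k * tolerance s k \<and>
       b ^ k * cnt b D k w (s ^ 5 + 1 - k) + gap s \<le> b ^ k * cnt b D k w (Suc s ^ 5 + 1 - k) + b ^ k * tolerance s k)"

lemma gap_le: "gap s \<le> 5 * Suc s ^ 4"
proof -
  have "real (Suc s) ^ 5 - real s ^ 5 \<le> 5 * real (Suc s) ^ 4"
    by (simp add: power_numeral_reduce algebra_simps)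
  then have "real (Suc s ^ 5) \<le> real (5 * Suc s ^ 4 + s ^ 5)" by simp
  then show ?thesis unfolding of_nat_le_iff gap_def by simp
qed

lemma gap_add: "s ^ 5 + gap s = Suc s ^ 5"
  unfolding gap_def by (simp add: power_mono)

lemma le_power5: "s \<le> s ^ 5" for s :: nat
  by (cases s) (simp_all add: self_le_power)

lemma le_gap: "s \<le> gap s"
proof -
  have "real s ^ 5 + real s \<le> real (Suc s) ^ 5"
    by (simp add: power_numeral_reduce algebra_simps)
  then have "real (s ^ 5 + s) \<le> real (Suc s ^ 5)" by simp
  then show ?thesis unfolding of_nat_le_iff gap_def by simp
qed

lemma abs_scale:
  fixes B x y d t l e :: real
  assumes B: "B > 0" and le: "\<bar>x - y - l * (d / B)\<bar> \<le> t + e / B"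
  shows "\<bar>B * x - B * y - l * d\<bar> \<le> B * t + e"
proof -
  have "B * x - B * y - l * d = B * (x - y - l * (d / B))" using B by (simp add: field_simps)
  also have "\<bar>\<dots>\<bar> = B * \<bar>x - y - l * (d / B)\<bar>" using B by (simp add: abs_mult)
  also have "\<dots> \<le> B * (t + e / B)" using B le by (intro mult_left_mono) auto
  finally show ?thesis using B by (simp add: distrib_left)
qed

text \<open>All controlled quantities come close to their means at some common word. That
  \<open>u\<close> is arbitrary lets the stages be chosen one after another.\<close>

lemma good_extension_glue:
  assumes b: "b > 0" and u: "\<And>i. u i < b"
  shows "\<exists>v\<in>words b (gap s). good b s (glue (s ^ 5) u v)"
proof -
  define L where "L = gap s"
  \<comment> \<open>The tag \<open>q\<close> selects class sizes or word counts; the third index is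
    accordingly a number of occurrences or the code of a word.\<close>
  define f where "f = (\<lambda>(q, k, j) v. if q then real (cls b (glue (s ^ 5) u v) k j (Suc s ^ 5 + 1 - k))
      else real (cnt b (glue (s ^ 5) u v) k j (Suc s ^ 5 + 1 - k)))"
  define I where "I = (UNIV :: bool set) \<times> {0<..<s} \<times> {..<s}"
  define c where "c = (\<lambda>(q :: bool, k, j :: nat). L * (2 * real (Suc k))\<^sup>2)"
  have cardI: "card I \<le> 2 * (s * s)" by (simp add: I_def card_cartesian_product)
  have Lpos: "L > 0" if "s > 0" using le_gap[of s] that by (simp add: L_def)
  have "\<exists>v\<in>words b L. \<forall>t\<in>I. (f t v - average b L (f t))\<^sup>2 \<le> card I * c t"
  proof (rule simultaneous_deviation[OF b])
    show "finite I" by (simp add: I_def)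
    fix t assume t: "t \<in> I"
    obtain q k j where qkj: "t = (q, k, j)" by (cases t)
    show "c t > 0" using Lpos t unfolding qkj c_def I_def by (auto simp: field_simps)
    show "average b L (\<lambda>v. (f t v - average b L (f t))\<^sup>2) \<le> c t"
      unfolding qkj f_def c_def prod.case by (cases q) (simp_all only: if_True if_False variance_cls[OF b] variance_cnt[OF b])
  qed
  then obtain v where v: "v \<in> words b L" "\<And>t. t \<in> I \<Longrightarrow> (f t v - average b L (f t))\<^sup>2 \<le> card I * c t" by blast
  have dev: "\<bar>f (q, k, j) v - average b L (f (q, k, j))\<bar> \<le> 12 * real (Suc k) * real (Suc s) ^ 3" if "0 < k" "k < s" "j < s" for q k j
  proof -
    have "(f (q, k, j) v - average b L (f (q, k, j)))\<^sup>2 \<le> card I * c (q, k, j)" using v(2) that by (auto simp: I_def)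
    also have "\<dots> \<le> (2 * (real s * real s)) * ((5 * real (Suc s) ^ 4) * (2 * real (Suc k))\<^sup>2)"
    proof (intro mult_mono)
      show "real (card I) \<le> 2 * (real s * real s)" using of_nat_mono[OF cardI, where 'a = real] by simp
      show "c (q, k, j) \<le> (5 * real (Suc s) ^ 4) * (2 * real (Suc k))\<^sup>2"
        using of_nat_mono[OF gap_le[of s], where 'a = real] unfolding c_def L_def prod.case
        by (intro mult_right_mono) auto
    qed (auto simp: c_def)
    also have "\<dots> \<le> (2 * (real (Suc s) * real (Suc s))) * ((5 * real (Suc s) ^ 4) * (2 * real (Suc k))\<^sup>2)"
      by (intro mult_right_mono mult_left_mono mult_mono) auto
    also have "\<dots> \<le> (12 * real (Suc k) * real (Suc s) ^ 3)\<^sup>2"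
    proof -
      have e: "(2 * (y * y)) * ((5 * y ^ 4) * (2 * x)\<^sup>2) = 40 * (x * y ^ 3)\<^sup>2"
        "(12 * x * y ^ 3)\<^sup>2 = 144 * (x * y ^ 3)\<^sup>2" for x y :: real
        by (simp_all add: power2_eq_square eval_nat_numeral algebra_simps)
      show ?thesis unfolding e(1)[of "real (Suc s)" "real (Suc k)"] e(2) by simp
    qed
    finally have "\<bar>f (q, k, j) v - average b L (f (q, k, j))\<bar> \<le> \<bar>12 * real (Suc k) * real (Suc s) ^ 3\<bar>"
      unfolding abs_le_square_iff .
    moreover have "\<bar>12 * real (Suc k) * real (Suc s) ^ 3\<bar> = 12 * real (Suc k) * real (Suc s) ^ 3" by (rule abs_of_nonneg) simp
    ultimately show ?thesis by simp
  qed
  have old: "glue (s ^ 5) u v' i = u i" if "i < s ^ 5" for v' i using that by (simp add: glue_def)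
  have len: "s ^ 5 + 1 - k + L = Suc s ^ 5 + 1 - k" if "k < s" for k
    using gap_add[of s] le_power5[of s] that by (simp add: L_def)
  have tolr: "real (tolerance s k) = 2 * real k + 12 * real (Suc k) * real (Suc s) ^ 3" for k
    by (simp add: tolerance_def)
  show ?thesis
  proof (intro bexI[of _ v])
    show "v \<in> words b (gap s)" using v(1) by (simp add: L_def)
    show "good b s (glue (s ^ 5) u v)" unfolding good_def
    proof (intro conjI allI impI)
      fix k j assume k: "k < s" "0 < k" and j: "j < s"
      let ?D = "glue (s ^ 5) u v" and ?M = "s ^ 5 + 1 - k" and ?M' = "Suc s ^ 5 + 1 - k"
      have kn: "k \<le> s ^ 5" using k le_power5[of s] by simp
      have bk: "real b ^ k > 0" using b by simp
      have o: "cls b ?D k j ?M = cls b u k j ?M" "clsp b ?D k j ?M = clsp b u k j ?M"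
        by (simp_all add: cls_def clsp_def cnt_glue_old cong: conj_cong)
      have "\<bar>f (True, k, j) v - real (cls b u k j ?M) -
         L * ((real (clsp b u k j ?M) - real (cls b u k j ?M)) / real b ^ k)\<bar> \<le>
         12 * real (Suc k) * real (Suc s) ^ 3 + (2 * real k + 2 * real L ^ 2 / real b ^ k)"
        using dev[OF k(2,1) j, of True] mean_cls[where u = u and L = L and j = j, OF b u k(2) kn, unfolded len[OF k(1)]]
        unfolding f_def prod.case if_True by linarith
      then have "\<bar>real (cls b ?D k j ?M') - real (cls b ?D k j ?M) -
         L * ((real (clsp b ?D k j ?M) - real (cls b ?D k j ?M)) / real b ^ k)\<bar> \<le> real (tolerance s k) + 2 * real L ^ 2 / real b ^ k"
        unfolding o tolr f_def prod.case if_True by linarith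
      from abs_scale[OF bk this] have *: "\<bar>real b ^ k * real (cls b ?D k j ?M') - real b ^ k * real (cls b ?D k j ?M) -
         L * (real (clsp b ?D k j ?M) - real (cls b ?D k j ?M))\<bar> \<le> real b ^ k * real (tolerance s k) + 2 * real L ^ 2" .
      have "real (b ^ k * cls b ?D k j ?M' + gap s * cls b ?D k j ?M) \<le>
         real (b ^ k * cls b ?D k j ?M + gap s * clsp b ?D k j ?M + (b ^ k * tolerance s k + 2 * gap s ^ 2))"
        "real (b ^ k * cls b ?D k j ?M + gap s * clsp b ?D k j ?M) \<le>
         real (b ^ k * cls b ?D k j ?M' + gap s * cls b ?D k j ?M + (b ^ k * tolerance s k + 2 * gap s ^ 2))"
        using * unfolding L_def by (simp_all add: abs_le_iff algebra_simps)
      then show "b ^ k * cls b ?D k j ?M' + gap s * cls b ?D k j ?M \<le>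
         b ^ k * cls b ?D k j ?M + gap s * clsp b ?D k j ?M + (b ^ k * tolerance s k + 2 * gap s ^ 2)"
        "b ^ k * cls b ?D k j ?M + gap s * clsp b ?D k j ?M \<le>
         b ^ k * cls b ?D k j ?M' + gap s * cls b ?D k j ?M + (b ^ k * tolerance s k + 2 * gap s ^ 2)"
        unfolding of_nat_le_iff .
    next
      fix k w assume k: "k < s" "0 < k" and w: "w < s" "w < b ^ k"
      let ?D = "glue (s ^ 5) u v" and ?M = "s ^ 5 + 1 - k" and ?M' = "Suc s ^ 5 + 1 - k"
      have kn: "k \<le> s ^ 5" using k le_power5[of s] by simp
      have bk: "real b ^ k > 0" using b by simp
      have o: "cnt b ?D k w ?M = cnt b u k w ?M" by (simp add: cnt_glue_old)
      have "\<bar>f (False, k, w) v - real (cnt b u k w ?M) - L / real b ^ k\<bar> \<le>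
         12 * real (Suc k) * real (Suc s) ^ 3 + 2 * real k"
        using dev[OF k(2,1) w(1), of False] mean_cnt[where u = u and L = L, OF b u k(2) kn w(2), unfolded len[OF k(1)]]
        unfolding f_def prod.case if_False by linarith
      then have "\<bar>real (cnt b ?D k w ?M') - real (cnt b ?D k w ?M) - L * (1 / real b ^ k)\<bar> \<le> real (tolerance s k) + 0 / real b ^ k"
        unfolding o tolr f_def prod.case if_False by simp
      from abs_scale[OF bk this] have *: "\<bar>real b ^ k * real (cnt b ?D k w ?M') - real b ^ k * real (cnt b ?D k w ?M) - L\<bar> \<le>
        real b ^ k * real (tolerance s k)" by simp
      have "real (b ^ k * cnt b ?D k w ?M') \<le> real (b ^ k * cnt b ?D k w ?M + gap s + b ^ k * tolerance s k)"
        "real (b ^ k * cnt b ?D k w ?M + gap s) \<le> real (b ^ k * cnt b ?D k w ?M' + b ^ k * tolerance s k)"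
        using * unfolding L_def by (simp_all add: abs_le_iff algebra_simps)
      then show "b ^ k * cnt b ?D k w ?M' \<le> b ^ k * cnt b ?D k w ?M + gap s + b ^ k * tolerance s k"
        "b ^ k * cnt b ?D k w ?M + gap s \<le> b ^ k * cnt b ?D k w ?M' + b ^ k * tolerance s k"
        unfolding of_nat_le_iff .
    qed
  qed
qed

section \<open>Prefixes as numbers and the search for extensions\<close>

lemma digit_less: "b > 0 \<Longrightarrow> digit b U i < b" by (simp add: digit_def)

lemma digit_high: "U < b ^ n \<Longrightarrow> n \<le> i \<Longrightarrow> b > 0 \<Longrightarrow> digit b U i = 0"
  unfolding digit_def using power_increasing[of n i b] by simp

lemma digit_add_low:
  assumes b: "b > 0" and i: "i < n"
  shows "digit b (U + b ^ n * V) i = digit b U i"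
proof -
  obtain r where r: "n = Suc (i + r)" using i less_imp_Suc_add by auto
  have "U + b ^ n * V = U + b ^ i * (b * (b ^ r * V))" unfolding r by (simp add: power_add)
  moreover have nz: "b ^ i \<noteq> 0" using b by simp
  ultimately have "(U + b ^ n * V) div b ^ i = b * (b ^ r * V) + U div b ^ i" by (simp only: div_mult_self2[OF nz])
  then show ?thesis by (simp add: digit_def)
qed

lemma digit_add_high:
  assumes b: "b > 0" and U: "U < b ^ n"
  shows "digit b (U + b ^ n * V) (n + i) = digit b V i"
proof -
  have "(U + b ^ n * V) div b ^ (n + i) = ((U + b ^ n * V) div b ^ n) div b ^ i"
    by (simp add: power_add div_mult2_eq)
  also have "(U + b ^ n * V) div b ^ n = V" using U b by simp
  finally show ?thesis by (simp add: digit_def)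
qed

lemma digit_digit_sum:
  assumes d: "\<And>t. t < L \<Longrightarrow> d t < b" and i: "i < L"
  shows "digit b (\<Sum>t<L. d t * b ^ t) i = d i"
  using i d
proof (induction L)
  case (Suc L)
  have b: "b > 0" using Suc.prems(2)[of i] Suc.prems(1) by simp
  have S: "(\<Sum>t<L. d t * b ^ t) < b ^ L" using Suc.prems by (intro digit_sum_less) auto
  show ?case
  proof (cases "i = L")
    case True
    then show ?thesis using digit_add_high[OF b S, of "d L" 0] Suc.prems(2)[of L] by (simp add: mult.commute) (simp add: digit_def)
  next
    case False
    then have "i < L" using Suc.prems by simp
    then show ?thesis using digit_add_low[OF b, of i L "(\<Sum>t<L. d t * b ^ t)" "d L"] Suc by (simp add: mult.commute)
  qed
qed simp

lemma good_extension:
  assumes b: "b > 0" and U: "U < b ^ (s ^ 5)"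
  shows "\<exists>V<b ^ gap s. good b s (digit b (U + b ^ (s ^ 5) * V))"
proof -
  let ?n = "s ^ 5"
  obtain v where v: "v \<in> words b (gap s)" "good b s (glue ?n (digit b U) v)"
    using good_extension_glue[OF b, where u = "digit b U"] digit_less[OF b] by blast
  define V where "V = (\<Sum>t<gap s. v ! t * b ^ t)"
  have vb: "\<And>t. t < gap s \<Longrightarrow> v ! t < b" using words_nth[OF v(1)] .
  have V: "V < b ^ gap s" unfolding V_def by (rule digit_sum_less[OF vb])
  have len: "length v = gap s" using v(1) by (simp add: words_def)
  have "digit b (U + b ^ ?n * V) i = glue ?n (digit b U) v i" for i
  proof -
    consider "i < ?n" | "?n \<le> i" "i - ?n < gap s" | "?n \<le> i" "gap s \<le> i - ?n" by linarith
    then show ?thesis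
    proof cases
      case 1
      then show ?thesis by (simp add: glue_def digit_add_low[OF b])
    next
      case 2
      then have "digit b (U + b ^ ?n * V) i = digit b V (i - ?n)" using digit_add_high[OF b U, of V "i - ?n"] by simp
      also have "\<dots> = v ! (i - ?n)" unfolding V_def using vb 2 by (intro digit_digit_sum)
      finally show ?thesis using 2 len by (simp add: glue_def)
    next
      case 3
      then have "digit b (U + b ^ ?n * V) i = digit b V (i - ?n)" using digit_add_high[OF b U, of V "i - ?n"] by simp
      also have "\<dots> = 0" using digit_high[OF V 3(2) b] .
      finally show ?thesis using 3 len by (simp add: glue_def)
    qed
  qed
  then have "digit b (U + b ^ ?n * V) = glue ?n (digit b U) v" by (rule ext)
  with v V show ?thesis by auto
qed

text \<open>The disjunct \<open>b ^ (s ^ 5) \<le> U\<close> only makes the search total.\<close>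
definition extension :: "nat \<Rightarrow> nat \<Rightarrow> nat \<Rightarrow> nat" where
  "extension b s U = (LEAST V. b ^ (s ^ 5) \<le> U \<or> V < b ^ gap s \<and> good b s (digit b (U + b ^ (s ^ 5) * V)))"

definition prefix_code :: "nat \<Rightarrow> nat \<Rightarrow> nat" where
  "prefix_code b s = rec_nat 0 (\<lambda>s U. U + b ^ (s ^ 5) * extension b s U) s"

text \<open>\<open>Suc i\<close> stages fix the first \<open>Suc i ^ 5\<close> digits, and digit
  \<open>i\<close> is among them.\<close>

definition base_seq :: "nat \<Rightarrow> nat \<Rightarrow> nat" where
  "base_seq b i = digit b (prefix_code b (Suc i)) i"

lemma extension_ex: "b > 0 \<Longrightarrow> \<exists>V. b ^ (s ^ 5) \<le> U \<or> V < b ^ gap s \<and> good b s (digit b (U + b ^ (s ^ 5) * V))"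
  using good_extension[of b U s] by (meson not_le)

lemma extension_good:
  assumes "b > 0" "U < b ^ (s ^ 5)"
  shows "extension b s U < b ^ gap s" "good b s (digit b (U + b ^ (s ^ 5) * extension b s U))"
  using LeastI_ex[OF extension_ex[OF assms(1), of s U]] assms(2) unfolding extension_def[symmetric] by auto

lemma prefix_code_Suc: "prefix_code b (Suc s) = prefix_code b s + b ^ (s ^ 5) * extension b s (prefix_code b s)"
  by (simp add: prefix_code_def)

lemma prefix_code_less: "b > 0 \<Longrightarrow> prefix_code b s < b ^ (s ^ 5)"
proof (induction s)
  case 0
  then show ?case by (simp add: prefix_code_def)
next
  case (Suc s)
  have "prefix_code b (Suc s) < b ^ (s ^ 5) + b ^ (s ^ 5) * extension b s (prefix_code b s)"
    using Suc by (simp add: prefix_code_Suc)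
  also have "\<dots> = b ^ (s ^ 5) * Suc (extension b s (prefix_code b s))" by simp
  also have "\<dots> \<le> b ^ (s ^ 5) * b ^ gap s" using extension_good(1)[of b "prefix_code b s" s] Suc by (intro mult_left_mono) auto
  also have "\<dots> = b ^ (Suc s ^ 5)" by (simp only: gap_add flip: power_add)
  finally show ?case .
qed

lemma digit_prefix_code: "s \<le> s' \<Longrightarrow> b > 0 \<Longrightarrow> i < s ^ 5 \<Longrightarrow> digit b (prefix_code b s') i = digit b (prefix_code b s) i"
proof (induction s' rule: dec_induct)
  case (step m)
  have "i < m ^ 5" using step.prems step.hyps power_mono[of s m 5] by linarith
  then show ?case using step by (simp add: prefix_code_Suc digit_add_low)
qed simp

lemma base_seq_eq: "b > 0 \<Longrightarrow> i < s ^ 5 \<Longrightarrow> base_seq b i = digit b (prefix_code b s) i"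
  using digit_prefix_code[of s "Suc i" b i] digit_prefix_code[of "Suc i" s b i] le_power5[of "Suc i"]
  unfolding base_seq_def by (cases "s \<le> Suc i") auto

lemma base_seq_less: "b > 0 \<Longrightarrow> base_seq b i < b" by (simp add: base_seq_def digit_less)

lemma good_cong:
  assumes "\<And>i. i < Suc s ^ 5 \<Longrightarrow> D i = D' i" "good b s D"
  shows "good b s D'"
proof -
  have w: "win b D k i = win b D' k i" if "i < Suc s ^ 5 + 1 - k" for k i
    using that assms(1) by (intro win_cong) auto
  have c: "cnt b D k w n = cnt b D' k w n" if "n \<le> Suc s ^ 5 + 1 - k" for k w n
    using that by (intro cnt_cong w) auto
  have "s ^ 5 \<le> Suc s ^ 5" by (intro power_mono) auto
  then have "cnt b D k w (Suc s ^ 5 + 1 - k) = cnt b D' k w (Suc s ^ 5 + 1 - k)"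
     "cnt b D k w (s ^ 5 + 1 - k) = cnt b D' k w (s ^ 5 + 1 - k)" for k w
    by (intro c; linarith)+
  then show ?thesis using assms(2) unfolding good_def cls_def clsp_def by presburger
qed

lemma good_base_seq: assumes b: "b > 0" shows "good b s (base_seq b)"
  by (rule good_cong[OF _ extension_good(2)[OF b prefix_code_less[OF b]]])
     (simp add: base_seq_eq[OF b, of _ "Suc s"] prefix_code_Suc)

section \<open>Normality of the base sequence\<close>

definition normal_digits :: "nat \<Rightarrow> (nat \<Rightarrow> nat) \<Rightarrow> bool" where
  "normal_digits b D \<longleftrightarrow> (\<forall>k. \<forall>w<b ^ k. (\<lambda>n. real (cnt b D k w n) / real n) \<longlonglongrightarrow> 1 / real b ^ k)"

text \<open>A prefix of \<open>nat \<lfloor>lam * real b ^ k\<rfloor> + k\<close> digits contains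
  \<open>nat \<lfloor>lam * real b ^ k\<rfloor> + 1\<close> windows of length
  \<open>k\<close>.\<close>

definition Poisson_digits :: "nat \<Rightarrow> (nat \<Rightarrow> nat) \<Rightarrow> bool" where
  "Poisson_digits b D \<longleftrightarrow> (\<forall>lam>0. \<forall>j. (\<lambda>k. real (cls b D k j (nat \<lfloor>lam * real b ^ k\<rfloor> + 1)) / real b ^ k)
      \<longlonglongrightarrow> exp (- lam) * lam ^ j / fact j)"

lemma null_comparison:
  fixes f g :: "nat \<Rightarrow> real"
  assumes "eventually (\<lambda>n. \<bar>f n\<bar> \<le> g n) sequentially" "g \<longlonglongrightarrow> 0"
  shows "f \<longlonglongrightarrow> 0"
  by (rule tendsto_rabs_zero_cancel, rule tendsto_sandwich[OF _ assms(1) tendsto_const assms(2)]) simp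

lemma abs_diff_diff_le: "\<bar>a - b\<bar> \<le> x \<Longrightarrow> \<bar>c - d\<bar> \<le> y \<Longrightarrow> \<bar>(a - c) - (b - d)\<bar> \<le> x + (y :: real)"
  by linarith

lemma abs_unscale:
  fixes B x y d t l e :: real
  assumes B: "B > 0" and le: "\<bar>B * x - B * y - l * d\<bar> \<le> B * t + e"
  shows "\<bar>x - y - l * (d / B)\<bar> \<le> t + e / B"
proof -
  have "B * \<bar>x - y - l * (d / B)\<bar> = \<bar>B * (x - y - l * (d / B))\<bar>" using B by (simp add: abs_mult)
  also have "B * (x - y - l * (d / B)) = B * x - B * y - l * d" using B by (simp add: field_simps)
  also have "\<bar>\<dots>\<bar> \<le> B * (t + e / B)" using B le by (simp add: distrib_left)
  finally show ?thesis using B by (simp only: mult_le_cancel_left_pos)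
qed

lemma ex_fifth_root: "\<exists>s::nat. s ^ 5 \<le> n \<and> n < Suc s ^ 5"
proof (induction n)
  case 0
  show ?case by (intro exI[of _ 0]) simp
next
  case (Suc n)
  then obtain s where s: "s ^ 5 \<le> n" "n < Suc s ^ 5" by blast
  show ?case
  proof (cases "Suc n < Suc s ^ 5")
    case True
    then show ?thesis using s by (intro exI[of _ s]) auto
  next
    case False
    then have "Suc n = Suc s ^ 5" using s by simp
    moreover have "Suc s ^ 5 < Suc (Suc s) ^ 5" by (intro power_strict_mono) auto
    ultimately show ?thesis by (intro exI[of _ "Suc s"]) auto
  qed
qed

lemma sum_gap: "(\<Sum>t<s. gap t) = s ^ 5"
  by (induction s) (simp_all add: gap_add)

lemma win_0: "win b D 0 i = 0" by (simp add: win_def)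

lemma cnt_0_word: "cnt b D 0 0 n = n" by (simp add: cnt_def win_0)

text \<open>Each stage adds an error of order \<open>s ^ 3\<close>, so the ends of stages carry an
  error of order \<open>s ^ 4\<close>. Between two ends the trivial bound by the stage length is
  again of order \<open>s ^ 4\<close>, the power 4/5 of \<open>n\<close>.\<close>

lemma base_seq_cnt_bound:
  assumes b: "b > 0" and k: "0 < k" and w: "w < b ^ k"
  shows "\<exists>A C. \<forall>n\<ge>1. \<bar>real (cnt b (base_seq b) k w n) - real n / real b ^ k\<bar> \<le> A + C * (real n powr (1/5)) ^ 4"
proof -
  \<comment> \<open>From this stage on, \<open>good\<close> covers the word length \<open>k\<close>
    and the word \<open>w\<close>.\<close>
  define s0 where "s0 = Suc (k + w)"
  define M where "M s = s ^ 5 + 1 - k" for s :: nat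
  define f where "f n = real (cnt b (base_seq b) k w n) - real n / real b ^ k" for n
  define C where "C = real (2 * k + 12 * Suc k)"
  have bk: "real b ^ k \<ge> 1" using b by simp
  have C0: "C \<ge> 0" by (simp add: C_def)
  have lip: "\<bar>f n' - f n\<bar> \<le> 2 * (real n' - real n)" if "n \<le> n'" for n n'
  proof -
    have "\<bar>real (cnt b (base_seq b) k w n') - real (cnt b (base_seq b) k w n)\<bar> \<le> real n' - real n"
      using cnt_diff_le[OF that, of b "base_seq b" k w] cnt_mono[OF that, of b "base_seq b" k w] that by linarith
    moreover have "\<bar>real n' / real b ^ k - real n / real b ^ k\<bar> \<le> real n' - real n"
    proof -
      have "\<bar>real n' / real b ^ k - real n / real b ^ k\<bar> = (real n' - real n) / real b ^ k"
        using that bk by (simp add: diff_divide_distrib[symmetric])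
      also have "\<dots> \<le> real n' - real n" using that bk by (simp add: divide_le_eq mult_left_le_one_le) (metis diff_ge_0_iff_ge mult.right_neutral mult_left_mono of_nat_le_iff)
      finally show ?thesis .
    qed
    ultimately show ?thesis unfolding f_def mult_2 by (rule abs_diff_diff_le)
  qed
  have kM: "M (Suc s) = M s + gap s" if "s \<ge> s0" for s
    using gap_add[of s] le_power5[of s] that unfolding M_def s0_def by linarith
  have step: "\<bar>f (M (Suc s)) - f (M s)\<bar> \<le> C * real (Suc s) ^ 3" if s: "s \<ge> s0" for s
  proof -
    have "k < s" "w < s" using s by (auto simp: s0_def)
    then have g: "b ^ k * cnt b (base_seq b) k w (M (Suc s)) \<le> b ^ k * cnt b (base_seq b) k w (M s) + gap s + b ^ k * tolerance s k"
      "b ^ k * cnt b (base_seq b) k w (M s) + gap s \<le> b ^ k * cnt b (base_seq b) k w (M (Suc s)) + b ^ k * tolerance s k"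
      using good_base_seq[OF b, of s] k w unfolding good_def M_def by blast+
    have "\<bar>real b ^ k * real (cnt b (base_seq b) k w (M (Suc s))) - real b ^ k * real (cnt b (base_seq b) k w (M s)) - real (gap s) * 1\<bar>
       \<le> real b ^ k * real (tolerance s k) + 0"
      using of_nat_mono[OF g(1), where 'a = real] of_nat_mono[OF g(2), where 'a = real] by (simp add: abs_le_iff)
    from abs_unscale[OF _ this] b have "\<bar>real (cnt b (base_seq b) k w (M (Suc s))) - real (cnt b (base_seq b) k w (M s)) - real (gap s) / real b ^ k\<bar> \<le> real (tolerance s k)"
      by simp
    also have "real (cnt b (base_seq b) k w (M (Suc s))) - real (cnt b (base_seq b) k w (M s)) - real (gap s) / real b ^ k = f (M (Suc s)) - f (M s)"
      by (simp add: f_def kM[OF s] add_divide_distrib)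
    finally have "\<bar>f (M (Suc s)) - f (M s)\<bar> \<le> real (tolerance s k)" .
    also have "\<dots> \<le> C * real (Suc s) ^ 3"
    proof -
      have "2 * k * 1 \<le> 2 * k * Suc s ^ 3" by (intro mult_left_mono) auto
      then have "tolerance s k \<le> (2 * k + 12 * Suc k) * Suc s ^ 3" unfolding tolerance_def by (simp add: distrib_right del: power_Suc)
      from of_nat_mono[OF this, where 'a = real] show ?thesis unfolding C_def by (simp only: of_nat_mult of_nat_power)
    qed
    finally show ?thesis .
  qed
  define A where "A = \<bar>f (M s0)\<bar> + (\<Sum>n\<le>M s0. \<bar>f n\<bar>)"
  have A0: "\<bar>f n\<bar> \<le> A" if "n \<le> M s0" for n
    using member_le_sum[of n "{..M s0}" "\<lambda>n. \<bar>f n\<bar>"] that unfolding A_def by simp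
  have M_le: "\<bar>f (M s)\<bar> \<le> A + C * real s ^ 4" if "s \<ge> s0" for s
    using that
  proof (induction s rule: dec_induct)
    case base
    then show ?case using A0[of "M s0"] C0 by (simp add: add_increasing2)
  next
    case (step s)
    have "real s ^ 4 + real (Suc s) ^ 3 \<le> real (Suc s) ^ 4" by (simp add: power_numeral_reduce algebra_simps)
    then have "C * (real s ^ 4 + real (Suc s) ^ 3) \<le> C * real (Suc s) ^ 4" using C0 by (intro mult_left_mono)
    then show ?case using step \<open>\<And>s. s \<ge> s0 \<Longrightarrow> \<bar>f (M (Suc s)) - f (M s)\<bar> \<le> C * real (Suc s) ^ 3\<close>[of s]
      by (simp add: distrib_left)
  qed
  \<comment> \<open>The constant is \<open>(C + 10) * 3 ^ 4\<close>: \<open>10\<close> comes from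
    the gap between stage ends and \<open>3\<close> from \<open>Suc s \<le> 3 * y\<close>
    below.\<close>
  have "\<bar>f n\<bar> \<le> A + (81 * C + 810) * (real n powr (1/5)) ^ 4" if n: "n \<ge> 1" for n
  proof (cases "n \<le> M s0")
    case True
    then show ?thesis using A0[OF True] C0 by (simp add: add_increasing2)
  next
    case False
    \<comment> \<open>The shift by \<open>k - 1\<close> places \<open>n\<close> between the numbers
      \<open>M s\<close> and \<open>M (Suc s)\<close> of windows complete at the two stage
      ends.\<close>
    obtain s where s: "s ^ 5 \<le> n + k - 1" "n + k - 1 < Suc s ^ 5" using ex_fifth_root by blast
    have ss: "s \<ge> s0"
    proof (rule ccontr)
      assume "\<not> s \<ge> s0"
      then have "Suc s ^ 5 \<le> s0 ^ 5" by (intro power_mono) auto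
      then show False using s False unfolding M_def by linarith
    qed
    have Mn: "M s \<le> n" using s n unfolding M_def by linarith
    have "n \<le> M (Suc s)" using s n unfolding M_def by linarith
    then have "real n - real (M s) \<le> real (gap s)" using kM[OF ss] by simp
    also have "\<dots> \<le> 5 * real (Suc s) ^ 4" using of_nat_mono[OF gap_le[of s], where 'a = real] by simp
    finally have "\<bar>f n\<bar> \<le> A + C * real s ^ 4 + 10 * real (Suc s) ^ 4"
    proof -
      have "\<bar>x\<bar> \<le> q + 10 * P" if "d \<le> 5 * P" "\<bar>x - y\<bar> \<le> 2 * d" "\<bar>y\<bar> \<le> q" for x y q d P :: real
        using that by linarith
      from this[OF _ lip[OF Mn] M_le[OF ss]] show ?thesis if "real n - real (M s) \<le> 5 * real (Suc s) ^ 4" using that .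
    qed
    also have "C * real s ^ 4 \<le> C * real (Suc s) ^ 4" using C0 by (intro mult_left_mono power_mono) auto
    finally have 1: "\<bar>f n\<bar> \<le> A + (C + 10) * real (Suc s) ^ 4" by (simp add: distrib_right)
    define y where "y = real n powr (1/5)"
    have y5: "y ^ 5 = real n" using n by (simp add: y_def powr_powr flip: powr_realpow)
    have y1: "y \<ge> 1" using n by (simp add: y_def ge_one_powr_ge_zero)
    have "real (Suc s) \<le> 3 * y"
    proof -
      \<comment> \<open>One stage back, the loss of \<open>k - 1\<close> windows is compensated,
        because \<open>gap r\<close> is at least \<open>r\<close> and hence at least
        \<open>k\<close>.\<close>
      obtain r where r: "s = Suc r" "k \<le> r" using ss by (cases s) (auto simp: s0_def)
      have "M (Suc r) \<le> n" using Mn r by simp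
      then have "r ^ 5 + gap r + 1 - k \<le> n" unfolding M_def gap_add[symmetric] .
      then have "r ^ 5 \<le> n" using le_gap[of r] r(2) by linarith
      then have "real r ^ 5 \<le> y ^ 5" unfolding y5 by (metis of_nat_le_iff of_nat_power)
      then have "real r \<le> y" using y1 by (simp add: power_mono_iff)
      then show ?thesis using y1 r by simp
    qed
    then have "real (Suc s) ^ 4 \<le> (3 * y) ^ 4" by (intro power_mono) auto
    then have "(C + 10) * real (Suc s) ^ 4 \<le> (C + 10) * (3 * y) ^ 4" using C0 by (intro mult_left_mono) auto
    with 1 show ?thesis unfolding y_def[symmetric] by (simp add: power_mult_distrib algebra_simps)
  qed
  then show ?thesis unfolding f_def by blast
qed

lemma base_seq_normal: assumes b: "b > 0" shows "normal_digits b (base_seq b)"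
  unfolding normal_digits_def
proof (intro allI impI)
  fix k w :: nat assume w: "w < b ^ k"
  show "(\<lambda>n. real (cnt b (base_seq b) k w n) / real n) \<longlonglongrightarrow> 1 / real b ^ k"
  proof (cases "k = 0")
    case True
    then have "w = 0" using w by simp
    have "eventually (\<lambda>n. 1 = real (cnt b (base_seq b) k w n) / real n) sequentially"
      using eventually_gt_at_top[of 0] by eventually_elim (simp add: True \<open>w = 0\<close> cnt_0_word)
    then show ?thesis using True by (simp add: tendsto_eventually eventually_mono)
  next
    case False
    then obtain A C where AC: "\<And>n. n \<ge> 1 \<Longrightarrow> \<bar>real (cnt b (base_seq b) k w n) - real n / real b ^ k\<bar> \<le> A + C * (real n powr (1/5)) ^ 4"
      using base_seq_cnt_bound[OF b _ w] by blast
    have lim: "(\<lambda>n. A * (1 / real n) + C * real n powr - (1/5)) \<longlonglongrightarrow> A * 0 + C * 0"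
      by (intro tendsto_intros lim_1_over_n tendsto_neg_powr filterlim_real_sequentially) auto
    have "(\<lambda>n. real (cnt b (base_seq b) k w n) / real n - 1 / real b ^ k) \<longlonglongrightarrow> 0"
    proof (rule null_comparison[OF _ lim[simplified]])
      show "eventually (\<lambda>n. \<bar>real (cnt b (base_seq b) k w n) / real n - 1 / real b ^ k\<bar> \<le> A / real n + C * real n powr - (1/5)) sequentially"
        using eventually_ge_at_top[of 1]
      proof eventually_elim
        case (elim n)
        have "real (cnt b (base_seq b) k w n) / real n - 1 / real b ^ k = (real (cnt b (base_seq b) k w n) - real n / real b ^ k) / real n"
          using elim by (simp add: diff_divide_distrib)
        also have "\<bar>\<dots>\<bar> \<le> (A + C * (real n powr (1/5)) ^ 4) / real n"
          using AC[OF elim] by (simp add: divide_right_mono abs_divide)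
        also have "(A + C * (real n powr (1/5)) ^ 4) / real n = A / real n + C * ((real n powr (1/5)) ^ 4 / real n)"
          by (simp add: add_divide_distrib)
        also have "(real n powr (1/5)) ^ 4 / real n = real n powr - (1/5)"
        proof -
          have "(real n powr (1/5)) ^ 4 = real n powr (4/5)" using elim by (simp add: powr_powr flip: powr_realpow)
          also have "real n powr (4/5) / real n = real n powr (4/5 - 1)" using elim by (simp only: powr_diff powr_one)
          finally show ?thesis by simp
        qed
        finally show ?case .
      qed
    qed
    then show ?thesis by (simp add: LIM_zero_iff)
  qed
qed

section \<open>Poisson probabilities and the Euler scheme\<close>

definition pois :: "nat \<Rightarrow> real \<Rightarrow> real" where
  "pois i x = exp (- x) * x ^ i / fact i"

text \<open>The counterpart of \<open>clsp\<close>: the inflow into class \<open>i\<close> in the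
  differential equation.\<close>

definition ppois :: "nat \<Rightarrow> real \<Rightarrow> real" where
  "ppois i x = (if i = 0 then 0 else pois (i - 1) x)"

lemma pois_deriv: "(pois i has_real_derivative (ppois i x - pois i x)) (at x)"
proof (cases i)
  case 0
  show ?thesis unfolding pois_def ppois_def 0 by (auto intro!: derivative_eq_intros)
next
  case (Suc m)
  have "((\<lambda>x. exp (- x) * x ^ Suc m) has_real_derivative (exp (- x) * (real (Suc m) * x ^ m) - exp (- x) * x ^ Suc m)) (at x)"
    by (rule derivative_eq_intros refl)+ (simp add: algebra_simps)
  from DERIV_cdivide[OF this, of "fact (Suc m)"]
  have "(pois (Suc m) has_real_derivative (exp (- x) * (real (Suc m) * x ^ m) - exp (- x) * x ^ Suc m) / fact (Suc m)) (at x)"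
    unfolding pois_def .
  moreover have "(exp (- x) * (real (Suc m) * x ^ m) - exp (- x) * x ^ Suc m) / fact (Suc m) = pois m x - pois (Suc m) x"
    unfolding pois_def by (simp add: diff_divide_distrib del: of_nat_Suc power_Suc)
  ultimately show ?thesis using Suc by (simp add: ppois_def)
qed

lemma pois_nonneg: "x \<ge> 0 \<Longrightarrow> 0 \<le> pois i x" by (simp add: pois_def)

text \<open>\<open>x ^ i / fact i\<close> is a single term of the series for
  \<open>exp x\<close>.\<close>

lemma pois_le_1: assumes "x \<ge> 0" shows "pois i x \<le> 1"
proof -
  have "(\<lambda>n. x ^ n /\<^sub>R fact n) sums exp x" by (rule exp_converges)
  then have "(\<Sum>n\<in>{i}. x ^ n /\<^sub>R fact n) \<le> exp x"
    unfolding sums_iff using assms sum_le_suminf[of "\<lambda>n. x ^ n /\<^sub>R fact n" "{i}"] by auto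
  then have "x ^ i / fact i \<le> exp x" by (simp add: divide_inverse mult.commute)
  then have "exp (- x) * (x ^ i / fact i) \<le> exp (- x) * exp x" by (intro mult_left_mono) auto
  then show ?thesis by (simp add: pois_def exp_minus)
qed

lemma ppois_bounds: "x \<ge> 0 \<Longrightarrow> 0 \<le> ppois i x" "x \<ge> 0 \<Longrightarrow> ppois i x \<le> 1"
  by (simp_all add: ppois_def pois_nonneg pois_le_1)

text \<open>The derivative is a difference of two numbers between 0 and 1.\<close>

lemma pois_lipschitz: assumes "x \<ge> 0" "y \<ge> 0" shows "\<bar>pois i x - pois i y\<bar> \<le> \<bar>x - y\<bar>"
proof -
  have 1: "\<bar>pois i y - pois i x\<bar> \<le> y - x" if xy: "0 \<le> x" "x < y" for x y
  proof -
    obtain z where z: "x < z" "z < y" "pois i y - pois i x = (y - x) * (ppois i z - pois i z)"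
      using MVT2[OF xy(2) pois_deriv, of i] by auto
    have "\<bar>ppois i z - pois i z\<bar> \<le> 1"
      using pois_nonneg[of z i] pois_le_1[of z i] ppois_bounds[of z i] z(1) xy by linarith
    then have "(y - x) * \<bar>ppois i z - pois i z\<bar> \<le> (y - x) * 1" using xy by (intro mult_left_mono) auto
    then show ?thesis unfolding z(3) using xy by (simp add: abs_mult)
  qed
  consider "x < y" | "x = y" | "y < x" by linarith
  then show ?thesis using 1[of x y] 1[of y x] assms by cases (auto simp: abs_minus_commute)
qed

lemma ppois_lipschitz: "x \<ge> 0 \<Longrightarrow> y \<ge> 0 \<Longrightarrow> \<bar>ppois i x - ppois i y\<bar> \<le> \<bar>x - y\<bar>"
  by (simp add: ppois_def pois_lipschitz)

text \<open>The mean value theorem suffices in place of a second derivative, because the first one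
  is Lipschitz with constant 2.\<close>

lemma pois_taylor:
  assumes x: "x \<ge> 0" and h: "h \<ge> 0"
  shows "\<bar>pois i (x + h) - pois i x - h * (ppois i x - pois i x)\<bar> \<le> 2 * h\<^sup>2"
proof (cases "h = 0")
  case False
  then have "x < x + h" using h by simp
  then obtain z where z: "x < z" "z < x + h" "pois i (x + h) - pois i x = (x + h - x) * (ppois i z - pois i z)"
    using MVT2[OF _ pois_deriv, of x "x + h" i] by blast
  have "\<bar>(ppois i z - pois i z) - (ppois i x - pois i x)\<bar> \<le> 2 * h"
    using ppois_lipschitz[of z x i] pois_lipschitz[of z x i] z x by linarith
  then have "h * \<bar>(ppois i z - pois i z) - (ppois i x - pois i x)\<bar> \<le> h * (2 * h)" using h by (intro mult_left_mono)
  moreover have "pois i (x + h) - pois i x - h * (ppois i x - pois i x) = h * ((ppois i z - pois i z) - (ppois i x - pois i x))"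
    unfolding z(3) by (simp add: algebra_simps)
  ultimately show ?thesis using h by (simp add: abs_mult power2_eq_square)
qed simp

lemma clsp_eq: "clsp b D k j n = (if j = 0 then 0 else cls b D k (j - 1) n)"
  by (cases j) (simp_all add: clsp_def cls_def)

text \<open>For \<open>h \<le> 1\<close> an Euler step is a convex combination, hence does not enlarge the maximal error.\<close>
lemma euler_step:
  fixes x y px py h E t X Y :: real
  assumes h: "0 \<le> h" "h \<le> 1" and x: "\<bar>x - y\<bar> \<le> E" and px: "\<bar>px - py\<bar> \<le> E"
    and X: "\<bar>X - x - h * (px - x)\<bar> \<le> t" and Y: "\<bar>Y - y - h * (py - y)\<bar> \<le> u"
  shows "\<bar>X - Y\<bar> \<le> E + (t + u)"
proof -
  have "\<bar>(1 - h) * (x - y) + h * (px - py)\<bar> \<le> (1 - h) * E + h * E"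
    using h x px by (intro order.trans[OF abs_triangle_ineq] add_mono) (auto simp: abs_mult intro!: mult_left_mono)
  then have "\<bar>(1 - h) * (x - y) + h * (px - py)\<bar> \<le> E" by (simp add: algebra_simps)
  moreover have "X - Y = ((1 - h) * (x - y) + h * (px - py)) + (X - x - h * (px - x)) - (Y - y - h * (py - y))"
    by (simp add: algebra_simps)
  ultimately show ?thesis using X Y by linarith
qed

text \<open>The time of the scheme is \<open>S ^ 5 / b ^ k\<close>. From stage \<open>Suc k\<close>
  on, \<open>good\<close> covers all classes \<open>j \<le> k\<close>; by then at most
  \<open>Suc k ^ 5\<close> windows have been read, so class sizes and Poisson values are both still
  close to their initial values. A stage adds its tolerance, \<open>2 * h ^ 2\<close> for collisions
  and \<open>2 * h ^ 2\<close> for the Taylor remainder, with \<open>h\<close> the step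
  size.\<close>

lemma base_seq_euler:
  assumes b: "b > 0" and j: "j \<le> k" and k: "0 < k"
    and S: "Suc k \<le> S" and h: "\<And>s. s < S \<Longrightarrow> real (gap s) \<le> real b ^ k"
  shows "\<bar>real (cls b (base_seq b) k j (S ^ 5 + 1 - k)) / real b ^ k - pois j (real (S ^ 5) / real b ^ k)\<bar> \<le>
    2 * real (Suc k ^ 5) / real b ^ k + (\<Sum>s\<in>{Suc k..<S}. real (tolerance s k) / real b ^ k + 4 * (real (gap s) / real b ^ k)\<^sup>2)"
  using S j h
proof (induction S arbitrary: j rule: dec_induct)
  case base
  let ?M = "Suc k ^ 5 + 1 - k"
  have bk: "real b ^ k > 0" using b by simp
  have "cls b (base_seq b) k j 0 = (if j = 0 then b ^ k else 0)" by (simp add: cls_def)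
  moreover have "\<bar>real (cls b (base_seq b) k j 0) - real (cls b (base_seq b) k j ?M)\<bar> \<le> real ?M - real 0"
    by (rule cls_diff_length) simp
  ultimately have "\<bar>real (cls b (base_seq b) k j ?M) - (if j = 0 then real b ^ k else 0)\<bar> \<le> real ?M"
    by (auto simp: abs_minus_commute)
  also have "\<dots> \<le> real (Suc k ^ 5)" using k by (intro of_nat_mono) linarith
  finally have "\<bar>(real (cls b (base_seq b) k j ?M) - (if j = 0 then real b ^ k else 0)) / real b ^ k\<bar> \<le> real (Suc k ^ 5) / real b ^ k"
    using bk by (simp add: abs_divide divide_right_mono)
  then have 1: "\<bar>real (cls b (base_seq b) k j ?M) / real b ^ k - of_bool (j = 0)\<bar> \<le> real (Suc k ^ 5) / real b ^ k"
    using bk by (simp add: diff_divide_distrib split: if_splits)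
  have "\<bar>pois j (real (Suc k ^ 5) / real b ^ k) - pois j 0\<bar> \<le> real (Suc k ^ 5) / real b ^ k"
    using pois_lipschitz[of "real (Suc k ^ 5) / real b ^ k" 0 j] bk by simp
  moreover have "pois j 0 = of_bool (j = 0)" by (simp add: pois_def)
  ultimately show ?case using 1 by (simp only: atLeastLessThan_empty sum.empty)
next
  case (step S)
  let ?B = "real b ^ k"
  let ?E = "\<lambda>S. 2 * real (Suc k ^ 5) / ?B + (\<Sum>s\<in>{Suc k..<S}. real (tolerance s k) / ?B + 4 * (real (gap s) / ?B)\<^sup>2)"
  let ?a = "\<lambda>i s. real (cls b (base_seq b) k i (s ^ 5 + 1 - k)) / ?B"
  let ?ap = "\<lambda>i s. real (clsp b (base_seq b) k i (s ^ 5 + 1 - k)) / ?B"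
  let ?h = "real (gap S) / ?B"
  have bk: "?B > 0" using b by simp
  have h: "0 \<le> ?h" "?h \<le> 1" using step.prems(2)[of S] bk by auto
  have IH: "\<bar>?a i S - pois i (real (S ^ 5) / ?B)\<bar> \<le> ?E S" if "i \<le> k" for i
    using step.IH[OF that] step.prems by simp
  have E0: "0 \<le> ?E S" using IH[of 0] by (meson abs_ge_zero order_trans zero_le)
  have IHp: "\<bar>?ap j S - ppois j (real (S ^ 5) / ?B)\<bar> \<le> ?E S"
    using IH[of "j - 1"] step.prems E0 by (cases j) (simp_all only: clsp_eq ppois_def, simp_all)
  have kS: "k < S" "j < S" using step by auto
  have g: "b ^ k * cls b (base_seq b) k j (Suc S ^ 5 + 1 - k) + gap S * cls b (base_seq b) k j (S ^ 5 + 1 - k) \<le>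
       b ^ k * cls b (base_seq b) k j (S ^ 5 + 1 - k) + gap S * clsp b (base_seq b) k j (S ^ 5 + 1 - k) + (b ^ k * tolerance S k + 2 * gap S ^ 2)"
    "b ^ k * cls b (base_seq b) k j (S ^ 5 + 1 - k) + gap S * clsp b (base_seq b) k j (S ^ 5 + 1 - k) \<le>
       b ^ k * cls b (base_seq b) k j (Suc S ^ 5 + 1 - k) + gap S * cls b (base_seq b) k j (S ^ 5 + 1 - k) + (b ^ k * tolerance S k + 2 * gap S ^ 2)"
    using good_base_seq[OF b, of S] kS k unfolding good_def by blast+
  have "\<bar>?B * real (cls b (base_seq b) k j (Suc S ^ 5 + 1 - k)) - ?B * real (cls b (base_seq b) k j (S ^ 5 + 1 - k)) -
     real (gap S) * (real (clsp b (base_seq b) k j (S ^ 5 + 1 - k)) - real (cls b (base_seq b) k j (S ^ 5 + 1 - k)))\<bar> \<le>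
     ?B * real (tolerance S k) + 2 * real (gap S) ^ 2"
    using of_nat_mono[OF g(1), where 'a = real] of_nat_mono[OF g(2), where 'a = real]
    by (simp add: abs_le_iff algebra_simps)
  from abs_unscale[OF bk this]
  have 1: "\<bar>real (cls b (base_seq b) k j (Suc S ^ 5 + 1 - k)) - real (cls b (base_seq b) k j (S ^ 5 + 1 - k)) -
     real (gap S) * (?ap j S - ?a j S)\<bar> \<le> real (tolerance S k) + 2 * real (gap S) ^ 2 / ?B" by (simp add: diff_divide_distrib)
  have "\<bar>?a j (Suc S) - ?a j S - ?h * (?ap j S - ?a j S)\<bar> =
     \<bar>real (cls b (base_seq b) k j (Suc S ^ 5 + 1 - k)) - real (cls b (base_seq b) k j (S ^ 5 + 1 - k)) -
     real (gap S) * (?ap j S - ?a j S)\<bar> / ?B"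
  proof -
    have "X / B - Y / B - g / B * d = (X - Y - g * d) / B" for X Y g d B :: real
      by (simp add: diff_divide_distrib)
    then show ?thesis using bk by (simp only: abs_divide) simp
  qed
  also have "\<dots> \<le> (real (tolerance S k) + 2 * real (gap S) ^ 2 / ?B) / ?B" using 1 bk by (intro divide_right_mono) auto
  also have "\<dots> = real (tolerance S k) / ?B + 2 * ?h\<^sup>2" by (simp add: add_divide_distrib power2_eq_square)
  finally have 2: "\<bar>?a j (Suc S) - ?a j S - ?h * (?ap j S - ?a j S)\<bar> \<le> real (tolerance S k) / ?B + 2 * ?h\<^sup>2" .
  have "real (Suc S ^ 5) / ?B = real (S ^ 5) / ?B + ?h"
    unfolding gap_add[symmetric] by (simp add: add_divide_distrib)
  then have 3: "\<bar>pois j (real (Suc S ^ 5) / ?B) - pois j (real (S ^ 5) / ?B) - ?h * (ppois j (real (S ^ 5) / ?B) - pois j (real (S ^ 5) / ?B))\<bar> \<le> 2 * ?h\<^sup>2"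
    using pois_taylor[of "real (S ^ 5) / ?B" ?h j] bk h by simp
  have "\<bar>?a j (Suc S) - pois j (real (Suc S ^ 5) / ?B)\<bar> \<le> ?E S + ((real (tolerance S k) / ?B + 2 * ?h\<^sup>2) + 2 * ?h\<^sup>2)"
    by (rule euler_step[OF h IH[OF step.prems(1)] IHp 2 3])
  also have "\<dots> = ?E (Suc S)" using step.hyps by simp
  finally show ?case .
qed

text \<open>Here \<open>\<beta> ^ k\<close> is the power -1/5 of \<open>b ^ k\<close>. The stage
  \<open>S\<close> reached at time \<open>lam\<close> satisfies
  \<open>S * \<beta> ^ k \<le> lam + 1\<close>, which makes \<open>S ^ 4 / b ^ k\<close> of order
  \<open>\<beta> ^ k\<close>, and all errors reduce to this quantity. \<open>k1\<close> ensures that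
  the scheme has started by stage \<open>S\<close>, \<open>k2\<close> that its steps are at most
  1.\<close>

lemma base_seq_Poisson_bound:
  assumes b: "b \<ge> 2" and lam: "lam > 0" and \<beta>: "0 < \<beta>" "\<beta> < 1" "\<beta> ^ 5 = 1 / real b" and k: "0 < k" "j \<le> k"
    and k1: "(real (k + 2) * \<beta> ^ k) ^ 5 < lam" and k2: "5 * (lam + 1) ^ 4 * \<beta> ^ k \<le> 1"
  shows "\<bar>real (cls b (base_seq b) k j (nat \<lfloor>lam * real b ^ k\<rfloor> + 1)) / real b ^ k - pois j lam\<bar> \<le>
     2 * (real (k + 1) * \<beta> ^ k) ^ 5 + (174 * (lam + 1) ^ 4 + 20 * (lam + 1) ^ 5 + 1) * (real (k + 1) * \<beta> ^ k)"
proof -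
  define B where "B = real b ^ k"
  define N where "N = nat \<lfloor>lam * B\<rfloor> + 1"
  define c where "c = lam + 1"
  have B0: "B > 0" using b by (simp add: B_def)
  have \<beta>B: "\<beta> ^ k > 0" "(\<beta> ^ k) ^ 5 * B = 1" using b \<beta>
    by (simp_all add: B_def power_mult[symmetric] mult.commute[of k] power_mult \<beta>(3) power_divide)
  have \<beta>1: "\<beta> ^ k \<le> 1" using \<beta> by (simp add: power_le_one)
  have c1: "c \<ge> 1" using lam by (simp add: c_def)
  have kB: "real k \<le> B"
  proof -
    have "k < 2 ^ k" by (rule less_exp)
    also have "2 ^ k \<le> b ^ k" using b by (intro power_mono) auto
    finally have "real k < real (b ^ k)" by (simp only: of_nat_less_iff)
    then show ?thesis by (simp add: B_def)
  qed
  have N: "lam * B \<le> real N" "real N \<le> lam * B + 1"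
    unfolding N_def using lam B0 by (simp_all add: of_nat_nat) linarith+
  \<comment> \<open>\<open>S\<close> is the last stage whose complete windows number at most
    \<open>N\<close>.\<close>
  obtain S where S: "S ^ 5 \<le> N + k - 1" "N + k - 1 < Suc S ^ 5" using ex_fifth_root by blast
  have N1: "N \<ge> 1" by (simp add: N_def)
  have S5: "real S ^ 5 \<le> lam * B + real k"
  proof -
    have "real (S ^ 5) \<le> real (N + k - 1)" using S(1) by (rule of_nat_mono)
    also have "\<dots> = real N + real k - 1" using N1 by simp
    finally show ?thesis using N(2) by simp
  qed
  then have S5c: "real S ^ 5 \<le> c * B" using kB by (simp add: c_def distrib_right)
  have Sc: "real S * \<beta> ^ k \<le> c"
  proof -
    have "(real S * \<beta> ^ k) ^ 5 = real S ^ 5 * (\<beta> ^ k) ^ 5" by (simp add: power_mult_distrib)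
    also have "\<dots> \<le> c * B * (\<beta> ^ k) ^ 5" using S5c \<beta>B by (intro mult_right_mono) auto
    also have "\<dots> = c" using \<beta>B(2) by (simp add: mult.assoc mult.commute[of B])
    also have "c \<le> c ^ 5" using c1 by (simp add: self_le_power)
    finally show ?thesis using c1 by (simp add: power_mono_iff \<beta>B less_imp_le)
  qed
  have S4: "real S ^ 4 / B \<le> c ^ 4 * \<beta> ^ k"
  proof -
    have "1 / B = (\<beta> ^ k) ^ 5" using \<beta>B(2) B0 by (simp add: field_simps)
    moreover have "s ^ 4 * x ^ 5 = (s * x) ^ 4 * x" for s x :: real by (simp add: eval_nat_numeral)
    ultimately have "real S ^ 4 / B = (real S * \<beta> ^ k) ^ 4 * \<beta> ^ k"
      by (metis mult.right_neutral times_divide_eq_right)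
    also have "\<dots> \<le> c ^ 4 * \<beta> ^ k" using Sc \<beta>B by (intro mult_right_mono power_mono) auto
    finally show ?thesis .
  qed
  have Sk: "Suc k \<le> S"
  proof (rule ccontr)
    assume "\<not> Suc k \<le> S"
    then have "Suc S ^ 5 \<le> (k + 2) ^ 5" by (intro power_mono) auto
    then have "N + k - 1 < (k + 2) ^ 5" using S(2) by linarith
    then have "N < (k + 2) ^ 5" using k by linarith
    then have "real N < real (k + 2) ^ 5" by (metis of_nat_less_iff of_nat_power)
    then have "lam * B < real (k + 2) ^ 5" using N(1) by linarith
    then have "lam * B * (\<beta> ^ k) ^ 5 < real (k + 2) ^ 5 * (\<beta> ^ k) ^ 5" using \<beta>B by (intro mult_strict_right_mono) auto
    also have "lam * B * (\<beta> ^ k) ^ 5 = lam" using \<beta>B(2) by (simp add: mult.assoc mult.commute[of B])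
    also have "real (k + 2) ^ 5 * (\<beta> ^ k) ^ 5 = (real (k + 2) * \<beta> ^ k) ^ 5" by (simp add: power_mult_distrib)
    finally show False using k1 by simp
  qed
  have gapS: "real (gap s) \<le> 5 * real S ^ 4" if "s < S" for s
  proof -
    have "real (gap s) \<le> 5 * real (Suc s) ^ 4" using of_nat_mono[OF gap_le[of s], where 'a = real] by simp
    also have "\<dots> \<le> 5 * real S ^ 4" using that by (intro mult_left_mono power_mono) auto
    finally show ?thesis .
  qed
  have gapSS: "real (gap S) \<le> 80 * real S ^ 4"
  proof -
    have "real (gap S) \<le> 5 * real (Suc S) ^ 4" using of_nat_mono[OF gap_le[of S], where 'a = real] by simp
    also have "\<dots> \<le> 5 * (2 * real S) ^ 4" using Sk by (intro mult_left_mono power_mono) auto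
    finally show ?thesis by (simp add: power_mult_distrib)
  qed
  have h: "real (gap s) \<le> real b ^ k" if "s < S" for s
  proof -
    have "real (gap s) / B \<le> 5 * real S ^ 4 / B" using gapS[OF that] B0 by (intro divide_right_mono) auto
    also have "\<dots> \<le> 5 * (c ^ 4 * \<beta> ^ k)" using S4 by simp
    also have "\<dots> \<le> 1" using k2 by (simp add: c_def mult.assoc)
    finally show ?thesis using B0 by (simp add: B_def)
  qed
  note E = base_seq_euler[OF _ k(2) k(1) Sk h, folded B_def]
  have T1: "real (Suc k ^ 5) / B = (real (k + 1) * \<beta> ^ k) ^ 5"
  proof -
    have "1 / B = (\<beta> ^ k) ^ 5" using \<beta>B(2) B0 by (simp add: field_simps)
    then have "real (Suc k ^ 5) * (1 / B) = real (k + 1) ^ 5 * (\<beta> ^ k) ^ 5" by (simp only: of_nat_power Suc_eq_plus1)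
    then show ?thesis by (simp add: power_mult_distrib)
  qed
  have T2: "(\<Sum>s\<in>{Suc k..<S}. real (tolerance s k) / B) \<le> 14 * c ^ 4 * (real (k + 1) * \<beta> ^ k)"
  proof -
    have "real (tolerance s k) / B \<le> 14 * real (k + 1) * real S ^ 3 / B" if "s \<in> {Suc k..<S}" for s
    proof -
      have "k \<le> (k + 1) * Suc s ^ 3" using mult_le_mono2[of 1 "Suc s ^ 3" "k + 1"] by (simp del: power_Suc)
      then have "2 * k + 12 * ((k + 1) * Suc s ^ 3) \<le> 14 * ((k + 1) * Suc s ^ 3)" by linarith
      then have "tolerance s k \<le> (14 * (k + 1)) * Suc s ^ 3" unfolding tolerance_def by (simp only: mult.assoc Suc_eq_plus1)
      also have "\<dots> \<le> (14 * (k + 1)) * S ^ 3" using that by (intro mult_left_mono power_mono) auto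
      finally have "real (tolerance s k) \<le> 14 * real (k + 1) * real S ^ 3"
        by (metis of_nat_le_iff of_nat_mult of_nat_numeral of_nat_power)
      then show ?thesis using B0 by (intro divide_right_mono) auto
    qed
    then have "(\<Sum>s\<in>{Suc k..<S}. real (tolerance s k) / B) \<le> (\<Sum>s\<in>{Suc k..<S}. 14 * real (k + 1) * real S ^ 3 / B)"
      by (rule sum_mono)
    also have "\<dots> = real (S - Suc k) * (14 * real (k + 1) * real S ^ 3 / B)" by simp
    also have "\<dots> \<le> real S * (14 * real (k + 1) * real S ^ 3 / B)" using B0 by (intro mult_right_mono) auto
    also have "\<dots> = 14 * real (k + 1) * (real S ^ 4 / B)"
    proof -
      have "x * (14 * y * x ^ 3 / z) = 14 * y * (x ^ 4 / z)" for x y z :: real by (simp add: eval_nat_numeral)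
      then show ?thesis .
    qed
    also have "\<dots> \<le> 14 * real (k + 1) * (c ^ 4 * \<beta> ^ k)" using S4 by (intro mult_left_mono) auto
    finally show ?thesis by (simp only: mult_ac)
  qed
  have T3: "(\<Sum>s\<in>{Suc k..<S}. 4 * (real (gap s) / B)\<^sup>2) \<le> 20 * c ^ 5 * \<beta> ^ k"
  proof -
    have "4 * (real (gap s) / B)\<^sup>2 \<le> 20 * (real S ^ 4 / B) * (real (gap s) / B)" if "s \<in> {Suc k..<S}" for s
    proof -
      have "real (gap s) / B \<le> 5 * real S ^ 4 / B" using gapS[of s] that B0 by (intro divide_right_mono) auto
      then have "real (gap s) / B * (real (gap s) / B) \<le> 5 * real S ^ 4 / B * (real (gap s) / B)"
        using B0 by (intro mult_right_mono) auto
      then show ?thesis by (simp add: power2_eq_square)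
    qed
    then have "(\<Sum>s\<in>{Suc k..<S}. 4 * (real (gap s) / B)\<^sup>2) \<le> (\<Sum>s\<in>{Suc k..<S}. 20 * (real S ^ 4 / B) * (real (gap s) / B))"
      by (rule sum_mono)
    also have "\<dots> \<le> (\<Sum>s<S. 20 * (real S ^ 4 / B) * (real (gap s) / B))"
      using B0 by (intro sum_mono2) auto
    also have "\<dots> = 20 * (real S ^ 4 / B) * (\<Sum>s<S. real (gap s) / B)" by (rule sum_distrib_left[symmetric])
    also have "(\<Sum>s<S. real (gap s) / B) = real (\<Sum>s<S. gap s) / B" unfolding of_nat_sum by (rule sum_divide_distrib[symmetric])
    also have "\<dots> = real S ^ 5 / B" by (simp add: sum_gap)
    also have "20 * (real S ^ 4 / B) * (real S ^ 5 / B) \<le> 20 * (c ^ 4 * \<beta> ^ k) * c"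
      using S4 S5c B0 \<beta>B(1) c1 by (intro mult_mono) (auto simp: divide_le_eq intro!: mult_nonneg_nonneg)
    also have "20 * (c ^ 4 * \<beta> ^ k) * c = 20 * c ^ 5 * \<beta> ^ k"
    proof -
      have "20 * (x ^ 4 * y) * x = 20 * x ^ 5 * y" for x y :: real by (simp add: eval_nat_numeral)
      then show ?thesis .
    qed
    finally show ?thesis .
  qed
  let ?M = "S ^ 5 + 1 - k"
  have MN: "?M \<le> N" using S N1 by linarith
  have NM: "real N - real ?M \<le> 80 * real S ^ 4"
  proof -
    have "N + k \<le> S ^ 5 + gap S" using S(2) unfolding gap_add[symmetric] by linarith
    then have "N \<le> ?M + gap S" using Sk le_power5[of S] by linarith
    then show ?thesis using gapSS by linarith
  qed
  have F1: "\<bar>real (cls b (base_seq b) k j N) / B - real (cls b (base_seq b) k j ?M) / B\<bar> \<le> 80 * (c ^ 4 * \<beta> ^ k)"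
  proof -
    have "\<bar>real (cls b (base_seq b) k j N) / B - real (cls b (base_seq b) k j ?M) / B\<bar> =
       \<bar>real (cls b (base_seq b) k j ?M) - real (cls b (base_seq b) k j N)\<bar> / B"
      using B0 by (simp add: abs_minus_commute flip: diff_divide_distrib)
    also have "\<dots> \<le> 80 * real S ^ 4 / B"
      using cls_diff_length[OF MN, of b "base_seq b" k j] NM B0 by (intro divide_right_mono) linarith+
    also have "\<dots> \<le> 80 * (c ^ 4 * \<beta> ^ k)" using S4 by simp
    finally show ?thesis .
  qed
  have F2: "\<bar>pois j (real (S ^ 5) / B) - pois j lam\<bar> \<le> 80 * (c ^ 4 * \<beta> ^ k) + real k * \<beta> ^ k"
  proof -
    have "lam * B \<le> real S ^ 5 + 80 * real S ^ 4"
    proof -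
      have "N + k \<le> S ^ 5 + gap S" using S(2) unfolding gap_add[symmetric] by linarith
      then have "real (N + k) \<le> real (S ^ 5 + gap S)" by (rule of_nat_mono)
      then show ?thesis using N(1) gapSS by simp
    qed
    then have "\<bar>real (S ^ 5) - lam * B\<bar> \<le> 80 * real S ^ 4 + real k"
    proof -
      have "\<bar>x - y\<bar> \<le> 80 * z + m" if "x \<le> y + m" "y \<le> x + 80 * z" "0 \<le> z" "0 \<le> m" for x y z m :: real
        using that by (simp add: abs_le_iff)
      from this[OF S5] show ?thesis if "lam * B \<le> real S ^ 5 + 80 * real S ^ 4" using that by simp
    qed
    then have "\<bar>real (S ^ 5) - lam * B\<bar> / B \<le> (80 * real S ^ 4 + real k) / B" using B0 by (intro divide_right_mono) auto
    also have "\<bar>real (S ^ 5) - lam * B\<bar> / B = \<bar>real (S ^ 5) / B - lam\<bar>"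
    proof -
      have "\<bar>x - lam * B\<bar> / B = \<bar>(x - lam * B) / B\<bar>" for x using B0 by (simp only: abs_divide abs_of_pos)
      then show ?thesis using B0 by (simp add: diff_divide_distrib)
    qed
    also have "(80 * real S ^ 4 + real k) / B = 80 * (real S ^ 4 / B) + real k / B" by (simp add: add_divide_distrib)
    also have "real k / B \<le> real k * \<beta> ^ k"
    proof -
      have "1 / B = (\<beta> ^ k) ^ 5" using \<beta>B(2) B0 by (simp add: field_simps)
      also have "\<dots> \<le> \<beta> ^ k" using \<beta>B \<beta>1 power_decreasing[of 1 5 "\<beta> ^ k"] by simp
      finally have "real k * (1 / B) \<le> real k * \<beta> ^ k" by (intro mult_left_mono) auto
      then show ?thesis by simp
    qed
    finally show ?thesis using pois_lipschitz[of "real (S ^ 5) / B" lam j] lam B0 S4 by simp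
  qed
  have "\<bar>real (cls b (base_seq b) k j ?M) / B - pois j (real (S ^ 5) / B)\<bar> \<le>
     2 * (real (k + 1) * \<beta> ^ k) ^ 5 + (14 * c ^ 4 * (real (k + 1) * \<beta> ^ k) + 20 * c ^ 5 * \<beta> ^ k)"
    using E T1 T2 T3 b by (simp add: sum.distrib)
  with F1 F2 have "\<bar>real (cls b (base_seq b) k j N) / B - pois j lam\<bar> \<le> 2 * (real (k + 1) * \<beta> ^ k) ^ 5 +
      (14 * c ^ 4 * (real (k + 1) * \<beta> ^ k) + 20 * c ^ 5 * \<beta> ^ k + (160 * (c ^ 4 * \<beta> ^ k) + real k * \<beta> ^ k))"
    by linarith
  \<comment> \<open>\<open>174 = 14 + 2 * 80\<close>: the tolerances, and twice the replacement of
    \<open>N\<close> by the end of stage \<open>S\<close>, once in the class size and once in the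
    argument of \<open>pois\<close>. The Euler errors give the \<open>c ^ 5\<close> term.\<close>
  also have "\<dots> \<le> 2 * (real (k + 1) * \<beta> ^ k) ^ 5 + (174 * c ^ 4 + 20 * c ^ 5 + 1) * (real (k + 1) * \<beta> ^ k)"
  proof -
    have 1: "1 * \<beta> ^ k \<le> real (k + 1) * \<beta> ^ k" "real k * \<beta> ^ k \<le> real (k + 1) * \<beta> ^ k"
      using \<beta>B by (intro mult_right_mono; simp)+
    have "20 * c ^ 5 * \<beta> ^ k \<le> 20 * c ^ 5 * (real (k + 1) * \<beta> ^ k)"
         "160 * (c ^ 4 * \<beta> ^ k) \<le> 160 * c ^ 4 * (real (k + 1) * \<beta> ^ k)"
      using 1 c1 by (simp_all add: mult.assoc mult_left_mono)
    with 1(2) show ?thesis by (simp add: distrib_right distrib_left mult.assoc)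
  qed
  finally show ?thesis unfolding N_def c_def B_def .
qed

lemma base_seq_Poisson: assumes b: "b \<ge> 2" shows "Poisson_digits b (base_seq b)"
  unfolding Poisson_digits_def
proof (intro allI impI)
  fix lam :: real and j :: nat assume lam: "lam > 0"
  define \<beta> where "\<beta> = (1 / real b) powr (1/5)"
  have \<beta>: "0 < \<beta>" "\<beta> < 1" "\<beta> ^ 5 = 1 / real b"
  proof -
    have "(1 / real b) powr (1/5) < 1 powr (1/5)" using b by (intro powr_less_mono2) auto
    then show "0 < \<beta>" "\<beta> < 1" "\<beta> ^ 5 = 1 / real b"
      using b by (auto simp: \<beta>_def powr_powr simp flip: powr_realpow)
  qed
  have q: "(\<lambda>k. real (k + a) * \<beta> ^ k) \<longlonglongrightarrow> 0" for a
  proof -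
    have "(\<lambda>k. real k * \<beta> ^ k + real a * \<beta> ^ k) \<longlonglongrightarrow> 0 + real a * 0"
      using \<beta> by (intro tendsto_intros powser_times_n_limit_0 LIMSEQ_power_zero) auto
    then show ?thesis by (simp add: distrib_right)
  qed
  let ?C = "174 * (lam + 1) ^ 4 + 20 * (lam + 1) ^ 5 + 1"
  have g: "(\<lambda>k. 2 * (real (k + 1) * \<beta> ^ k) ^ 5 + ?C * (real (k + 1) * \<beta> ^ k)) \<longlonglongrightarrow> 2 * 0 ^ 5 + ?C * 0"
    by (intro tendsto_intros q)
  have ev1: "eventually (\<lambda>k. (real (k + 2) * \<beta> ^ k) ^ 5 < lam) sequentially"
    using tendsto_power[OF q[of 2], of 5] lam by (intro order_tendstoD(2)) auto
  have ev2: "eventually (\<lambda>k. 5 * (lam + 1) ^ 4 * \<beta> ^ k < 1) sequentially"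
  proof (rule order_tendstoD(2))
    show "(\<lambda>k. 5 * (lam + 1) ^ 4 * \<beta> ^ k) \<longlonglongrightarrow> 5 * (lam + 1) ^ 4 * 0"
      using \<beta> by (intro tendsto_intros LIMSEQ_power_zero) auto
  qed simp
  have "(\<lambda>k. real (cls b (base_seq b) k j (nat \<lfloor>lam * real b ^ k\<rfloor> + 1)) / real b ^ k - pois j lam) \<longlonglongrightarrow> 0"
  proof (rule null_comparison)
    show "eventually (\<lambda>k. \<bar>real (cls b (base_seq b) k j (nat \<lfloor>lam * real b ^ k\<rfloor> + 1)) / real b ^ k - pois j lam\<bar> \<le>
       2 * (real (k + 1) * \<beta> ^ k) ^ 5 + ?C * (real (k + 1) * \<beta> ^ k)) sequentially"
      using ev1 ev2 eventually_gt_at_top[of 0] eventually_ge_at_top[of j]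
      by eventually_elim (rule base_seq_Poisson_bound[OF b lam \<beta>]; simp)
  qed (use g in simp)
  then show "(\<lambda>k. real (cls b (base_seq b) k j (nat \<lfloor>lam * real b ^ k\<rfloor> + 1)) / real b ^ k) \<longlonglongrightarrow> exp (- lam) * lam ^ j / fact j"
    by (simp add: LIM_zero_iff pois_def)
qed

section \<open>Perturbing the base sequence\<close>

text \<open>For \<open>p \<ge> 1\<close> this is the integer part of the logarithm of
  \<open>p\<close> to base \<open>b\<close>, written as a bounded count so that it is
  recursive.\<close>

definition scale :: "nat \<Rightarrow> nat \<Rightarrow> nat" where
  "scale b p = card {i. i < p \<and> b ^ Suc i \<le> p}"

definition block_len :: "nat \<Rightarrow> (nat \<Rightarrow> nat) \<Rightarrow> nat \<Rightarrow> nat" where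
  "block_len b m k = b ^ k div m k"

definition perturb :: "nat \<Rightarrow> (nat \<Rightarrow> nat) \<Rightarrow> (nat \<Rightarrow> nat) \<Rightarrow> nat \<Rightarrow> nat" where
  "perturb b m r p =
     (if b ^ scale b p \<le> p \<and> p < b ^ scale b p + block_len b m (scale b p)
      then (if even (scale b p) then 0 else r (p - block_len b m (scale b p))) else r p)"

lemma scale_eq: fixes b p :: nat assumes b: "b \<ge> 2" and k: "b ^ k \<le> p" "p < b ^ Suc k" shows "scale b p = k"
proof -
  have "{i. i < p \<and> b ^ Suc i \<le> p} = {..<k}"
  proof (intro set_eqI iffI)
    fix i assume "i \<in> {i. i < p \<and> b ^ Suc i \<le> p}"
    then have "b ^ Suc i \<le> p" by blast
    then have "b ^ Suc i < b ^ Suc k" using k(2) by (rule order.strict_trans1)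
    then have "Suc i < Suc k" by (rule power_less_imp_less_exp[of b, rotated]) (use b in simp)
    then show "i \<in> {..<k}" by simp
  next
    fix i assume i: "i \<in> {..<k}"
    then have "b ^ Suc i \<le> b ^ k" using b by (intro power_increasing) auto
    moreover have "i < b ^ i" using b by (intro power_gt_expt) auto
    moreover have "b ^ i \<le> b ^ k" using b i by (intro power_increasing) auto
    ultimately show "i \<in> {i. i < p \<and> b ^ Suc i \<le> p}" using k by simp
  qed
  then show ?thesis by (simp add: scale_def)
qed

lemma ex_scale: fixes b p :: nat assumes b: "b \<ge> 2" and p: "p \<ge> 1" shows "\<exists>k. b ^ k \<le> p \<and> p < b ^ Suc k"
  using p
proof (induction p rule: dec_induct)
  case base
  show ?case using b by (intro exI[of _ 0]) simp
next
  case (step p)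
  then obtain k where k: "b ^ k \<le> p" "p < b ^ Suc k" by blast
  show ?case
  proof (cases "Suc p < b ^ Suc k")
    case True
    then show ?thesis using k by (intro exI[of _ k]) auto
  next
    case False
    then have "Suc p = b ^ Suc k" using k by simp
    moreover have "b ^ Suc k < b ^ Suc (Suc k)" using b by (intro power_strict_increasing) auto
    ultimately show ?thesis by (intro exI[of _ "Suc k"]) auto
  qed
qed

text \<open>With \<open>m k \<ge> 4\<close> a block has at most \<open>b ^ k div 4\<close> digits,
  so it ends before the next scale and before the source of the next copy.\<close>

locale perturbation =
  fixes b :: nat and m r :: "nat \<Rightarrow> nat"
  assumes b: "b \<ge> 2" and m: "\<And>k. m k \<ge> 4" and r: "\<And>i. r i < b"
begin

abbreviation "x \<equiv> perturb b m r"
abbreviation "len \<equiv> block_len b m"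

lemma len4: "4 * len k \<le> b ^ k"
proof -
  have "4 * len k \<le> m k * (b ^ k div m k)" unfolding block_len_def using m[of k] by (intro mult_right_mono) auto
  also have "\<dots> \<le> b ^ k" by simp
  finally show ?thesis .
qed

lemma in_block: assumes "b ^ k \<le> p" "p < b ^ k + len k" shows "scale b p = k"
proof (rule scale_eq[OF b assms(1)])
  have "2 * b ^ k \<le> b * b ^ k" using b by (intro mult_right_mono) auto
  then show "p < b ^ Suc k" unfolding power_Suc using assms len4[of k] by linarith
qed

lemma x_even: "b ^ k \<le> p \<Longrightarrow> p < b ^ k + len k \<Longrightarrow> even k \<Longrightarrow> x p = 0"
  using in_block[of k p] by (simp add: perturb_def)

lemma x_odd: "b ^ k \<le> p \<Longrightarrow> p < b ^ k + len k \<Longrightarrow> odd k \<Longrightarrow> x p = r (p - len k)"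
  using in_block[of k p] by (simp add: perturb_def)

lemma x_outside: assumes "\<And>k. b ^ k \<le> p \<Longrightarrow> \<not> p < b ^ k + len k" shows "x p = r p"
  using assms[of "scale b p"] by (auto simp: perturb_def)

lemma x_gap: assumes k: "b ^ k + len k \<le> p" "p < b ^ Suc k" shows "x p = r p"
proof -
  have "scale b p = k" using k by (intro scale_eq[OF b]) auto
  then show ?thesis using k by (simp add: perturb_def)
qed

text \<open>The previous block ends by \<open>5/4 * b ^ (k - 1)\<close>, whereas the source starts
  no earlier than \<open>3/4 * b ^ k\<close>, which is at least
  \<open>3/2 * b ^ (k - 1)\<close>.\<close>

lemma x_source: assumes k: "odd k" "b ^ k - len k \<le> p" "p < b ^ k" shows "x p = r p"
proof -
  obtain k' where k': "k = Suc k'" using k(1) by (cases k) auto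
  have "2 * b ^ k' \<le> b * b ^ k'" using b by (intro mult_right_mono) auto
  then have "b ^ k' + len k' \<le> p" using k(2) len4[of k] len4[of k'] unfolding k' power_Suc by linarith
  then show ?thesis using k(3) unfolding k' by (intro x_gap) auto
qed

lemma x_copy: assumes "b ^ k \<le> p" "p < b ^ k + len k" "odd k" shows "x p = x (p - len k)"
proof -
  have "b ^ k - len k \<le> p - len k" "p - len k < b ^ k" using assms(1,2) len4[of k] by linarith+
  then show ?thesis using x_odd[OF assms] x_source[OF assms(3), of "p - len k"] by simp
qed

lemma x_less: "x p < b"
  using r b by (simp add: perturb_def)

lemma diff_in_block: assumes "x p \<noteq> r p" shows "\<exists>k. b ^ k \<le> p \<and> p < b ^ k + len k"
  using assms x_outside by blast

text \<open>A changed window starts inside a block or fewer than \<open>k\<close> digits before one.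
  The second kind contributes only boundedly many windows per scale.\<close>

lemma diff_windows:
  assumes "win b x k i \<noteq> win b r k i" "i + k < b ^ Suc K"
  shows "\<exists>\<kappa>\<le>K. i \<in> {b ^ \<kappa>..<b ^ \<kappa> + len \<kappa>} \<or> i \<in> {b ^ \<kappa> - k..<b ^ \<kappa>}"
proof -
  obtain t where t: "t < k" "x (i + t) \<noteq> r (i + t)" using assms(1) win_cong[of k x i r i b] by blast
  then obtain \<kappa> where \<kappa>: "b ^ \<kappa> \<le> i + t" "i + t < b ^ \<kappa> + len \<kappa>" using diff_in_block by blast
  have "b ^ \<kappa> < b ^ Suc K" using \<kappa>(1) t(1) assms(2) by linarith
  then have "\<kappa> < Suc K" by (rule power_less_imp_less_exp[of b, rotated]) (use b in simp)
  moreover have "i \<in> {b ^ \<kappa>..<b ^ \<kappa> + len \<kappa>} \<or> i \<in> {b ^ \<kappa> - k..<b ^ \<kappa>}" using \<kappa> t(1) by auto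
  ultimately show ?thesis by (intro exI[of _ \<kappa>]) auto
qed

lemma card_edges: "card (\<Union>\<kappa>\<le>K. {b ^ \<kappa> - k..<b ^ \<kappa>}) \<le> Suc K * k"
proof -
  have "card (\<Union>\<kappa>\<le>K. {b ^ \<kappa> - k..<b ^ \<kappa>}) \<le> (\<Sum>\<kappa>\<le>K. card {b ^ \<kappa> - k..<b ^ \<kappa>})" by (rule card_UN_le) simp
  also have "\<dots> \<le> (\<Sum>\<kappa>\<le>K. k)" by (intro sum_mono) simp
  finally show ?thesis by simp
qed

lemma card_diff_windows:
  assumes "n + k \<le> b ^ Suc K"
  shows "card {i. i < n \<and> win b x k i \<noteq> win b r k i} \<le> Suc K * k + (\<Sum>\<kappa>\<le>K. len \<kappa>)"
proof -
  have "{i. i < n \<and> win b x k i \<noteq> win b r k i} \<subseteq> (\<Union>\<kappa>\<le>K. {b ^ \<kappa> - k..<b ^ \<kappa>}) \<union> (\<Union>\<kappa>\<le>K. {b ^ \<kappa>..<b ^ \<kappa> + len \<kappa>})"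
  proof
    fix i assume "i \<in> {i. i < n \<and> win b x k i \<noteq> win b r k i}"
    then have "win b x k i \<noteq> win b r k i" "i + k < b ^ Suc K" using assms by auto
    from diff_windows[OF this] show "i \<in> (\<Union>\<kappa>\<le>K. {b ^ \<kappa> - k..<b ^ \<kappa>}) \<union> (\<Union>\<kappa>\<le>K. {b ^ \<kappa>..<b ^ \<kappa> + len \<kappa>})" by auto
  qed
  then have "card {i. i < n \<and> win b x k i \<noteq> win b r k i} \<le> card ((\<Union>\<kappa>\<le>K. {b ^ \<kappa> - k..<b ^ \<kappa>}) \<union> (\<Union>\<kappa>\<le>K. {b ^ \<kappa>..<b ^ \<kappa> + len \<kappa>}))"
    by (intro card_mono) auto
  also have "\<dots> \<le> card (\<Union>\<kappa>\<le>K. {b ^ \<kappa> - k..<b ^ \<kappa>}) + card (\<Union>\<kappa>\<le>K. {b ^ \<kappa>..<b ^ \<kappa> + len \<kappa>})" by (rule card_Un_le)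
  also have "card (\<Union>\<kappa>\<le>K. {b ^ \<kappa>..<b ^ \<kappa> + len \<kappa>}) \<le> (\<Sum>\<kappa>\<le>K. card {b ^ \<kappa>..<b ^ \<kappa> + len \<kappa>})" by (rule card_UN_le) simp
  finally show ?thesis using card_edges[of k K] by simp
qed

lemma sum_powers_le: "(\<Sum>\<kappa>\<le>K. real b ^ \<kappa>) \<le> 2 * real b ^ K"
proof (induction K)
  case (Suc K)
  have "2 * real b ^ K \<le> real b * real b ^ K" using b by (intro mult_right_mono) auto
  then show ?case using Suc by simp
qed simp

text \<open>Block lengths are \<open>o(b ^ \<kappa>)\<close>, and geometric growth passes this on to
  their partial sums.\<close>

lemma sum_len_le:
  assumes \<epsilon>: "\<epsilon> > 0" and lim: "filterlim m at_top sequentially"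
  shows "\<exists>C\<ge>0. \<forall>K. (\<Sum>\<kappa>\<le>K. real (len \<kappa>)) \<le> C + \<epsilon> * real b ^ K"
proof -
  obtain K0 where K0: "\<And>\<kappa>. \<kappa> \<ge> K0 \<Longrightarrow> m \<kappa> \<ge> nat \<lceil>2 / \<epsilon>\<rceil>"
    using lim unfolding filterlim_at_top eventually_sequentially by blast
  define C where "C = (\<Sum>\<kappa><K0. real (len \<kappa>))"
  have "real (len \<kappa>) \<le> (if \<kappa> < K0 then real (len \<kappa>) else 0) + \<epsilon> / 2 * real b ^ \<kappa>" for \<kappa>
  proof (cases "\<kappa> < K0")
    case False
    then have "m \<kappa> \<ge> nat \<lceil>2 / \<epsilon>\<rceil>" using K0 by simp
    then have "2 / \<epsilon> \<le> real (m \<kappa>)" by linarith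
    then have "1 / real (m \<kappa>) \<le> \<epsilon> / 2" using \<epsilon> m[of \<kappa>] by (simp add: field_simps)
    have "real (len \<kappa>) \<le> real (b ^ \<kappa>) / real (m \<kappa>)" unfolding block_len_def by (rule of_nat_div_le_of_nat)
    also have "\<dots> = 1 / real (m \<kappa>) * real b ^ \<kappa>" by simp
    also have "\<dots> \<le> \<epsilon> / 2 * real b ^ \<kappa>" using \<open>1 / real (m \<kappa>) \<le> \<epsilon> / 2\<close> by (intro mult_right_mono) auto
    finally show ?thesis using False by simp
  qed (use \<epsilon> in simp)
  then have 1: "(\<Sum>\<kappa>\<le>K. real (len \<kappa>)) \<le> (\<Sum>\<kappa>\<le>K. (if \<kappa> < K0 then real (len \<kappa>) else 0) + \<epsilon> / 2 * real b ^ \<kappa>)" for K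
    by (intro sum_mono)
  have "(\<Sum>\<kappa>\<le>K. real (len \<kappa>)) \<le> C + \<epsilon> * real b ^ K" for K
  proof -
    have "(\<Sum>\<kappa>\<le>K. if \<kappa> < K0 then real (len \<kappa>) else 0) = (\<Sum>\<kappa>\<in>{..K} \<inter> {..<K0}. real (len \<kappa>))"
      by (simp add: sum.If_cases Int_def lessThan_def)
    also have "\<dots> \<le> C" unfolding C_def by (intro sum_mono2) auto
    finally have "(\<Sum>\<kappa>\<le>K. if \<kappa> < K0 then real (len \<kappa>) else 0) \<le> C" .
    moreover have "\<epsilon> / 2 * (\<Sum>\<kappa>\<le>K. real b ^ \<kappa>) \<le> \<epsilon> / 2 * (2 * real b ^ K)"
      using \<epsilon> sum_powers_le by (intro mult_left_mono) auto
    ultimately show ?thesis using 1[of K] by (simp add: sum.distrib sum_distrib_left)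
  qed
  then show ?thesis by (intro exI[of _ C]) (auto simp: C_def sum_nonneg)
qed

text \<open>The first \<open>lam * b ^ k\<close> windows meet blocks of scale at most
  \<open>k + c\<close> with \<open>c\<close> fixed, hence only \<open>o(b ^ k)\<close> of them
  change, and a changed window affects at most two words.\<close>

lemma Poisson_perturb:
  assumes P: "Poisson_digits b r" and lim: "filterlim m at_top sequentially"
  shows "Poisson_digits b x"
  unfolding Poisson_digits_def
proof (intro allI impI)
  fix lam :: real and j :: nat assume lam: "lam > 0"
  define N where "N k = nat \<lfloor>lam * real b ^ k\<rfloor> + 1" for k
  \<comment> \<open>The summand 2 leaves room for the \<open>+ 1\<close> in \<open>N k\<close> and
    for \<open>k\<close>, both of which are at most \<open>b ^ k\<close>.\<close>
  obtain c where c: "lam + 2 \<le> real b ^ c"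
    using b real_arch_pow[of "real b" "lam + 2"] by (auto intro: less_imp_le)
  have NK: "N k + k \<le> b ^ Suc (k + c)" for k
  proof -
    have "k < 2 ^ k" by (rule less_exp)
    also have "2 ^ k \<le> b ^ k" using b by (intro power_mono) auto
    finally have kb: "real k \<le> real b ^ k" by (metis less_imp_le of_nat_le_iff of_nat_power)
    have "real (N k) \<le> lam * real b ^ k + 1" using lam by (simp add: N_def of_nat_nat)
    moreover have "1 \<le> real b ^ k" using b by simp
    ultimately have "real (N k + k) \<le> (lam + 2) * real b ^ k" using kb unfolding distrib_right of_nat_add by linarith
    also have "\<dots> \<le> real b ^ c * real b ^ k" using c by (intro mult_right_mono) auto
    also have "\<dots> = real (b ^ (k + c))" by (simp add: power_add)
    finally have "N k + k \<le> b ^ (k + c)" by (simp only: of_nat_le_iff)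
    also have "\<dots> \<le> b ^ Suc (k + c)" using b by (intro power_increasing) auto
    finally show ?thesis .
  qed
  have z: "(\<lambda>k. (real (Suc (k + c)) * real k) / real b ^ k) \<longlonglongrightarrow> 0"
  proof -
    have q: "(\<lambda>k. real k * \<beta> ^ k) \<longlonglongrightarrow> 0" "(\<lambda>k. \<beta> ^ k) \<longlonglongrightarrow> 0" if "0 < \<beta>" "\<beta> < 1" for \<beta> :: real
      using that by (intro powser_times_n_limit_0 LIMSEQ_power_zero; simp)+
    \<comment> \<open>The square root distributes the decay of \<open>1 / b ^ k\<close> over the two
      linear factors.\<close>
    define \<beta> where "\<beta> = 1 / sqrt (real b)"
    have \<beta>: "0 < \<beta>" "\<beta> < 1" using b by (auto simp: \<beta>_def)
    have "\<beta> * \<beta> = 1 / real b" by (simp add: \<beta>_def)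
    have "(\<lambda>k. (real k * \<beta> ^ k + real (Suc c) * \<beta> ^ k) * (real k * \<beta> ^ k)) \<longlonglongrightarrow> (0 + real (Suc c) * 0) * 0"
      by (intro tendsto_intros q \<beta>)
    moreover have "(real k * \<beta> ^ k + real (Suc c) * \<beta> ^ k) * (real k * \<beta> ^ k) = (real (Suc (k + c)) * real k) / real b ^ k" for k
    proof -
      have "(real k * \<beta> ^ k + real (Suc c) * \<beta> ^ k) * (real k * \<beta> ^ k) = (real (Suc (k + c)) * real k) * (\<beta> * \<beta>) ^ k"
        by (simp add: power_mult_distrib algebra_simps)
      then show ?thesis by (simp add: \<open>\<beta> * \<beta> = 1 / real b\<close> power_divide)
    qed
    ultimately show ?thesis by simp
  qed
  have "(\<lambda>k. real (cls b x k j (N k)) / real b ^ k - real (cls b r k j (N k)) / real b ^ k) \<longlonglongrightarrow> 0"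
  proof (rule LIMSEQ_I)
    fix \<epsilon> :: real assume \<epsilon>: "\<epsilon> > 0"
    \<comment> \<open>Scales up to \<open>k + c\<close> then cost
      \<open>\<delta> * b ^ (k + c) = \<epsilon> / 4 * b ^ k\<close>; the factor 2 for the affected
      words brings this to \<open>\<epsilon> / 2\<close>.\<close>
    define \<delta> where "\<delta> = \<epsilon> / (4 * real b ^ c)"
    have \<delta>: "\<delta> > 0" using \<epsilon> b by (simp add: \<delta>_def)
    obtain C where C: "C \<ge> 0" "\<And>K. (\<Sum>\<kappa>\<le>K. real (len \<kappa>)) \<le> C + \<delta> * real b ^ K"
      using sum_len_le[OF \<delta> lim] by blast
    have "(\<lambda>k. 2 * ((real (Suc (k + c)) * real k) / real b ^ k) + 2 * C * (1 / real b) ^ k) \<longlonglongrightarrow> 2 * 0 + 2 * C * 0"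
      using b by (intro tendsto_intros z LIMSEQ_power_zero) auto
    then have "eventually (\<lambda>k. 2 * ((real (Suc (k + c)) * real k) / real b ^ k) + 2 * C * (1 / real b) ^ k < \<epsilon> / 2) sequentially"
      using \<epsilon> by (intro order_tendstoD(2)) auto
    then obtain k0 where k0: "\<And>k. k \<ge> k0 \<Longrightarrow> 2 * ((real (Suc (k + c)) * real k) / real b ^ k) + 2 * C * (1 / real b) ^ k < \<epsilon> / 2"
      unfolding eventually_sequentially by blast
    show "\<exists>no. \<forall>k\<ge>no. norm (real (cls b x k j (N k)) / real b ^ k - real (cls b r k j (N k)) / real b ^ k - 0) < \<epsilon>"
    proof (intro exI[of _ k0] allI impI)
      fix k assume k: "k \<ge> k0"
      let ?c = "card {i. i < N k \<and> win b x k i \<noteq> win b r k i}"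
      have bk: "real b ^ k > 0" using b by simp
      have "real ?c \<le> real (Suc (k + c)) * real k + (\<Sum>\<kappa>\<le>k + c. real (len \<kappa>))"
        using of_nat_mono[OF card_diff_windows[OF NK[of k]], where 'a = real] by (simp only: of_nat_add of_nat_mult of_nat_sum)
      also have "\<dots> \<le> real (Suc (k + c)) * real k + (C + \<delta> * real b ^ (k + c))" using C(2)[of "k + c"] by simp
      also have "\<delta> * real b ^ (k + c) = \<epsilon> / 4 * real b ^ k" using b by (simp add: \<delta>_def power_add)
      finally have F: "real ?c \<le> real (Suc (k + c)) * real k + (C + \<epsilon> / 4 * real b ^ k)" .
      have "\<bar>real (cls b x k j (N k)) - real (cls b r k j (N k))\<bar> \<le> 2 * (real (Suc (k + c)) * real k + (C + \<epsilon> / 4 * real b ^ k))"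
        by (rule order.trans[OF cls_diff_windows mult_left_mono[OF F]]) simp
      then have "\<bar>real (cls b x k j (N k)) - real (cls b r k j (N k))\<bar> / real b ^ k \<le>
          2 * (real (Suc (k + c)) * real k + (C + \<epsilon> / 4 * real b ^ k)) / real b ^ k" using bk by (intro divide_right_mono) auto
      also have "\<dots> = 2 * ((real (Suc (k + c)) * real k) / real b ^ k) + 2 * C * (1 / real b) ^ k + \<epsilon> / 2"
        using bk by (simp add: add_divide_distrib distrib_left power_divide)
      also have "\<dots> < \<epsilon>" using k0[OF k] by simp
      finally have "\<bar>real (cls b x k j (N k)) - real (cls b r k j (N k))\<bar> / real b ^ k < \<epsilon>" .
      then show "norm (real (cls b x k j (N k)) / real b ^ k - real (cls b r k j (N k)) / real b ^ k - 0) < \<epsilon>"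
        using bk by (simp flip: diff_divide_distrib)
    qed
  qed
  moreover have "(\<lambda>k. real (cls b r k j (N k)) / real b ^ k) \<longlonglongrightarrow> exp (- lam) * lam ^ j / fact j"
    using P lam unfolding Poisson_digits_def N_def by blast
  ultimately have "(\<lambda>k. (real (cls b x k j (N k)) / real b ^ k - real (cls b r k j (N k)) / real b ^ k) + real (cls b r k j (N k)) / real b ^ k)
      \<longlonglongrightarrow> 0 + exp (- lam) * lam ^ j / fact j" by (rule tendsto_add)
  then show "(\<lambda>k. real (cls b x k j (nat \<lfloor>lam * real b ^ k\<rfloor> + 1)) / real b ^ k) \<longlonglongrightarrow> exp (- lam) * lam ^ j / fact j"
    by (simp add: N_def)
qed

end

lemma infinite_nat_ex_ge: "infinite {k :: nat. P k} \<Longrightarrow> \<exists>k\<ge>K. P k"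
  using finite_subset[of "{k. P k}" "{..<K}"] by (auto simp: subset_iff not_le[symmetric])

text \<open>With an additive constant in place of a threshold the estimate is uniform in
  \<open>n\<close>, which makes it easy to add up over scales.\<close>

lemma sublinear_iff:
  fixes g :: "nat \<Rightarrow> real"
  shows "(\<lambda>n. g n / real n) \<longlonglongrightarrow> 0 \<longleftrightarrow> (\<forall>\<epsilon>>0. \<exists>C\<ge>0. \<forall>n. \<bar>g n\<bar> \<le> C + \<epsilon> * real n)"
proof
  assume L: "(\<lambda>n. g n / real n) \<longlonglongrightarrow> 0"
  show "\<forall>\<epsilon>>0. \<exists>C\<ge>0. \<forall>n. \<bar>g n\<bar> \<le> C + \<epsilon> * real n"
  proof (intro allI impI)
    fix \<epsilon> :: real assume \<epsilon>: "\<epsilon> > 0"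
    from LIMSEQ_D[OF L \<epsilon>] obtain n0 where n0: "\<And>n. n \<ge> n0 \<Longrightarrow> \<bar>g n / real n\<bar> < \<epsilon>" by auto
    define C where "C = (\<Sum>i\<le>n0. \<bar>g i\<bar>)"
    have "\<bar>g n\<bar> \<le> C + \<epsilon> * real n" for n
    proof (cases "n \<le> n0")
      case True
      then have "\<bar>g n\<bar> \<le> C" unfolding C_def by (intro member_le_sum) auto
      then show ?thesis using \<epsilon> by (simp add: add_increasing2)
    next
      case False
      then have "\<bar>g n\<bar> / real n < \<epsilon>" using n0[of n] by (simp add: abs_divide)
      then have "\<bar>g n\<bar> \<le> \<epsilon> * real n" using False by (simp add: field_simps)
      moreover have "C \<ge> 0" by (simp add: C_def sum_nonneg)
      ultimately show ?thesis by simp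
    qed
    then show "\<exists>C\<ge>0. \<forall>n. \<bar>g n\<bar> \<le> C + \<epsilon> * real n" by (intro exI[of _ C]) (simp add: C_def sum_nonneg)
  qed
next
  assume *: "\<forall>\<epsilon>>0. \<exists>C\<ge>0. \<forall>n. \<bar>g n\<bar> \<le> C + \<epsilon> * real n"
  show "(\<lambda>n. g n / real n) \<longlonglongrightarrow> 0"
  proof (rule LIMSEQ_I)
    fix \<epsilon> :: real assume \<epsilon>: "\<epsilon> > 0"
    then have "\<epsilon> / 2 > 0" by simp
    with * obtain C where C: "C \<ge> 0" "\<And>n. \<bar>g n\<bar> \<le> C + \<epsilon> / 2 * real n" by blast
    obtain n0 :: nat where n0: "2 * C / \<epsilon> < real n0" using reals_Archimedean2 by blast
    show "\<exists>no. \<forall>n\<ge>no. norm (g n / real n - 0) < \<epsilon>"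
    proof (intro exI[of _ "Suc n0"] allI impI)
      fix n assume n: "n \<ge> Suc n0"
      then have "2 * C / \<epsilon> < real n" using n0 by simp
      then have "C < \<epsilon> / 2 * real n" using \<epsilon> by (simp add: field_simps)
      then have "\<bar>g n\<bar> < \<epsilon> * real n" using C(2)[of n] by (simp add: field_simps)
      then show "norm (g n / real n - 0) < \<epsilon>" using n by (simp add: abs_divide field_simps)
    qed
  qed
qed

lemma limit_ratio_iff:
  fixes f :: "nat \<Rightarrow> real"
  shows "(\<lambda>n. f n / real n) \<longlonglongrightarrow> L \<longleftrightarrow> (\<forall>\<epsilon>>0. \<exists>C\<ge>0. \<forall>n. \<bar>f n - real n * L\<bar> \<le> C + \<epsilon> * real n)"
proof -
  have "(\<lambda>n. f n / real n) \<longlonglongrightarrow> L \<longleftrightarrow> (\<lambda>n. f n / real n - L) \<longlonglongrightarrow> 0" by (rule LIM_zero_iff[symmetric])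
  also have "\<dots> \<longleftrightarrow> (\<lambda>n. (f n - real n * L) / real n) \<longlonglongrightarrow> 0"
  proof (rule tendsto_cong)
    show "eventually (\<lambda>n. f n / real n - L = (f n - real n * L) / real n) sequentially"
      using eventually_gt_at_top[of 0] by eventually_elim (simp add: diff_divide_distrib)
  qed
  finally show ?thesis unfolding sublinear_iff .
qed

text \<open>Below \<open>b ^ Suc K\<close> there are only \<open>Suc K\<close> scales, so an error
  made once per scale is negligible.\<close>

lemma scale_sublinear:
  assumes b: "b \<ge> 2" and \<epsilon>: "\<epsilon> > 0"
  shows "\<exists>C\<ge>0. \<forall>K. real (Suc K) \<le> C + \<epsilon> * real b ^ K"
proof -
  have "(\<lambda>K. real K * (1 / real b) ^ K + (1 / real b) ^ K) \<longlonglongrightarrow> 0 + 0"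
    using b by (intro tendsto_add powser_times_n_limit_0 LIMSEQ_power_zero) auto
  then have "eventually (\<lambda>K. real K * (1 / real b) ^ K + (1 / real b) ^ K < \<epsilon>) sequentially"
    using \<epsilon> by (intro order_tendstoD(2)) auto
  then obtain K0 where K0: "\<And>K. K \<ge> K0 \<Longrightarrow> real K * (1 / real b) ^ K + (1 / real b) ^ K < \<epsilon>"
    unfolding eventually_sequentially by blast
  have "real (Suc K) \<le> real (Suc K0) + \<epsilon> * real b ^ K" for K
  proof (cases "K \<ge> K0")
    case True
    have bk: "real b ^ K > 0" using b by simp
    have "(real K * (1 / real b) ^ K + (1 / real b) ^ K) * real b ^ K \<le> \<epsilon> * real b ^ K"
      using K0[OF True] bk by (intro mult_right_mono) auto
    moreover have "(real K * (1 / real b) ^ K + (1 / real b) ^ K) * real b ^ K = real (Suc K)"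
      using bk by (simp add: power_divide distrib_right)
    ultimately show ?thesis by simp
  next
    case False
    then show ?thesis using \<epsilon> by (simp add: add_increasing2)
  qed
  then show ?thesis by (intro exI[of _ "real (Suc K0)"]) simp
qed

context perturbation
begin

section \<open>Recurring block proportions destroy the two properties\<close>

text \<open>Compare the unseen words at \<open>lam = 1\<close> and at \<open>lam = 1 + 1/M\<close>.
  If \<open>k\<close> is odd and \<open>m k = M\<close>, all but at most \<open>k\<close> of the
  windows read in between lie in the copied block and repeat earlier windows. So at most
  \<open>k\<close> words are seen for the first time, although the proportion of unseen words should
  drop from \<open>exp (- 1)\<close> to \<open>exp (- l2)\<close>.\<close>

lemma not_Poisson_perturb:
  assumes inf: "infinite {k. odd k \<and> m k = M}"
  shows "\<not> Poisson_digits b x"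
proof
  assume P: "Poisson_digits b x"
  obtain k0 where "odd k0 \<and> m k0 = M" using inf by (metis (mono_tags, lifting) Collect_empty_eq finite.emptyI)
  then have M4: "M \<ge> 4" using m[of k0] by simp
  define l2 where "l2 = 1 + 1 / real M"
  define N where "N lam k = nat \<lfloor>lam * real b ^ k\<rfloor> + 1" for lam k
  have l2: "l2 > 1" using M4 by (simp add: l2_def)
  have L1: "(\<lambda>k. real (cls b x k 0 (N 1 k)) / real b ^ k) \<longlonglongrightarrow> exp (- 1)"
    using P unfolding Poisson_digits_def N_def by (auto dest!: spec[of _ "1::real"] spec[of _ "0::nat"])
  have "(\<lambda>k. real (cls b x k 0 (nat \<lfloor>l2 * real b ^ k\<rfloor> + 1)) / real b ^ k) \<longlonglongrightarrow> exp (- l2) * l2 ^ 0 / fact 0"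
    using P l2 unfolding Poisson_digits_def by (meson less_trans zero_less_one)
  then have L2: "(\<lambda>k. real (cls b x k 0 (N l2 k)) / real b ^ k) \<longlonglongrightarrow> exp (- l2)"
    by (simp add: N_def)
  have key: "\<bar>real (cls b x k 0 (N 1 k)) - real (cls b x k 0 (N l2 k))\<bar> \<le> real k" if k: "odd k" "m k = M" for k
  proof -
    let ?n1 = "b ^ k + 1" and ?n2 = "b ^ k + len k + 1"
    have N1: "N 1 k = ?n1" by (simp add: N_def floor_of_nat flip: of_nat_power)
    have "l2 * real b ^ k = real (b ^ k) + real (b ^ k) / real M" by (simp add: l2_def distrib_right)
    then have "\<lfloor>l2 * real b ^ k\<rfloor> = \<lfloor>real_of_int (int (b ^ k)) + real (b ^ k) / real M\<rfloor>" by simp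
    then have "\<lfloor>l2 * real b ^ k\<rfloor> = int (b ^ k) + \<lfloor>real (b ^ k) / real M\<rfloor>" by (simp only: int_add_floor)
    also have "\<lfloor>real (b ^ k) / real M\<rfloor> = int (len k)" unfolding floor_divide_of_nat_eq block_len_def k(2) ..
    also have "int (b ^ k) + int (len k) = int (b ^ k + len k)" by simp
    finally have N2: "N l2 k = ?n2" by (simp only: N_def nat_int)
    \<comment> \<open>These are the windows that may reach beyond the end of the block.\<close>
    let ?W = "win b x k ` {?n2 - k..<?n2}"
    have "{w\<in>{..<b^k}. (cnt b x k w ?n1 = 0) \<noteq> (cnt b x k w ?n2 = 0)} \<subseteq> ?W"
    proof
      fix w assume "w \<in> {w\<in>{..<b^k}. (cnt b x k w ?n1 = 0) \<noteq> (cnt b x k w ?n2 = 0)}"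
      moreover have "cnt b x k w ?n1 \<le> cnt b x k w ?n2" by (rule cnt_mono) simp
      ultimately have c: "cnt b x k w ?n1 = 0" "cnt b x k w ?n2 \<noteq> 0" by auto
      then obtain i where i: "i < ?n2" "win b x k i = w" by (auto simp: cnt_def card_eq_0_iff)
      have no: "win b x k i' \<noteq> w" if "i' < ?n1" for i' using c(1) that by (auto simp: cnt_def card_eq_0_iff)
      show "w \<in> ?W"
      proof (rule ccontr)
        assume "w \<notin> ?W"
        then have "i + k < ?n2" using i by (cases "i < ?n2 - k") auto
        moreover have "\<not> i < ?n1" using no[of i] i(2) by blast
        then have "b ^ k \<le> i" by simp
        ultimately have "win b x k i = win b x k (i - len k)"
          using len4[of k]
        proof (intro win_cong)
          fix t assume t: "t < k" and ik: "i + k < ?n2" and bi: "b ^ k \<le> i" and l4: "4 * len k \<le> b ^ k"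
          have "x (i + t) = x (i + t - len k)" using t ik bi k(1) by (intro x_copy) auto
          also have "i + t - len k = i - len k + t" using bi l4 by linarith
          finally show "x (i + t) = x (i - len k + t)" .
        qed
        moreover have "i - len k < ?n1" using i(1) by linarith
        ultimately show False using no i(2) by metis
      qed
    qed
    then have "card {w\<in>{..<b^k}. (cnt b x k w ?n1 = 0) \<noteq> (cnt b x k w ?n2 = 0)} \<le> card ?W" by (intro card_mono) auto
    also have "\<dots> \<le> card {?n2 - k..<?n2}" by (rule card_image_le) simp
    also have "\<dots> \<le> k" by simp
    finally have c: "card {w\<in>{..<b^k}. (cnt b x k w ?n1 = 0) \<noteq> (cnt b x k w ?n2 = 0)} \<le> k" .
    have "\<bar>real (cls b x k 0 ?n1) - real (cls b x k 0 ?n2)\<bar> \<le> real (card {w\<in>{..<b^k}. (cnt b x k w ?n1 = 0) \<noteq> (cnt b x k w ?n2 = 0)})"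
      using card_fibre_diff_le[of "{..<b^k}" "\<lambda>w. cnt b x k w ?n1 = 0" "\<lambda>w. cnt b x k w ?n2 = 0"] by (simp add: cls_def)
    also have "\<dots> \<le> real k" using c by (rule of_nat_mono)
    finally show ?thesis unfolding N1 N2 .
  qed
  define d where "d = exp (- 1) - exp (- l2)"
  have d: "d > 0" using l2 by (simp add: d_def)
  have "(\<lambda>k. real (cls b x k 0 (N 1 k)) / real b ^ k - real (cls b x k 0 (N l2 k)) / real b ^ k - real k * (1 / real b) ^ k) \<longlonglongrightarrow> d - 0"
    unfolding d_def using b by (intro tendsto_diff L1 L2 powser_times_n_limit_0) auto
  then have "eventually (\<lambda>k. real (cls b x k 0 (N 1 k)) / real b ^ k - real (cls b x k 0 (N l2 k)) / real b ^ k - real k * (1 / real b) ^ k > 0) sequentially"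
    using d by (intro order_tendstoD(1)) auto
  then obtain K where K: "\<And>k. k \<ge> K \<Longrightarrow> real (cls b x k 0 (N 1 k)) / real b ^ k - real (cls b x k 0 (N l2 k)) / real b ^ k - real k * (1 / real b) ^ k > 0"
    unfolding eventually_sequentially by blast
  obtain k where k: "k \<ge> K" "odd k" "m k = M" using infinite_nat_ex_ge[OF inf] by blast
  have "real (cls b x k 0 (N 1 k)) / real b ^ k - real (cls b x k 0 (N l2 k)) / real b ^ k =
     (real (cls b x k 0 (N 1 k)) - real (cls b x k 0 (N l2 k))) / real b ^ k" by (simp add: diff_divide_distrib)
  also have "\<dots> \<le> real k / real b ^ k" using key[OF k(2,3)] by (intro divide_right_mono) auto
  finally show False using K[OF k(1)] by (simp add: power_divide)
qed

text \<open>If \<open>u\<close> and \<open>v\<close> are the frequencies of the digit 0 before and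
  after a block of zeros of relative length \<open>l\<close>, then
  \<open>v - u = l * (1 - v)\<close>. With \<open>l\<close> bounded below, \<open>u\<close> and
  \<open>v\<close> cannot both be close to \<open>1 / b\<close>.\<close>

lemma not_normal_perturb:
  assumes inf: "infinite {k. even k \<and> m k = M}"
  shows "\<not> normal_digits b x"
proof
  assume N: "normal_digits b x"
  obtain k0 where "even k0 \<and> m k0 = M" using inf by (metis (mono_tags, lifting) Collect_empty_eq finite.emptyI)
  then have M4: "M \<ge> 4" using m[of k0] by simp
  have "(\<lambda>n. real (cnt b x 1 0 n) / real n) \<longlonglongrightarrow> 1 / real b ^ 1"
    using N b unfolding normal_digits_def by (metis zero_less_power less_le_trans zero_less_numeral)
  then have lim: "(\<lambda>n. real (cnt b x 1 0 n) / real n) \<longlonglongrightarrow> 1 / real b" by simp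
  \<comment> \<open>The block forces \<open>v - u\<close> to be at least
    \<open>1 / (2 * M) * (1 / 4) = 4 * \<epsilon>\<close>, while convergence allows only
    \<open>2 * \<epsilon>\<close>.\<close>
  define \<epsilon> where "\<epsilon> = 1 / (32 * real M)"
  have \<epsilon>: "\<epsilon> > 0" "\<epsilon> \<le> 1/8" using M4 by (auto simp: \<epsilon>_def)
  from LIMSEQ_D[OF lim \<epsilon>(1)] obtain n0 where n0: "\<And>n. n \<ge> n0 \<Longrightarrow> \<bar>real (cnt b x 1 0 n) / real n - 1 / real b\<bar> < \<epsilon>" by auto
  \<comment> \<open>\<open>k \<ge> 2 * M\<close> makes \<open>b ^ k\<close> large enough for the
    rounding in \<open>len k\<close> to cost no more than a factor 2.\<close>
  obtain k where k: "k \<ge> max n0 (2 * M)" "even k" "m k = M" using infinite_nat_ex_ge[OF inf] by blast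
  let ?n1 = "b ^ k" and ?n2 = "b ^ k + len k"
  have kb: "k < b ^ k" using b by (intro power_gt_expt) auto
  have n1: "?n1 \<ge> n0" "?n1 \<ge> 2 * M" using k(1) kb by linarith+
  have c2: "cnt b x 1 0 ?n2 = cnt b x 1 0 ?n1 + len k"
  proof -
    have "cnt b x 1 0 (?n1 + l) = cnt b x 1 0 ?n1 + l" if "l \<le> len k" for l
      using that
    proof (induction l)
      case (Suc l)
      have "x (b ^ k + l) = 0" using Suc.prems k(2) by (intro x_even) auto
      then have "win b x 1 (b ^ k + l) = 0" by (simp add: win_def)
      with Suc show ?case by (simp add: cnt_Suc)
    qed simp
    then show ?thesis by simp
  qed
  have n1pos: "real ?n1 > 0" using b by simp
  define u where "u = real (cnt b x 1 0 ?n1) / real ?n1"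
  define v where "v = real (cnt b x 1 0 ?n2) / real ?n2"
  define l where "l = real (len k) / real ?n1"
  have uv: "\<bar>u - 1 / real b\<bar> < \<epsilon>" "\<bar>v - 1 / real b\<bar> < \<epsilon>" using n0[of ?n1] n0[of ?n2] n1 unfolding u_def v_def by auto
  have "v * (1 + l) = u + l"
  proof -
    have "?n2 \<noteq> 0" using b by simp
    then have n2: "real ?n2 \<noteq> 0" by (simp only: of_nat_eq_0_iff not_False_eq_True)
    have "v * real ?n2 = real (cnt b x 1 0 ?n2)" by (simp only: v_def times_divide_eq_left nonzero_mult_div_cancel_right[OF n2])
    also have "\<dots> = real (cnt b x 1 0 ?n1) + real (len k)" using c2 by simp
    finally have "v * real ?n2 / real ?n1 = u + l" by (simp add: u_def l_def add_divide_distrib)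
    moreover have "real ?n2 / real ?n1 = 1 + l" using n1pos by (simp add: l_def add_divide_distrib)
    ultimately show ?thesis by (simp flip: times_divide_eq_right)
  qed
  then have e: "v - u = l * (1 - v)" by (simp add: algebra_simps)
  have lM: "l \<ge> 1 / (2 * real M)"
  proof -
    have "b ^ k < M * (len k + 1)" unfolding block_len_def k(3) using M4 by (simp add: dividend_less_times_div)
    then have "b ^ k \<le> 2 * M * len k" using n1(2) by (simp add: distrib_left)
    then have "real ?n1 \<le> 2 * real M * real (len k)" by (metis of_nat_le_iff of_nat_mult of_nat_numeral)
    then show ?thesis using n1pos M4 by (simp add: l_def field_simps)
  qed
  have "1 / real b \<le> 1 / 2" using b by simp
  then have "1 - v \<ge> 1 / 4" using uv(2) \<epsilon> by linarith
  then have "l * (1 - v) \<ge> 1 / (2 * real M) * (1 / 4)" using lM M4 n1pos by (intro mult_mono) (auto simp: l_def)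
  then have "v - u \<ge> 4 * \<epsilon>" using e by (simp add: \<epsilon>_def)
  then show False using uv \<epsilon> by linarith
qed

section \<open>Sparse zeros and arbitrary copies preserve normality\<close>

text \<open>At even scales the block itself is short. At odd scales the block repeats an interval of
  \<open>r\<close> in place of another interval of the same length; by normality of \<open>r\<close>
  both contain the word \<open>w\<close> almost equally often. The minimum with \<open>n\<close>
  allows for counting that stops inside a block.\<close>

lemma block_sum_bound:
  assumes N: "normal_digits b r" and w: "w < b ^ k" and lim: "filterlim (\<lambda>i. m (2 * i)) at_top sequentially"
    and \<epsilon>: "\<epsilon> > 0"
  shows "\<exists>C\<ge>0. \<forall>\<kappa> n. \<bar>\<Sum>i\<in>{b ^ \<kappa>..<min n (b ^ \<kappa> + len \<kappa>)}. of_bool (win b x k i = w) - of_bool (win b r k i = w)\<bar> \<le> C + \<epsilon> * real b ^ \<kappa>"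
proof -
  let ?S = "\<lambda>\<kappa> n. \<Sum>i\<in>{b ^ \<kappa>..<min n (b ^ \<kappa> + len \<kappa>)}. of_bool (win b x k i = w) - of_bool (win b r k i = w) :: real"
  obtain i0 where i0: "\<And>i. i \<ge> i0 \<Longrightarrow> m (2 * i) \<ge> nat \<lceil>1 / \<epsilon>\<rceil>"
    using lim unfolding filterlim_at_top eventually_sequentially by blast
  \<comment> \<open>Two intervals have four end points, all at most \<open>2 * b ^ \<kappa>\<close>;
    four deviations of \<open>\<epsilon> / 8 * (2 * b ^ \<kappa>)\<close> make
    \<open>\<epsilon> * b ^ \<kappa>\<close>.\<close>
  have "\<epsilon> / 8 > 0" using \<epsilon> by simp
  moreover have "(\<lambda>n. real (cnt b r k w n) / real n) \<longlonglongrightarrow> 1 / real b ^ k" using N w unfolding normal_digits_def by blast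
  ultimately obtain C where C: "C \<ge> 0" "\<And>n. \<bar>real (cnt b r k w n) - real n * (1 / real b ^ k)\<bar> \<le> C + \<epsilon> / 8 * real n"
    unfolding limit_ratio_iff by blast
  define C' where "C' = (\<Sum>\<kappa><2 * i0. real (len \<kappa>))"
  have C': "C' \<ge> 0" by (simp add: C'_def sum_nonneg)
  have ev: "\<bar>?S \<kappa> n\<bar> \<le> C' + \<epsilon> * real b ^ \<kappa>" if even: "even \<kappa>" for \<kappa> n
  proof -
    have "\<bar>?S \<kappa> n\<bar> \<le> (\<Sum>i\<in>{b ^ \<kappa>..<min n (b ^ \<kappa> + len \<kappa>)}. 1)"
      by (intro order.trans[OF sum_abs] sum_mono) (auto simp: of_bool_def)
    also have "\<dots> \<le> real (len \<kappa>)" by simp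
    finally have 1: "\<bar>?S \<kappa> n\<bar> \<le> real (len \<kappa>)" .
    show ?thesis
    proof (cases "\<kappa> < 2 * i0")
      case True
      then have "real (len \<kappa>) \<le> C'" unfolding C'_def by (intro member_le_sum) auto
      moreover have "0 \<le> \<epsilon> * real b ^ \<kappa>" using \<epsilon> by simp
      ultimately show ?thesis using 1 by linarith
    next
      case False
      obtain i where i: "\<kappa> = 2 * i" using even by (rule evenE)
      then have "m \<kappa> \<ge> nat \<lceil>1 / \<epsilon>\<rceil>" using i0[of i] False by simp
      then have "1 / \<epsilon> \<le> real (m \<kappa>)" by linarith
      then have 2: "1 / real (m \<kappa>) \<le> \<epsilon>" using \<epsilon> m[of \<kappa>] by (simp add: field_simps)
      have "real (len \<kappa>) \<le> real (b ^ \<kappa>) / real (m \<kappa>)" unfolding block_len_def by (rule of_nat_div_le_of_nat)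
      also have "\<dots> = 1 / real (m \<kappa>) * real b ^ \<kappa>" by simp
      also have "\<dots> \<le> \<epsilon> * real b ^ \<kappa>" using 2 by (intro mult_right_mono) auto
      finally show ?thesis using 1 C' by linarith
    qed
  qed
  have od: "\<bar>?S \<kappa> n\<bar> \<le> real k + 4 * C + \<epsilon> * real b ^ \<kappa>" if odd: "odd \<kappa>" for \<kappa> n
  proof -
    define a where "a = b ^ \<kappa>"
    define t where "t = min n (a + len \<kappa>)"
    define l where "l = len \<kappa>"
    have la: "4 * l \<le> a" using len4[of \<kappa>] by (simp add: l_def a_def)
    have nn: "0 \<le> real k + 4 * C + \<epsilon> * real b ^ \<kappa>" using C \<epsilon> by simp
    show ?thesis
    proof (cases "a \<le> t")
      case False
      then have "{b ^ \<kappa>..<min n (b ^ \<kappa> + len \<kappa>)} = {}" by (simp add: a_def t_def)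
      then show ?thesis using nn by (simp only: sum.empty abs_zero)
    next
      case True
      have tl: "t \<le> a + l" by (simp add: t_def l_def)
      \<comment> \<open>Inside the block the windows are those of \<open>r\<close> shifted by
        \<open>l\<close>; fewer than \<open>k\<close> reach past its end.\<close>
      have D: "\<bar>\<Sum>i\<in>{a..<t}. of_bool (win b x k i = w) - of_bool (win b r k (i - l) = w) :: real\<bar> \<le> real k"
      proof -
        have "\<bar>\<Sum>i\<in>{a..<t}. of_bool (win b x k i = w) - of_bool (win b r k (i - l) = w) :: real\<bar> \<le>
          (\<Sum>i\<in>{a..<t}. of_bool (i \<in> {a + l + 1 - k..<a + l}))"
        proof (intro order.trans[OF sum_abs] sum_mono)
          fix i assume i: "i \<in> {a..<t}"
          show "\<bar>of_bool (win b x k i = w) - of_bool (win b r k (i - l) = w) :: real\<bar> \<le> of_bool (i \<in> {a + l + 1 - k..<a + l})"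
          proof (cases "i + k \<le> a + l")
            case True
            have "win b x k i = win b r k (i - l)"
            proof (rule win_cong)
              fix s assume s: "s < k"
              have "x (i + s) = r (i + s - len \<kappa>)" using s True i odd by (intro x_odd) (auto simp: a_def l_def)
              moreover have "i + s - len \<kappa> = i - l + s" using i la by (simp add: l_def)
              ultimately show "x (i + s) = r (i - l + s)" by simp
            qed
            then show ?thesis by simp
          next
            case False
            then have "i \<in> {a + l + 1 - k..<a + l}" using i tl by auto
            then show ?thesis by (simp add: of_bool_def)
          qed
        qed
        also have "\<dots> = real (card {i\<in>{a..<t}. i \<in> {a + l + 1 - k..<a + l}})"
          by (simp add: of_bool_def sum.If_cases Int_def)
        also have "\<dots> \<le> real (card {a + l + 1 - k..<a + l})" by (intro of_nat_mono card_mono) auto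
        also have "\<dots> \<le> real k" by simp
        finally show ?thesis .
      qed
      have sh: "(\<Sum>i\<in>{a..<t}. of_bool (win b r k (i - c) = w) :: real) = real (cnt b r k w (t - c)) - real (cnt b r k w (a - c))" if c: "c \<le> a" for c
      proof -
        have "(\<Sum>i\<in>{a..<t}. of_bool (win b r k (i - c) = w) :: real) = (\<Sum>i\<in>{a - c..<t - c}. of_bool (win b r k i = w))"
          using c by (intro sum.reindex_bij_witness[of _ "\<lambda>i. i + c" "\<lambda>i. i - c"]) auto
        also have "\<dots> = (\<Sum>i<t - c. of_bool (win b r k i = w)) - (\<Sum>i<a - c. of_bool (win b r k i = w))"
          using sum.atLeastLessThan_concat[of 0 "a - c" "t - c" "\<lambda>i. of_bool (win b r k i = w) :: real"] diff_le_mono[OF True, of c]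
          unfolding lessThan_atLeast0 by linarith
        finally show ?thesis by (simp add: cnt_sum)
      qed
      have "?S \<kappa> n = (\<Sum>i\<in>{a..<t}. of_bool (win b x k i = w) - of_bool (win b r k i = w))"
        by (simp only: a_def t_def)
      also have "\<dots> = (\<Sum>i\<in>{a..<t}. of_bool (win b x k i = w) - of_bool (win b r k (i - l) = w)) +
         ((\<Sum>i\<in>{a..<t}. of_bool (win b r k (i - l) = w)) - (\<Sum>i\<in>{a..<t}. of_bool (win b r k (i - 0) = w)))"
        by (simp add: sum_subtractf)
      finally have S: "?S \<kappa> n = (\<Sum>i\<in>{a..<t}. of_bool (win b x k i = w) - of_bool (win b r k (i - l) = w)) +
         ((real (cnt b r k w (t - l)) - real (cnt b r k w (a - l))) - (real (cnt b r k w t) - real (cnt b r k w a)))"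
        using sh[of l] sh[of 0] la by simp
      define dev where "dev n = real (cnt b r k w n) - real n * (1 / real b ^ k)" for n
      define q where "q = C + \<epsilon> / 4 * real a"
      have dv: "\<bar>dev i\<bar> \<le> q" if "i \<le> 2 * a" for i
      proof -
        have "\<bar>dev i\<bar> \<le> C + \<epsilon> / 8 * real i" using C(2) by (simp only: dev_def)
        also have "\<epsilon> / 8 * real i \<le> \<epsilon> / 8 * real (2 * a)" using that \<epsilon> by (intro mult_left_mono of_nat_mono) auto
        finally show ?thesis by (simp add: q_def)
      qed
      have "(real (cnt b r k w (t - l)) - real (cnt b r k w (a - l))) - (real (cnt b r k w t) - real (cnt b r k w a)) =
         dev (t - l) - dev (a - l) - (dev t - dev a) + ((real (t - l) - real (a - l)) - (real t - real a)) * (1 / real b ^ k)"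
        by (simp add: dev_def algebra_simps)
      also have "(real (t - l) - real (a - l)) - (real t - real a) = 0" using True la by simp
      finally have "(real (cnt b r k w (t - l)) - real (cnt b r k w (a - l))) - (real (cnt b r k w t) - real (cnt b r k w a)) =
         dev (t - l) - dev (a - l) - (dev t - dev a)" by simp
      then have E: "\<bar>(real (cnt b r k w (t - l)) - real (cnt b r k w (a - l))) - (real (cnt b r k w t) - real (cnt b r k w a))\<bar>
          \<le> \<bar>dev (t - l)\<bar> + \<bar>dev (a - l)\<bar> + \<bar>dev t\<bar> + \<bar>dev a\<bar>" by linarith
      moreover have "\<bar>dev (t - l)\<bar> \<le> q" "\<bar>dev (a - l)\<bar> \<le> q"
        "\<bar>dev t\<bar> \<le> q" "\<bar>dev a\<bar> \<le> q"
        using la tl by (intro dv; linarith)+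
      ultimately have "\<bar>(real (cnt b r k w (t - l)) - real (cnt b r k w (a - l))) - (real (cnt b r k w t) - real (cnt b r k w a))\<bar>
          \<le> 4 * q" by linarith
      then have "\<bar>?S \<kappa> n\<bar> \<le> real k + 4 * q" unfolding S by (intro order.trans[OF abs_triangle_ineq add_mono[OF D]])
      then show ?thesis by (simp add: a_def q_def)
    qed
  qed
  have "\<bar>?S \<kappa> n\<bar> \<le> (C' + real k + 4 * C) + \<epsilon> * real b ^ \<kappa>" for \<kappa> n
    using ev[of \<kappa> n] od[of \<kappa> n] C C' by (cases "even \<kappa>") linarith+
  then show ?thesis using C C' by (intro exI[of _ "C' + real k + 4 * C"]) auto
qed

text \<open>The difference of the counts is split into windows starting in a block, where
  \<open>block_sum_bound\<close> gives cancellation, and windows just before a block, at most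
  \<open>k\<close> per scale.\<close>

lemma normal_perturb:
  assumes N: "normal_digits b r" and lim: "filterlim (\<lambda>i. m (2 * i)) at_top sequentially"
  shows "normal_digits b x"
  unfolding normal_digits_def limit_ratio_iff
proof (intro allI impI)
  fix k w :: nat and \<epsilon> :: real assume w: "w < b ^ k" and \<epsilon>: "\<epsilon> > 0"
  let ?T = "\<lambda>i. of_bool (win b x k i = w) - of_bool (win b r k i = w) :: real"
  \<comment> \<open>Two parts for the blocks, one for the constant errors per scale, and one for the
    deviation of \<open>r\<close> itself.\<close>
  define \<delta> where "\<delta> = \<epsilon> / 4"
  have \<delta>: "\<delta> > 0" using \<epsilon> by (simp add: \<delta>_def)
  obtain C1 where C1: "C1 \<ge> 0" "\<And>\<kappa> n. \<bar>\<Sum>i\<in>{b ^ \<kappa>..<min n (b ^ \<kappa> + len \<kappa>)}. ?T i\<bar> \<le> C1 + \<delta> * real b ^ \<kappa>"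
    using block_sum_bound[OF N w lim \<delta>] by blast
  \<comment> \<open>Each scale has the constant error \<open>k + C1\<close>; dividing by it
    beforehand makes the total over all scales at most \<open>\<delta> * b ^ K\<close> plus a
    constant.\<close>
  have "\<delta> / (k + C1 + 1) > 0" using \<delta> C1 by simp
  from scale_sublinear[OF b this] obtain C2 where C2: "C2 \<ge> 0" "\<And>K. real (Suc K) \<le> C2 + \<delta> / (k + C1 + 1) * real b ^ K" by blast
  have "(\<lambda>n. real (cnt b r k w n) / real n) \<longlonglongrightarrow> 1 / real b ^ k" using N w unfolding normal_digits_def by blast
  then obtain C3 where C3: "C3 \<ge> 0" "\<And>n. \<bar>real (cnt b r k w n) - real n * (1 / real b ^ k)\<bar> \<le> C3 + \<delta> * real n"
    using \<delta> unfolding limit_ratio_iff by blast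
  have g: "\<bar>\<Sum>i<n. ?T i\<bar> \<le> C2 * (real k + C1) + 3 * \<delta> * real (Suc n + k)" for n
  proof -
    \<comment> \<open>With \<open>Suc n + k\<close> instead of \<open>n\<close>, the argument is
      positive and all windows counted end below \<open>b ^ Suc K\<close>.\<close>
    obtain K where K: "b ^ K \<le> Suc n + k" "Suc n + k < b ^ Suc K" using ex_scale[OF b, of "Suc n + k"] by auto
    define A where "A = (\<Union>\<kappa>\<le>K. {b ^ \<kappa>..<min n (b ^ \<kappa> + len \<kappa>)})"
    have An: "A \<subseteq> {..<n}" by (auto simp: A_def)
    have "(\<Sum>i<n. ?T i) = (\<Sum>i\<in>{..<n} - A. ?T i) + (\<Sum>i\<in>A. ?T i)"
      using An by (intro sum.subset_diff) auto
    moreover have "\<bar>\<Sum>i\<in>{..<n} - A. ?T i\<bar> \<le> real (Suc K) * real k"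
    proof -
      have "\<bar>\<Sum>i\<in>{..<n} - A. ?T i\<bar> \<le> (\<Sum>i\<in>{..<n} - A. of_bool (i \<in> (\<Union>\<kappa>\<le>K. {b ^ \<kappa> - k..<b ^ \<kappa>})))"
      proof (intro order.trans[OF sum_abs] sum_mono)
        fix i assume i: "i \<in> {..<n} - A"
        show "\<bar>?T i\<bar> \<le> of_bool (i \<in> (\<Union>\<kappa>\<le>K. {b ^ \<kappa> - k..<b ^ \<kappa>}))"
        proof (cases "win b x k i = win b r k i")
          case False
          have "i + k < b ^ Suc K" using i K by auto
          from diff_windows[OF False this] i have "i \<in> (\<Union>\<kappa>\<le>K. {b ^ \<kappa> - k..<b ^ \<kappa>})"
            unfolding A_def by auto
          then show ?thesis by (simp add: of_bool_def)
        qed simp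
      qed
      also have "\<dots> = real (card {i\<in>{..<n} - A. i \<in> (\<Union>\<kappa>\<le>K. {b ^ \<kappa> - k..<b ^ \<kappa>})})"
        by (simp add: of_bool_def sum.If_cases Int_def)
      also have "\<dots> \<le> real (card (\<Union>\<kappa>\<le>K. {b ^ \<kappa> - k..<b ^ \<kappa>}))" by (intro of_nat_mono card_mono) auto
      also have "\<dots> \<le> real (Suc K * k)" by (intro of_nat_mono card_edges)
      finally show ?thesis by (simp only: of_nat_mult)
    qed
    moreover have "\<bar>\<Sum>i\<in>A. ?T i\<bar> \<le> real (Suc K) * C1 + \<delta> * (2 * real b ^ K)"
    proof -
      have disj: "{b ^ \<kappa>..<min n (b ^ \<kappa> + len \<kappa>)} \<inter> {b ^ \<kappa>'..<min n (b ^ \<kappa>' + len \<kappa>')} = {}" if "\<kappa> \<noteq> \<kappa>'" for \<kappa> \<kappa>'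
      proof (rule ccontr)
        assume "\<not> ?thesis"
        then obtain i where i: "i \<in> {b ^ \<kappa>..<min n (b ^ \<kappa> + len \<kappa>)}" "i \<in> {b ^ \<kappa>'..<min n (b ^ \<kappa>' + len \<kappa>')}" by blast
        have "scale b i = \<kappa>" using i(1) by (intro in_block) simp_all
        moreover have "scale b i = \<kappa>'" using i(2) by (intro in_block) simp_all
        ultimately show False using that by simp
      qed
      have A: "(\<Sum>i\<in>A. ?T i) = (\<Sum>\<kappa>\<le>K. \<Sum>i\<in>{b ^ \<kappa>..<min n (b ^ \<kappa> + len \<kappa>)}. ?T i)"
        unfolding A_def by (rule sum.UNION_disjoint) (simp, simp, use disj in blast)
      have "\<bar>\<Sum>i\<in>A. ?T i\<bar> \<le> (\<Sum>\<kappa>\<le>K. C1 + \<delta> * real b ^ \<kappa>)"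
        unfolding A by (rule order.trans[OF sum_abs], rule sum_mono, rule C1(2))
      also have "\<dots> = real (Suc K) * C1 + \<delta> * (\<Sum>\<kappa>\<le>K. real b ^ \<kappa>)" by (simp only: sum.distrib sum_distrib_left sum_constant card_atMost)
      also have "\<dots> \<le> real (Suc K) * C1 + \<delta> * (2 * real b ^ K)" using sum_powers_le \<delta> by (intro add_left_mono mult_left_mono) auto
      finally show ?thesis .
    qed
    ultimately have "\<bar>\<Sum>i<n. ?T i\<bar> \<le> real (Suc K) * (real k + C1) + \<delta> * (2 * real b ^ K)" unfolding distrib_left by linarith
    also have "real (Suc K) * (real k + C1) \<le> (C2 + \<delta> / (k + C1 + 1) * real b ^ K) * (real k + C1)"
      using C2 C1 by (intro mult_right_mono) auto
    also have "\<dots> = C2 * (real k + C1) + \<delta> * real b ^ K * ((real k + C1) / (k + C1 + 1))" by (simp add: distrib_right)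
    also have "\<delta> * real b ^ K * ((real k + C1) / (k + C1 + 1)) \<le> \<delta> * real b ^ K * 1"
      using \<delta> C1 by (intro mult_left_mono) auto
    finally have "\<bar>\<Sum>i<n. ?T i\<bar> \<le> C2 * (real k + C1) + 3 * \<delta> * real b ^ K" by simp
    also have "\<dots> \<le> C2 * (real k + C1) + 3 * \<delta> * real (Suc n + k)"
      using of_nat_mono[OF K(1), where 'a = real] \<delta> by (intro add_left_mono mult_left_mono) auto
    finally show ?thesis .
  qed
  have "\<bar>real (cnt b x k w n) - real n * (1 / real b ^ k)\<bar> \<le> (C2 * (real k + C1) + 3 * \<delta> * (1 + real k) + C3) + \<epsilon> * real n" for n
  proof -
    have "real (cnt b x k w n) - real (cnt b r k w n) = (\<Sum>i<n. ?T i)" by (simp add: cnt_sum sum_subtractf)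
    then have "\<bar>real (cnt b x k w n) - real n * (1 / real b ^ k)\<bar> \<le> C2 * (real k + C1) + 3 * \<delta> * real (Suc n + k) + (C3 + \<delta> * real n)"
      using g[of n] C3(2)[of n] by linarith
    also have "\<dots> = (C2 * (real k + C1) + 3 * \<delta> * (1 + real k) + C3) + \<epsilon> * real n"
      by (simp add: \<delta>_def field_simps)
    finally show ?thesis .
  qed
  then show "\<exists>C\<ge>0. \<forall>n. \<bar>real (cnt b x k w n) - real n * (1 / real b ^ k)\<bar> \<le> C + \<epsilon> * real n"
    using C1 C2 C3 \<delta> by (intro exI[of _ "C2 * (real k + C1) + 3 * \<delta> * (1 + real k) + C3"]) auto
qed

end

section \<open>Base expansions\<close>

lemma occurrences_eq_cnt:
  assumes d: "\<And>i. d (Suc i) < b" and w: "w \<in> words b k"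
  shows "occurrences w (map d [1..<Suc n]) = cnt b (\<lambda>i. d (Suc i)) k (\<Sum>t<k. w ! t * b ^ t) (n + 1 - k)"
proof -
  have lw: "length w = k" using w by (simp add: words_def)
  have "i + k \<le> n \<and> take k (drop i (map d [1..<Suc n])) = w \<longleftrightarrow>
     i < n + 1 - k \<and> win b (\<lambda>i. d (Suc i)) k i = (\<Sum>t<k. w ! t * b ^ t)" for i
  proof (cases "i + k \<le> n")
    case True
    have A: "take k (drop i (map d [1..<Suc n])) = map (\<lambda>t. d (Suc (i + t))) [0..<k]"
      using True by (intro nth_equalityI) (simp_all del: upt_Suc)
    have "take k (drop i (map d [1..<Suc n])) = w \<longleftrightarrow> (\<forall>t<k. d (Suc (i + t)) = w ! t)"
      unfolding A using lw by (simp add: list_eq_iff_nth_eq)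
    also have "\<dots> \<longleftrightarrow> win b (\<lambda>i. d (Suc i)) k i = (\<Sum>t<k. w ! t * b ^ t)"
      unfolding win_def
    proof
      assume "\<forall>t<k. d (Suc (i + t)) = w ! t"
      then show "(\<Sum>t<k. d (Suc (i + t)) * b ^ t) = (\<Sum>t<k. w ! t * b ^ t)" by (intro sum.cong) auto
    next
      assume "(\<Sum>t<k. d (Suc (i + t)) * b ^ t) = (\<Sum>t<k. w ! t * b ^ t)"
      from digit_sum_eqD[OF d words_nth[OF w] this] show "\<forall>t<k. d (Suc (i + t)) = w ! t" by blast
    qed
    finally have "take k (drop i (map d [1..<Suc n])) = w \<longleftrightarrow> win b (\<lambda>i. d (Suc i)) k i = (\<Sum>t<k. w ! t * b ^ t)" .
    moreover have "i < n + 1 - k" using True by linarith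
    ultimately show ?thesis using True by blast
  next
    case False
    then have "\<not> i < n + 1 - k" by linarith
    with False show ?thesis by blast
  qed
  then have "{i. i + k \<le> n \<and> take k (drop i (map d [1..<Suc n])) = w} =
     {i. i < n + 1 - k \<and> win b (\<lambda>i. d (Suc i)) k i = (\<Sum>t<k. w ! t * b ^ t)}" by blast
  then show ?thesis unfolding occurrences_def cnt_def lw by (simp del: upt_Suc)
qed

lemma bij_word_code: assumes b: "b > 0"
  shows "bij_betw (\<lambda>w. \<Sum>t<k. w ! t * b ^ t) (words b k) {..<b ^ k}"
proof (rule bij_betw_byWitness[where f' = "\<lambda>c. map (\<lambda>t. c div b ^ t mod b) [0..<k]"])
  show "\<forall>w\<in>words b k. map (\<lambda>t. (\<Sum>t<k. w ! t * b ^ t) div b ^ t mod b) [0..<k] = w"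
  proof
    fix w assume w: "w \<in> words b k"
    have "(\<Sum>t<k. w ! t * b ^ t) div b ^ t mod b = w ! t" if "t < k" for t
      using digit_digit_sum[of k "\<lambda>t. w ! t" b t] words_nth[OF w] that by (simp add: digit_def)
    then show "map (\<lambda>t. (\<Sum>t<k. w ! t * b ^ t) div b ^ t mod b) [0..<k] = w"
      using w by (intro nth_equalityI) (simp_all add: words_def)
  qed
  show "\<forall>c\<in>{..<b ^ k}. (\<Sum>t<k. map (\<lambda>t. c div b ^ t mod b) [0..<k] ! t * b ^ t) = c"
  proof
    fix c assume c: "c \<in> {..<b ^ k}"
    have "(\<Sum>t<k. map (\<lambda>t. c div b ^ t mod b) [0..<k] ! t * b ^ t) = (\<Sum>t<k. c div b ^ t mod b * b ^ t)"
      by (intro sum.cong) auto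
    then show "(\<Sum>t<k. map (\<lambda>t. c div b ^ t mod b) [0..<k] ! t * b ^ t) = c" using digit_expansion[of c b k] c by simp
  qed
  show "(\<lambda>w. \<Sum>t<k. w ! t * b ^ t) ` words b k \<subseteq> {..<b ^ k}"
    using words_nth by (auto intro!: digit_sum_less)
  show "(\<lambda>c. map (\<lambda>t. c div b ^ t mod b) [0..<k]) ` {..<b ^ k} \<subseteq> words b k"
    using b by (auto simp: words_def)
qed

lemma Z_eq_cls:
  assumes b: "b > 0" and d: "\<And>i. d (Suc i) < b" and lam: "lam > 0"
  shows "Z b lam j k d = real (cls b (\<lambda>i. d (Suc i)) k j (nat \<lfloor>lam * real b ^ k\<rfloor> + 1)) / real b ^ k"
proof -
  let ?N = "nat \<lfloor>lam * real b ^ k\<rfloor> + 1" and ?c = "\<lambda>w. \<Sum>t<k. w ! t * b ^ t"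
  have "lam * real b ^ k \<ge> 0" using lam by simp
  then have "\<lfloor>lam * real b ^ k + real k\<rfloor> = \<lfloor>lam * real b ^ k\<rfloor> + int k" by (simp add: floor_add_int[symmetric])
  moreover have "\<lfloor>lam * real b ^ k\<rfloor> \<ge> 0" using lam by simp
  ultimately have "nat \<lfloor>lam * real b ^ k + real k\<rfloor> = nat \<lfloor>lam * real b ^ k\<rfloor> + k" by (simp add: nat_add_distrib)
  then have r: "restrict_to d (lam * real b ^ k + real k) = map d [1..<Suc (nat \<lfloor>lam * real b ^ k\<rfloor> + k)]"
    by (simp add: restrict_to_def del: upt_Suc)
  have o: "occurrences w (restrict_to d (lam * real b ^ k + real k)) = cnt b (\<lambda>i. d (Suc i)) k (?c w) ?N" if "w \<in> words b k" for w
    unfolding r occurrences_eq_cnt[where d = d, OF d that] by simp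
  have "card {w \<in> words b k. occurrences w (restrict_to d (lam * real b ^ k + real k)) = j} =
     card {c. c < b ^ k \<and> cnt b (\<lambda>i. d (Suc i)) k c ?N = j}"
  proof (rule bij_betw_same_card[of ?c])
    have B: "bij_betw ?c (words b k) {..<b ^ k}" by (rule bij_word_code[OF b])
    have "?c ` {w \<in> words b k. occurrences w (restrict_to d (lam * real b ^ k + real k)) = j} = {c. c < b ^ k \<and> cnt b (\<lambda>i. d (Suc i)) k c ?N = j}"
    proof (intro set_eqI iffI)
      fix c assume "c \<in> ?c ` {w \<in> words b k. occurrences w (restrict_to d (lam * real b ^ k + real k)) = j}"
      then obtain w where w: "w \<in> words b k" "occurrences w (restrict_to d (lam * real b ^ k + real k)) = j" "c = ?c w" by blast
      then show "c \<in> {c. c < b ^ k \<and> cnt b (\<lambda>i. d (Suc i)) k c ?N = j}" using o[OF w(1)] B by (auto simp: bij_betw_def)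
    next
      fix c assume c: "c \<in> {c. c < b ^ k \<and> cnt b (\<lambda>i. d (Suc i)) k c ?N = j}"
      then have "c \<in> ?c ` words b k" using B by (auto simp: bij_betw_def)
      then obtain w where w: "w \<in> words b k" "c = ?c w" by blast
      then show "c \<in> ?c ` {w \<in> words b k. occurrences w (restrict_to d (lam * real b ^ k + real k)) = j}" using c o[OF w(1)] by auto
    qed
    then show "bij_betw ?c {w \<in> words b k. occurrences w (restrict_to d (lam * real b ^ k + real k)) = j} {c. c < b ^ k \<and> cnt b (\<lambda>i. d (Suc i)) k c ?N = j}"
      using B unfolding bij_betw_def by (auto intro: inj_on_subset)
  qed
  then show ?thesis by (simp add: Z_def cls_def)
qed

lemma Poisson_expansion_iff:
  assumes "b > 0" "\<And>i. d (Suc i) < b"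
  shows "Poisson_generic_expansion b d \<longleftrightarrow> Poisson_digits b (\<lambda>i. d (Suc i))"
  unfolding Poisson_generic_expansion_def Poisson_digits_def
  by (intro all_cong1 imp_cong refl) (simp add: Z_eq_cls[where d = d, OF assms])

text \<open>Counting windows by starting position instead of by containment in the prefix changes a
  count by at most \<open>k + 1\<close>, which vanishes after division by \<open>n\<close>.\<close>

lemma normal_expansion_iff:
  assumes b: "b > 0" and d: "\<And>i. d (Suc i) < b"
  shows "normal_expansion b d \<longleftrightarrow> normal_digits b (\<lambda>i. d (Suc i))"
proof -
  let ?c = "\<lambda>k w. \<Sum>t<k. w ! t * b ^ t"
  let ?D = "\<lambda>i. d (Suc i)"
  have 1: "(\<lambda>n. real (occurrences w (restrict_to d (real n))) / real n) \<longlonglongrightarrow> 1 / real b ^ k \<longleftrightarrow>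
     (\<lambda>n. real (cnt b ?D k (?c k w) n) / real n) \<longlonglongrightarrow> 1 / real b ^ k" if w: "w \<in> words b k" for w k
  proof -
    have o: "occurrences w (restrict_to d (real n)) = cnt b ?D k (?c k w) (n + 1 - k)" for n
      using occurrences_eq_cnt[where d = d, OF d w, of n] by (simp add: restrict_to_def del: upt_Suc)
    have g0: "(\<lambda>n. real (k + 1) * (1 / real n)) \<longlonglongrightarrow> 0" by (rule tendsto_mult_right_zero) (rule lim_1_over_n)
    have z: "(\<lambda>n. real (cnt b ?D k (?c k w) n) / real n - real (occurrences w (restrict_to d (real n))) / real n) \<longlonglongrightarrow> 0"
    proof (rule null_comparison[OF _ g0], rule always_eventually, rule allI)
      fix n
      have "cnt b ?D k (?c k w) n \<le> cnt b ?D k (?c k w) (n + 1 - k) + (k + 1) \<and> cnt b ?D k (?c k w) (n + 1 - k) \<le> cnt b ?D k (?c k w) n + (k + 1)"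
      proof (cases "n + 1 - k \<le> n")
        case True
        show ?thesis using cnt_diff_le[OF True, of b ?D k "?c k w"] cnt_mono[OF True, of b ?D k "?c k w"] by linarith
      next
        case False
        then have "n \<le> n + 1 - k" by simp
        from cnt_diff_le[OF this, of b ?D k "?c k w"] cnt_mono[OF this, of b ?D k "?c k w"] show ?thesis by linarith
      qed
      then have "\<bar>real (cnt b ?D k (?c k w) n) - real (cnt b ?D k (?c k w) (n + 1 - k))\<bar> \<le> real (k + 1)"
        unfolding abs_le_iff by linarith
      then have "\<bar>real (cnt b ?D k (?c k w) n) - real (cnt b ?D k (?c k w) (n + 1 - k))\<bar> / real n \<le> real (k + 1) / real n"
        by (intro divide_right_mono) auto
      then show "\<bar>real (cnt b ?D k (?c k w) n) / real n - real (occurrences w (restrict_to d (real n))) / real n\<bar> \<le> real (k + 1) * (1 / real n)"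
        unfolding o by (simp add: abs_divide flip: diff_divide_distrib)
    qed
    show ?thesis
    proof
      assume "(\<lambda>n. real (occurrences w (restrict_to d (real n))) / real n) \<longlonglongrightarrow> 1 / real b ^ k"
      from tendsto_add[OF z this] show "(\<lambda>n. real (cnt b ?D k (?c k w) n) / real n) \<longlonglongrightarrow> 1 / real b ^ k" by simp
    next
      assume "(\<lambda>n. real (cnt b ?D k (?c k w) n) / real n) \<longlonglongrightarrow> 1 / real b ^ k"
      from tendsto_diff[OF this z] show "(\<lambda>n. real (occurrences w (restrict_to d (real n))) / real n) \<longlonglongrightarrow> 1 / real b ^ k" by simp
    qed
  qed
  have im: "?c k ` words b k = {..<b ^ k}" for k using bij_word_code[OF b, of k] by (simp add: bij_betw_def)
  have "normal_expansion b d \<longleftrightarrow> (\<forall>k. \<forall>w\<in>words b k. (\<lambda>n. real (cnt b ?D k (?c k w) n) / real n) \<longlonglongrightarrow> 1 / real b ^ k)"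
    unfolding normal_expansion_def using 1 by blast
  also have "\<dots> \<longleftrightarrow> (\<forall>k. \<forall>w\<in>?c k ` words b k. (\<lambda>n. real (cnt b ?D k w n) / real n) \<longlonglongrightarrow> 1 / real b ^ k)" by simp
  finally show ?thesis unfolding im normal_digits_def by (simp only: Ball_def lessThan_iff)
qed

section \<open>Digits of a real from comparisons with rationals\<close>

text \<open>For \<open>0 < x < 1\<close> this equals \<open>\<lceil>x * b ^ j\<rceil> - 1\<close>,
  the number formed by the first \<open>j\<close> digits. The strict comparison selects the
  expansion with infinitely many nonzero digits, and a count of comparisons can be read from an
  oracle.\<close>

definition below :: "nat \<Rightarrow> real \<Rightarrow> nat \<Rightarrow> nat" where
  "below b x j = card {p. p < b ^ j \<and> (0 < p \<and> real p / real (b ^ j) < x)}"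

definition digits :: "nat \<Rightarrow> real \<Rightarrow> nat \<Rightarrow> nat" where
  "digits b x j = below b x (Suc j) mod b"

lemma below_eq:
  assumes b: "b > 0" and M: "real M / real (b ^ j) < x" "x \<le> real (Suc M) / real (b ^ j)" and x: "x < 1"
  shows "below b x j = M"
proof -
  have bj: "real (b ^ j) > 0" using b by simp
  have "real M < x * real (b ^ j)" using M(1) bj by (simp only: pos_divide_less_eq)
  also have "\<dots> \<le> 1 * real (b ^ j)" using x by (intro mult_right_mono) auto
  finally have "real M < real (b ^ j)" by (simp only: mult_1)
  then have Mb: "M < b ^ j" by (simp only: of_nat_less_iff)
  have "p < b ^ j \<and> (0 < p \<and> real p / real (b ^ j) < x) \<longleftrightarrow> p \<in> {1..M}" for p
  proof
    assume p: "p < b ^ j \<and> (0 < p \<and> real p / real (b ^ j) < x)"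
    then have "real p / real (b ^ j) < real (Suc M) / real (b ^ j)" using M(2) by linarith
    then have "real p < real (Suc M)" using bj by (simp only: divide_less_cancel)
    then show "p \<in> {1..M}" using p by auto
  next
    assume p: "p \<in> {1..M}"
    then have "real p / real (b ^ j) \<le> real M / real (b ^ j)" using bj by (intro divide_right_mono) auto
    then show "p < b ^ j \<and> (0 < p \<and> real p / real (b ^ j) < x)" using p Mb M(1) by auto
  qed
  then have "{p. p < b ^ j \<and> (0 < p \<and> real p / real (b ^ j) < x)} = {1..M}" by blast
  then show ?thesis by (simp only: below_def card_atLeastAtMost)
qed

lemma below_bounds:
  assumes b: "b > 0" and x: "0 < x" "x < 1"
  shows "real (below b x j) / real (b ^ j) < x" "x \<le> real (Suc (below b x j)) / real (b ^ j)"
proof -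
  have bj: "real (b ^ j) > 0" using b by simp
  define M where "M = nat (\<lceil>x * real (b ^ j)\<rceil> - 1)"
  have "\<lceil>x * real (b ^ j)\<rceil> \<ge> 1" using x bj by (simp add: less_ceiling_iff int_one_le_iff_zero_less)
  then have "real M = of_int \<lceil>x * real (b ^ j)\<rceil> - 1" by (simp add: M_def)
  then have "real M < x * real (b ^ j)" "x * real (b ^ j) \<le> real (Suc M)" by linarith+
  then have M: "real M / real (b ^ j) < x" "x \<le> real (Suc M) / real (b ^ j)" using bj by (simp_all add: field_simps)
  from below_eq[OF b M x(2)] M show "real (below b x j) / real (b ^ j) < x" "x \<le> real (Suc (below b x j)) / real (b ^ j)"
    by simp_all
qed

text \<open>Dropping the last digit preserves the two inequalities that characterise
  \<open>below\<close>.\<close>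

lemma below_Suc_div:
  assumes b: "b > 0" and x: "0 < x" "x < 1"
  shows "below b x (Suc j) div b = below b x j"
proof -
  let ?M = "below b x (Suc j)"
  have bj: "real (b ^ j) > 0" "real b > 0" using b by auto
  have 1: "real (?M div b) / real (b ^ j) < x"
  proof -
    have "real (?M div b) \<le> real ?M / real b" by (rule of_nat_div_le_of_nat)
    then have "real (?M div b) / real (b ^ j) \<le> real ?M / real b / real (b ^ j)" using bj by (intro divide_right_mono) auto
    also have "\<dots> = real ?M / real (b ^ Suc j)" by simp
    finally show ?thesis using below_bounds(1)[OF b x, of "Suc j"] by linarith
  qed
  have 2: "x \<le> real (Suc (?M div b)) / real (b ^ j)"
  proof -
    have "Suc ?M \<le> b * Suc (?M div b)" using dividend_less_times_div[OF b, of ?M] by simp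
    then have "real (Suc ?M) \<le> real b * real (Suc (?M div b))" by (metis of_nat_le_iff of_nat_mult)
    then have "real (Suc ?M) / real (b ^ Suc j) \<le> real b * real (Suc (?M div b)) / real (b ^ Suc j)" by (intro divide_right_mono) auto
    also have "\<dots> = real (Suc (?M div b)) / real (b ^ j)" using bj by simp
    finally show ?thesis using below_bounds(2)[OF b x, of "Suc j"] by linarith
  qed
  show ?thesis using below_eq[OF b 1 2 x(2)] by simp
qed

lemma below_Suc:
  assumes b: "b > 0" and x: "0 < x" "x < 1"
  shows "below b x (Suc j) = b * below b x j + digits b x j"
  using below_Suc_div[OF assms, of j] mult_div_mod_eq[of b "below b x (Suc j)"] unfolding digits_def by simp

lemma below_0: "below b x 0 = 0"
proof -
  have "{p. p < b ^ 0 \<and> (0 < p \<and> real p / real (b ^ 0) < x)} = {}" by auto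
  then show ?thesis by (simp only: below_def card.empty)
qed

lemma digits_partial_sum:
  assumes b: "b > 0" and x: "0 < x" "x < 1"
  shows "(\<Sum>i<n. real (digits b x i) / real b ^ Suc i) = real (below b x n) / real (b ^ n)"
proof (induction n)
  case (Suc n)
  have "real (below b x (Suc n)) / real (b ^ Suc n) = real (below b x n) / real (b ^ n) + real (digits b x n) / real b ^ Suc n"
    using b by (simp add: below_Suc[OF assms] add_divide_distrib)
  then show ?case using Suc by simp
qed (simp add: below_0)

lemma digits_less: "b > 0 \<Longrightarrow> digits b x j < b" by (simp add: digits_def)

lemma is_expansion_digits:
  assumes b: "b \<ge> 2" and x: "0 < x" "x < 1"
  shows "is_expansion b x (\<lambda>j. digits b x (j - 1))"
  unfolding is_expansion_def
proof (intro conjI allI impI)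
  have b0: "b > 0" using b by simp
  show "digits b x (j - 1) < b" for j by (rule digits_less[OF b0])
  have "(\<lambda>n. x - real (below b x n) / real (b ^ n)) \<longlonglongrightarrow> 0"
  proof (rule null_comparison)
    show "(\<lambda>n. (1 / real b) ^ n) \<longlonglongrightarrow> 0" using b by (intro LIMSEQ_power_zero) auto
    show "eventually (\<lambda>n. \<bar>x - real (below b x n) / real (b ^ n)\<bar> \<le> (1 / real b) ^ n) sequentially"
    proof (intro always_eventually allI)
      fix n
      have "real (Suc (below b x n)) / real (b ^ n) = real (below b x n) / real (b ^ n) + (1 / real b) ^ n"
        by (simp add: add_divide_distrib power_divide)
      then show "\<bar>x - real (below b x n) / real (b ^ n)\<bar> \<le> (1 / real b) ^ n"
        using below_bounds[OF b0 x, of n] by linarith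
    qed
  qed
  from tendsto_diff[OF tendsto_const[of x] this] have "(\<lambda>n. real (below b x n) / real (b ^ n)) \<longlonglongrightarrow> x" by simp
  then show "(\<lambda>j. real (digits b x (Suc j - 1)) / real b ^ Suc j) sums x"
    unfolding sums_def digits_partial_sum[OF b0 x, symmetric] by simp
  show "infinite {j. j \<ge> 1 \<and> digits b x (j - 1) \<noteq> 0}"
  proof
    \<comment> \<open>If the digits vanished from \<open>J\<close> on, \<open>x\<close> would equal
      its partial sum, which lies strictly below \<open>x\<close>.\<close>
    assume "finite {j. j \<ge> 1 \<and> digits b x (j - 1) \<noteq> 0}"
    then obtain J where J: "\<And>j. j \<ge> 1 \<Longrightarrow> digits b x (j - 1) \<noteq> 0 \<Longrightarrow> j < J"
      unfolding finite_nat_set_iff_bounded by auto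
    have z: "digits b x i = 0" if "i \<ge> J" for i using J[of "Suc i"] that by fastforce
    have "(\<Sum>i<J + n. real (digits b x i) / real b ^ Suc i) = (\<Sum>i<J. real (digits b x i) / real b ^ Suc i)" for n
      by (induction n) (simp_all add: z)
    then have "real (below b x (J + n)) / real (b ^ (J + n)) = real (below b x J) / real (b ^ J)" for n
      by (simp only: digits_partial_sum[OF b0 x])
    then have "(\<lambda>n. real (below b x (n + J)) / real (b ^ (n + J))) \<longlonglongrightarrow> real (below b x J) / real (b ^ J)"
      by (simp only: add.commute[of _ J] tendsto_const)
    moreover have "(\<lambda>n. real (below b x (n + J)) / real (b ^ (n + J))) \<longlonglongrightarrow> x"
      using \<open>(\<lambda>n. real (below b x n) / real (b ^ n)) \<longlonglongrightarrow> x\<close> by (rule LIMSEQ_ignore_initial_segment)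
    ultimately have "x = real (below b x J) / real (b ^ J)" using LIMSEQ_unique by blast
    then show False using below_bounds(1)[OF b0 x, of J] by simp
  qed
qed

text \<open>Since nonzero digits recur, partial sums stay strictly below \<open>x\<close>; a tail
  after \<open>n\<close> digits is at most \<open>1 / b ^ n\<close>. These two bounds determine
  \<open>below\<close>, hence the digits.\<close>

lemma expansion_digits:
  assumes b: "b \<ge> 2" and e: "is_expansion b x d" and x: "x < 1"
  shows "d (Suc j) = digits b x j" and "0 < x"
proof -
  have b0: "b > 0" using b by simp
  have d: "d (Suc i) < b" for i using e by (simp add: is_expansion_def)
  let ?f = "\<lambda>i. real (d (Suc i)) / real b ^ Suc i"
  define M where "M n = (\<Sum>i<n. d (Suc i) * b ^ (n - Suc i))" for n
  have MSuc: "M (Suc n) = b * M n + d (Suc n)" for n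
  proof -
    have "(\<Sum>i<n. d (Suc i) * b ^ (Suc n - Suc i)) = (\<Sum>i<n. b * (d (Suc i) * b ^ (n - Suc i)))"
      by (intro sum.cong refl) (auto simp: Suc_diff_Suc[symmetric] simp del: diff_Suc_Suc)
    then show ?thesis by (simp add: M_def sum_distrib_left)
  qed
  have part: "(\<Sum>i<n. ?f i) = real (M n) / real (b ^ n)" for n
  proof (induction n)
    case (Suc n)
    have "real (M (Suc n)) / real (b ^ Suc n) = real (M n) / real (b ^ n) + ?f n"
      using b by (simp add: MSuc add_divide_distrib)
    then show ?case using Suc by simp
  qed (simp add: M_def)
  have sm: "?f sums x" and inf: "infinite {j. j \<ge> 1 \<and> d j \<noteq> 0}" using e by (auto simp: is_expansion_def)
  have lower: "real (M n) / real (b ^ n) < x" for n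
  proof -
    obtain j where j: "j \<ge> Suc n" "j \<ge> 1 \<and> d j \<noteq> 0" using infinite_nat_ex_ge[OF inf] by blast
    then obtain i where i: "j = Suc i" "i \<ge> n" by (cases j) auto
    have "real (M n) / real (b ^ n) = (\<Sum>i<n. ?f i)" using part by simp
    also have "\<dots> < (\<Sum>i<n. ?f i) + ?f i" using j i b by simp
    also have "\<dots> \<le> (\<Sum>i<Suc i. ?f i)"
    proof -
      have "(\<Sum>i<n. ?f i) \<le> (\<Sum>i<i. ?f i)" using i(2) by (intro sum_mono2) auto
      then show ?thesis by simp
    qed
    also have "\<dots> \<le> x" using sm sum_le_suminf[of ?f "{..<Suc i}"] by (auto simp: sums_iff)
    finally show ?thesis .
  qed
  have upper: "x \<le> real (Suc (M n)) / real (b ^ n)" for n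
  proof (rule LIMSEQ_le_const2)
    show "(\<lambda>N. \<Sum>i<N. ?f i) \<longlonglongrightarrow> x" using sm by (simp add: sums_def)
    have "(\<Sum>i<n + N. ?f i) \<le> real (M n) / real (b ^ n) + 1 / real (b ^ n) - 1 / real (b ^ (n + N))" for N
    proof (induction N)
      case 0
      show ?case using part[of n] by simp
    next
      case (Suc N)
      have "real (d (Suc (n + N))) \<le> real b - 1" using d[of "n + N"] by linarith
      then have "?f (n + N) \<le> (real b - 1) / real b ^ Suc (n + N)" by (intro divide_right_mono) auto
      also have "\<dots> = 1 / real (b ^ (n + N)) - 1 / real (b ^ (n + Suc N))" using b by (simp add: diff_divide_distrib)
      finally show ?case using Suc by simp
    qed
    then have le: "(\<Sum>i<n + N. ?f i) \<le> real (Suc (M n)) / real (b ^ n)" for N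
      by (rule order.trans) (simp add: add_divide_distrib)
    show "\<exists>N. \<forall>m\<ge>N. (\<Sum>i<m. ?f i) \<le> real (Suc (M n)) / real (b ^ n)"
    proof (intro exI[of _ n] allI impI)
      fix m assume "n \<le> m"
      then show "(\<Sum>i<m. ?f i) \<le> real (Suc (M n)) / real (b ^ n)" using le[of "m - n"] by simp
    qed
  qed
  have M: "below b x n = M n" for n by (rule below_eq[OF b0 lower upper x])
  show "d (Suc j) = digits b x j" unfolding digits_def M MSuc using d[of j] by simp
  show "0 < x" using lower[of 0] by (simp add: M_def)
qed

lemma normal_numbers_iff:
  assumes b: "b \<ge> 2"
  shows "x \<in> normal_numbers b \<longleftrightarrow> 0 < x \<and> x < 1 \<and> normal_digits b (digits b x)"
proof
  assume "x \<in> normal_numbers b"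
  then obtain d where x: "0 \<le> x" "x < 1" and d: "is_expansion b x d" "normal_expansion b d" by (auto simp: normal_numbers_def)
  note e = expansion_digits[OF b d(1) x(2)]
  have "d (Suc i) < b" for i using d(1) by (simp add: is_expansion_def)
  then have "normal_digits b (\<lambda>i. d (Suc i))" using normal_expansion_iff[of b d] d(2) b by simp
  then show "0 < x \<and> x < 1 \<and> normal_digits b (digits b x)" using e x by simp
next
  assume x: "0 < x \<and> x < 1 \<and> normal_digits b (digits b x)"
  have "normal_expansion b (\<lambda>j. digits b x (j - 1))"
    using normal_expansion_iff[of b "\<lambda>j. digits b x (j - 1)"] digits_less[of b x] b x by simp
  then show "x \<in> normal_numbers b" using is_expansion_digits[OF b, of x] x unfolding normal_numbers_def by auto
qed

lemma Poisson_numbers_iff: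
  assumes b: "b \<ge> 2"
  shows "x \<in> Poisson_generic_numbers b \<longleftrightarrow> 0 < x \<and> x < 1 \<and> Poisson_digits b (digits b x)"
proof
  assume "x \<in> Poisson_generic_numbers b"
  then obtain d where x: "0 \<le> x" "x < 1" and d: "is_expansion b x d" "Poisson_generic_expansion b d"
    by (auto simp: Poisson_generic_numbers_def)
  note e = expansion_digits[OF b d(1) x(2)]
  have "d (Suc i) < b" for i using d(1) by (simp add: is_expansion_def)
  then have "Poisson_digits b (\<lambda>i. d (Suc i))" using Poisson_expansion_iff[of b d] d(2) b by simp
  then show "0 < x \<and> x < 1 \<and> Poisson_digits b (digits b x)" using e x by simp
next
  assume x: "0 < x \<and> x < 1 \<and> Poisson_digits b (digits b x)"
  have "Poisson_generic_expansion b (\<lambda>j. digits b x (j - 1))"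
    using Poisson_expansion_iff[of b "\<lambda>j. digits b x (j - 1)"] digits_less[of b x] b x by simp
  then show "x \<in> Poisson_generic_numbers b" using is_expansion_digits[OF b, of x] x unfolding Poisson_generic_numbers_def by auto
qed

section \<open>Membership in the class\<close>

text \<open>The parameter \<open>p\<close> lets the sequence itself depend on a variable, as it does
  on a prefix code in \<open>decidable_good\<close>.\<close>

lemma recursive_win:
  assumes D: "recursive (Suc (Suc 0)) (\<lambda>z e. D z (e 0) (e (Suc 0)))"
    and "recursive n p" "recursive n k" "recursive n i"
  shows "recursive n (\<lambda>z e. win b (D z (p z e)) (k z e) (i z e))"
proof -
  have "recursive (Suc (Suc (Suc 0))) (\<lambda>z e. win b (D z (e 0)) (e (Suc 0)) (e (Suc (Suc 0))))"
    unfolding win_def by (intro recursive_sum recursive_mult recursive_pow recursive_const recursive_comp2[where f = D, OF D] recursive_add recursive_var) simp_all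
  from recursive_comp3[where f = "\<lambda>z p k i. win b (D z p) k i", OF this assms(2-)] show ?thesis .
qed

lemma recursive_cnt:
  assumes D: "recursive (Suc (Suc 0)) (\<lambda>z e. D z (e 0) (e (Suc 0)))"
    and "recursive n p" "recursive n k" "recursive n w" "recursive n m"
  shows "recursive n (\<lambda>z e. cnt b (D z (p z e)) (k z e) (w z e) (m z e))"
proof -
  have "recursive (Suc (Suc (Suc (Suc 0)))) (\<lambda>z e. cnt b (D z (e 0)) (e (Suc 0)) (e (Suc (Suc 0))) (e (Suc (Suc (Suc 0)))))"
    unfolding cnt_def by (intro recursive_card decidable_eq recursive_win[where D = D, OF D] recursive_var) simp_all
  from recursive_comp4[where f = "\<lambda>z p k w m. cnt b (D z p) k w m", OF this assms(2-)] show ?thesis .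
qed

lemma recursive_cls:
  assumes D: "recursive (Suc (Suc 0)) (\<lambda>z e. D z (e 0) (e (Suc 0)))"
    and "recursive n p" "recursive n k" "recursive n j" "recursive n m"
  shows "recursive n (\<lambda>z e. cls b (D z (p z e)) (k z e) (j z e) (m z e))"
    and "recursive n (\<lambda>z e. clsp b (D z (p z e)) (k z e) (j z e) (m z e))"
proof -
  have "recursive (Suc (Suc (Suc (Suc 0)))) (\<lambda>z e. cls b (D z (e 0)) (e (Suc 0)) (e (Suc (Suc 0))) (e (Suc (Suc (Suc 0)))))"
    unfolding cls_def by (intro recursive_card decidable_eq recursive_cnt[where D = D, OF D] recursive_pow recursive_const recursive_var) simp_all
  from recursive_comp4[where f = "\<lambda>z p k w m. cls b (D z p) k w m", OF this assms(2-)]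
  show "recursive n (\<lambda>z e. cls b (D z (p z e)) (k z e) (j z e) (m z e))" .
  have "recursive (Suc (Suc (Suc (Suc 0)))) (\<lambda>z e. clsp b (D z (e 0)) (e (Suc 0)) (e (Suc (Suc 0))) (e (Suc (Suc (Suc 0)))))"
    unfolding clsp_def by (intro recursive_card decidable_eq recursive_Suc recursive_cnt[where D = D, OF D] recursive_pow recursive_const recursive_var) simp_all
  from recursive_comp4[where f = "\<lambda>z p k w m. clsp b (D z p) k w m", OF this assms(2-)]
  show "recursive n (\<lambda>z e. clsp b (D z (p z e)) (k z e) (j z e) (m z e))" .
qed

definition oracle_digits :: "nat \<Rightarrow> (nat \<Rightarrow> nat) \<Rightarrow> nat \<Rightarrow> nat" where
  "oracle_digits b z j = card {p. p < b ^ Suc j \<and> (0 < p \<and> z (prod_encode (p, b ^ Suc j)) = 1)} mod b"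

lemma oracle_digits_eq_digits: "x < 1 \<Longrightarrow> oracle_digits b (interval_oracle x) j = digits b x j"
proof -
  assume "x < 1"
  then have "interval_oracle x (prod_encode (p, q)) = 1 \<longleftrightarrow> real p / real q < x" for p q
    by (simp add: interval_oracle_def of_bool_def)
  then show ?thesis by (simp only: oracle_digits_def digits_def below_def)
qed

lemma recursive_oracle_digits: "recursive (Suc (Suc 0)) (\<lambda>z e. oracle_digits b z (e (Suc 0)))"
  unfolding oracle_digits_def by (intro recursive_mod recursive_card decidable_conj decidable_less decidable_eq recursive_oracle recursive_prod_encode recursive_pow recursive_Suc recursive_const recursive_var) simp_all

lemma abs_ratio_le_iff:
  fixes C X Y B a :: real
  assumes "B > 0" "Y > 0" "a > 0"
  shows "\<bar>C / B - X / Y\<bar> \<le> 1 / a \<longleftrightarrow> a * (C * Y) \<le> a * (X * B) + B * Y \<and> a * (X * B) \<le> a * (C * Y) + B * Y"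
proof -
  have "\<bar>C / B - X / Y\<bar> \<le> 1 / a \<longleftrightarrow> a * B * Y * \<bar>C / B - X / Y\<bar> \<le> a * B * Y * (1 / a)"
    using assms by (simp only: mult_le_cancel_left_pos mult_pos_pos)
  also have "a * B * Y * \<bar>C / B - X / Y\<bar> = \<bar>a * B * Y * (C / B - X / Y)\<bar>" using assms by (simp add: abs_mult)
  also have "a * B * Y * (C / B - X / Y) = a * (C * Y) - a * (X * B)" using assms by (simp add: field_simps)
  also have "a * B * Y * (1 / a) = B * Y" using assms by simp
  finally show ?thesis by (simp add: abs_le_iff) linarith
qed

text \<open>A whole family of limits becomes one statement of the form required by
  \<open>effective_Pi_3I\<close>: \<open>a\<close> is at once the accuracy and the bound on the
  parameters, so that the parameters are quantified boundedly. The guard \<open>0 < a\<close> keeps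
  out \<open>1 / 0\<close>, which is 0.\<close>

lemma tendsto_0_iff_1_over:
  fixes f :: "'i \<Rightarrow> nat \<Rightarrow> real"
  assumes fin: "\<And>a. finite (I a)" and I: "\<And>a i. i \<in> I a \<Longrightarrow> P i" and ex: "\<And>i. P i \<Longrightarrow> \<exists>a0. \<forall>a\<ge>a0. i \<in> I a"
  shows "(\<forall>i. P i \<longrightarrow> (f i) \<longlonglongrightarrow> 0) \<longleftrightarrow> (\<forall>a::nat. \<exists>c::nat. \<forall>d. c \<le> d \<longrightarrow> 0 < a \<longrightarrow> (\<forall>i\<in>I a. \<bar>f i d\<bar> \<le> 1 / real a))"
proof
  assume L: "\<forall>i. P i \<longrightarrow> (f i) \<longlonglongrightarrow> 0"
  show "\<forall>a::nat. \<exists>c::nat. \<forall>d. c \<le> d \<longrightarrow> 0 < a \<longrightarrow> (\<forall>i\<in>I a. \<bar>f i d\<bar> \<le> 1 / real a)"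
  proof
    fix a :: nat
    show "\<exists>c::nat. \<forall>d. c \<le> d \<longrightarrow> 0 < a \<longrightarrow> (\<forall>i\<in>I a. \<bar>f i d\<bar> \<le> 1 / real a)"
    proof (cases "a = 0")
      case False
      have "eventually (\<lambda>d. \<forall>i\<in>I a. \<bar>f i d\<bar> \<le> 1 / real a) sequentially"
      proof (rule eventually_ball_finite[OF fin], rule ballI)
        fix i assume "i \<in> I a"
        then have "(f i) \<longlonglongrightarrow> 0" using L I by blast
        then have "\<exists>no. \<forall>d\<ge>no. norm (f i d - 0) < 1 / real a" using False by (intro LIMSEQ_D) auto
        then show "eventually (\<lambda>d. \<bar>f i d\<bar> \<le> 1 / real a) sequentially"
          unfolding eventually_sequentially by (auto intro: less_imp_le)
      qed
      then show ?thesis unfolding eventually_sequentially by blast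
    qed simp
  qed
next
  assume R: "\<forall>a::nat. \<exists>c::nat. \<forall>d. c \<le> d \<longrightarrow> 0 < a \<longrightarrow> (\<forall>i\<in>I a. \<bar>f i d\<bar> \<le> 1 / real a)"
  show "\<forall>i. P i \<longrightarrow> (f i) \<longlonglongrightarrow> 0"
  proof (intro allI impI LIMSEQ_I)
    fix i and \<epsilon> :: real assume "P i" "\<epsilon> > 0"
    obtain a0 where a0: "\<And>a. a \<ge> a0 \<Longrightarrow> i \<in> I a" using ex[OF \<open>P i\<close>] by blast
    obtain m :: nat where m: "1 / \<epsilon> < real m" using reals_Archimedean2 by blast
    define a where "a = Suc (a0 + m)"
    obtain c where c: "\<And>d. c \<le> d \<Longrightarrow> \<bar>f i d\<bar> \<le> 1 / real a"
    proof -
      from R obtain c where "\<forall>d. c \<le> d \<longrightarrow> 0 < a \<longrightarrow> (\<forall>i\<in>I a. \<bar>f i d\<bar> \<le> 1 / real a)" by blast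
      moreover have "0 < a" "i \<in> I a" using a0[of a] by (simp_all add: a_def)
      ultimately show thesis using that by blast
    qed
    have "1 / \<epsilon> < real a" using m by (simp add: a_def)
    then have "1 / real a < \<epsilon>" using \<open>\<epsilon> > 0\<close> by (simp add: a_def field_simps)
    then show "\<exists>no. \<forall>d\<ge>no. norm (f i d - 0) < \<epsilon>" using c by (intro exI[of _ c]) fastforce
  qed
qed

lemma normal_digits_iff:
  assumes b: "b > 0"
  shows "normal_digits b D \<longleftrightarrow> (\<forall>a. \<exists>c. \<forall>d. c \<le> d \<longrightarrow> 0 < a \<longrightarrow> 0 < d \<longrightarrow> (\<forall>k<a. \<forall>w<a. w < b ^ k \<longrightarrow>
     a * (cnt b D k w d * b ^ k) \<le> a * (1 * d) + d * b ^ k \<and> a * (1 * d) \<le> a * (cnt b D k w d * b ^ k) + d * b ^ k))"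
    (is "_ \<longleftrightarrow> ?R")
proof -
  \<comment> \<open>The value 0 at \<open>d = 0\<close> corresponds to the guard
    \<open>0 < d\<close> in the recursive condition.\<close>
  let ?f = "\<lambda>(k, w) d. if d = 0 then 0 else real (cnt b D k w d) / real d - 1 / real b ^ k"
  let ?I = "\<lambda>a. {(k, w). k < a \<and> w < a \<and> w < b ^ k}"
  have fin: "finite (?I a)" for a by (rule finite_subset[of _ "{..<a} \<times> {..<a}"]) auto
  have ev: "(\<lambda>d. if d = 0 then 0 else real (cnt b D k w d) / real d - 1 / real b ^ k) \<longlonglongrightarrow> 0 \<longleftrightarrow>
     (\<lambda>d. real (cnt b D k w d) / real d) \<longlonglongrightarrow> 1 / real b ^ k" for k w
  proof -
    have "(\<lambda>d. if d = 0 then 0 else real (cnt b D k w d) / real d - 1 / real b ^ k) \<longlonglongrightarrow> 0 \<longleftrightarrow>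
      (\<lambda>d. real (cnt b D k w d) / real d - 1 / real b ^ k) \<longlonglongrightarrow> 0"
    proof (rule tendsto_cong)
      show "eventually (\<lambda>d. (if d = 0 then 0 else real (cnt b D k w d) / real d - 1 / real b ^ k) =
          real (cnt b D k w d) / real d - 1 / real b ^ k) sequentially"
        using eventually_gt_at_top[of 0] by eventually_elim simp
    qed
    then show ?thesis by (simp add: LIM_zero_iff)
  qed
  have "normal_digits b D \<longleftrightarrow> (\<forall>i. (case i of (k, w) \<Rightarrow> w < b ^ k) \<longrightarrow> (?f i) \<longlonglongrightarrow> 0)"
    unfolding normal_digits_def by (simp add: ev)
  also have "\<dots> \<longleftrightarrow> (\<forall>a::nat. \<exists>c::nat. \<forall>d. c \<le> d \<longrightarrow> 0 < a \<longrightarrow> (\<forall>i\<in>?I a. \<bar>?f i d\<bar> \<le> 1 / real a))"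
  proof (rule tendsto_0_iff_1_over[OF fin])
    fix i :: "nat \<times> nat" assume "case i of (k, w) \<Rightarrow> w < b ^ k"
    then show "\<exists>a0. \<forall>a\<ge>a0. i \<in> ?I a" by (cases i) (auto intro!: exI[of _ "Suc (fst i + snd i)"])
  qed auto
  also have "\<dots> \<longleftrightarrow> ?R"
  proof (intro all_cong1 ex_cong1 imp_cong refl)
    fix a d :: nat assume a: "0 < a"
    have 1: "\<bar>real (cnt b D k w d) / real d - 1 / real b ^ k\<bar> \<le> 1 / real a \<longleftrightarrow>
       a * (cnt b D k w d * b ^ k) \<le> a * (1 * d) + d * b ^ k \<and> a * (1 * d) \<le> a * (cnt b D k w d * b ^ k) + d * b ^ k" if d: "d > 0" for k w
    proof -
      have "\<bar>real (cnt b D k w d) / real d - 1 / real b ^ k\<bar> \<le> 1 / real a \<longleftrightarrow>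
         real (a * (cnt b D k w d * b ^ k)) \<le> real (a * (1 * d) + d * b ^ k) \<and> real (a * (1 * d)) \<le> real (a * (cnt b D k w d * b ^ k) + d * b ^ k)"
        using abs_ratio_le_iff[of "real d" "real b ^ k" "real a" "real (cnt b D k w d)" 1] a d b by simp
      then show ?thesis unfolding of_nat_le_iff .
    qed
    show "(\<forall>i\<in>?I a. \<bar>?f i d\<bar> \<le> 1 / real a) \<longleftrightarrow> (0 < d \<longrightarrow> (\<forall>k<a. \<forall>w<a. w < b ^ k \<longrightarrow>
     a * (cnt b D k w d * b ^ k) \<le> a * (1 * d) + d * b ^ k \<and> a * (1 * d) \<le> a * (cnt b D k w d * b ^ k) + d * b ^ k))"
    proof (cases "d = 0")
      case False
      then have d: "d > 0" by simp
      have "(\<forall>i\<in>?I a. \<bar>?f i d\<bar> \<le> 1 / real a) \<longleftrightarrow> (\<forall>k<a. \<forall>w<a. w < b ^ k \<longrightarrow> \<bar>real (cnt b D k w d) / real d - 1 / real b ^ k\<bar> \<le> 1 / real a)"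
        using False by auto
      then show ?thesis unfolding 1[OF d] using d by blast
    qed auto
  qed
  finally show ?thesis .
qed

lemma effective_normal:
  assumes b: "b \<ge> 2"
  shows "effective_Pi real_sat 3 (normal_numbers b)"
proof (rule effective_Pi_3I)
  let ?R = "\<lambda>z a c d. c \<le> d \<longrightarrow> 0 < a \<longrightarrow> 0 < d \<longrightarrow> (\<forall>k<a. \<forall>w<a. w < b ^ k \<longrightarrow>
     a * (cnt b (oracle_digits b z) k w d * b ^ k) \<le> a * (1 * d) + d * b ^ k \<and> a * (1 * d) \<le> a * (cnt b (oracle_digits b z) k w d * b ^ k) + d * b ^ k)"
  have "decidable (Suc (Suc (Suc 0))) (\<lambda>z e. ?R z (e 0) (e (Suc 0)) (e (Suc (Suc 0))))"
    by (intro decidable_imp decidable_ball decidable_conj decidable_le decidable_less recursive_add recursive_mult recursive_pow recursive_cnt[where D = "\<lambda>z p. oracle_digits b z" and p = "\<lambda>z e. 0", OF recursive_oracle_digits]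
       recursive_const recursive_var) simp_all
  then show "decidable 3 (\<lambda>z e. ?R z (e 0) (e 1) (e 2))" by (simp add: numeral_3_eq_3 numeral_2_eq_2)
  fix x
  have o: "oracle_digits b (interval_oracle x) = digits b x" if "x < 1" using oracle_digits_eq_digits[OF that] by (rule ext)
  have b0: "b > 0" using b by simp
  show "x \<in> normal_numbers b \<longleftrightarrow> 0 < x \<and> x < 1 \<and> (\<forall>a. \<exists>c. \<forall>d. ?R (interval_oracle x) a c d)"
    unfolding normal_numbers_iff[OF b] normal_digits_iff[OF b0] by (intro conj_cong refl) (simp only: o)
qed

definition Poisson_at :: "nat \<Rightarrow> (nat \<Rightarrow> nat) \<Rightarrow> real \<Rightarrow> nat \<Rightarrow> bool" where
  "Poisson_at b D lam j \<longleftrightarrow> (\<lambda>k. real (cls b D k j (nat \<lfloor>lam * real b ^ k\<rfloor> + 1)) / real b ^ k) \<longlonglongrightarrow> pois j lam"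

lemma sum_cls: "(\<Sum>j\<le>J. cls b D k j n) = card {w. w < b ^ k \<and> cnt b D k w n \<le> J}"
proof -
  have "card {w. w < b ^ k \<and> cnt b D k w n \<le> J} = card (\<Union>j\<in>{..J}. {w. w < b ^ k \<and> cnt b D k w n = j})"
    by (rule arg_cong[where f = card]) auto
  also have "\<dots> = (\<Sum>j\<in>{..J}. card {w. w < b ^ k \<and> cnt b D k w n = j})" by (rule card_UN_disjoint) auto
  finally show ?thesis by (simp add: cls_def)
qed

text \<open>A single class size is not monotone in \<open>lam\<close>, but the number of words
  occurring at most \<open>J\<close> times is decreasing. So its limit at a real \<open>lam\<close>
  is squeezed between rational ones, by continuity of the Poisson sums; a class is then a difference
  of two cumulative counts.\<close>

lemma Poisson_from_rationals:
  assumes b: "b > 0" and rat: "\<And>p q j. p > 0 \<Longrightarrow> q > 0 \<Longrightarrow> Poisson_at b D (real p / real q) j"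
  shows "Poisson_digits b D"
proof -
  let ?N = "\<lambda>lam k. nat \<lfloor>lam * real b ^ k\<rfloor> + 1"
  let ?F = "\<lambda>J lam k. \<Sum>j\<le>J. real (cls b D k j (?N lam k)) / real b ^ k"
  let ?G = "\<lambda>J lam. \<Sum>j\<le>J. pois j lam"
  have F: "?F J lam k = real (card {w. w < b ^ k \<and> cnt b D k w (?N lam k) \<le> J}) / real b ^ k" for J lam k
    by (simp add: sum_divide_distrib[symmetric] sum_cls flip: of_nat_sum)
  have mono: "?F J lam' k \<le> ?F J lam k" if "lam \<le> lam'" for J lam lam' k
  proof -
    have "lam * real b ^ k \<le> lam' * real b ^ k" using that by (intro mult_right_mono) auto
    then have N: "?N lam k \<le> ?N lam' k" by (simp add: floor_mono nat_mono)
    have "{w. w < b ^ k \<and> cnt b D k w (?N lam' k) \<le> J} \<subseteq> {w. w < b ^ k \<and> cnt b D k w (?N lam k) \<le> J}"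
      using cnt_mono[OF N] order.trans by blast
    then have "card {w. w < b ^ k \<and> cnt b D k w (?N lam' k) \<le> J} \<le> card {w. w < b ^ k \<and> cnt b D k w (?N lam k) \<le> J}"
      by (intro card_mono) auto
    then show ?thesis unfolding F by (intro divide_right_mono of_nat_mono) auto
  qed
  have G: "\<bar>?G J x - ?G J y\<bar> \<le> real (Suc J) * \<bar>x - y\<bar>" if "x \<ge> 0" "y \<ge> 0" for J x y
  proof -
    have "\<bar>?G J x - ?G J y\<bar> = \<bar>\<Sum>j\<le>J. pois j x - pois j y\<bar>" by (simp only: sum_subtractf)
    also have "\<dots> \<le> (\<Sum>j\<le>J. \<bar>x - y\<bar>)" by (rule order.trans[OF sum_abs], rule sum_mono, rule pois_lipschitz[OF that])
    finally show ?thesis by simp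
  qed
  have lim: "(\<lambda>k. ?F J lam k) \<longlonglongrightarrow> ?G J lam" if lam: "lam > 0" for J lam
  proof (rule LIMSEQ_I)
    fix \<epsilon> :: real assume \<epsilon>: "\<epsilon> > 0"
    \<comment> \<open>\<open>Suc J\<close> is a Lipschitz constant of the cumulative Poisson
      probability, so moving \<open>lam\<close> by \<open>\<delta>\<close> costs at most
      \<open>\<epsilon> / 2\<close>.\<close>
    define \<delta> where "\<delta> = \<epsilon> / (2 * real (Suc J))"
    have \<delta>: "\<delta> > 0" using \<epsilon> by (simp add: \<delta>_def)
    have ratl: "\<exists>p q. p > 0 \<and> q > 0 \<and> u < real p / real q \<and> real p / real q < v" if uv: "0 \<le> u" "u < v" for u v :: real
    proof -
      obtain r where r: "r \<in> \<rat>" "u < r" "r < v" using Rats_dense_in_real[OF uv(2)] by blast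
      have "r > 0" using r uv by simp
      from Rats_abs_nat_div_natE[OF r(1)] obtain p q :: nat where pq: "q \<noteq> 0" "\<bar>r\<bar> = real p / real q" by metis
      then have e: "r = real p / real q" using \<open>r > 0\<close> by simp
      then have "p > 0" using \<open>r > 0\<close> by (cases p) auto
      then show ?thesis using r e pq(1) by (intro exI[of _ p] exI[of _ q]) auto
    qed
    obtain p q where pq: "p > 0" "q > 0" "max 0 (lam - \<delta>) < real p / real q" "real p / real q < lam"
      using ratl[of "max 0 (lam - \<delta>)" lam] lam \<delta> by auto
    obtain p' q' where pq': "p' > 0" "q' > 0" "lam < real p' / real q'" "real p' / real q' < lam + \<delta>"
      using ratl[of lam "lam + \<delta>"] lam \<delta> by auto
    let ?l = "real p / real q" and ?l' = "real p' / real q'"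
    have L: "(\<lambda>k. ?F J ?l k) \<longlonglongrightarrow> ?G J ?l" using rat[OF pq(1,2)] unfolding Poisson_at_def by (intro tendsto_sum)
    have L': "(\<lambda>k. ?F J ?l' k) \<longlonglongrightarrow> ?G J ?l'" using rat[OF pq'(1,2)] unfolding Poisson_at_def by (intro tendsto_sum)
    have e2: "\<epsilon> / 2 > 0" using \<epsilon> by simp
    from LIMSEQ_D[OF L e2] obtain n1 where n1: "\<And>k. k \<ge> n1 \<Longrightarrow> \<bar>?F J ?l k - ?G J ?l\<bar> < \<epsilon> / 2" by auto
    from LIMSEQ_D[OF L' e2] obtain n2 where n2: "\<And>k. k \<ge> n2 \<Longrightarrow> \<bar>?F J ?l' k - ?G J ?l'\<bar> < \<epsilon> / 2" by auto
    have J\<delta>: "real (Suc J) * \<delta> = \<epsilon> / 2" unfolding \<delta>_def by (simp del: of_nat_Suc)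
    have g1: "\<bar>?G J ?l - ?G J lam\<bar> \<le> \<epsilon> / 2"
    proof -
      have "\<bar>?G J ?l - ?G J lam\<bar> \<le> real (Suc J) * \<bar>?l - lam\<bar>" using lam by (intro G) auto
      also have "\<dots> \<le> real (Suc J) * \<delta>" using pq by (intro mult_left_mono) auto
      finally show ?thesis unfolding J\<delta> .
    qed
    have g2: "\<bar>?G J ?l' - ?G J lam\<bar> \<le> \<epsilon> / 2"
    proof -
      have "\<bar>?G J ?l' - ?G J lam\<bar> \<le> real (Suc J) * \<bar>?l' - lam\<bar>" using lam by (intro G) auto
      also have "\<dots> \<le> real (Suc J) * \<delta>" using pq' by (intro mult_left_mono) auto
      finally show ?thesis unfolding J\<delta> .
    qed
    show "\<exists>no. \<forall>k\<ge>no. norm (?F J lam k - ?G J lam) < \<epsilon>"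
    proof (intro exI[of _ "max n1 n2"] allI impI)
      fix k assume k: "k \<ge> max n1 n2"
      have "?F J lam k \<le> ?F J ?l k" "?F J ?l' k \<le> ?F J lam k" using pq pq' by (intro mono; simp)+
      moreover have "\<bar>?F J ?l k - ?G J ?l\<bar> < \<epsilon> / 2" "\<bar>?F J ?l' k - ?G J ?l'\<bar> < \<epsilon> / 2" using n1[of k] n2[of k] k by simp_all
      ultimately have "\<bar>?F J lam k - ?G J lam\<bar> < \<epsilon>" using g1 g2 by linarith
      then show "norm (?F J lam k - ?G J lam) < \<epsilon>" by simp
    qed
  qed
  have "(\<lambda>k. real (cls b D k j (?N lam k)) / real b ^ k) \<longlonglongrightarrow> pois j lam" if lam: "lam > 0" for lam j
  proof (cases j)
    case 0
    then show ?thesis using lim[OF lam, of 0] by simp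
  next
    case (Suc i)
    from tendsto_diff[OF lim[OF lam, of "Suc i"] lim[OF lam, of i]] show ?thesis unfolding Suc by simp
  qed
  then show ?thesis unfolding Poisson_digits_def pois_def by blast
qed

text \<open>Subtracting a sequence with the right limit is as good as subtracting the limit itself,
  and a rational sequence makes each comparison exactly decidable. For \<open>k \<ge> p\<close> the
  truncated subtraction is a genuine one.\<close>

lemma pois_rational_limit:
  assumes p: "p > 0" and q: "q > 0"
  shows "(\<lambda>k. real ((q * k - p) ^ k * p ^ j) / real ((q * k) ^ k * (q ^ j * fact j))) \<longlonglongrightarrow> pois j (real p / real q)"
proof -
  let ?l = "real p / real q"
  have "(\<lambda>k. (1 + (- ?l) / real k) ^ k * (?l ^ j / fact j)) \<longlonglongrightarrow> exp (- ?l) * (?l ^ j / fact j)"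
    by (intro tendsto_mult tendsto_const tendsto_exp_limit_sequentially)
  moreover have "eventually (\<lambda>k. (1 + (- ?l) / real k) ^ k * (?l ^ j / fact j) =
     real ((q * k - p) ^ k * p ^ j) / real ((q * k) ^ k * (q ^ j * fact j))) sequentially"
    using eventually_ge_at_top[of p]
  proof eventually_elim
    case (elim k)
    have k: "k > 0" using elim p by simp
    have "1 * p \<le> q * k" using elim q by (intro mult_mono) auto
    then have "real (q * k - p) = real q * real k - real p" by simp
    also have "\<dots> = real q * real k * (1 + (- ?l) / real k)" using k q by (simp add: field_simps)
    finally have e: "real (q * k - p) ^ k = (real q * real k) ^ k * (1 + (- ?l) / real k) ^ k" by (simp only: power_mult_distrib)
    have A: "(real q * real k) ^ k \<noteq> 0" using k q by simp
    have gen: "A * T * x / (A * (y * f)) = T * (x / y / f)" if "A \<noteq> 0" for A T x y f :: real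
      using that by simp
    show ?case unfolding of_nat_mult of_nat_power power_divide of_nat_fact e by (rule gen[OF A, symmetric])
  qed
  ultimately have "(\<lambda>k. real ((q * k - p) ^ k * p ^ j) / real ((q * k) ^ k * (q ^ j * fact j))) \<longlonglongrightarrow> exp (- ?l) * (?l ^ j / fact j)"
    by (rule Lim_transform_eventually)
  then show ?thesis by (simp add: pois_def)
qed

lemma Poisson_digits_iff:
  assumes b: "b > 0"
  shows "Poisson_digits b D \<longleftrightarrow> (\<forall>a. \<exists>c. \<forall>k. c \<le> k \<longrightarrow> 0 < a \<longrightarrow> (\<forall>p<a. \<forall>q<a. \<forall>j<a. 0 < p \<longrightarrow> 0 < q \<longrightarrow>
     a * (cls b D k j (p * b ^ k div q + 1) * ((q * k) ^ k * (q ^ j * fact j))) \<le>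
       a * ((q * k - p) ^ k * p ^ j * b ^ k) + b ^ k * ((q * k) ^ k * (q ^ j * fact j)) \<and>
     a * ((q * k - p) ^ k * p ^ j * b ^ k) \<le>
       a * (cls b D k j (p * b ^ k div q + 1) * ((q * k) ^ k * (q ^ j * fact j))) + b ^ k * ((q * k) ^ k * (q ^ j * fact j))))"
    (is "_ \<longleftrightarrow> ?R")
proof -
  let ?X = "\<lambda>p q j k. (q * k - p) ^ k * p ^ j" and ?Y = "\<lambda>q j k. (q * k) ^ k * (q ^ j * fact j) :: nat"
  let ?C = "\<lambda>p q j k. cls b D k j (p * b ^ k div q + 1)"
  let ?f = "\<lambda>(p, q, j) k. real (?C p q j k) / real b ^ k - real (?X p q j k) / real (?Y q j k)"
  let ?I = "\<lambda>a::nat. {(p, q, j). p < a \<and> q < a \<and> j < a \<and> 0 < p \<and> 0 < q}"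
  have fin: "finite (?I a)" for a by (rule finite_subset[of _ "{..<a} \<times> {..<a} \<times> {..<a}"]) auto
  have N: "nat \<lfloor>real p / real q * real b ^ k\<rfloor> + 1 = p * b ^ k div q + 1" for p q k
  proof -
    have "real p / real q * real b ^ k = real (p * b ^ k) / real q" by simp
    then have "\<lfloor>real p / real q * real b ^ k\<rfloor> = int (p * b ^ k div q)" by (simp only: floor_divide_of_nat_eq)
    then show ?thesis by (simp only: nat_int)
  qed
  have at: "Poisson_at b D (real p / real q) j \<longleftrightarrow> (?f (p, q, j)) \<longlonglongrightarrow> 0" if pq: "p > 0" "q > 0" for p q j
  proof
    assume "Poisson_at b D (real p / real q) j"
    then have "(\<lambda>k. real (?C p q j k) / real b ^ k) \<longlonglongrightarrow> pois j (real p / real q)" by (simp only: Poisson_at_def N)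
    from tendsto_diff[OF this pois_rational_limit[OF pq, of j]] show "(?f (p, q, j)) \<longlonglongrightarrow> 0" by simp
  next
    assume "(?f (p, q, j)) \<longlonglongrightarrow> 0"
    from tendsto_add[OF this pois_rational_limit[OF pq, of j]]
    show "Poisson_at b D (real p / real q) j" unfolding Poisson_at_def N by simp
  qed
  have "Poisson_digits b D \<longleftrightarrow> (\<forall>p q j. 0 < p \<longrightarrow> 0 < q \<longrightarrow> Poisson_at b D (real p / real q) j)"
  proof
    assume P: "Poisson_digits b D"
    show "\<forall>p q j. 0 < p \<longrightarrow> 0 < q \<longrightarrow> Poisson_at b D (real p / real q) j"
    proof (intro allI impI)
      fix p q j :: nat assume "0 < p" "0 < q"
      then have "real p / real q > 0" by simp
      then show "Poisson_at b D (real p / real q) j" using P unfolding Poisson_digits_def Poisson_at_def pois_def by blast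
    qed
  qed (use Poisson_from_rationals[OF b] in blast)
  also have "\<dots> \<longleftrightarrow> (\<forall>i. (case i of (p, q, j) \<Rightarrow> 0 < p \<and> 0 < q) \<longrightarrow> (?f i) \<longlonglongrightarrow> 0)"
    using at by (simp only: split_paired_All prod.case) blast
  also have "\<dots> \<longleftrightarrow> (\<forall>a::nat. \<exists>c::nat. \<forall>k. c \<le> k \<longrightarrow> 0 < a \<longrightarrow> (\<forall>i\<in>?I a. \<bar>?f i k\<bar> \<le> 1 / real a))"
  proof (rule tendsto_0_iff_1_over[OF fin])
    fix i :: "nat \<times> nat \<times> nat" assume i: "case i of (p, q, j) \<Rightarrow> 0 < p \<and> 0 < q"
    obtain p q j where pqj: "i = (p, q, j)" by (cases i)
    show "\<exists>a0. \<forall>a\<ge>a0. i \<in> ?I a" using i unfolding pqj by (intro exI[of _ "Suc (p + q + j)"]) auto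
  qed auto
  also have "\<dots> \<longleftrightarrow> ?R"
  proof (intro all_cong1 ex_cong1 imp_cong refl)
    fix a k :: nat assume a: "0 < a"
    have 1: "\<bar>real (?C p q j k) / real b ^ k - real (?X p q j k) / real (?Y q j k)\<bar> \<le> 1 / real a \<longleftrightarrow>
       a * (?C p q j k * ?Y q j k) \<le> a * (?X p q j k * b ^ k) + b ^ k * ?Y q j k \<and>
       a * (?X p q j k * b ^ k) \<le> a * (?C p q j k * ?Y q j k) + b ^ k * ?Y q j k" if q: "q > 0" for p q j
    proof -
      have Y: "?Y q j k > 0" using q by (cases "k = 0") auto
      have pos: "real b ^ k > 0" "real (?Y q j k) > 0" "real a > 0" using b a of_nat_0_less_iff[THEN iffD2, OF Y] by simp_all
      have "\<bar>real (?C p q j k) / real b ^ k - real (?X p q j k) / real (?Y q j k)\<bar> \<le> 1 / real a \<longleftrightarrow>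
         real (a * (?C p q j k * ?Y q j k)) \<le> real (a * (?X p q j k * b ^ k) + b ^ k * ?Y q j k) \<and>
         real (a * (?X p q j k * b ^ k)) \<le> real (a * (?C p q j k * ?Y q j k) + b ^ k * ?Y q j k)"
        using abs_ratio_le_iff[OF pos, of "real (?C p q j k)" "real (?X p q j k)"] by (simp only: of_nat_add of_nat_mult of_nat_power)
      then show ?thesis unfolding of_nat_le_iff .
    qed
    have "(\<forall>i\<in>?I a. \<bar>?f i k\<bar> \<le> 1 / real a) \<longleftrightarrow> (\<forall>p<a. \<forall>q<a. \<forall>j<a. 0 < p \<longrightarrow> 0 < q \<longrightarrow>
       \<bar>real (?C p q j k) / real b ^ k - real (?X p q j k) / real (?Y q j k)\<bar> \<le> 1 / real a)"
      by (simp only: Ball_def split_paired_All mem_Collect_eq prod.case) blast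
    also have "\<dots> \<longleftrightarrow> (\<forall>p<a. \<forall>q<a. \<forall>j<a. 0 < p \<longrightarrow> 0 < q \<longrightarrow>
       a * (?C p q j k * ?Y q j k) \<le> a * (?X p q j k * b ^ k) + b ^ k * ?Y q j k \<and>
       a * (?X p q j k * b ^ k) \<le> a * (?C p q j k * ?Y q j k) + b ^ k * ?Y q j k)" using 1 by blast
    finally show "(\<forall>i\<in>?I a. \<bar>?f i k\<bar> \<le> 1 / real a) \<longleftrightarrow> \<dots>" .
  qed
  finally show ?thesis .
qed

lemma effective_Poisson:
  assumes b: "b \<ge> 2"
  shows "effective_Pi real_sat 3 (Poisson_generic_numbers b)"
proof (rule effective_Pi_3I)
  let ?R = "\<lambda>z a c k. c \<le> k \<longrightarrow> 0 < a \<longrightarrow> (\<forall>p<a. \<forall>q<a. \<forall>j<a. 0 < p \<longrightarrow> 0 < q \<longrightarrow>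
     a * (cls b (oracle_digits b z) k j (p * b ^ k div q + 1) * ((q * k) ^ k * (q ^ j * fact j))) \<le>
       a * ((q * k - p) ^ k * p ^ j * b ^ k) + b ^ k * ((q * k) ^ k * (q ^ j * fact j)) \<and>
     a * ((q * k - p) ^ k * p ^ j * b ^ k) \<le>
       a * (cls b (oracle_digits b z) k j (p * b ^ k div q + 1) * ((q * k) ^ k * (q ^ j * fact j))) + b ^ k * ((q * k) ^ k * (q ^ j * fact j)))"
  have "decidable (Suc (Suc (Suc 0))) (\<lambda>z e. ?R z (e 0) (e (Suc 0)) (e (Suc (Suc 0))))"
    by (intro decidable_imp decidable_ball decidable_conj decidable_le decidable_less recursive_add recursive_mult recursive_pow recursive_monus recursive_div recursive_fact
       recursive_cls(1)[where D = "\<lambda>z p. oracle_digits b z" and p = "\<lambda>z e. 0", OF recursive_oracle_digits] recursive_const recursive_var) simp_all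
  then show "decidable 3 (\<lambda>z e. ?R z (e 0) (e 1) (e 2))" by (simp add: numeral_3_eq_3 numeral_2_eq_2)
  fix x
  have o: "oracle_digits b (interval_oracle x) = digits b x" if "x < 1" using oracle_digits_eq_digits[OF that] by (rule ext)
  have b0: "b > 0" using b by simp
  show "x \<in> Poisson_generic_numbers b \<longleftrightarrow> 0 < x \<and> x < 1 \<and> (\<forall>a. \<exists>c. \<forall>k. ?R (interval_oracle x) a c k)"
    unfolding Poisson_numbers_iff[OF b] Poisson_digits_iff[OF b0] by (intro conj_cong refl) (simp only: o)
qed

section \<open>Recursiveness of the base sequence and its perturbation\<close>

lemma recursive_digit: "recursive (Suc (Suc 0)) (\<lambda>z e. digit b (e 0) (e (Suc 0)))"
  unfolding digit_def by (intro recursive_mod recursive_div recursive_pow recursive_const recursive_var) simp_all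

lemma recursive_gap: "recursive n s \<Longrightarrow> recursive n (\<lambda>z e. gap (s z e))"
  unfolding gap_def by (intro recursive_monus recursive_pow recursive_Suc recursive_const)

lemma decidable_good: "decidable (Suc (Suc 0)) (\<lambda>z e. good b (e 0) (digit b (e (Suc 0))))"
  unfolding good_def tolerance_def
  by (intro decidable_imp decidable_ball decidable_conj decidable_le decidable_less recursive_add recursive_mult recursive_pow recursive_monus recursive_gap recursive_Suc
       recursive_cls[where D = "\<lambda>z. digit b", OF recursive_digit] recursive_cnt[where D = "\<lambda>z. digit b", OF recursive_digit] recursive_const recursive_var) simp_all

lemma recursive_extension:
  assumes b: "b > 0"
  shows "recursive (Suc (Suc 0)) (\<lambda>z e. extension b (e 0) (e (Suc 0)))"
  unfolding extension_def
proof (rule recursive_Least)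
  show "\<exists>V. b ^ (e 0 ^ 5) \<le> e (Suc 0) \<or> V < b ^ gap (e 0) \<and> good b (e 0) (digit b (e (Suc 0) + b ^ (e 0 ^ 5) * V))" for e :: "nat \<Rightarrow> nat"
    by (rule extension_ex[OF b])
qed (intro decidable_disj decidable_conj decidable_le decidable_less recursive_pow recursive_gap recursive_add recursive_mult recursive_const recursive_var
      decidable_good[THEN recursive_comp2[where f = "\<lambda>z s W. of_bool (good b s (digit b W))"]], simp_all)

lemma recursive_base_seq:
  assumes b: "b > 0" and a: "recursive n a"
  shows "recursive n (\<lambda>z e. base_seq b (a z e))"
proof -
  have p: "recursive n (\<lambda>z e. prefix_code b (c z e))" if "recursive n c" for c n
    unfolding prefix_code_def
    by (intro recursive_prec recursive_add recursive_mult recursive_pow recursive_const recursive_var that recursive_comp2[where f = "\<lambda>z. extension b", OF recursive_extension[OF b]]) simp_all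
  show ?thesis unfolding base_seq_def by (intro recursive_comp2[where f = "\<lambda>z. digit b", OF recursive_digit] p recursive_Suc a)
qed

lemma recursive_perturb:
  assumes b: "b > 0" and m: "recursive (Suc 0) (\<lambda>z e. m z (e 0))"
  shows "recursive (Suc 0) (\<lambda>z e. perturb b (m z) (base_seq b) (e 0))"
proof -
  have scale: "recursive n (\<lambda>z e. scale b (a z e))" if "recursive n a" for n a
  proof -
    have "recursive (Suc 0) (\<lambda>z e. scale b (e 0))" unfolding scale_def by (intro recursive_card decidable_le recursive_pow recursive_Suc recursive_const recursive_var) simp_all
    from recursive_comp1[where f = "\<lambda>z. scale b", OF this that] show ?thesis .
  qed
  have len: "recursive n (\<lambda>z e. block_len b (m z) (a z e))" if "recursive n a" for n a
    unfolding block_len_def by (intro recursive_div recursive_pow recursive_const that recursive_comp1[where f = m, OF m])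
  show ?thesis unfolding perturb_def
    by (intro recursive_if decidable_conj decidable_le decidable_less decidable_even recursive_base_seq b recursive_monus recursive_add recursive_pow scale len recursive_const recursive_var) simp_all
qed

section \<open>Subsets of the Baire space at level 3 as convergence to infinity\<close>

lemma baire_Pi_3E:
  assumes "effective_Pi baire_sat 3 A"
  obtains R where "decidable (Suc (Suc (Suc 0))) (\<lambda>z e. R z (e 0) (e (Suc 0)) (e (Suc (Suc 0))))"
    "\<And>z. z \<in> A \<longleftrightarrow> (\<forall>a. \<exists>c. \<forall>d. R z a c d)"
proof -
  from assms obtain \<phi> where \<phi>: "Pi_fm (Suc (Suc (Suc 0))) \<phi>" "\<And>z e. z \<in> A \<longleftrightarrow> sat (baire_sat z) e \<phi>"
    unfolding effective_Pi_def numeral_3_eq_3 by blast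
  from \<phi>(1) obtain v1 \<phi>1 where 1: "\<phi> = All v1 \<phi>1" "Sigma_fm (Suc (Suc 0)) \<phi>1" by (cases rule: Pi_fm.cases) auto
  from 1(2) obtain v2 \<phi>2 where 2: "\<phi>1 = Ex v2 \<phi>2" "Pi_fm (Suc 0) \<phi>2" by (cases rule: Sigma_fm.cases) auto
  from 2(2) obtain v3 \<phi>3 where 3: "\<phi>2 = All v3 \<phi>3" "Sigma_fm 0 \<phi>3" by (cases rule: Pi_fm.cases) auto
  from 3(2) have bd: "bounded_fm \<phi>3" by (cases rule: Sigma_fm.cases) auto
  \<comment> \<open>The three quantified variables may coincide, and then the innermost one wins.
    The remaining ones get code 0, which decodes to the integer 0.\<close>
  define E where "E a c d i = (if i = v3 then d else if i = v2 then c else if i = v1 then a else 0)" for a c d i :: nat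
  define R where "R z a c d = sat (baire_sat z) (\<lambda>i. int_decode (E a c d i)) \<phi>3" for z a c d
  obtain n where sat: "decidable n (\<lambda>z e. sat (baire_sat z) (\<lambda>i. int_decode (e i)) \<phi>3)" using decidable_bounded_fm[OF bd] by blast
  have g: "recursive (Suc (Suc (Suc 0))) (\<lambda>z e. if i = v3 then e (Suc (Suc 0)) else if i = v2 then e (Suc 0) else if i = v1 then e 0 else 0)" for i
    by (cases "i = v3"; cases "i = v2"; cases "i = v1"; simp add: recursive_var recursive_const)
  from recursive_comp[OF sat, of "Suc (Suc (Suc 0))" "\<lambda>i z e. if i = v3 then e (Suc (Suc 0)) else if i = v2 then e (Suc 0) else if i = v1 then e 0 else 0", OF g]
  have "decidable (Suc (Suc (Suc 0))) (\<lambda>z e. R z (e 0) (e (Suc 0)) (e (Suc (Suc 0))))"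
    unfolding R_def E_def .
  moreover have "z \<in> A \<longleftrightarrow> (\<forall>a. \<exists>c. \<forall>d. R z a c d)" for z
  proof -
    have e: "(\<lambda>i. int_decode (E a c d i)) = (\<lambda>_. 0)(v1 := int_decode a, v2 := int_decode c, v3 := int_decode d)" for a c d
      by (auto simp: E_def fun_eq_iff int_decode_def sum_decode_def)
    have q: "(\<forall>i. P i) \<longleftrightarrow> (\<forall>a. P (int_decode a))" "(\<exists>i. P i) \<longleftrightarrow> (\<exists>a. P (int_decode a))" for P
      by (metis int_encode_inverse)+
    have "z \<in> A \<longleftrightarrow> sat (baire_sat z) (\<lambda>_. 0) (All v1 (Ex v2 (All v3 \<phi>3)))" using \<phi>(2) unfolding 1 2 3 .
    also have "\<dots> \<longleftrightarrow> (\<forall>a. \<exists>c. \<forall>d. sat (baire_sat z) ((\<lambda>_. 0)(v1 := a, v2 := c, v3 := d)) \<phi>3)" by (simp only: sat.simps)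
    also have "\<dots> \<longleftrightarrow> (\<forall>a. \<exists>c. \<forall>d. sat (baire_sat z) ((\<lambda>_. 0)(v1 := int_decode a, v2 := int_decode c, v3 := int_decode d)) \<phi>3)"
      by (subst q(1), subst q(2), subst q(1)) (rule refl)
    finally show ?thesis unfolding R_def e .
  qed
  ultimately show thesis by (rule that)
qed

text \<open>\<open>\<exists>c. \<forall>d. R a c d\<close> holds iff \<open>refuted R a\<close> is bounded, that is, eventually constant.  If this is so for
  every \<open>a\<close>, then \<open>stable R\<close> tends to infinity; otherwise it takes some value infinitely often, since
  \<open>stable R k \<le> a\<close> whenever \<open>refuted R a\<close> changes at \<open>k\<close>.\<close>
definition refuted :: "(nat \<Rightarrow> nat \<Rightarrow> nat \<Rightarrow> bool) \<Rightarrow> nat \<Rightarrow> nat \<Rightarrow> nat" where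
  "refuted R a k = card {c. c < k \<and> (\<forall>c'<Suc c. \<exists>d<k. \<not> R a c' d)}"

definition stable :: "(nat \<Rightarrow> nat \<Rightarrow> nat \<Rightarrow> bool) \<Rightarrow> nat \<Rightarrow> nat" where
  "stable R k = card {a. a < k \<and> (\<forall>a'<Suc a. refuted R a' (Suc k) = refuted R a' k)}"

lemma refuted_mono: "k \<le> k' \<Longrightarrow> refuted R a k \<le> refuted R a k'"
proof -
  assume k: "k \<le> k'"
  have "{c. c < k \<and> (\<forall>c'<Suc c. \<exists>d<k. \<not> R a c' d)} \<subseteq> {c. c < k' \<and> (\<forall>c'<Suc c. \<exists>d<k'. \<not> R a c' d)}"
    using order.strict_trans2[OF _ k] by blast
  from card_mono[OF _ this] show ?thesis by (simp add: refuted_def)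
qed

text \<open>\<open>c\<close> itself is never refuted, and \<open>refuted\<close> counts only initial
  segments of refuted numbers.\<close>

lemma refuted_bounded: assumes "\<forall>d. R a c d" shows "refuted R a k \<le> c"
proof -
  have "{c. c < k \<and> (\<forall>c'<Suc c. \<exists>d<k. \<not> R a c' d)} \<subseteq> {..<c}"
  proof
    fix x assume "x \<in> {c. c < k \<and> (\<forall>c'<Suc c. \<exists>d<k. \<not> R a c' d)}"
    then have x: "\<forall>c'<Suc x. \<exists>d<k. \<not> R a c' d" by blast
    show "x \<in> {..<c}"
    proof (rule ccontr)
      assume "x \<notin> {..<c}"
      then have "c < Suc x" by simp
      with x assms show False by blast
    qed
  qed
  from card_mono[OF _ this] show ?thesis by (simp add: refuted_def)
qed

lemma refuted_unbounded: assumes "\<And>c. \<exists>d. \<not> R a c d" shows "\<exists>k. n \<le> refuted R a k"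
proof -
  from assms obtain d where d: "\<And>c. \<not> R a c (d c)" by metis
  \<comment> \<open>Large enough to include a counterexample for each of the first \<open>n\<close>
    candidates.\<close>
  define k where "k = Suc (n + (\<Sum>c<n. d c))"
  have "{..<n} \<subseteq> {c. c < k \<and> (\<forall>c'<Suc c. \<exists>d<k. \<not> R a c' d)}"
  proof
    fix c assume c: "c \<in> {..<n}"
    have "\<exists>d<k. \<not> R a c' d" if "c' < Suc c" for c'
    proof -
      have "d c' \<le> (\<Sum>c<n. d c)" using that c by (intro member_le_sum) auto
      then show ?thesis using d by (intro exI[of _ "d c'"]) (auto simp: k_def)
    qed
    then show "c \<in> {c. c < k \<and> (\<forall>c'<Suc c. \<exists>d<k. \<not> R a c' d)}" using c by (auto simp: k_def)
  qed
  from card_mono[OF _ this] show ?thesis by (intro exI[of _ k]) (simp add: refuted_def)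
qed

lemma mono_bounded_eventually_const:
  fixes g :: "nat \<Rightarrow> nat"
  assumes "\<And>k k'. k \<le> k' \<Longrightarrow> g k \<le> g k'" "\<And>k. g k \<le> c"
  shows "\<exists>k0. \<forall>k\<ge>k0. g (Suc k) = g k"
proof -
  have fin: "finite (range g)" by (rule finite_subset[of _ "{..c}"]) (use assms(2) in auto)
  then have "Max (range g) \<in> range g" by (intro Max_in) auto
  then obtain k0 where k0: "g k0 = Max (range g)" by auto
  have c: "g k = g k0" if "k \<ge> k0" for k
    using assms(1)[OF that] Max_ge[OF fin, of "g k"] k0 by simp
  have "g (Suc k) = g k" if "k \<ge> k0" for k
    using c[OF that] c[OF le_SucI[OF that]] by (rule trans[rotated, OF sym])
  then show ?thesis by blast
qed

lemma stable_at_top: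
  assumes "\<forall>a. \<exists>c. \<forall>d. R a c d"
  shows "filterlim (stable R) at_top sequentially"
  unfolding filterlim_at_top
proof
  fix A :: nat
  have "\<forall>a. \<exists>k0. \<forall>k\<ge>k0. refuted R a (Suc k) = refuted R a k"
  proof
    fix a
    obtain c where "\<forall>d. R a c d" using assms by blast
    then show "\<exists>k0. \<forall>k\<ge>k0. refuted R a (Suc k) = refuted R a k"
      using mono_bounded_eventually_const[of "refuted R a" c] refuted_mono refuted_bounded by blast
  qed
  then obtain k0 where k0: "\<And>a k. k \<ge> k0 a \<Longrightarrow> refuted R a (Suc k) = refuted R a k" by metis
  show "eventually (\<lambda>k. A \<le> stable R k) sequentially"
    unfolding eventually_sequentially
  proof (intro exI[of _ "A + (\<Sum>a<A. k0 a)"] allI impI)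
    fix k assume k: "A + (\<Sum>a<A. k0 a) \<le> k"
    have "{..<A} \<subseteq> {a. a < k \<and> (\<forall>a'<Suc a. refuted R a' (Suc k) = refuted R a' k)}"
    proof
      fix a assume a: "a \<in> {..<A}"
      have "refuted R a' (Suc k) = refuted R a' k" if "a' < Suc a" for a'
      proof (rule k0)
        have "k0 a' \<le> (\<Sum>a<A. k0 a)" using that a by (intro member_le_sum) auto
        then show "k0 a' \<le> k" using k by simp
      qed
      then show "a \<in> {a. a < k \<and> (\<forall>a'<Suc a. refuted R a' (Suc k) = refuted R a' k)}" using a k by auto
    qed
    from card_mono[OF _ this] show "A \<le> stable R k" by (simp add: stable_def)
  qed
qed

lemma stable_constant:
  assumes "\<not> (\<forall>a. \<exists>c. \<forall>d. R a c d)"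
  shows "\<exists>M. infinite {k. stable R k = M}"
proof -
  obtain a where a: "\<And>c. \<exists>d. \<not> R a c d" using assms by blast
  have "infinite {k. refuted R a (Suc k) \<noteq> refuted R a k}"
  proof
    assume "finite {k. refuted R a (Suc k) \<noteq> refuted R a k}"
    then obtain K where K: "\<And>k. refuted R a (Suc k) \<noteq> refuted R a k \<Longrightarrow> k < K" unfolding finite_nat_set_iff_bounded by auto
    have c: "refuted R a (K + k) = refuted R a K" for k
    proof (induction k)
      case (Suc k)
      have "refuted R a (Suc (K + k)) = refuted R a (K + k)" using K[of "K + k"] by (meson not_add_less1)
      then show ?case using Suc by simp
    qed simp
    obtain k where k: "Suc (refuted R a K) \<le> refuted R a k" using refuted_unbounded[of R a, OF a] by blast
    have "refuted R a k \<le> refuted R a (K + k)" by (rule refuted_mono) simp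
    then show False using k c[of k] by simp
  qed
  moreover have "{k. refuted R a (Suc k) \<noteq> refuted R a k} \<subseteq> {k. stable R k \<le> a}"
  proof
    fix k assume k: "k \<in> {k. refuted R a (Suc k) \<noteq> refuted R a k}"
    have "{a. a < k \<and> (\<forall>a'<Suc a. refuted R a' (Suc k) = refuted R a' k)} \<subseteq> {..<a}"
    proof
      fix x assume "x \<in> {a. a < k \<and> (\<forall>a'<Suc a. refuted R a' (Suc k) = refuted R a' k)}"
      then have x: "\<forall>a'<Suc x. refuted R a' (Suc k) = refuted R a' k" by blast
      show "x \<in> {..<a}"
      proof (rule ccontr)
        assume "x \<notin> {..<a}"
        then have "a < Suc x" by simp
        with x k show False by blast
      qed
    qed
    from card_mono[OF _ this] show "k \<in> {k. stable R k \<le> a}" by (simp add: stable_def)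
  qed
  ultimately have inf: "infinite {k. stable R k \<le> a}" by (rule infinite_super[rotated])
  have "{k. stable R k \<le> a} = (\<Union>M\<in>{..a}. {k. stable R k = M})" by auto
  with inf show ?thesis by (metis finite_UN_I finite_atMost)
qed

text \<open>Gives a bound on \<open>m z 4\<close> that holds for all \<open>z\<close>, so that the
  zero block at scale 4 is known not to be empty.\<close>

lemma stable_le: "stable R k \<le> k"
proof -
  have "card {a. a < k \<and> (\<forall>a'<Suc a. refuted R a' (Suc k) = refuted R a' k)} \<le> card {..<k}" by (intro card_mono) auto
  then show ?thesis by (simp add: stable_def)
qed

lemma recursive_stable:
  assumes R: "decidable (Suc (Suc (Suc 0))) (\<lambda>z e. R z (e 0) (e (Suc 0)) (e (Suc (Suc 0))))" and a: "recursive n a"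
  shows "recursive n (\<lambda>z e. stable (R z) (a z e))"
proof -
  have "recursive (Suc (Suc 0)) (\<lambda>z e. refuted (R z) (e 0) (e (Suc 0)))"
    unfolding refuted_def
    by (intro recursive_card decidable_ball decidable_bex decidable_not recursive_Suc recursive_var recursive_comp3[where f = "\<lambda>z a c d. of_bool (R z a c d)", OF R]) simp_all
  note ref = recursive_comp2[where f = "\<lambda>z. refuted (R z)", OF this]
  have "recursive (Suc 0) (\<lambda>z e. stable (R z) (e 0))"
    unfolding stable_def by (intro recursive_card decidable_ball decidable_eq ref recursive_Suc recursive_var) simp_all
  from recursive_comp1[where f = "\<lambda>z. stable (R z)", OF this a] show ?thesis .
qed

section \<open>Completeness\<close>

text \<open>The digit at \<open>p\<close> keeps the sum strictly below 1, the value for all digits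
  equal to \<open>b - 1\<close>; infinitely many nonzero digits make \<open>D\<close> the admissible
  expansion.\<close>

lemma real_of_digits:
  assumes b: "b \<ge> 2" and D: "\<And>i. D i < b" and inf: "infinite {i. D i \<noteq> 0}" and p: "D p < b - 1"
  defines "F \<equiv> (\<Sum>i. real (D i) / real b ^ Suc i)"
  shows "0 < F" "F < 1" "digits b F = D"
proof -
  have geo: "(\<lambda>i. (real b - 1) / real b ^ Suc i) sums 1"
  proof -
    have "(\<lambda>i. (1 / real b) ^ i) sums (1 / (1 - 1 / real b))" using b by (intro geometric_sums) auto
    from sums_mult[OF this, of "(real b - 1) / real b"]
    have "(\<lambda>i. (real b - 1) / real b * (1 / real b) ^ i) sums ((real b - 1) / real b * (1 / (1 - 1 / real b)))" .
    moreover have "(real b - 1) / real b * (1 / (1 - 1 / real b)) = 1" using b by (simp add: field_simps)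
    moreover have "(real b - 1) / real b * (1 / real b) ^ i = (real b - 1) / real b ^ Suc i" for i by (simp add: power_divide)
    ultimately show ?thesis by (simp only:)
  qed
  have le: "real (D i) / real b ^ Suc i \<le> (real b - 1) / real b ^ Suc i" for i
  proof -
    have "real (D i) \<le> real b - 1" using D[of i] by linarith
    then show ?thesis by (intro divide_right_mono) auto
  qed
  have sm: "summable (\<lambda>i. real (D i) / real b ^ Suc i)"
    using le by (intro summable_comparison_test'[OF sums_summable[OF geo], of 0]) auto
  have F: "(\<lambda>i. real (D i) / real b ^ Suc i) sums F" unfolding F_def using sm by (rule summable_sums)
  from sums_diff[OF geo F] have d: "(\<lambda>i. (real b - 1) / real b ^ Suc i - real (D i) / real b ^ Suc i) sums (1 - F)" .
  have "0 < (real b - 1) / real b ^ Suc p - real (D p) / real b ^ Suc p"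
  proof -
    have "real (D p) < real b - 1" using p by linarith
    then have "real (D p) / real b ^ Suc p < (real b - 1) / real b ^ Suc p" using b by (intro divide_strict_right_mono) auto
    then show ?thesis by simp
  qed
  moreover have "(\<Sum>i\<in>{p}. (real b - 1) / real b ^ Suc i - real (D i) / real b ^ Suc i) \<le> 1 - F"
    using sum_le_suminf[OF sums_summable[OF d], of "{p}"] le d by (simp add: sums_iff)
  ultimately show F1: "F < 1" by simp
  have e: "is_expansion b F (\<lambda>j. D (j - 1))"
    unfolding is_expansion_def
  proof (intro conjI allI impI)
    show "D (j - 1) < b" for j by (rule D)
    show "(\<lambda>j. real (D (Suc j - 1)) / real b ^ Suc j) sums F" using F by simp
    have "Suc ` {i. D i \<noteq> 0} \<subseteq> {j. 1 \<le> j \<and> D (j - 1) \<noteq> 0}" by auto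
    moreover have "infinite (Suc ` {i. D i \<noteq> 0})" using inf by (simp add: finite_image_iff)
    ultimately show "infinite {j. 1 \<le> j \<and> D (j - 1) \<noteq> 0}" by (rule infinite_super)
  qed
  show "0 < F" by (rule expansion_digits(2)[OF b e F1])
  show "digits b F = D"
  proof
    fix j show "digits b F j = D j" using expansion_digits(1)[OF b e F1, of j] by simp
  qed
qed

lemma below_sum:
  assumes b: "b > 0" and x: "0 < x" "x < 1"
  shows "below b x N = (\<Sum>i<N. digits b x i * b ^ (N - Suc i))"
proof (induction N)
  case (Suc N)
  have "(\<Sum>i<N. digits b x i * b ^ (Suc N - Suc i)) = (\<Sum>i<N. b * (digits b x i * b ^ (N - Suc i)))"
    by (intro sum.cong refl) (auto simp: Suc_diff_Suc[symmetric] simp del: diff_Suc_Suc)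
  then show ?case using Suc by (simp add: below_Suc[OF assms] sum_distrib_left)
qed (simp add: below_0)

text \<open>The first \<open>Suc n\<close> digits determine \<open>F z\<close> up to
  \<open>1 / b ^ Suc n\<close>, at most half of \<open>1 / 2 ^ n\<close>; rounding to a multiple of
  \<open>1 / 2 ^ n\<close> costs the other half.\<close>

lemma computable_from_digits:
  assumes b: "b \<ge> 2" and X: "recursive (Suc 0) (\<lambda>z e. X z (e 0))"
    and F: "\<And>z. 0 < F z" "\<And>z. F z < 1" "\<And>z. digits b (F z) = X z"
  shows "computable_map F"
proof -
  have b0: "b > 0" using b by simp
  define S where "S z N = (\<Sum>i<N. X z i * b ^ (N - Suc i))" for z N
  \<comment> \<open>The numerator and denominator are those of \<open>u + 1 / 2\<close>, with
    \<open>u\<close> defined below, so the quotient rounds \<open>u\<close> to a nearest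
    integer.\<close>
  define K where "K z n = (2 * 2 ^ n * S z (Suc n) + b ^ Suc n) div (2 * b ^ Suc n)" for z n
  \<comment> \<open>Even codes are the nonnegative integers: \<open>int_decode\<close> maps
    \<open>2 * c\<close> to \<open>c\<close>.\<close>
  have "recursive (Suc 0) (\<lambda>z e. 2 * K z (e 0))"
    unfolding K_def S_def
    by (intro recursive_mult recursive_div recursive_add recursive_pow recursive_sum recursive_monus recursive_Suc recursive_comp1[where f = X, OF X] recursive_const recursive_var) simp_all
  then obtain f where f: "\<And>z e. computes z f (map e [0..<Suc 0]) (2 * K z (e 0))" unfolding recursive_def by blast
  show ?thesis unfolding computable_map_def
  proof (intro exI[of _ f] allI)
    fix z n
    have c: "computes z f [n] (2 * K z n)" using f[of z "\<lambda>_. n"] by simp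
    have dec: "int_decode (2 * K z n) = int (K z n)" by (simp add: int_decode_def sum_decode_def)
    have S: "S z N = below b (F z) N" for N unfolding S_def below_sum[OF b0 F(1,2)] F(3) ..
    let ?B = "real b ^ Suc n"
    have B0: "?B > 0" using b by simp
    have B2: "2 * 2 ^ n \<le> ?B" using power_mono[of 2 "real b" "Suc n"] b by simp
    have lo: "real (S z (Suc n)) / ?B < F z" and hi: "F z \<le> real (S z (Suc n)) / ?B + 1 / ?B"
      using below_bounds[OF b0 F(1)[of z] F(2)[of z], where j = "Suc n"] unfolding S by (simp_all add: add_divide_distrib)
    define u where "u = 2 ^ n * (real (S z (Suc n)) / ?B)"
    have u: "u \<le> 2 ^ n * F z" "2 ^ n * F z \<le> u + 1 / 2"
    proof -
      show "u \<le> 2 ^ n * F z" unfolding u_def using lo by (intro mult_left_mono) auto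
      have "2 ^ n * F z \<le> 2 ^ n * (real (S z (Suc n)) / ?B + 1 / ?B)" using hi by (intro mult_left_mono) auto
      also have "\<dots> = u + 2 ^ n / ?B" by (simp add: u_def distrib_left)
      also have "2 ^ n / ?B \<le> 1 / 2" using B0 B2 by (simp add: divide_le_eq)
      finally show "2 ^ n * F z \<le> u + 1 / 2" by simp
    qed
    have "real (2 * 2 ^ n * S z (Suc n) + b ^ Suc n) / real (2 * b ^ Suc n) = u + 1 / 2"
      using B0 b by (simp add: u_def add_divide_distrib)
    then have "int (K z n) = \<lfloor>u + 1 / 2\<rfloor>" unfolding K_def by (metis floor_divide_of_nat_eq)
    then have "real (K z n) \<le> u + 1 / 2" "u - 1 / 2 < real (K z n)" by linarith+
    then have "\<bar>2 ^ n * F z - real (K z n)\<bar> \<le> 1" using u by linarith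
    then have "\<bar>2 ^ n * F z - real (K z n)\<bar> / 2 ^ n \<le> 1 / 2 ^ n" by (intro divide_right_mono) auto
    also have "\<bar>2 ^ n * F z - real (K z n)\<bar> / 2 ^ n = \<bar>(2 ^ n * F z - real (K z n)) / 2 ^ n\<bar>" by (simp add: abs_divide)
    also have "(2 ^ n * F z - real (K z n)) / 2 ^ n = F z - real_of_int (int_decode (2 * K z n)) / 2 ^ n"
      by (simp add: dec diff_divide_distrib)
    finally show "\<exists>v. computes z f [n] v \<and> \<bar>F z - real_of_int (int_decode v) / 2 ^ n\<bar> \<le> 1 / 2 ^ n"
      using c by blast
  qed
qed

context perturbation
begin

text \<open>This must hold even when \<open>x\<close> is not normal. From the end of block
  \<open>k\<close> up to \<open>b ^ Suc k\<close> the sequences \<open>x\<close> and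
  \<open>r\<close> agree, so if \<open>x\<close> were eventually 0, \<open>r\<close> would contain
  runs of zeros of length proportional to their position, against the frequency
  \<open>1 / b\<close>.\<close>

lemma infinite_nonzero:
  assumes N: "normal_digits b r"
  shows "infinite {i. x i \<noteq> 0}"
proof
  assume "finite {i. x i \<noteq> 0}"
  then obtain I where I: "\<And>i. x i \<noteq> 0 \<Longrightarrow> i < I" unfolding finite_nat_set_iff_bounded by auto
  have "(\<lambda>n. real (cnt b r 1 0 n) / real n) \<longlonglongrightarrow> 1 / real b ^ 1"
    using N b unfolding normal_digits_def by (metis zero_less_power less_le_trans zero_less_numeral)
  then have "(\<lambda>n. real (cnt b r 1 0 n) / real n) \<longlonglongrightarrow> 1 / real b" by simp
  then have "\<exists>C\<ge>0. \<forall>n. \<bar>real (cnt b r 1 0 n) - real n * (1 / real b)\<bar> \<le> C + 1 / 100 * real n"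
    unfolding limit_ratio_iff by (rule allE[of _ "1 / 100"]) simp
  then obtain C where C: "\<And>n. \<bar>real (cnt b r 1 0 n) - real n * (1 / real b)\<bar> \<le> C + 1 / 100 * real n" by blast
  \<comment> \<open>Makes \<open>t\<close> exceed \<open>100 * C\<close>, so that the additive
    constant is absorbed.\<close>
  obtain k0 :: nat where k0: "100 * C < real k0" using reals_Archimedean2 by blast
  define k where "k = k0 + I"
  define s where "s = b ^ k + len k"
  define t where "t = b ^ Suc k"
  have kb: "k < b ^ k" using b by (intro power_gt_expt) auto
  \<comment> \<open>\<open>s\<close> is at most \<open>5/4 * b ^ k\<close> and \<open>t\<close> at
    least \<open>2 * b ^ k\<close>, so the run from \<open>s\<close> to \<open>t\<close> fills at
    least 3/8 of the first \<open>t\<close> digits.\<close>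
  have st: "5 * t \<ge> 8 * s"
  proof -
    have "2 * b ^ k \<le> t" unfolding t_def power_Suc using b by (intro mult_right_mono) auto
    moreover have "8 * (B + l) \<le> 5 * T" if "2 * B \<le> T" "4 * l \<le> B" for B l T :: nat using that by presburger
    ultimately show ?thesis using len4[of k] unfolding s_def by blast
  qed
  have "cnt b r 1 0 (s + l) = cnt b r 1 0 s + l" if "s + l \<le> t" for l
    using that
  proof (induction l)
    case (Suc l)
    have "x (s + l) = r (s + l)" using Suc.prems unfolding s_def t_def by (intro x_gap[of k]) auto
    moreover have "x (s + l) = 0"
    proof (rule ccontr)
      assume "x (s + l) \<noteq> 0"
      then have "s + l < I" by (rule I)
      then show False using kb unfolding s_def k_def by linarith
    qed
    ultimately have "win b r 1 (s + l) = 0" by (simp add: win_def)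
    with Suc show ?case by (simp add: cnt_Suc)
  qed simp
  from this[of "t - s"] st have "cnt b r 1 0 t = cnt b r 1 0 s + (t - s)" by simp
  then have "real (cnt b r 1 0 t) = real (cnt b r 1 0 s) + (real t - real s)" using st by simp
  moreover have "d \<le> (tb - sb) + 2 * C + et + es"
    if "ct = cs + d" "\<bar>ct - tb\<bar> \<le> C + et" "\<bar>cs - sb\<bar> \<le> C + es" for ct cs d tb sb et es :: real
    using that by linarith
  ultimately have "real t - real s \<le> (real t - real s) * (1 / real b) + 2 * C + 1 / 100 * real t + 1 / 100 * real s"
    using C[of t] C[of s] unfolding left_diff_distrib by blast
  also have "(real t - real s) * (1 / real b) \<le> (real t - real s) * (1 / 2)" using b st by (intro mult_left_mono) auto
  finally have "real t - real s \<le> (real t - real s) * (1 / 2) + 2 * C + 1 / 100 * real t + 1 / 100 * real s"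
    by simp
  moreover have "d \<le> 4 * C + 1 / 50 * x + 1 / 50 * y"
    if "d \<le> d * (1 / 2) + 2 * C + 1 / 100 * x + 1 / 100 * y" for d x y :: real
    using that by linarith
  ultimately have "real t - real s \<le> 4 * C + 1 / 50 * real t + 1 / 50 * real s" by blast
  moreover have "100 * C < real t"
  proof -
    have "k0 < b ^ k" using kb unfolding k_def by simp
    also have "b ^ k \<le> t" unfolding t_def using b by simp
    finally show ?thesis using k0 by linarith
  qed
  moreover have "8 * real s \<le> 5 * real t" using of_nat_mono[OF st, where 'a = real] by simp
  ultimately show False by linarith
qed

end

theorem theorem4:
  fixes b :: nat
  assumes "b \<ge> 2"
  shows "D2_Pi_complete 3 (normal_numbers b - Poisson_generic_numbers b)"
  unfolding D2_Pi_complete_def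
proof (intro conjI allI impI)
  note b = assms
  have b0: "b > 0" using b by simp
  show "effective_D2_Pi real_sat 3 (normal_numbers b - Poisson_generic_numbers b)"
    unfolding effective_D2_Pi_def using effective_normal[OF b] effective_Poisson[OF b] by blast
  fix C :: "(nat \<Rightarrow> nat) set" assume "effective_D2_Pi baire_sat 3 C"
  then obtain A B where AB: "effective_Pi baire_sat 3 A" "effective_Pi baire_sat 3 B" "C = A - B"
    unfolding effective_D2_Pi_def by blast
  obtain RA where RA: "decidable (Suc (Suc (Suc 0))) (\<lambda>z e. RA z (e 0) (e (Suc 0)) (e (Suc (Suc 0))))"
    "\<And>z. z \<in> A \<longleftrightarrow> (\<forall>a. \<exists>c. \<forall>d. RA z a c d)" using baire_Pi_3E[OF AB(1)] by blast
  obtain RB where RB: "decidable (Suc (Suc (Suc 0))) (\<lambda>z e. RB z (e 0) (e (Suc 0)) (e (Suc (Suc 0))))"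
    "\<And>z. z \<in> B \<longleftrightarrow> (\<forall>a. \<exists>c. \<forall>d. RB z a c d)" using baire_Pi_3E[OF AB(2)] by blast
  \<comment> \<open>Each sequence is spread over the scales of one parity; adding 4 meets the
    requirement of the locale.\<close>
  define m where "m z k = 4 + (if even k then stable (RA z) (k div 2) else stable (RB z) (k div 2))" for z k
  define X where "X z = perturb b (m z) (base_seq b)" for z
  define F where "F z = (\<Sum>i. real (X z i) / real b ^ Suc i)" for z
  have P: "perturbation b (m z) (base_seq b)" for z
    by unfold_locales (use b base_seq_less[OF b0] in \<open>auto simp: m_def\<close>)
  have N: "normal_digits b (base_seq b)" by (rule base_seq_normal[OF b0])
  \<comment> \<open>Scale 4 is even and its block is never empty, since
    \<open>m z 4 \<le> 6 \<le> b ^ 4\<close>. So the digit at \<open>b ^ 4\<close> is 0 for every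
    \<open>z\<close>, which keeps \<open>F z\<close> below 1.\<close>
  have small: "X z (b ^ 4) < b - 1" for z
  proof -
    have "m z 4 \<le> 6" using stable_le[of "RA z" 2] by (simp add: m_def)
    also have "6 \<le> (2::nat) ^ 4" by simp
    also have "\<dots> \<le> b ^ 4" using b by (intro power_mono) auto
    finally have "block_len b (m z) 4 > 0" unfolding block_len_def by (simp add: div_greater_zero_iff m_def)
    then have "X z (b ^ 4) = 0" unfolding X_def by (intro perturbation.x_even[OF P, of 4]) auto
    then show ?thesis using b by simp
  qed
  have F: "0 < F z" "F z < 1" "digits b (F z) = X z" for z
  proof -
    have "X z i < b" for i unfolding X_def by (rule perturbation.x_less[OF P])
    moreover have "infinite {i. X z i \<noteq> 0}" unfolding X_def by (rule perturbation.infinite_nonzero[OF P N])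
    ultimately show "0 < F z" "F z < 1" "digits b (F z) = X z"
      unfolding F_def using real_of_digits[where D = "X z", OF b _ _ small] by blast+
  qed
  have "recursive (Suc 0) (\<lambda>z e. m z (e 0))"
    unfolding m_def by (intro recursive_add recursive_if decidable_even recursive_stable RA(1) RB(1) recursive_div recursive_const recursive_var) simp_all
  from recursive_perturb[where m = m, OF b0 this] have X: "recursive (Suc 0) (\<lambda>z e. X z (e 0))" unfolding X_def .
  have mA: "m z (2 * i) = 4 + stable (RA z) i" and mB: "m z (Suc (2 * i)) = 4 + stable (RB z) i" for z i
    by (simp_all add: m_def)
  have shift: "filterlim (\<lambda>i. 4 + s i) at_top sequentially" if "filterlim s at_top sequentially" for s :: "nat \<Rightarrow> nat"
    by (rule filterlim_at_top_mono[OF that]) simp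
  \<comment> \<open>Outside \<open>A\<close> the failure of normality alone excludes the image,
    whatever happens at odd scales. Inside \<open>A\<close>, the image is normal, and the odd scales
    decide between Poisson genericity and its failure.\<close>
  have key: "z \<in> C \<longleftrightarrow> normal_digits b (X z) \<and> \<not> Poisson_digits b (X z)" for z
  proof (cases "z \<in> A")
    case False
    then obtain M where M: "infinite {i. stable (RA z) i = M}" using stable_constant[of "RA z"] RA(2) by blast
    have "(\<lambda>i. 2 * i) ` {i. stable (RA z) i = M} \<subseteq> {k. even k \<and> m z k = 4 + M}" by (auto simp: mA)
    moreover have "infinite ((\<lambda>i. 2 * i) ` {i. stable (RA z) i = M})" using M by (simp add: finite_image_iff inj_on_def)
    ultimately have "infinite {k. even k \<and> m z k = 4 + M}" by (rule infinite_super)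
    then have "\<not> normal_digits b (X z)" unfolding X_def by (rule perturbation.not_normal_perturb[OF P])
    then show ?thesis using False AB(3) by blast
  next
    case True
    then have limA: "filterlim (\<lambda>i. m z (2 * i)) at_top sequentially"
      using stable_at_top[of "RA z"] RA(2) by (simp add: mA shift)
    then have nx: "normal_digits b (X z)" unfolding X_def by (rule perturbation.normal_perturb[OF P N])
    show ?thesis
    proof (cases "z \<in> B")
      case False
      then obtain M where M: "infinite {i. stable (RB z) i = M}" using stable_constant[of "RB z"] RB(2) by blast
      have "(\<lambda>i. Suc (2 * i)) ` {i. stable (RB z) i = M} \<subseteq> {k. odd k \<and> m z k = 4 + M}" by (auto simp: mB)
      moreover have "infinite ((\<lambda>i. Suc (2 * i)) ` {i. stable (RB z) i = M})" using M by (simp add: finite_image_iff inj_on_def)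
      ultimately have "infinite {k. odd k \<and> m z k = 4 + M}" by (rule infinite_super)
      then have "\<not> Poisson_digits b (X z)" unfolding X_def by (rule perturbation.not_Poisson_perturb[OF P])
      then show ?thesis using False True AB(3) nx by blast
    next
      case zB: True
      then have limB: "filterlim (\<lambda>i. m z (Suc (2 * i))) at_top sequentially"
        using stable_at_top[of "RB z"] RB(2) by (simp add: mB shift)
      have "filterlim (m z) at_top sequentially"
        unfolding filterlim_at_top
      proof
        fix K
        obtain i0 where i0: "\<And>i. i \<ge> i0 \<Longrightarrow> K \<le> m z (2 * i)" using limA unfolding filterlim_at_top eventually_sequentially by blast
        obtain i1 where i1: "\<And>i. i \<ge> i1 \<Longrightarrow> K \<le> m z (Suc (2 * i))" using limB unfolding filterlim_at_top eventually_sequentially by blast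
        show "eventually (\<lambda>k. K \<le> m z k) sequentially"
          unfolding eventually_sequentially
        proof (intro exI[of _ "2 * (i0 + i1) + 1"] allI impI)
          fix k assume k: "2 * (i0 + i1) + 1 \<le> k"
          show "K \<le> m z k"
          proof (cases "even k")
            case True
            then obtain i where "k = 2 * i" by (rule evenE)
            then show ?thesis using i0[of i] k by simp
          next
            case False
            then obtain i where "k = 2 * i + 1" by (rule oddE)
            then show ?thesis using i1[of i] k by simp
          qed
        qed
      qed
      then have "Poisson_digits b (X z)" unfolding X_def by (rule perturbation.Poisson_perturb[OF P base_seq_Poisson[OF b]])
      then show ?thesis using zB AB(3) by blast
    qed
  qed
  show "\<exists>F. computable_map F \<and> range F \<subseteq> {0..<1} \<and> (\<forall>z. z \<in> C \<longleftrightarrow> F z \<in> normal_numbers b - Poisson_generic_numbers b)"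
  proof (intro exI[of _ F] conjI allI)
    show "computable_map F" by (rule computable_from_digits[OF b X F])
    show "range F \<subseteq> {0..<1}" using less_imp_le[OF F(1)] F(2) by auto
    fix z
    show "z \<in> C \<longleftrightarrow> F z \<in> normal_numbers b - Poisson_generic_numbers b"
      unfolding key Diff_iff normal_numbers_iff[OF b] Poisson_numbers_iff[OF b] F(3) using F(1,2) by blast
  qed
qed

end
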